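(* Let $\Gamma$ be a countable discrete group acting by automorphisms on a compact metrizable abelian group $X$. Then the following are equivalent: (1) the action is expansive; (2) the left $\mathbb{Z}\Gamma$-module $\widehat{X}$ is finitely generated, and whenever $\widehat{X}$ is identified with $(\mathbb{Z}\Gamma)^k/J$ for some $k\in\mathbb{N}$ and some left $\mathbb{Z}\Gamma$-submodule $J$ of $(\mathbb{Z}\Gamma)^k$, there exists $A\in M_k(\mathbb{Z}\Gamma)$ which is invertible in $M_k(\ell^1(\Gamma))$ and whose rows are contained in $J$; (3) there exist some $k\in\mathbb{N}$, some left $\mathbb{Z}\Gamma$-submodule $J$ of $(\mathbb{Z}\Gamma)^k$, and some $A\in M_k(\mathbb{Z}\Gamma)$ invertible in $M_k(\ell^1(\Gamma))$ such that the left $\mathbb{Z}\Gamma$-module $\widehat{X}$ is isomorphic to $(\mathbb{Z}\Gamma)^k/J$ and the rows of $A$ are contained in $J$; (4) the left $\mathbb{Z}\Gamma$-module $\widehat{X}$ is finitely generated, and $\ell^1(\Gamma)\otimes_{\mathbb{Z}\Gamma}\widehat{X}=\{0\}$.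
   Context: $\mathbb{Z}\Gamma$ is the integral group ring of $\Gamma$; $\ell^1(\Gamma)$ is the Banach algebra of absolutely summable real-valued functions on $\Gamma$ with convolution product, containing $\mathbb{Z}\Gamma$. Elements of $(\mathbb{Z}\Gamma)^k$ are row vectors. $\widehat{X}$ is the Pontryagin dual of $X$, a left $\mathbb{Z}\Gamma$-module through the induced $\Gamma$-action. The action is expansive if, for a compatible metric $\rho$ on $X$, there is $c>0$ with $\sup_{s\in\Gamma}\rho(sx,sy)>c$ for all distinct $x,y\in X$. Automorphisms of compact groups are assumed continuous. *)

theory Defs
  imports
    "HOL-Analysis.Analysis"
    "HOL-Algebra.Module"
    "HOL-Algebra.AbelCoset"
    "HOL-Algebra.Bij"
    "HOL-Algebra.Generated_Groups"
    "HOL-Algebra.Elementary_Groups"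
    "HOL-Algebra.Free_Abelian_Groups"
begin

section \<open>Actions on compact metrizable abelian groups\<close>

locale compact_metrizable_abelian_group = comm_group X for X (structure) +
  fixes T :: "'a topology"
  assumes topspace_eq: "topspace T = carrier X"
    and continuous_mult: "continuous_map (prod_topology T T) T (\<lambda>(x, y). x \<otimes> y)"
    and continuous_inv: "continuous_map T T (\<lambda>x. inv x)"
    and compact: "compact_space T"
    and metrizable: "metrizable_space T"

text \<open>Inverses of the automorphisms are again of the form \<open>\<alpha> s\<close>, so continuity of all \<open>\<alpha> s\<close>
  makes each of them a homeomorphism.\<close>

definition acts_by_automorphisms ::
    "'g monoid \<Rightarrow> 'x monoid \<Rightarrow> 'x topology \<Rightarrow> ('g \<Rightarrow> 'x \<Rightarrow> 'x) \<Rightarrow> bool" where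
  "acts_by_automorphisms \<Gamma> X T \<alpha> \<longleftrightarrow>
     \<alpha> \<in> hom \<Gamma> (AutoGroup X) \<and> (\<forall>s\<in>carrier \<Gamma>. continuous_map T T (\<alpha> s))"

text \<open>On a compact space a compatible metric is bounded, so the supremum of reals below is a
  genuine one.\<close>

definition expansive ::
    "'g monoid \<Rightarrow> 'x monoid \<Rightarrow> 'x topology \<Rightarrow> ('g \<Rightarrow> 'x \<Rightarrow> 'x) \<Rightarrow> bool" where
  "expansive \<Gamma> X T \<alpha> \<longleftrightarrow>
     (\<exists>\<rho>. Metric_space (carrier X) \<rho> \<and> Metric_space.mtopology (carrier X) \<rho> = T \<and>
        (\<exists>c>0. \<forall>x\<in>carrier X. \<forall>y\<in>carrier X. x \<noteq> y \<longrightarrow>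
           (SUP s\<in>carrier \<Gamma>. \<rho> (\<alpha> s x) (\<alpha> s y)) > c))"


section \<open>The rings $\mathbb{Z}\Gamma$, $\ell^1(\Gamma)$ and $M_k(R)$\<close>

text \<open>Functions on \<open>\<Gamma>\<close> are represented by functions on the whole type that vanish outside
  \<open>carrier \<Gamma>\<close>.\<close>

definition group_ring :: "'g monoid \<Rightarrow> ('g \<Rightarrow> int) ring" where
  "group_ring \<Gamma> =
     \<lparr>carrier = {a. finite {s. a s \<noteq> 0} \<and> {s. a s \<noteq> 0} \<subseteq> carrier \<Gamma>},
      monoid.mult = (\<lambda>a b s. if s \<in> carrier \<Gamma>
                then \<Sum>t\<in>{t. a t \<noteq> 0}. a t * b (inv\<^bsub>\<Gamma>\<^esub> t \<otimes>\<^bsub>\<Gamma>\<^esub> s) else 0),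
      one = (\<lambda>s. if s = \<one>\<^bsub>\<Gamma>\<^esub> then 1 else 0),
      ring.zero = (\<lambda>s. 0),
      add = (\<lambda>a b s. a s + b s)\<rparr>"

definition l1_ring :: "'g monoid \<Rightarrow> ('g \<Rightarrow> real) ring" where
  "l1_ring \<Gamma> =
     \<lparr>carrier = {f. (\<lambda>s. \<bar>f s\<bar>) summable_on carrier \<Gamma> \<and> {s. f s \<noteq> 0} \<subseteq> carrier \<Gamma>},
      monoid.mult = (\<lambda>f h s. if s \<in> carrier \<Gamma>
                then \<Sum>\<^sub>\<infinity>t\<in>carrier \<Gamma>. f t * h (inv\<^bsub>\<Gamma>\<^esub> t \<otimes>\<^bsub>\<Gamma>\<^esub> s) else 0),
      one = (\<lambda>s. if s = \<one>\<^bsub>\<Gamma>\<^esub> then 1 else 0),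
      ring.zero = (\<lambda>s. 0),
      add = (\<lambda>f h s. f s + h s)\<rparr>"

definition l1_of :: "('g \<Rightarrow> int) \<Rightarrow> 'g \<Rightarrow> real" where
  "l1_of a = (\<lambda>s. of_int (a s))"

text \<open>A \<open>k \<times> k\<close> matrix is the \<open>k\<close>-tuple of its rows, so that \<open>A i\<close> is an element of the
  left module \<open>free_left_module R k\<close> below.\<close>

definition matrix_ring :: "('a, 'm) ring_scheme \<Rightarrow> nat \<Rightarrow> (nat \<Rightarrow> nat \<Rightarrow> 'a) ring" where
  "matrix_ring R k =
     \<lparr>carrier = {..<k} \<rightarrow>\<^sub>E ({..<k} \<rightarrow>\<^sub>E carrier R),
      monoid.mult = (\<lambda>A B. \<lambda>i\<in>{..<k}. \<lambda>j\<in>{..<k}. \<Oplus>\<^bsub>R\<^esub>l\<in>{..<k}. A i l \<otimes>\<^bsub>R\<^esub> B l j),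
      one = (\<lambda>i\<in>{..<k}. \<lambda>j\<in>{..<k}. if i = j then \<one>\<^bsub>R\<^esub> else \<zero>\<^bsub>R\<^esub>),
      ring.zero = (\<lambda>i\<in>{..<k}. \<lambda>j\<in>{..<k}. \<zero>\<^bsub>R\<^esub>),
      add = (\<lambda>A B. \<lambda>i\<in>{..<k}. \<lambda>j\<in>{..<k}. A i j \<oplus>\<^bsub>R\<^esub> B i j)\<rparr>"

definition matrix_l1_of :: "nat \<Rightarrow> (nat \<Rightarrow> nat \<Rightarrow> 'g \<Rightarrow> int) \<Rightarrow> nat \<Rightarrow> nat \<Rightarrow> 'g \<Rightarrow> real" where
  "matrix_l1_of k A = (\<lambda>i\<in>{..<k}. \<lambda>j\<in>{..<k}. l1_of (A i j))"


section \<open>Left modules\<close>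

text \<open>The locale \<^locale>\<open>module\<close> requires a commutative ring of scalars, but the record type
  \<open>module\<close> and the locale \<^locale>\<open>submodule\<close> do not. The fields \<open>mult\<close> and \<open>one\<close>, which the
  record inherits from rings, play no role for modules and are left unspecified.\<close>

definition free_left_module :: "('a, 'm) ring_scheme \<Rightarrow> nat \<Rightarrow> ('a, nat \<Rightarrow> 'a) module" where
  "free_left_module R k =
     \<lparr>carrier = {..<k} \<rightarrow>\<^sub>E carrier R, monoid.mult = undefined, one = undefined,
      ring.zero = (\<lambda>i\<in>{..<k}. \<zero>\<^bsub>R\<^esub>),
      add = (\<lambda>v w. \<lambda>i\<in>{..<k}. v i \<oplus>\<^bsub>R\<^esub> w i),
      smult = (\<lambda>a v. \<lambda>i\<in>{..<k}. a \<otimes>\<^bsub>R\<^esub> v i)\<rparr>"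

definition quotient_left_module :: "('a, 'b) module \<Rightarrow> 'b set \<Rightarrow> ('a, 'b set) module" where
  "quotient_left_module M J =
     \<lparr>carrier = a_rcosets\<^bsub>M\<^esub> J, monoid.mult = undefined, one = undefined,
      ring.zero = J, add = set_add M,
      smult = (\<lambda>a C. \<Union>v\<in>C. J +>\<^bsub>M\<^esub> (a \<odot>\<^bsub>M\<^esub> v))\<rparr>"

definition left_module_isomorphic ::
    "('a, 'm) ring_scheme \<Rightarrow> ('a, 'b) module \<Rightarrow> ('a, 'c) module \<Rightarrow> bool" where
  "left_module_isomorphic R M N \<longleftrightarrow>
     (\<exists>h \<in> iso (add_monoid M) (add_monoid N).
        \<forall>a\<in>carrier R. \<forall>x\<in>carrier M. h (a \<odot>\<^bsub>M\<^esub> x) = a \<odot>\<^bsub>N\<^esub> h x)"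

definition finitely_generated_left_module ::
    "('a, 'm) ring_scheme \<Rightarrow> ('a, 'b) module \<Rightarrow> bool" where
  "finitely_generated_left_module R M \<longleftrightarrow>
     (\<exists>S. finite S \<and> S \<subseteq> carrier M \<and>
        (\<forall>x\<in>carrier M. \<exists>c \<in> S \<rightarrow> carrier R. x = (\<Oplus>\<^bsub>M\<^esub>y\<in>S. c y \<odot>\<^bsub>M\<^esub> y)))"

text \<open>\<open>M \<otimes>\<^sub>R N\<close> as an abelian group, for an abelian group \<open>M\<close> with right \<open>R\<close>-action \<open>r\<close> and a
  left \<open>R\<close>-module \<open>N\<close>: the free abelian group on \<open>M \<times> N\<close> modulo the subgroup generated by the
  biadditivity and balancing relations.\<close>

definition tensor_relations ::
    "('a, 'm) ring_scheme \<Rightarrow> ('b, 'n) ring_scheme \<Rightarrow> ('b \<Rightarrow> 'a \<Rightarrow> 'b) \<Rightarrow> ('a, 'c) module \<Rightarrow>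
     ('b \<times> 'c \<Rightarrow>\<^sub>0 int) set" where
  "tensor_relations R M r N =
     {frag_of (x \<oplus>\<^bsub>M\<^esub> x', y) - frag_of (x, y) - frag_of (x', y) | x x' y.
        x \<in> carrier M \<and> x' \<in> carrier M \<and> y \<in> carrier N} \<union>
     {frag_of (x, y \<oplus>\<^bsub>N\<^esub> y') - frag_of (x, y) - frag_of (x, y') | x y y'.
        x \<in> carrier M \<and> y \<in> carrier N \<and> y' \<in> carrier N} \<union>
     {frag_of (r x a, y) - frag_of (x, a \<odot>\<^bsub>N\<^esub> y) | x a y.
        x \<in> carrier M \<and> a \<in> carrier R \<and> y \<in> carrier N}"

definition tensor_product ::
    "('a, 'm) ring_scheme \<Rightarrow> ('b, 'n) ring_scheme \<Rightarrow> ('b \<Rightarrow> 'a \<Rightarrow> 'b) \<Rightarrow> ('a, 'c) module \<Rightarrow>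
     ('b \<times> 'c \<Rightarrow>\<^sub>0 int) set monoid" where
  "tensor_product R M r N =
     (let F = free_Abelian_group (carrier M \<times> carrier N)
      in F Mod generate F (tensor_relations R M r N))"


section \<open>The Pontryagin dual as a left $\mathbb{Z}\Gamma$-module\<close>

definition circle_group :: "complex monoid" where
  "circle_group = \<lparr>carrier = sphere 0 1, monoid.mult = (*), one = 1\<rparr>"

definition characters :: "'x monoid \<Rightarrow> 'x topology \<Rightarrow> ('x \<Rightarrow> complex) set" where
  "characters X T =
     {\<phi> \<in> hom X circle_group. \<phi> \<in> extensional (carrier X) \<and> continuous_map T euclidean \<phi>}"

text \<open>The group operation of the dual, written additively in the module, is pointwise
  multiplication. The induced action of \<open>\<Gamma>\<close> is \<open>(s \<cdot> \<phi>) x = \<phi> (s\<^sup>-\<^sup>1 x)\<close>; extended linearly, a group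
  ring element \<open>a = \<Sum> a\<^sub>s s\<close> sends \<open>\<phi>\<close> to the product of the characters
  \<open>(s \<cdot> \<phi>)\<close> raised to the powers \<open>a\<^sub>s\<close>.\<close>

definition dual_module ::
    "'g monoid \<Rightarrow> 'x monoid \<Rightarrow> 'x topology \<Rightarrow> ('g \<Rightarrow> 'x \<Rightarrow> 'x) \<Rightarrow>
     ('g \<Rightarrow> int, 'x \<Rightarrow> complex) module" where
  "dual_module \<Gamma> X T \<alpha> =
     \<lparr>carrier = characters X T, monoid.mult = undefined, one = undefined,
      ring.zero = (\<lambda>x\<in>carrier X. 1),
      add = (\<lambda>\<phi> \<psi>. \<lambda>x\<in>carrier X. \<phi> x * \<psi> x),
      smult = (\<lambda>a \<phi>. \<lambda>x\<in>carrier X. \<Prod>s\<in>{s. a s \<noteq> 0}. \<phi> (\<alpha> (inv\<^bsub>\<Gamma>\<^esub> s) x) powi a s)\<rparr>"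

text \<open>\<open>\<ell>\<^sup>1(\<Gamma>) \<otimes> M\<close> over the integral group ring, which acts on \<open>\<ell>\<^sup>1(\<Gamma>)\<close> by right multiplication.\<close>

definition l1_tensor ::
    "'g monoid \<Rightarrow> ('g \<Rightarrow> int, 'b) module \<Rightarrow> (('g \<Rightarrow> real) \<times> 'b \<Rightarrow>\<^sub>0 int) set monoid" where
  "l1_tensor \<Gamma> M =
     tensor_product (group_ring \<Gamma>) (l1_ring \<Gamma>) (\<lambda>f a. f \<otimes>\<^bsub>l1_ring \<Gamma>\<^esub> l1_of a) M"

end

theory Submission
  imports Defs
begin

text \<open>Everything passes through the condition (*): for a presentation of the dual as
  \<open>(\<int>\<Gamma>)\<^sup>k / J\<close>, no nonzero bounded row in \<open>\<ell>\<^sup>\<infinity>(\<Gamma>)\<^sup>k\<close> annihilates \<open>J\<close>. By Hahn-Banach, (*) makes the real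
  span of \<open>J\<close> dense in \<open>\<ell>\<^sup>1(\<Gamma>)\<^sup>k\<close>; approximating the unit vectors, multiplying by a large integer and
  rounding gives rows in \<open>J\<close> forming a matrix close to a multiple of the identity, which is
  invertible by the Neumann series. Expansiveness implies (*), since small multiples of an
  annihilating row exponentiate to points of \<open>X\<close> whose orbits stay near the identity. Vanishing of the
  tensor product implies (*), since an annihilating row defines a nonzero balanced map on
  \<open>\<ell>\<^sup>1(\<Gamma>) \<times> X^\<close>. Conversely, an invertible matrix with rows in \<open>J\<close> forces small angles to vanish, and
  kills the tensor product.

  The duality theory needed, namely that characters separate points and that every homomorphism
  from the dual to the circle is an evaluation, is obtained from an invariant mean in place of Haar
  measure: a minimal self-adjoint idempotent for convolution, found as a limit of rescaled
  convolution powers, is a multiple of a character.\<close>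

section \<open>The Hahn-Banach theorem\<close>

text \<open>The obstacle is the passage between two dualities. Points of \<open>X\<close> act on the
  dual with values in the circle, whereas density in l1 is tested by real bounded functions, and
  \<open>J\<close> is closed under integral multiples only. From real to circle values one
  exponentiates; this yields a point of \<open>X\<close> because every homomorphism on the dual is
  an evaluation. The way back chooses an argument for each value of a character along an orbit.
  Arguments are additive only modulo \<open>2 * pi\<close>, but pairing them with integral rows
  keeps the ambiguity a multiple of \<open>2 * pi\<close>, and the norms of finitely many rows turn
  smallness of the angles into exact vanishing.

  Condition (2) speaks about all presentations, so the triviality of the annihilator is derived for
  an arbitrary one. Finite generation has a separate source: finitely many characters that cut out a
  neighbourhood witnessing expansiveness generate a submodule separating the points, and a subgroup
  of the dual that separates points is the whole dual.\<close>

definition function_subspace :: "('i \<Rightarrow> real) set \<Rightarrow> bool" where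
  "function_subspace V \<longleftrightarrow> (\<lambda>i. 0) \<in> V \<and> (\<forall>v\<in>V. \<forall>w\<in>V. (\<lambda>i. v i + w i) \<in> V) \<and>
     (\<forall>t. \<forall>v\<in>V. (\<lambda>i. t * v i) \<in> V)"

text \<open>Relative to a set \<open>V\<close> of functions rather than a type:
  \<open>Hahn_Banach\<close> is applied to bounded functions on a group carrier and to finitely
  supported functions on an index set.\<close>

definition sublinear_on :: "('i \<Rightarrow> real) set \<Rightarrow> (('i \<Rightarrow> real) \<Rightarrow> real) \<Rightarrow> bool" where
  "sublinear_on V p \<longleftrightarrow> (\<forall>v\<in>V. \<forall>w\<in>V. p (\<lambda>i. v i + w i) \<le> p v + p w) \<and>
     (\<forall>t\<ge>0. \<forall>v\<in>V. p (\<lambda>i. t * v i) = t * p v)"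

definition linear_functional_on :: "('i \<Rightarrow> real) set \<Rightarrow> (('i \<Rightarrow> real) \<Rightarrow> real) \<Rightarrow> bool" where
  "linear_functional_on V F \<longleftrightarrow> (\<forall>v\<in>V. \<forall>w\<in>V. F (\<lambda>i. v i + w i) = F v + F w) \<and>
     (\<forall>t. \<forall>v\<in>V. F (\<lambda>i. t * v i) = t * F v)"

lemma function_subspaceD:
  assumes "function_subspace V"
  shows "(\<lambda>i. 0) \<in> V" "\<And>v w. v \<in> V \<Longrightarrow> w \<in> V \<Longrightarrow> (\<lambda>i. v i + w i) \<in> V"
    "\<And>t v. v \<in> V \<Longrightarrow> (\<lambda>i. t * v i) \<in> V" "\<And>v. v \<in> V \<Longrightarrow> (\<lambda>i. - v i) \<in> V"
    "\<And>v w. v \<in> V \<Longrightarrow> w \<in> V \<Longrightarrow> (\<lambda>i. v i - w i) \<in> V"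
proof -
  show 1: "(\<lambda>i. 0) \<in> V" "\<And>v w. v \<in> V \<Longrightarrow> w \<in> V \<Longrightarrow> (\<lambda>i. v i + w i) \<in> V"
    "\<And>t v. v \<in> V \<Longrightarrow> (\<lambda>i. t * v i) \<in> V"
    using assms by (auto simp: function_subspace_def)
  show 2: "(\<lambda>i. - v i) \<in> V" if "v \<in> V" for v
    using 1(3)[OF that, of "-1"] by simp
  show "(\<lambda>i. v i - w i) \<in> V" if "v \<in> V" "w \<in> V" for v w
    using 1(2)[OF that(1) 2[OF that(2)]] by simp
qed

lemma sublinear_onD:
  assumes "sublinear_on V p"
  shows "\<And>v w. v \<in> V \<Longrightarrow> w \<in> V \<Longrightarrow> p (\<lambda>i. v i + w i) \<le> p v + p w"
    "\<And>t v. t \<ge> 0 \<Longrightarrow> v \<in> V \<Longrightarrow> p (\<lambda>i. t * v i) = t * p v"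
  using assms by (auto simp: sublinear_on_def)

lemma sublinear_on_zero:
  assumes "function_subspace V" "sublinear_on V p"
  shows "p (\<lambda>i. 0) = 0"
  using sublinear_onD(2)[OF assms(2), of 0 "\<lambda>i. 0"] function_subspaceD(1)[OF assms(1)] by simp

text \<open>This lower bound keeps the infimum over a chain of sublinear functionals finite.\<close>

lemma sublinear_on_minus:
  assumes "function_subspace V" "sublinear_on V p" "v \<in> V"
  shows "- p (\<lambda>i. - v i) \<le> p v"
  using sublinear_onD(1)[OF assms(2,3) function_subspaceD(4)[OF assms(1,3)]]
    sublinear_on_zero[OF assms(1,2)] by simp

text \<open>A minimal sublinear functional coincides with all its shifts, and the last inequality of
  \<open>shifted_sublinear\<close> then makes it additive.\<close>

definition shifted_sublinear :: "(('i \<Rightarrow> real) \<Rightarrow> real) \<Rightarrow> ('i \<Rightarrow> real) \<Rightarrow> ('i \<Rightarrow> real) \<Rightarrow> real" where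
  "shifted_sublinear p w v = (INF t\<in>{0..}. p (\<lambda>i. v i + t * w i) - t * p w)"

lemma shifted_sublinear:
  assumes V: "function_subspace V" and p: "sublinear_on V p" and w: "w \<in> V"
  shows "sublinear_on V (shifted_sublinear p w)"
    and "\<And>v. v \<in> V \<Longrightarrow> shifted_sublinear p w v \<le> p v"
    and "shifted_sublinear p w (\<lambda>i. - w i) \<le> - p w"
    and "\<And>v. v \<in> V \<Longrightarrow> shifted_sublinear p w v \<le> p (\<lambda>i. v i + w i) - p w"
proof -
  note VD = function_subspaceD[OF V] and pD = sublinear_onD[OF p]
  have vt: "(\<lambda>i. v i + t * w i) \<in> V" if "v \<in> V" for v t
    using VD(2)[OF that VD(3)[OF w]] by blast
  \<comment> \<open>Subadditivity applied to \<open>t * w = (v + t * w) + (- v)\<close>; hence the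
    infimum is over a set bounded below.\<close>
  have lower: "- p (\<lambda>i. - v i) \<le> p (\<lambda>i. v i + t * w i) - t * p w" if "v \<in> V" "t \<ge> 0" for v t
    using pD(1)[OF vt[OF that(1), of t] VD(4)[OF that(1)]] pD(2)[OF that(2) w] by simp
  have bdd: "bdd_below ((\<lambda>t. p (\<lambda>i. v i + t * w i) - t * p w) ` {0..})" if "v \<in> V" for v
    using lower[OF that] by (intro bdd_belowI2[where m="- p (\<lambda>i. - v i)"]) auto
  have le: "shifted_sublinear p w v \<le> p (\<lambda>i. v i + t * w i) - t * p w" if "v \<in> V" "t \<ge> 0" for v t
    unfolding shifted_sublinear_def by (rule cINF_lower[OF bdd]) (use that in auto)
  have ge: "c \<le> shifted_sublinear p w v"
    if "\<And>t. t \<ge> 0 \<Longrightarrow> c \<le> p (\<lambda>i. v i + t * w i) - t * p w" for v c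
    unfolding shifted_sublinear_def by (rule cINF_greatest) (use that in auto)
  show "shifted_sublinear p w v \<le> p v" if "v \<in> V" for v using le[OF that, of 0] by simp
  \<comment> \<open>For \<open>v = - w\<close> the term at \<open>t = 1\<close> is
    \<open>p 0 - p w\<close>.\<close>
  show "shifted_sublinear p w (\<lambda>i. - w i) \<le> - p w"
    using le[OF VD(4)[OF w], of 1] sublinear_on_zero[OF V p] by simp
  show "shifted_sublinear p w v \<le> p (\<lambda>i. v i + w i) - p w" if "v \<in> V" for v
    using le[OF that, of 1] by simp
  have add: "shifted_sublinear p w (\<lambda>i. v i + u i) \<le> shifted_sublinear p w v + shifted_sublinear p w u"
    if vV: "v \<in> V" and uV: "u \<in> V" for v u
  proof -
    have key: "shifted_sublinear p w (\<lambda>i. v i + u i)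
        \<le> (p (\<lambda>i. v i + s * w i) - s * p w) + (p (\<lambda>i. u i + t * w i) - t * p w)"
      if "s \<ge> 0" "t \<ge> 0" for s t
    proof -
      have "shifted_sublinear p w (\<lambda>i. v i + u i) \<le> p (\<lambda>i. (v i + u i) + (s + t) * w i) - (s + t) * p w"
        using le[OF VD(2)[OF vV uV]] that by simp
      also have "(\<lambda>i. (v i + u i) + (s + t) * w i) = (\<lambda>i. (v i + s * w i) + (u i + t * w i))"
        by (auto simp: algebra_simps)
      also have "p \<dots> \<le> p (\<lambda>i. v i + s * w i) + p (\<lambda>i. u i + t * w i)"
        by (rule pD(1)[OF vt[OF vV] vt[OF uV]])
      finally show ?thesis by (simp add: algebra_simps)
    qed
    have "shifted_sublinear p w (\<lambda>i. v i + u i) - (p (\<lambda>i. v i + s * w i) - s * p w)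
        \<le> shifted_sublinear p w u" if "s \<ge> 0" for s
      by (rule ge) (use key[OF that] in \<open>simp add: algebra_simps\<close>)
    then have "shifted_sublinear p w (\<lambda>i. v i + u i) - shifted_sublinear p w u
        \<le> shifted_sublinear p w v"
      by (intro ge) (force simp: algebra_simps)
    then show ?thesis by simp
  qed
  have scale_le: "shifted_sublinear p w (\<lambda>i. t * v i) \<le> t * shifted_sublinear p w v"
    if t: "t > 0" and vV: "v \<in> V" for t v
  proof -
    have "shifted_sublinear p w (\<lambda>i. t * v i) / t \<le> shifted_sublinear p w v"
    proof (rule ge)
      fix s :: real assume s: "s \<ge> 0"
      have "shifted_sublinear p w (\<lambda>i. t * v i) \<le> p (\<lambda>i. t * v i + (t * s) * w i) - (t * s) * p w"
        using le[OF VD(3)[OF vV, of t], of "t * s"] s t by simp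
      also have "(\<lambda>i. t * v i + (t * s) * w i) = (\<lambda>i. t * (v i + s * w i))"
        by (auto simp: algebra_simps)
      also have "p \<dots> = t * p (\<lambda>i. v i + s * w i)"
        using pD(2)[OF _ vt[OF vV]] t by simp
      finally show "shifted_sublinear p w (\<lambda>i. t * v i) / t \<le> p (\<lambda>i. v i + s * w i) - s * p w"
        using t by (simp add: field_simps)
    qed
    then show ?thesis using t by (simp add: field_simps)
  qed
  have scale: "shifted_sublinear p w (\<lambda>i. t * v i) = t * shifted_sublinear p w v"
    if t: "t \<ge> 0" and vV: "v \<in> V" for t v
  proof (cases "t = 0")
    case True
    have "shifted_sublinear p w (\<lambda>i. 0) \<ge> 0"
      using pD(2)[OF _ w] by (intro ge) simp
    moreover have "shifted_sublinear p w (\<lambda>i. 0) \<le> 0"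
      using le[OF VD(1), of 0] sublinear_on_zero[OF V p] by simp
    ultimately show ?thesis using True by simp
  next
    case False
    then have t: "t > 0" using t by simp
    \<comment> \<open>The reverse inequality is \<open>scale_le\<close> for the factor
      \<open>inverse t\<close>.\<close>
    have "shifted_sublinear p w (\<lambda>i. inverse t * (t * v i)) \<le> inverse t * shifted_sublinear p w (\<lambda>i. t * v i)"
      using scale_le[OF _ VD(3)[OF vV]] t by simp
    moreover have "(\<lambda>i. inverse t * (t * v i)) = v" using t by (auto simp: field_simps)
    ultimately have "t * shifted_sublinear p w v \<le> shifted_sublinear p w (\<lambda>i. t * v i)"
      using t by (simp add: field_simps)
    then show ?thesis using scale_le[OF t vV] by simp
  qed
  show "sublinear_on V (shifted_sublinear p w)" using add scale by (simp add: sublinear_on_def)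
qed

text \<open>Subadditivity of an infimum needs the chain: if \<open>q\<close> is nearly optimal at
  \<open>v\<close> and \<open>q'\<close> at \<open>w\<close>, the smaller of the two serves both.
  The common bound \<open>p\<close> keeps the infimum finite.\<close>

lemma sublinear_chain_Inf:
  assumes V: "function_subspace V" and C: "C \<noteq> {}" and p: "sublinear_on V p"
    and sub: "\<And>q. q \<in> C \<Longrightarrow> sublinear_on V q" and le: "\<And>q v. q \<in> C \<Longrightarrow> v \<in> V \<Longrightarrow> q v \<le> p v"
    and chain: "\<And>q q'. q \<in> C \<Longrightarrow> q' \<in> C \<Longrightarrow> (\<forall>v\<in>V. q v \<le> q' v) \<or> (\<forall>v\<in>V. q' v \<le> q v)"
  shows "sublinear_on V (\<lambda>v. INF q\<in>C. q v)"
    and "\<And>q v. q \<in> C \<Longrightarrow> v \<in> V \<Longrightarrow> (INF q\<in>C. q v) \<le> q v"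
proof -
  note VD = function_subspaceD[OF V]
  have bdd: "bdd_below ((\<lambda>q. q v) ` C)" if "v \<in> V" for v
  proof (rule bdd_belowI2)
    fix q assume q: "q \<in> C"
    show "- p (\<lambda>i. - v i) \<le> q v"
      using sublinear_on_minus[OF V sub[OF q] that] le[OF q VD(4)[OF that]] by simp
  qed
  show lower: "(INF q\<in>C. q v) \<le> q v" if "q \<in> C" "v \<in> V" for q v
    by (rule cINF_lower[OF bdd]) (use that in auto)
  have "(INF q\<in>C. q (\<lambda>i. v i + w i)) \<le> (INF q\<in>C. q v) + (INF q\<in>C. q w)"
    if v: "v \<in> V" and w: "w \<in> V" for v w
  proof -
    have key: "(INF q\<in>C. q (\<lambda>i. v i + w i)) \<le> q v + q' w" if q: "q \<in> C" and q': "q' \<in> C" for q q'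
    proof -
      obtain r where r: "r \<in> C" "r v \<le> q v" "r w \<le> q' w"
        using chain[OF q q'] v w q q' by blast
      have "(INF q\<in>C. q (\<lambda>i. v i + w i)) \<le> r (\<lambda>i. v i + w i)" using lower r(1) VD(2)[OF v w] by blast
      also have "\<dots> \<le> r v + r w" using sublinear_onD(1)[OF sub[OF r(1)] v w] .
      finally show ?thesis using r by simp
    qed
    have "(INF q\<in>C. q (\<lambda>i. v i + w i)) - q v \<le> (INF q\<in>C. q w)" if "q \<in> C" for q
      by (rule cINF_greatest[OF C]) (use key[OF that] in \<open>simp add: algebra_simps\<close>)
    then have "(INF q\<in>C. q (\<lambda>i. v i + w i)) - (INF q\<in>C. q w) \<le> (INF q\<in>C. q v)"
      by (intro cINF_greatest[OF C]) (force simp: algebra_simps)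
    then show ?thesis by simp
  qed
  moreover have "(INF q\<in>C. q (\<lambda>i. t * v i)) = t * (INF q\<in>C. q v)" if t: "t \<ge> 0" and v: "v \<in> V" for t v
  proof -
    have "(INF q\<in>C. q (\<lambda>i. t * v i)) = (INF q\<in>C. t * q v)"
      using sublinear_onD(2)[OF sub t v] by (intro INF_cong) auto
    also have "\<dots> = t * (INF q\<in>C. q v)"
    proof -
      \<comment> \<open>Multiplication by \<open>t \<ge> 0\<close> is monotone and continuous, hence
        commutes with the infimum.\<close>
      have "t * Inf ((\<lambda>q. q v) ` C) = (INF x\<in>(\<lambda>q. q v) ` C. t * x)"
        using t C bdd[OF v]
        by (intro continuous_at_Inf_mono) (auto intro!: monoI mult_left_mono continuous_intros)
      then show ?thesis by (simp add: image_image)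
    qed
    finally show ?thesis .
  qed
  ultimately show "sublinear_on V (\<lambda>v. INF q\<in>C. q v)" by (simp add: sublinear_on_def)
qed

text \<open>Zorn's lemma is applied below \<open>shifted_sublinear p v0\<close> instead of
  \<open>p\<close>: every linear functional there automatically attains \<open>p v0\<close> at
  \<open>v0\<close>, so no extension from a line is carried out.\<close>

lemma Hahn_Banach:
  assumes V: "function_subspace V" and p: "sublinear_on V p" and v0: "v0 \<in> V"
  obtains F where "linear_functional_on V F" "\<And>v. v \<in> V \<Longrightarrow> F v \<le> p v" "F v0 = p v0"
proof -
  note VD = function_subspaceD[OF V]
  let ?p = "shifted_sublinear p v0"
  note p0 = shifted_sublinear[OF V p v0]
  \<comment> \<open>Extensionality makes the pointwise order on \<open>S\<close>
    antisymmetric.\<close>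
  define S where "S = {q. sublinear_on V q \<and> (\<forall>v\<in>V. q v \<le> ?p v) \<and> q \<in> extensional V}"
  \<comment> \<open>The order is reversed, so that a maximal element for Zorn's lemma is a minimal
    functional.\<close>
  define R where "R = {(q, q'). q \<in> S \<and> q' \<in> S \<and> (\<forall>v\<in>V. q' v \<le> q v)}"
  have restr: "sublinear_on V (restrict q V)" if "sublinear_on V q" for q
    using that VD by (auto simp: sublinear_on_def)
  have RS: "Field R \<subseteq> S" by (auto simp: R_def Field_def)
  have SR: "S \<subseteq> Field R" by (auto simp: R_def Field_def)
  have FS: "Field R = S" using RS SR by auto
  have "a = b" if "(a, b) \<in> R" "(b, a) \<in> R" for a b
  proof (rule extensionalityI[of _ V])
    show "a \<in> extensional V" "b \<in> extensional V" using that by (auto simp: R_def S_def)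
    show "a v = b v" if "v \<in> V" for v
      using \<open>(a, b) \<in> R\<close> \<open>(b, a) \<in> R\<close> that by (auto simp: R_def intro: order.antisym)
  qed
  moreover have "refl_on S R" "trans R"
    by (auto simp: R_def refl_on_def trans_def intro: order.trans)
  moreover have "R \<subseteq> S \<times> S" by (auto simp: R_def)
  ultimately have "partial_order_on (Field R) R"
    unfolding FS by (auto simp: partial_order_on_def preorder_on_def antisym_def)
  then have PO: "Partial_order R" by simp
  have "\<exists>u\<in>Field R. \<forall>a\<in>C. (a, u) \<in> R" if C: "C \<in> Chains R" for C
  proof (cases "C = {}")
    case True
    have "restrict ?p V \<in> S" using restr[OF p0(1)] by (auto simp: S_def)
    then show ?thesis using True FS by auto
  next
    case False
    have CS: "C \<subseteq> S" using C by (auto simp: Chains_def R_def)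
    have ch: "(\<forall>v\<in>V. q v \<le> q' v) \<or> (\<forall>v\<in>V. q' v \<le> q v)" if "q \<in> C" "q' \<in> C" for q q'
      using C that by (auto simp: Chains_def R_def)
    have sub: "sublinear_on V q" if "q \<in> C" for q using that CS by (auto simp: S_def)
    have le: "q v \<le> ?p v" if "q \<in> C" "v \<in> V" for q v using that CS by (auto simp: S_def)
    have I1: "sublinear_on V (\<lambda>v. INF q\<in>C. q v)"
        "\<And>q v. q \<in> C \<Longrightarrow> v \<in> V \<Longrightarrow> (INF q\<in>C. q v) \<le> q v"
      by (rule sublinear_chain_Inf[OF V False p0(1)]; use sub le ch in blast)+
    obtain q0 where q0: "q0 \<in> C" using False by auto
    have "restrict (\<lambda>v. INF q\<in>C. q v) V \<in> S"
      using restr[OF I1(1)] I1(2)[OF q0] q0 CS by (force simp: S_def)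
    then show ?thesis using I1(2) CS FS by (intro bexI[of _ "restrict (\<lambda>v. INF q\<in>C. q v) V"]) (auto simp: R_def)
  qed
  then obtain q where q: "q \<in> S" and qmin: "\<And>a. a \<in> S \<Longrightarrow> (q, a) \<in> R \<Longrightarrow> a = q"
    using Zorns_po_lemma[OF PO] FS by metis
  have qs: "sublinear_on V q" and qle: "\<And>v. v \<in> V \<Longrightarrow> q v \<le> ?p v" using q by (auto simp: S_def)
  have shift_eq: "shifted_sublinear q w v = q v" if w: "w \<in> V" and v: "v \<in> V" for v w
  proof -
    note sh = shifted_sublinear[OF V qs w]
    have "restrict (shifted_sublinear q w) V \<in> S"
      using restr[OF sh(1)] sh(2) qle by (force simp: S_def)
    moreover from this have "(q, restrict (shifted_sublinear q w) V) \<in> R"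
      using sh(2) q by (auto simp: R_def)
    ultimately have "restrict (shifted_sublinear q w) V = q" using qmin by blast
    then show ?thesis using v by (metis restrict_apply')
  qed
  have add: "q (\<lambda>i. v i + w i) = q v + q w" if v: "v \<in> V" and w: "w \<in> V" for v w
  proof -
    have "q v \<le> q (\<lambda>i. v i + w i) - q w"
      using shifted_sublinear(4)[OF V qs w v] shift_eq[OF w v] by simp
    then show ?thesis using sublinear_onD(1)[OF qs v w] by simp
  qed
  have neg: "q (\<lambda>i. - v i) = - q v" if v: "v \<in> V" for v
    using add[OF v VD(4)[OF v]] sublinear_on_zero[OF V qs] by simp
  have scale: "q (\<lambda>i. t * v i) = t * q v" if v: "v \<in> V" for t v
  proof (cases "t \<ge> 0")
    case True then show ?thesis using sublinear_onD(2)[OF qs _ v] by blast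
  next
    case False
    then have "q (\<lambda>i. (- t) * v i) = (- t) * q v" by (intro sublinear_onD(2)[OF qs _ v]) simp
    then show ?thesis using neg[OF VD(3)[OF v, of t]] by simp
  qed
  have lp: "q v \<le> p v" if "v \<in> V" for v using qle[OF that] p0(2)[OF that] by simp
  \<comment> \<open>The value of the shifted functional at \<open>- v0\<close> is at most
    \<open>- p v0\<close>; by linearity of \<open>q\<close> this reads
    \<open>q v0 \<ge> p v0\<close>.\<close>
  have "q (\<lambda>i. - v0 i) \<le> - p v0" using qle[OF VD(4)[OF v0]] p0(3) by simp
  then have "q v0 = p v0" using neg[OF v0] lp[OF v0] by simp
  then show ?thesis using that[of q] add scale lp by (auto simp: linear_functional_on_def)
qed

section \<open>Invariant means\<close>

definition average :: "('x, 'm) monoid_scheme \<Rightarrow> nat \<Rightarrow> 'x \<Rightarrow> ('x \<Rightarrow> real) \<Rightarrow> 'x \<Rightarrow> real" where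
  "average X n x f = (\<lambda>y. (\<Sum>k<n. f (x [^]\<^bsub>X\<^esub> k \<otimes>\<^bsub>X\<^esub> y)) / real n)"

text \<open>Compositions are included so that two averagings, one good for \<open>f\<close> and one
  good for \<open>g\<close>, combine to a single one that is good for both.\<close>

inductive_set averagings :: "('x, 'm) monoid_scheme \<Rightarrow> (('x \<Rightarrow> real) \<Rightarrow> 'x \<Rightarrow> real) set" for X where
  averagings_id: "(\<lambda>f. f) \<in> averagings X"
| averagings_step: "B \<in> averagings X \<Longrightarrow> n > 0 \<Longrightarrow> x \<in> carrier X \<Longrightarrow>
    (\<lambda>f. average X n x (B f)) \<in> averagings X"

lemma averagings_add: "B \<in> averagings X \<Longrightarrow> B (\<lambda>y. f y + g y) = (\<lambda>y. B f y + B g y)"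
  by (induction rule: averagings.induct)
     (auto simp: average_def sum.distrib add_divide_distrib)

lemma averagings_scale: "B \<in> averagings X \<Longrightarrow> B (\<lambda>y. t * f y) = (\<lambda>y. t * B f y)"
  by (induction rule: averagings.induct) (auto simp: average_def sum_distrib_left)

lemma averagings_comp:
  assumes "B \<in> averagings X" "C \<in> averagings X"
  shows "(\<lambda>f. B (C f)) \<in> averagings X"
  using assms by (induction rule: averagings.induct) (auto intro: averagings.intros)

context comm_group begin

lemma averagings_le:
  "B \<in> averagings G \<Longrightarrow> (\<And>y. y \<in> carrier G \<Longrightarrow> f y \<le> c) \<Longrightarrow> y \<in> carrier G \<Longrightarrow> B f y \<le> c"
proof (induction arbitrary: y rule: averagings.induct)
  case (averagings_step B n x)
  have "(\<Sum>k<n. B f (x [^] k \<otimes> y)) \<le> (\<Sum>k<n. c)"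
    using averagings_step by (intro sum_mono) auto
  then show ?case using averagings_step(2) by (simp add: average_def field_simps)
qed auto

text \<open>Commutativity of the group enters here: translations by powers of \<open>x\<close> and
  of \<open>z\<close> may be applied in either order.\<close>

lemma average_commute:
  assumes "x \<in> carrier G" "z \<in> carrier G" "y \<in> carrier G"
  shows "average G n x (average G m z f) y = average G m z (average G n x f) y"
proof -
  have "f (z [^] j \<otimes> (x [^] i \<otimes> y)) = f (x [^] i \<otimes> (z [^] j \<otimes> y))" for i j :: nat
    using assms by (simp add: m_lcomm)
  then show ?thesis
    unfolding average_def sum_divide_distrib [symmetric]
    by (subst sum.swap) (simp add: mult.commute)
qed

lemma average_cong:
  assumes "x \<in> carrier G" "y \<in> carrier G" "\<And>y. y \<in> carrier G \<Longrightarrow> f y = g y"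
  shows "average G n x f y = average G n x g y"
  unfolding average_def using assms by (intro arg_cong2[of _ _ _ _ "(/)"] sum.cong) auto

lemma averagings_commute_average:
  "B \<in> averagings G \<Longrightarrow> x \<in> carrier G \<Longrightarrow> y \<in> carrier G \<Longrightarrow>
     average G n x (B f) y = B (average G n x f) y"
proof (induction arbitrary: y rule: averagings.induct)
  case (averagings_step B m z)
  have "average G n x (average G m z (B f)) y = average G m z (average G n x (B f)) y"
    using averagings_step by (intro average_commute) auto
  also have "\<dots> = average G m z (B (average G n x f)) y"
    using averagings_step by (intro average_cong) auto
  finally show ?case .
qed auto

lemma averagings_commute:
  "B \<in> averagings G \<Longrightarrow> C \<in> averagings G \<Longrightarrow> y \<in> carrier G \<Longrightarrow> B (C f) y = C (B f) y"
proof (induction arbitrary: y rule: averagings.induct)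
  case (averagings_step B n x)
  have "average G n x (B (C f)) y = average G n x (C (B f)) y"
    using averagings_step by (intro average_cong) auto
  also have "\<dots> = C (average G n x (B f)) y"
    using averagings_step by (intro averagings_commute_average) auto
  finally show ?case .
qed auto

text \<open>The infimum of \<open>average_bounds f\<close> is subadditive because averagings commute, and for
  \<open>f = h - h (a \<otimes> _)\<close> it is at most zero because the averages over powers of \<open>a\<close> telescope. Hence
  every linear functional below it is an invariant mean.\<close>

definition average_bounds :: "('a \<Rightarrow> real) \<Rightarrow> real set" where
  "average_bounds f = {c. \<exists>B\<in>averagings G. \<forall>y\<in>carrier G. B f y \<le> c}"

lemma average_bounds_add:
  assumes "c \<in> average_bounds f" "d \<in> average_bounds g"
  shows "c + d \<in> average_bounds (\<lambda>y. f y + g y)"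
proof -
  obtain B C where B: "B \<in> averagings G" "\<And>y. y \<in> carrier G \<Longrightarrow> B f y \<le> c"
    and C: "C \<in> averagings G" "\<And>y. y \<in> carrier G \<Longrightarrow> C g y \<le> d"
    using assms by (auto simp: average_bounds_def)
  have "B (C (\<lambda>y. f y + g y)) y \<le> c + d" if y: "y \<in> carrier G" for y
  proof -
    have "B (C (\<lambda>y. f y + g y)) y = C (B f) y + B (C g) y"
      using averagings_commute[OF B(1) C(1) y] by (simp add: averagings_add[OF B(1)] averagings_add[OF C(1)])
    also have "\<dots> \<le> c + d"
      using averagings_le[OF C(1) B(2) y] averagings_le[OF B(1) C(2) y] by (rule add_mono)
    finally show ?thesis .
  qed
  then show ?thesis
    unfolding average_bounds_def by (intro CollectI bexI[OF _ averagings_comp[OF B(1) C(1)]] ballI)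
qed

lemma average_bounds_scale:
  assumes "c \<in> average_bounds f" "t \<ge> 0"
  shows "t * c \<in> average_bounds (\<lambda>y. t * f y)"
proof -
  obtain B where B: "B \<in> averagings G" "\<And>y. y \<in> carrier G \<Longrightarrow> B f y \<le> c"
    using assms(1) by (auto simp: average_bounds_def)
  show ?thesis
    unfolding average_bounds_def
    by (intro CollectI bexI[OF _ B(1)]) (use B(2) assms(2) in \<open>simp add: averagings_scale[OF B(1)] mult_left_mono\<close>)
qed

lemma average_bounds_upper:
  assumes "\<And>y. y \<in> carrier G \<Longrightarrow> f y \<le> c"
  shows "c \<in> average_bounds f"
  unfolding average_bounds_def using assms by (intro CollectI bexI[OF _ averagings_id]) auto

lemma average_bounds_lower:
  assumes f: "\<And>y. y \<in> carrier G \<Longrightarrow> d \<le> f y" and c: "c \<in> average_bounds f"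
  shows "d \<le> c"
proof -
  obtain B where B: "B \<in> averagings G" "\<And>y. y \<in> carrier G \<Longrightarrow> B f y \<le> c"
    using c by (auto simp: average_bounds_def)
  have "B (\<lambda>y. - 1 * f y) \<one> \<le> - d" by (rule averagings_le[OF B(1)]) (use f in auto)
  then show ?thesis using B(2)[of \<one>] by (simp only: averagings_scale[OF B(1)]) simp
qed

lemma real_invariant_mean_exists:
  obtains F :: "('a \<Rightarrow> real) \<Rightarrow> real" where
    "linear_functional_on {f. bounded (f ` carrier G)} F"
    "\<And>f c. bounded (f ` carrier G) \<Longrightarrow> (\<And>y. y \<in> carrier G \<Longrightarrow> f y \<le> c) \<Longrightarrow> F f \<le> c"
    "\<And>f a. bounded (f ` carrier G) \<Longrightarrow> a \<in> carrier G \<Longrightarrow> F (\<lambda>y. f (a \<otimes> y)) = F f"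
proof -
  define V where "V = {f :: 'a \<Rightarrow> real. bounded (f ` carrier G)}"
  define p where "p f = Inf (average_bounds f)" for f
  have V: "function_subspace V"
    unfolding function_subspace_def V_def
  proof (intro conjI ballI allI; clarsimp)
    show "bounded ((\<lambda>i. 0::real) ` carrier G)" by (auto simp: bounded_iff)
    show "bounded ((\<lambda>i. v i + w i) ` carrier G)"
      if vw: "bounded (v ` carrier G)" "bounded (w ` carrier G)" for v w :: "'a \<Rightarrow> real"
      using bounded_plus_comp[OF vw] .
    show "bounded ((\<lambda>i. t * v i) ` carrier G)" if "bounded (v ` carrier G)" for v and t :: real
      using bounded_scaling[OF that, of t] by (simp add: image_image)
  qed
  have bnd: "\<exists>K. \<forall>y\<in>carrier G. - K \<le> f y \<and> f y \<le> K" if "f \<in> V" for f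
    using that unfolding V_def bounded_iff by (simp add: abs_le_iff) force
  have bdd: "bdd_below (average_bounds f)" if "f \<in> V" for f
    using bnd[OF that] average_bounds_lower by (meson bdd_belowI)
  have ne: "average_bounds f \<noteq> {}" if "f \<in> V" for f
    using bnd[OF that] average_bounds_upper by blast
  have ple: "p f \<le> c" if "f \<in> V" "c \<in> average_bounds f" for f c
    unfolding p_def using bdd[OF that(1)] that(2) by (rule cInf_lower[rotated])
  have padd: "p (\<lambda>y. f y + g y) \<le> p f + p g" if f: "f \<in> V" and g: "g \<in> V" for f g
  proof -
    have fg: "(\<lambda>y. f y + g y) \<in> V" using function_subspaceD(2)[OF V f g] .
    have "p (\<lambda>y. f y + g y) - c \<le> p g" if "c \<in> average_bounds f" for c
      unfolding p_def[of g]
      by (rule cInf_greatest[OF ne[OF g]])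
         (use ple[OF fg average_bounds_add[OF that]] in \<open>simp add: algebra_simps\<close>)
    then have "p (\<lambda>y. f y + g y) - p g \<le> p f"
      unfolding p_def[of f] by (intro cInf_greatest[OF ne[OF f]]) (force simp: algebra_simps)
    then show ?thesis by simp
  qed
  have pscale_le: "p (\<lambda>y. t * f y) \<le> t * p f" if t: "t > 0" and f: "f \<in> V" for t f
  proof -
    have "p (\<lambda>y. t * f y) / t \<le> p f"
      unfolding p_def[of f]
      by (rule cInf_greatest[OF ne[OF f]])
         (use ple[OF function_subspaceD(3)[OF V f] average_bounds_scale] t in \<open>simp add: field_simps\<close>)
    then show ?thesis using t by (simp add: field_simps)
  qed
  have p0: "p (\<lambda>y. 0) = 0"
  proof (rule antisym)
    show "p (\<lambda>y. 0) \<le> 0"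
      using ple[OF function_subspaceD(1)[OF V] average_bounds_upper] by simp
    show "0 \<le> p (\<lambda>y. 0)"
      unfolding p_def
      by (rule cInf_greatest[OF ne[OF function_subspaceD(1)[OF V]]]) (auto intro: average_bounds_lower)
  qed
  have pscale: "p (\<lambda>y. t * f y) = t * p f" if t: "t \<ge> 0" and f: "f \<in> V" for t f
  proof (cases "t = 0")
    case True then show ?thesis using p0 by simp
  next
    case False
    then have t: "t > 0" using t by simp
    have "p (\<lambda>y. inverse t * (t * f y)) \<le> inverse t * p (\<lambda>y. t * f y)"
      using t by (intro pscale_le function_subspaceD(3)[OF V f]) auto
    moreover have "(\<lambda>y. inverse t * (t * f y)) = f" using t by (auto simp: field_simps)
    ultimately have "t * p f \<le> p (\<lambda>y. t * f y)" using t by (simp add: field_simps)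
    then show ?thesis using pscale_le[OF t f] by simp
  qed
  have p: "sublinear_on V p" using padd pscale by (simp add: sublinear_on_def)
  \<comment> \<open>Domination by \<open>p\<close> carries all properties of the mean: positivity
    and normalisation through constant bounds, invariance through the telescoping averages.\<close>
  obtain F where F: "linear_functional_on V F" "\<And>v. v \<in> V \<Longrightarrow> F v \<le> p v"
    using Hahn_Banach[OF V p function_subspaceD(1)[OF V]] by metis
  have up: "F f \<le> c" if "f \<in> V" "\<And>y. y \<in> carrier G \<Longrightarrow> f y \<le> c" for f c
    using F(2)[OF that(1)] ple[OF that(1) average_bounds_upper[OF that(2)]] by simp
  have Fadd: "F (\<lambda>i. v i + w i) = F v + F w" if "v \<in> V" "w \<in> V" for v w
    using F(1) that by (simp add: linear_functional_on_def)
  have Fscale: "F (\<lambda>i. t * v i) = t * F v" if "v \<in> V" for v t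
    using F(1) that by (simp add: linear_functional_on_def)
  have inv_le: "F f \<le> F (\<lambda>y. f (a \<otimes> y))" if f: "f \<in> V" and a: "a \<in> carrier G" for f a
  proof -
    have fa: "(\<lambda>y. f (a \<otimes> y)) \<in> V"
      using f a unfolding V_def by (auto elim!: bounded_subset)
    define h where "h = (\<lambda>y. f y + (-1) * f (a \<otimes> y))"
    have h: "h \<in> V" unfolding h_def by (intro function_subspaceD(2,3)[OF V] f fa)
    obtain K where K: "\<And>y. y \<in> carrier G \<Longrightarrow> - K \<le> f y \<and> f y \<le> K" using bnd[OF f] by blast
    have "F h \<le> 2 * K / real (Suc n)" for n
    proof -
      have "average G (Suc n) a h y \<le> 2 * K / real (Suc n)" if y: "y \<in> carrier G" for y
      proof -
        have "(\<Sum>k<Suc n. h (a [^] k \<otimes> y)) = (\<Sum>k<Suc n. f (a [^] k \<otimes> y) - f (a [^] Suc k \<otimes> y))"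
          using a y by (intro sum.cong) (auto simp: h_def m_assoc[symmetric] m_comm)
        also have "\<dots> = f (a [^] (0::nat) \<otimes> y) - f (a [^] Suc n \<otimes> y)"
          by (rule sum_lessThan_telescope')
        also have "\<dots> \<le> 2 * K" using K[of "a [^] (0::nat) \<otimes> y"] K[of "a [^] Suc n \<otimes> y"] a y by simp
        finally show ?thesis unfolding average_def by (intro divide_right_mono) auto
      qed
      then have "2 * K / real (Suc n) \<in> average_bounds h"
        unfolding average_bounds_def
        using averagings_step[OF averagings_id, of "Suc n" a] a by (intro CollectI bexI[rotated]) auto
      then show ?thesis using F(2)[OF h] ple[OF h] order.trans by blast
    qed
    moreover have "(\<lambda>n. 2 * K / real (Suc n)) \<longlonglongrightarrow> 0"
      by (intro LIMSEQ_Suc lim_const_over_n)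
    ultimately have "F h \<le> 0" by (intro LIMSEQ_le_const) auto
    then show ?thesis unfolding h_def
      using Fadd[OF f function_subspaceD(3)[OF V fa, of "-1"]] Fscale[OF fa, of "-1"] by simp
  qed
  have inv: "F (\<lambda>y. f (a \<otimes> y)) = F f" if f: "f \<in> V" and a: "a \<in> carrier G" for f a
  proof -
    have fa: "(\<lambda>y. f (a \<otimes> y)) \<in> V"
      using f a unfolding V_def by (auto elim!: bounded_subset)
    \<comment> \<open>\<open>inv_le\<close> for \<open>- f\<close> is the reverse
      inequality.\<close>
    have "F (\<lambda>y. (-1) * f y) \<le> F (\<lambda>y. (-1) * f (a \<otimes> y))"
      by (rule inv_le[OF function_subspaceD(3)[OF V f] a])
    then show ?thesis using Fscale[OF fa, of "-1"] Fscale[OF f, of "-1"] inv_le[OF f a] by simp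
  qed
  show ?thesis
    by (rule that[of F]) (use F(1) up inv in \<open>auto simp: V_def\<close>)
qed

end

text \<open>Only integrals of continuous functions occur below, so that an invariant mean on all bounded
  functions serves as Haar integral.\<close>

locale invariant_mean = comm_group X for X :: "('x, 'm) monoid_scheme" (structure) +
  fixes m :: "('x \<Rightarrow> complex) \<Rightarrow> complex"
  assumes mean_add: "\<And>f g. bounded (f ` carrier X) \<Longrightarrow> bounded (g ` carrier X) \<Longrightarrow>
      m (\<lambda>x. f x + g x) = m f + m g"
    and mean_scale: "\<And>f c. bounded (f ` carrier X) \<Longrightarrow> m (\<lambda>x. c * f x) = c * m f"
    and mean_cnj: "\<And>f. bounded (f ` carrier X) \<Longrightarrow> m (\<lambda>x. cnj (f x)) = cnj (m f)"
    and mean_nonneg: "\<And>f. bounded (f ` carrier X) \<Longrightarrow> (\<And>x. x \<in> carrier X \<Longrightarrow> 0 \<le> Re (f x)) \<Longrightarrow>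
      0 \<le> Re (m f)"
    and mean_one: "m (\<lambda>x. 1) = 1"
    and mean_translate: "\<And>f a. bounded (f ` carrier X) \<Longrightarrow> a \<in> carrier X \<Longrightarrow>
      m (\<lambda>x. f (a \<otimes> x)) = m f"
    and mean_inv: "\<And>f. bounded (f ` carrier X) \<Longrightarrow> m (\<lambda>x. f (inv x)) = m f"

text \<open>The real mean is averaged with its reflection under \<open>inv\<close>, which preserves
  translation invariance because the group is abelian, and is then extended to complex functions
  through real and imaginary parts.\<close>

lemma (in comm_group) invariant_mean_exists:
  obtains m where "invariant_mean G m"
proof -
  obtain F :: "('a \<Rightarrow> real) \<Rightarrow> real" where
    lin: "linear_functional_on {f. bounded (f ` carrier G)} F"
    and le: "\<And>f c. bounded (f ` carrier G) \<Longrightarrow> (\<And>y. y \<in> carrier G \<Longrightarrow> f y \<le> c) \<Longrightarrow> F f \<le> c"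
    and tr: "\<And>f a. bounded (f ` carrier G) \<Longrightarrow> a \<in> carrier G \<Longrightarrow> F (\<lambda>y. f (a \<otimes> y)) = F f"
    using real_invariant_mean_exists by metis
  have add: "F (\<lambda>i. v i + w i) = F v + F w"
    if "bounded (v ` carrier G)" "bounded (w ` carrier G)" for v w
    using lin that by (simp add: linear_functional_on_def)
  have scale: "F (\<lambda>i. t * v i) = t * F v" if "bounded (v ` carrier G)" for v t
    using lin that by (simp add: linear_functional_on_def)
  have binv: "bounded ((\<lambda>x. f (inv x)) ` carrier G)" if "bounded (f ` carrier G)" for f :: "'a \<Rightarrow> real"
    using that by (auto elim!: bounded_subset)
  have btr: "bounded ((\<lambda>x. f (a \<otimes> x)) ` carrier G)"
    if "bounded (f ` carrier G)" "a \<in> carrier G" for a and f :: "'a \<Rightarrow> real"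
    using that by (auto elim!: bounded_subset)
  have bsc: "bounded ((\<lambda>x. t * f x) ` carrier G)" if "bounded (f ` carrier G)" for t and f :: "'a \<Rightarrow> real"
    using bounded_scaling[OF that, of t] by (simp add: image_image)
  have bad: "bounded ((\<lambda>i. v i + w i) ` carrier G)"
    if "bounded (v ` carrier G)" "bounded (w ` carrier G)" for v w :: "'a \<Rightarrow> real"
    using bounded_plus_comp[OF that] .
  define H where "H f = (F f + F (\<lambda>x. f (inv x))) / 2" for f
  have Hadd: "H (\<lambda>i. v i + w i) = H v + H w"
    if "bounded (v ` carrier G)" "bounded (w ` carrier G)" for v w
    using that add[of v w] add[of "\<lambda>x. v (inv x)" "\<lambda>x. w (inv x)"] binv
    by (simp add: H_def field_simps)
  have Hscale: "H (\<lambda>i. t * v i) = t * H v" if "bounded (v ` carrier G)" for v t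
    using that scale[of v t] scale[of "\<lambda>x. v (inv x)" t] binv by (simp add: H_def field_simps)
  have Hle: "H f \<le> c" if "bounded (f ` carrier G)" "\<And>y. y \<in> carrier G \<Longrightarrow> f y \<le> c" for f c
    using le[OF that] le[OF binv[OF that(1)], of c] that(2) by (simp add: H_def)
  have Hge: "c \<le> H f" if "bounded (f ` carrier G)" "\<And>y. y \<in> carrier G \<Longrightarrow> c \<le> f y" for f c
    using Hle[OF bsc[OF that(1), of "-1"], of "- c"] Hscale[OF that(1), of "-1"] that(2) by simp
  have Htr: "H (\<lambda>y. f (a \<otimes> y)) = H f" if f: "bounded (f ` carrier G)" and a: "a \<in> carrier G" for f a
  proof -
    have c: "f (inv (a \<otimes> y)) = f (inv a \<otimes> inv y)" if "y \<in> carrier G" for y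
      using a that by (simp add: inv_mult)
    have "F (\<lambda>x. f (a \<otimes> inv x)) = F (\<lambda>x. f (a \<otimes> inv (a \<otimes> x)))"
      using tr[OF binv[OF btr[OF f a]] a] by simp
    \<comment> \<open>The two integrands agree on the carrier only. Bounding both differences by
      \<open>0\<close> there replaces an equality of functions.\<close>
    also have "\<dots> = F (\<lambda>x. f (inv x))"
    proof -
      have b: "bounded ((\<lambda>x. f (a \<otimes> inv (a \<otimes> x))) ` carrier G)"
        using f a by (auto elim!: bounded_subset)
      have "F (\<lambda>x. f (a \<otimes> inv (a \<otimes> x)) + (-1) * f (inv x)) \<le> 0"
        by (rule le[OF bad[OF b bsc[OF binv[OF f]]]]) (use a in \<open>auto simp: inv_mult m_assoc[symmetric]\<close>)
      moreover have "F (\<lambda>x. f (inv x) + (-1) * f (a \<otimes> inv (a \<otimes> x))) \<le> 0"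
        by (rule le[OF bad[OF binv[OF f] bsc[OF b]]]) (use a in \<open>auto simp: inv_mult m_assoc[symmetric]\<close>)
      ultimately show ?thesis
        using add[OF b bsc[OF binv[OF f], of "-1"]] add[OF binv[OF f] bsc[OF b, of "-1"]]
          scale[OF b, of "-1"] scale[OF binv[OF f], of "-1"] by simp
    qed
    finally show ?thesis using tr[OF f a] by (simp add: H_def)
  qed
  have Hinv: "H (\<lambda>y. f (inv y)) = H f" if f: "bounded (f ` carrier G)" for f
  proof -
    have b: "bounded ((\<lambda>x. f (inv (inv x))) ` carrier G)" using binv[OF binv[OF f]] .
    have "F (\<lambda>x. f (inv (inv x)) + (-1) * f x) \<le> 0" "F (\<lambda>x. f x + (-1) * f (inv (inv x))) \<le> 0"
      by (rule le[OF bad[OF b bsc[OF f]]], simp) (rule le[OF bad[OF f bsc[OF b]]], simp)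
    then have "F (\<lambda>x. f (inv (inv x))) = F f"
      using add[OF b bsc[OF f, of "-1"]] add[OF f bsc[OF b, of "-1"]]
          scale[OF b, of "-1"] scale[OF f, of "-1"] by simp
    then show ?thesis by (simp add: H_def)
  qed
  define M where "M f = Complex (H (\<lambda>x. Re (f x))) (H (\<lambda>x. Im (f x)))" for f
  have bRe: "bounded ((\<lambda>x. Re (f x)) ` carrier G)" and bIm: "bounded ((\<lambda>x. Im (f x)) ` carrier G)"
    if "bounded (f ` carrier G)" for f :: "'a \<Rightarrow> complex"
    using bounded_linear_image[OF that bounded_linear_Re] bounded_linear_image[OF that bounded_linear_Im]
    by (simp_all add: image_image)
  have "invariant_mean G M"
  proof
    fix f g :: "'a \<Rightarrow> complex" assume f: "bounded (f ` carrier G)"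
    show "M (\<lambda>x. c * f x) = c * M f" for c
      using Hadd[OF bsc[OF bRe[OF f], of "Re c"] bsc[OF bIm[OF f], of "- Im c"]]
        Hadd[OF bsc[OF bIm[OF f], of "Re c"] bsc[OF bRe[OF f], of "Im c"]]
        Hscale[OF bRe[OF f]] Hscale[OF bIm[OF f]] Hscale[OF bIm[OF f], of "- Im c"]
      by (simp add: M_def complex_eq_iff)
    show "M (\<lambda>x. cnj (f x)) = cnj (M f)"
      using Hscale[OF bIm[OF f], of "-1"] by (simp add: M_def complex_eq_iff)
    show "M (\<lambda>x. f (a \<otimes> x)) = M f" if "a \<in> carrier G" for a
      using Htr[OF bRe[OF f] that] Htr[OF bIm[OF f] that] by (simp add: M_def)
    show "M (\<lambda>x. f (inv x)) = M f"
      using Hinv[OF bRe[OF f]] Hinv[OF bIm[OF f]] by (simp add: M_def)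
    show "0 \<le> Re (M f)" if "\<And>x. x \<in> carrier G \<Longrightarrow> 0 \<le> Re (f x)"
      using Hge[OF bRe[OF f] that] by (simp add: M_def)
    show "M (\<lambda>x. f x + g x) = M f + M g" if g: "bounded (g ` carrier G)"
      using Hadd[OF bRe[OF f] bRe[OF g]] Hadd[OF bIm[OF f] bIm[OF g]]
      by (simp add: M_def complex_eq_iff)
  next
    have b: "bounded ((\<lambda>x. c) ` carrier G)" for c :: real by (auto simp: bounded_iff)
    have "H (\<lambda>x. c) = c" for c
      using Hle[OF b, of c c] Hge[OF b, of c c] by simp
    then show "M (\<lambda>x. 1) = 1" by (simp add: M_def complex_eq_iff)
  qed
  then show ?thesis using that by blast
qed

section \<open>Linearity and bounds of the mean\<close>

context invariant_mean begin

lemma bounded_on_add: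
  fixes f g :: "'x \<Rightarrow> complex"
  assumes "bounded (f ` carrier X)" "bounded (g ` carrier X)"
  shows "bounded ((\<lambda>x. f x + g x) ` carrier X)"
  using bounded_plus_comp[OF assms] .

lemma bounded_on_iff:
  fixes f :: "'x \<Rightarrow> complex"
  shows "bounded (f ` carrier X) \<longleftrightarrow> (\<exists>K>0. \<forall>x\<in>carrier X. cmod (f x) \<le> K)"
  by (auto simp: bounded_pos)

lemma bounded_on_mult:
  fixes f g :: "'x \<Rightarrow> complex"
  assumes "bounded (f ` carrier X)" "bounded (g ` carrier X)"
  shows "bounded ((\<lambda>x. f x * g x) ` carrier X)"
proof -
  obtain K L where "K > 0" "L > 0" "\<And>x. x \<in> carrier X \<Longrightarrow> cmod (f x) \<le> K"
    "\<And>x. x \<in> carrier X \<Longrightarrow> cmod (g x) \<le> L"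
    using assms by (auto simp: bounded_on_iff)
  then have "cmod (f x * g x) \<le> K * L" if "x \<in> carrier X" for x
    using that by (auto simp: norm_mult intro!: mult_mono)
  then show ?thesis using \<open>K > 0\<close> \<open>L > 0\<close> by (auto simp: bounded_on_iff intro!: exI[of _ "K * L"])
qed

lemma bounded_on_const: "bounded ((\<lambda>x. c::complex) ` carrier X)" by (auto simp: bounded_iff)

lemma bounded_on_cnj: "bounded (f ` carrier X) \<Longrightarrow> bounded ((\<lambda>x. cnj (f x)) ` carrier X)"
  by (auto simp: bounded_iff)

lemma bounded_on_minus: "bounded (f ` carrier X) \<Longrightarrow> bounded ((\<lambda>x. - f x :: complex) ` carrier X)"
  by (auto simp: bounded_iff)

lemma bounded_on_diff:
  fixes f g :: "'x \<Rightarrow> complex"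
  assumes "bounded (f ` carrier X)" "bounded (g ` carrier X)"
  shows "bounded ((\<lambda>x. f x - g x) ` carrier X)"
  using bounded_minus_comp[OF assms] .

lemma bounded_on_sum:
  fixes f :: "'i \<Rightarrow> 'x \<Rightarrow> complex"
  assumes "\<And>i. i \<in> I \<Longrightarrow> bounded (f i ` carrier X)"
  shows "bounded ((\<lambda>x. \<Sum>i\<in>I. f i x) ` carrier X)"
  using assms by (induction I rule: infinite_finite_induct) (auto intro: bounded_on_add bounded_on_const)

lemmas bounded_on_intros = bounded_on_add bounded_on_mult bounded_on_const bounded_on_cnj
  bounded_on_minus bounded_on_diff bounded_on_sum

lemma mean_diff:
  assumes "bounded (f ` carrier X)" "bounded (g ` carrier X)"
  shows "m (\<lambda>x. f x - g x) = m f - m g"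
  using mean_add[OF assms(1) bounded_on_mult[OF bounded_on_const[of "-1"] assms(2)]]
    mean_scale[OF assms(2), of "-1"] by simp

lemma mean_const: "m (\<lambda>x. c) = c"
  using mean_scale[OF bounded_on_const[of 1], of c] mean_one by simp

lemma mean_sum:
  assumes "finite I" "\<And>i. i \<in> I \<Longrightarrow> bounded (f i ` carrier X)"
  shows "m (\<lambda>x. \<Sum>i\<in>I. f i x) = (\<Sum>i\<in>I. m (f i))"
  using assms by (induction I rule: finite_induct) (auto simp: mean_const mean_add bounded_on_sum)

text \<open>Multiplication by a unimodular \<open>c\<close> makes \<open>c * m f\<close> real and
  nonnegative; positivity is then applied to \<open>K - c * f\<close>.\<close>

lemma norm_mean_le:
  assumes f: "bounded (f ` carrier X)" and K: "\<And>x. x \<in> carrier X \<Longrightarrow> cmod (f x) \<le> K"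
  shows "cmod (m f) \<le> K"
proof -
  define c where "c = (if m f = 0 then 1 else cnj (m f) / cmod (m f))"
  have c1: "cmod c = 1" by (auto simp: c_def norm_divide)
  have cm: "c * m f = cmod (m f)"
    by (auto simp: c_def complex_norm_square[symmetric] power2_eq_square field_simps mult.commute)
  have "0 \<le> Re (m (\<lambda>x. of_real K - c * f x))"
  proof (rule mean_nonneg)
    show "bounded ((\<lambda>x. complex_of_real K - c * f x) ` carrier X)" by (intro bounded_on_intros f)
    fix x assume "x \<in> carrier X"
    then have "Re (c * f x) \<le> K"
      using K[of x] complex_Re_le_cmod[of "c * f x"] c1 by (simp add: norm_mult)
    then show "0 \<le> Re (complex_of_real K - c * f x)" by simp
  qed
  also have "m (\<lambda>x. of_real K - c * f x) = of_real K - c * m f"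
    using f by (simp add: mean_diff mean_scale mean_const bounded_on_intros)
  finally show ?thesis by (simp add: cm)
qed

text \<open>Independence of the values outside the carrier is not among the axioms; it follows since
  the difference has norm bound \<open>0\<close> on the carrier.\<close>

lemma mean_cong:
  assumes f: "bounded (f ` carrier X)" and eq: "\<And>x. x \<in> carrier X \<Longrightarrow> f x = g x"
  shows "m f = m g"
proof -
  have g: "bounded (g ` carrier X)" using f eq by (metis (no_types, lifting) image_cong)
  have "cmod (m (\<lambda>x. f x - g x)) \<le> 0"
    by (rule norm_mean_le) (use f g eq in \<open>auto intro: bounded_on_intros\<close>)
  then show ?thesis using mean_diff[OF f g] by simp
qed

lemma mean_mono_Re:
  assumes f: "bounded (f ` carrier X)" and g: "bounded (g ` carrier X)"
    and le: "\<And>x. x \<in> carrier X \<Longrightarrow> Re (f x) \<le> Re (g x)"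
  shows "Re (m f) \<le> Re (m g)"
  using mean_nonneg[OF bounded_on_diff[OF g f]] le mean_diff[OF g f] by simp

lemma norm_mean_diff_le:
  assumes f: "bounded (f ` carrier X)" and g: "bounded (g ` carrier X)"
    and le: "\<And>x. x \<in> carrier X \<Longrightarrow> cmod (f x - g x) \<le> e"
  shows "cmod (m f - m g) \<le> e"
  using norm_mean_le[OF bounded_on_diff[OF f g] le] mean_diff[OF f g] by simp

lemma bounded_on_translate:
  fixes f :: "'x \<Rightarrow> complex"
  shows "bounded (f ` carrier X) \<Longrightarrow> a \<in> carrier X \<Longrightarrow> bounded ((\<lambda>x. f (a \<otimes> x)) ` carrier X)"
  by (auto elim!: bounded_subset)

lemma bounded_on_inv:
  fixes f :: "'x \<Rightarrow> complex"
  shows "bounded (f ` carrier X) \<Longrightarrow> bounded ((\<lambda>x. f (inv x)) ` carrier X)"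
  by (auto elim!: bounded_subset)

lemma mean_reflect:
  assumes f: "bounded (f ` carrier X)" and a: "a \<in> carrier X"
  shows "m (\<lambda>x. f (a \<otimes> inv x)) = m f"
  using mean_inv[OF bounded_on_translate[OF f a]] mean_translate[OF f a] by simp

end

section \<open>Convolution of continuous functions\<close>

lemma continuous_map_mult_algebra:
  fixes f g :: "'a \<Rightarrow> 'b::real_normed_algebra"
  shows "continuous_map Z euclidean f \<Longrightarrow> continuous_map Z euclidean g \<Longrightarrow>
    continuous_map Z euclidean (\<lambda>x. f x * g x)"
  by (simp add: continuous_map_atin tendsto_mult)

lemma continuous_map_cnj:
  "continuous_map Z euclidean f \<Longrightarrow> continuous_map Z euclidean (\<lambda>x. cnj (f x))"
  by (simp add: continuous_map_atin tendsto_cnj)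

lemma continuous_map_euclidean_iff:
  fixes f :: "'a \<Rightarrow> 'b::metric_space"
  shows "continuous_map Z euclidean f \<longleftrightarrow>
    (\<forall>x\<in>topspace Z. \<forall>e>0. \<exists>U. openin Z U \<and> x \<in> U \<and> (\<forall>y\<in>U. dist (f y) (f x) < e))"
  using Met_TC.continuous_map_to_metric[of Z f] by (simp add: dist_commute)

locale compact_group_mean = compact_metrizable_abelian_group X T + invariant_mean X m
  for X :: "'x monoid" (structure) and T and m
begin

section \<open>Functions of two variables on the compact group\<close>

lemma compact_cover:
  assumes "\<And>x. x \<in> carrier X \<Longrightarrow> openin T (U x)" "\<And>x. x \<in> carrier X \<Longrightarrow> x \<in> U x"
  obtains Z where "finite Z" "Z \<subseteq> carrier X" "\<And>x. x \<in> carrier X \<Longrightarrow> \<exists>z\<in>Z. x \<in> U z"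
proof -
  have "\<exists>\<F>. finite \<F> \<and> \<F> \<subseteq> U ` carrier X \<and> topspace T \<subseteq> \<Union>\<F>"
    using compact unfolding compact_space_alt by (rule allE[of _ "U ` carrier X"])
      (use assms in \<open>auto simp: topspace_eq\<close>)
  then obtain Z where "finite Z" "Z \<subseteq> carrier X" "topspace T \<subseteq> \<Union>(U ` Z)"
    by (metis finite_subset_image)
  then show ?thesis using that[of Z] by (auto simp: topspace_eq)
qed

text \<open>The tube lemma: finitely many product neighbourhoods cover the slice over
  \<open>x\<close>, and the intersection of their first factors works for every \<open>y\<close> at
  once.\<close>

lemma joint_uniform:
  fixes F :: "'x \<Rightarrow> 'x \<Rightarrow> complex"
  assumes F: "continuous_map (prod_topology T T) euclidean (\<lambda>p. F (fst p) (snd p))"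
    and x: "x \<in> carrier X" and e: "e > 0"
  obtains U where "openin T U" "x \<in> U"
    "\<And>x' y. x' \<in> U \<Longrightarrow> y \<in> carrier X \<Longrightarrow> cmod (F x' y - F x y) < e"
proof -
  have "\<exists>U V. openin T U \<and> openin T V \<and> x \<in> U \<and> y \<in> V \<and>
      (\<forall>x'\<in>U. \<forall>y'\<in>V. cmod (F x' y' - F x y) < e/2)" (is "\<exists>U V. ?P y U V") if y: "y \<in> carrier X" for y
  proof -
    obtain W where W: "openin (prod_topology T T) W" "(x, y) \<in> W"
      "\<And>p. p \<in> W \<Longrightarrow> dist (F (fst p) (snd p)) (F x y) < e/2"
      using F[unfolded continuous_map_euclidean_iff, rule_format, of "(x,y)" "e/2"] x y e
      by (auto simp: topspace_eq)
    obtain U V where "openin T U" "openin T V" "x \<in> U" "y \<in> V" "U \<times> V \<subseteq> W"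
      using W(1)[unfolded openin_prod_topology_alt, rule_format, OF W(2)] by blast
    moreover from this have "\<forall>x'\<in>U. \<forall>y'\<in>V. cmod (F x' y' - F x y) < e/2"
      using W(3)[of "(x', y')" for x' y'] by (auto simp: dist_norm subset_iff)
    ultimately show ?thesis by blast
  qed
  then have "\<forall>y\<in>carrier X. \<exists>p. ?P y (fst p) (snd p)" by simp
  then obtain p where p: "\<And>y. y \<in> carrier X \<Longrightarrow> ?P y (fst (p y)) (snd (p y))" unfolding bchoice_iff by blast
  define U where "U y = fst (p y)" for y
  define V where "V y = snd (p y)" for y
  have UV: "\<And>y. y \<in> carrier X \<Longrightarrow> openin T (U y)" "\<And>y. y \<in> carrier X \<Longrightarrow> openin T (V y)"
    "\<And>y. y \<in> carrier X \<Longrightarrow> x \<in> U y" "\<And>y. y \<in> carrier X \<Longrightarrow> y \<in> V y"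
    "\<And>y x' y'. y \<in> carrier X \<Longrightarrow> x' \<in> U y \<Longrightarrow> y' \<in> V y \<Longrightarrow> cmod (F x' y' - F x y) < e/2"
    using p unfolding U_def V_def by blast+
  obtain Z where Z: "finite Z" "Z \<subseteq> carrier X" "\<And>y. y \<in> carrier X \<Longrightarrow> \<exists>z\<in>Z. y \<in> V z"
    using compact_cover[OF UV(2,4)] by metis
  show ?thesis
  proof (rule that[of "carrier X \<inter> \<Inter>(U ` Z)"])
    have "openin T (\<Inter>(U ` Z) \<inter> topspace T)"
      using Z UV(1) by (intro openin_INT) auto
    then show "openin T (carrier X \<inter> \<Inter>(U ` Z))" by (simp add: topspace_eq Int_commute)
    show "x \<in> carrier X \<inter> \<Inter>(U ` Z)" using x Z(2) UV(3) by auto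
    fix x' y assume x': "x' \<in> carrier X \<inter> \<Inter>(U ` Z)" and y: "y \<in> carrier X"
    obtain z where z: "z \<in> Z" "y \<in> V z" using Z(3)[OF y] by blast
    have "cmod (F x' y - F x z) < e/2" "cmod (F x y - F x z) < e/2"
      using UV(5)[of z _ y] UV(3)[of z] z x' Z(2) by auto
    then show "cmod (F x' y - F x y) < e"
      using dist_triangle_half_r[of "F x z" "F x' y" e "F x y"] by (simp add: dist_norm norm_minus_commute)
  qed
qed

text \<open>Total boundedness of the family of slices \<open>F x\<close> in the supremum norm. The
  choice \<open>r\<close> of a nearby slice need not be continuous in any sense.\<close>

lemma joint_net:
  fixes F :: "'x \<Rightarrow> 'x \<Rightarrow> complex"
  assumes F: "continuous_map (prod_topology T T) euclidean (\<lambda>p. F (fst p) (snd p))" and e: "e > 0"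
  obtains Z r where "finite Z" "Z \<subseteq> carrier X" "\<And>x. x \<in> carrier X \<Longrightarrow> r x \<in> Z"
    "\<And>x y. x \<in> carrier X \<Longrightarrow> y \<in> carrier X \<Longrightarrow> cmod (F x y - F (r x) y) < e"
proof -
  have "\<exists>U. openin T U \<and> x \<in> U \<and> (\<forall>x'\<in>U. \<forall>y\<in>carrier X. cmod (F x' y - F x y) < e)"
    if "x \<in> carrier X" for x
    using joint_uniform[OF F that e] by metis
  then obtain U where U: "\<And>x. x \<in> carrier X \<Longrightarrow> openin T (U x)" "\<And>x. x \<in> carrier X \<Longrightarrow> x \<in> U x"
    "\<And>x x' y. x \<in> carrier X \<Longrightarrow> x' \<in> U x \<Longrightarrow> y \<in> carrier X \<Longrightarrow> cmod (F x' y - F x y) < e"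
    by metis
  obtain Z where Z: "finite Z" "Z \<subseteq> carrier X" "\<And>y. y \<in> carrier X \<Longrightarrow> \<exists>z\<in>Z. y \<in> U z"
    using compact_cover[OF U(1,2)] by metis
  obtain r where r: "\<And>x. x \<in> carrier X \<Longrightarrow> r x \<in> Z \<and> x \<in> U (r x)"
    using Z(3) by metis
  show ?thesis
  proof (rule that[of Z r])
    fix x y assume "x \<in> carrier X" "y \<in> carrier X"
    then show "cmod (F x y - F (r x) y) < e" using r[of x] Z(2) U(3)[of "r x" x y] by blast
  qed (use Z r in auto)
qed

abbreviation cont :: "('x \<Rightarrow> complex) \<Rightarrow> bool" where "cont f \<equiv> continuous_map T euclidean f"

lemma cont_bounded: "cont f \<Longrightarrow> bounded (f ` carrier X)"
  using image_compactin[of T "topspace T" euclidean f] compact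
  by (simp add: compact_space_def topspace_eq compact_imp_bounded)

abbreviation joint :: "('x \<Rightarrow> 'x \<Rightarrow> complex) \<Rightarrow> bool" where
  "joint F \<equiv> continuous_map (prod_topology T T) euclidean (\<lambda>p. F (fst p) (snd p))"

lemma joint_swap: "joint F \<Longrightarrow> joint (\<lambda>x y. F y x)"
  using continuous_map_compose[of "prod_topology T T" "prod_topology T T" "\<lambda>p. (snd p, fst p)" euclidean
      "\<lambda>p. F (fst p) (snd p)"]
  by (simp add: o_def continuous_map_paired continuous_map_fst continuous_map_snd)

lemma joint_slice:
  assumes "joint F" "x \<in> carrier X"
  shows "cont (F x)"
  using continuous_map_compose[of T "prod_topology T T" "\<lambda>y. (x, y)" euclidean "\<lambda>p. F (fst p) (snd p)"] assms
  by (simp add: o_def continuous_map_paired topspace_eq id_def[symmetric])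

lemma joint_bounded:
  assumes "joint F"
  obtains K where "K > 0" "\<And>x y. x \<in> carrier X \<Longrightarrow> y \<in> carrier X \<Longrightarrow> cmod (F x y) \<le> K"
proof -
  have "compact_space (prod_topology T T)" using compact by (simp add: compact_space_prod_topology)
  then have "compactin (prod_topology T T) (carrier X \<times> carrier X)"
    by (simp add: compact_space_def topspace_eq)
  then have "bounded ((\<lambda>p. F (fst p) (snd p)) ` (carrier X \<times> carrier X))"
    using image_compactin[OF _ assms] by (simp add: compact_imp_bounded)
  then obtain K where "K > 0" "\<forall>p\<in>carrier X \<times> carrier X. cmod (F (fst p) (snd p)) \<le> K"
    by (auto simp: bounded_pos)
  then show ?thesis using that[of K] by auto
qed

lemma joint_mean_cont:
  assumes F: "joint F"
  shows "cont (\<lambda>x. m (F x))"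
  unfolding continuous_map_euclidean_iff
proof (intro ballI allI impI)
  fix x and e :: real assume x: "x \<in> topspace T" and e: "e > 0"
  obtain U where U: "openin T U" "x \<in> U"
    "\<And>x' y. x' \<in> U \<Longrightarrow> y \<in> carrier X \<Longrightarrow> cmod (F x' y - F x y) < e/2"
    using joint_uniform[OF F, of x "e/2"] x e by (auto simp: topspace_eq)
  have "dist (m (F x')) (m (F x)) < e" if x': "x' \<in> U" for x'
  proof -
    have "x' \<in> carrier X" using openin_subset[OF U(1)] x' by (auto simp: topspace_eq)
    then have "cmod (m (F x') - m (F x)) \<le> e/2"
      using x U(3)[OF x'] by (intro norm_mean_diff_le cont_bounded joint_slice[OF F])
        (auto simp: topspace_eq intro: less_imp_le)
    then show ?thesis using e by (simp add: dist_norm)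
  qed
  then show "\<exists>U. openin T U \<and> x \<in> U \<and> (\<forall>y\<in>U. dist (m (F y)) (m (F x)) < e)" using U by blast
qed

text \<open>A finite net replaces \<open>F\<close> by a step function in the first variable, for
  which the interchange is finite additivity. The steps may be arbitrary sets because the mean is
  defined on all bounded functions.\<close>

lemma mean_Fubini:
  assumes F: "joint F"
  shows "m (\<lambda>x. m (F x)) = m (\<lambda>y. m (\<lambda>x. F x y))"
proof -
  have key: "cmod (m (\<lambda>x. m (F x)) - m (\<lambda>y. m (\<lambda>x. F x y))) \<le> 2 * e" if e: "e > 0" for e
  proof -
    obtain Z r where Z: "finite Z" "Z \<subseteq> carrier X" "\<And>x. x \<in> carrier X \<Longrightarrow> r x \<in> Z"
      "\<And>x y. x \<in> carrier X \<Longrightarrow> y \<in> carrier X \<Longrightarrow> cmod (F x y - F (r x) y) < e"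
      using joint_net[OF F e] by metis
    obtain K where K: "K > 0" "\<And>x y. x \<in> carrier X \<Longrightarrow> y \<in> carrier X \<Longrightarrow> cmod (F x y) \<le> K"
      using joint_bounded[OF F] by metis
    \<comment> \<open>Indicator of the set of points represented by \<open>z\<close>.\<close>
    define I where "I z x = (if r x = z then 1 else 0 :: complex)" for z x
    have I: "bounded (I z ` carrier X)" for z
      by (rule boundedI[of _ 1]) (auto simp: I_def)
    have rX: "r x \<in> carrier X" if "x \<in> carrier X" for x using Z that by auto
    have split: "(\<Sum>z\<in>Z. I z x * g z) = g (r x)" if "x \<in> carrier X" for g :: "'x \<Rightarrow> complex" and x
    proof -
      have "(\<Sum>z\<in>Z. I z x * g z) = (\<Sum>z\<in>Z. if r x = z then g z else 0)"
        by (intro sum.cong) (auto simp: I_def)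
      then show ?thesis using Z(1) Z(3)[OF that] by (simp add: sum.delta')
    qed
    have b1: "bounded ((\<lambda>x. m (F x)) ` carrier X)" by (rule cont_bounded[OF joint_mean_cont[OF F]])
    have b2: "bounded ((\<lambda>y. m (\<lambda>x. F x y)) ` carrier X)"
      by (rule cont_bounded[OF joint_mean_cont[OF joint_swap[OF F]]])
    have bF: "bounded (F x ` carrier X)" if "x \<in> carrier X" for x
      by (rule cont_bounded[OF joint_slice[OF F that]])
    have bF': "bounded ((\<lambda>x. F x y) ` carrier X)" if "y \<in> carrier X" for y
      by (rule cont_bounded[OF joint_slice[OF joint_swap[OF F] that]])
    have bIg: "bounded ((\<lambda>x. \<Sum>z\<in>Z. I z x * g z) ` carrier X)" for g
      by (intro bounded_on_intros I)
    have mIg: "m (\<lambda>x. \<Sum>z\<in>Z. I z x * g z) = (\<Sum>z\<in>Z. m (I z) * g z)" for g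
      using Z(1) I by (simp add: mean_sum mult.commute[of "I _ _"] mean_scale bounded_on_intros)
        (simp add: mult.commute)
    have 1: "cmod (m (\<lambda>x. m (F x)) - m (\<lambda>x. \<Sum>z\<in>Z. I z x * m (F z))) \<le> e"
    proof (rule norm_mean_diff_le[OF b1 bIg])
      fix x assume x: "x \<in> carrier X"
      show "cmod (m (F x) - (\<Sum>z\<in>Z. I z x * m (F z))) \<le> e"
        unfolding split[OF x, of "\<lambda>z. m (F z)"]
        by (rule norm_mean_diff_le[OF bF[OF x] bF[OF rX[OF x]]]) (use Z(4)[OF x] in \<open>auto intro: less_imp_le\<close>)
    qed
    have bS: "bounded ((\<lambda>y. \<Sum>z\<in>Z. m (I z) * F z y) ` carrier X)"
      using Z(2) by (intro bounded_on_intros bF) auto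
    have 2: "cmod (m (\<lambda>y. m (\<lambda>x. F x y)) - m (\<lambda>y. \<Sum>z\<in>Z. m (I z) * F z y)) \<le> e"
    proof (rule norm_mean_diff_le[OF b2 bS])
      fix y assume y: "y \<in> carrier X"
      have "cmod (m (\<lambda>x. F x y) - m (\<lambda>x. \<Sum>z\<in>Z. I z x * F z y)) \<le> e"
      proof (rule norm_mean_diff_le[OF bF'[OF y] bIg])
        fix x assume x: "x \<in> carrier X"
        show "cmod (F x y - (\<Sum>z\<in>Z. I z x * F z y)) \<le> e"
          unfolding split[OF x, of "\<lambda>z. F z y"] using Z(4)[OF x y] by simp
      qed
      then show "cmod (m (\<lambda>x. F x y) - (\<Sum>z\<in>Z. m (I z) * F z y)) \<le> e" by (simp only: mIg)
    qed
    have "m (\<lambda>y. \<Sum>z\<in>Z. m (I z) * F z y) = (\<Sum>z\<in>Z. m (I z) * m (F z))"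
      using Z(1,2) bF by (subst mean_sum) (auto intro!: bounded_on_intros sum.cong mean_scale)
    with 1 2 show ?thesis unfolding mIg
      using dist_triangle_le[of "m (\<lambda>x. m (F x))" "\<Sum>z\<in>Z. m (I z) * m (F z)" "m (\<lambda>y. m (\<lambda>x. F x y))" "2 * e"]
      by (simp add: dist_norm)
  qed
  have "cmod (m (\<lambda>x. m (F x)) - m (\<lambda>y. m (\<lambda>x. F x y))) \<le> 0"
  proof (rule field_le_epsilon)
    fix e :: real assume "0 < e"
    then show "cmod (m (\<lambda>x. m (F x)) - m (\<lambda>y. m (\<lambda>x. F x y))) \<le> 0 + e"
      using key[of "e/2"] by (simp only: half_gt_zero) simp
  qed
  then show ?thesis by simp
qed

section \<open>The convolution algebra of continuous functions\<close>

lemma continuous_map_op: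
  "continuous_map Z T a \<Longrightarrow> continuous_map Z T b \<Longrightarrow> continuous_map Z T (\<lambda>p. a p \<otimes> b p)"
  using continuous_map_compose[of Z "prod_topology T T" "\<lambda>p. (a p, b p)" T "\<lambda>(x,y). x \<otimes> y"] continuous_mult
  by (simp add: o_def continuous_map_paired)

lemma continuous_map_inverse:
  "continuous_map Z T a \<Longrightarrow> continuous_map Z T (\<lambda>p. inv (a p))"
  using continuous_map_compose[of Z T a T "\<lambda>x. inv x"] continuous_inv by (simp add: o_def)

lemma cont_comp: "cont f \<Longrightarrow> continuous_map Z T a \<Longrightarrow> continuous_map Z euclidean (\<lambda>p. f (a p))"
  using continuous_map_compose[of Z T a euclidean f] by (simp add: o_def)

lemmas cont_intros = continuous_map_op continuous_map_inverse continuous_map_mult_algebra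
  continuous_map_cnj continuous_map_fst continuous_map_snd continuous_map_add continuous_map_diff
  continuous_map_minus

text \<open>Vanishing outside the carrier makes functions that agree on the carrier equal, so that
  the laws of convolution are equations and can be used for rewriting.\<close>

definition CX :: "('x \<Rightarrow> complex) set" where
  "CX = {f. cont f \<and> (\<forall>x. x \<notin> carrier X \<longrightarrow> f x = 0)}"

lemma CX_cont: "f \<in> CX \<Longrightarrow> cont f" by (simp add: CX_def)
lemma CX_bounded: "f \<in> CX \<Longrightarrow> bounded (f ` carrier X)" by (simp add: CX_cont cont_bounded)

definition cut :: "('x \<Rightarrow> complex) \<Rightarrow> 'x \<Rightarrow> complex" where
  "cut f x = (if x \<in> carrier X then f x else 0)"

lemma cut_CX: "cont f \<Longrightarrow> cut f \<in> CX"
  unfolding CX_def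
  by (auto simp: cut_def topspace_eq intro: continuous_map_eq[where f=f])

lemma CX_eqI: "f \<in> CX \<Longrightarrow> g \<in> CX \<Longrightarrow> (\<And>x. x \<in> carrier X \<Longrightarrow> f x = g x) \<Longrightarrow> f = g"
  by (rule ext) (metis (mono_tags, lifting) CX_def mem_Collect_eq)

lemma CX_add: "f \<in> CX \<Longrightarrow> g \<in> CX \<Longrightarrow> (\<lambda>x. f x + g x) \<in> CX"
  and CX_diff: "f \<in> CX \<Longrightarrow> g \<in> CX \<Longrightarrow> (\<lambda>x. f x - g x) \<in> CX"
  and CX_scale: "f \<in> CX \<Longrightarrow> (\<lambda>x. c * f x) \<in> CX"
  by (auto simp: CX_def continuous_map_add continuous_map_diff continuous_map_cnj
      continuous_map_mult_algebra)

definition star :: "('x \<Rightarrow> complex) \<Rightarrow> 'x \<Rightarrow> complex" where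
  "star f = cut (\<lambda>x. cnj (f (inv x)))"

definition translate :: "'x \<Rightarrow> ('x \<Rightarrow> complex) \<Rightarrow> 'x \<Rightarrow> complex" where
  "translate a f = cut (\<lambda>x. f (a \<otimes> x))"

definition conv :: "('x \<Rightarrow> complex) \<Rightarrow> ('x \<Rightarrow> complex) \<Rightarrow> 'x \<Rightarrow> complex" where
  "conv f g = cut (\<lambda>x. m (\<lambda>y. f y * g (inv y \<otimes> x)))"

lemma continuous_map_ident: "continuous_map T T (\<lambda>x. x)"
  using continuous_map_id by (simp add: id_def)

lemma star_CX:
  assumes "f \<in> CX"
  shows "star f \<in> CX"
  unfolding star_def by (intro cut_CX cont_intros cont_comp[OF CX_cont[OF assms]] continuous_map_ident)

lemma translate_CX:
  assumes "a \<in> carrier X" "f \<in> CX"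
  shows "translate a f \<in> CX"
  unfolding translate_def
  by (intro cut_CX cont_intros cont_comp[OF CX_cont[OF assms(2)]] continuous_map_ident)
     (use assms in \<open>simp add: topspace_eq\<close>)

lemma joint_conv:
  assumes "cont f" "cont g"
  shows "joint (\<lambda>x y. f y * g (inv y \<otimes> x))"
  by (intro cont_intros cont_comp[OF assms(1)] cont_comp[OF assms(2)])

lemma conv_CX: "f \<in> CX \<Longrightarrow> g \<in> CX \<Longrightarrow> conv f g \<in> CX"
  unfolding conv_def by (intro cut_CX joint_mean_cont joint_conv CX_cont)

lemma conv_bounded:
  assumes "f \<in> CX" "g \<in> CX" "x \<in> carrier X"
  shows "bounded ((\<lambda>y. f y * g (inv y \<otimes> x)) ` carrier X)"
  using cont_bounded[OF joint_slice[OF joint_conv[OF assms(1,2)[THEN CX_cont]] assms(3)]] .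

lemma conv_apply: "x \<in> carrier X \<Longrightarrow> conv f g x = m (\<lambda>y. f y * g (inv y \<otimes> x))"
  by (simp add: conv_def cut_def)

lemma star_apply: "x \<in> carrier X \<Longrightarrow> star f x = cnj (f (inv x))"
  by (simp add: star_def cut_def)

lemma translate_apply: "x \<in> carrier X \<Longrightarrow> translate a f x = f (a \<otimes> x)"
  by (simp add: translate_def cut_def)

text \<open>The substitution of \<open>x \<otimes> inv y\<close> for \<open>y\<close> exchanges the
  factors. It is for this that the mean is required to be invariant under inversion.\<close>

lemma conv_commute:
  assumes f: "f \<in> CX" and g: "g \<in> CX"
  shows "conv f g = conv g f"
proof (rule CX_eqI)
  fix x assume x: "x \<in> carrier X"
  have "conv f g x = m (\<lambda>y. f (x \<otimes> inv y) * g (inv (x \<otimes> inv y) \<otimes> x))"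
    unfolding conv_apply[OF x] by (rule mean_reflect[symmetric, OF conv_bounded[OF f g x] x])
  also have "\<dots> = m (\<lambda>y. g y * f (inv y \<otimes> x))"
  proof (rule mean_cong[symmetric, OF conv_bounded[OF g f x]])
    fix y assume y: "y \<in> carrier X"
    have "inv (x \<otimes> inv y) \<otimes> x = y" using x y by (simp add: inv_mult_group m_assoc)
    moreover have "inv y \<otimes> x = x \<otimes> inv y" using x y by (simp add: m_comm)
    ultimately show "g y * f (inv y \<otimes> x) = f (x \<otimes> inv y) * g (inv (x \<otimes> inv y) \<otimes> x)" by simp
  qed
  finally show "conv f g x = conv g f x" using x by (simp add: conv_apply)
qed (use assms conv_CX in auto)

text \<open>Fubini for the triple product, followed by translation of the inner variable by
  \<open>z\<close>.\<close>

lemma conv_assoc: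
  assumes f: "f \<in> CX" and g: "g \<in> CX" and h: "h \<in> CX"
  shows "conv (conv f g) h = conv f (conv g h)"
proof (rule CX_eqI)
  fix x assume x: "x \<in> carrier X"
  note c = f[THEN CX_cont] g[THEN CX_cont] h[THEN CX_cont]
  define F where "F y z = f z * g (inv z \<otimes> y) * h (inv y \<otimes> x)" for y z
  have F: "joint F"
    unfolding F_def using x by (intro cont_intros cont_comp[OF c(1)] cont_comp[OF c(2)] cont_comp[OF c(3)])
      (simp add: topspace_eq)
  have "conv (conv f g) h x = m (\<lambda>y. m (F y))"
    unfolding conv_apply[OF x]
  proof (rule mean_cong[OF conv_bounded[OF conv_CX[OF f g] h x]])
    fix y assume y: "y \<in> carrier X"
    have "m (F y) = h (inv y \<otimes> x) * m (\<lambda>z. f z * g (inv z \<otimes> y))"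
      unfolding F_def using mean_scale[OF conv_bounded[OF f g y], of "h (inv y \<otimes> x)"] by (simp add: mult_ac)
    then show "conv f g y * h (inv y \<otimes> x) = m (F y)" by (simp add: conv_apply[OF y])
  qed
  also have "\<dots> = m (\<lambda>z. m (\<lambda>y. F y z))" by (rule mean_Fubini[OF F])
  also have "\<dots> = m (\<lambda>z. f z * conv g h (inv z \<otimes> x))"
  proof (rule mean_cong[OF cont_bounded[OF joint_mean_cont[OF joint_swap[OF F]]]])
    fix z assume z: "z \<in> carrier X"
    have b: "bounded ((\<lambda>y. F y z) ` carrier X)" by (rule cont_bounded[OF joint_slice[OF joint_swap[OF F] z]])
    have "m (\<lambda>y. F y z) = m (\<lambda>y. F (z \<otimes> y) z)" by (rule mean_translate[symmetric, OF b z])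
    also have "\<dots> = m (\<lambda>y. f z * (g y * h (inv y \<otimes> (inv z \<otimes> x))))"
    proof (rule mean_cong[OF bounded_on_translate[OF b z]])
      fix y assume y: "y \<in> carrier X"
      have "inv z \<otimes> (z \<otimes> y) = y" using y z by (simp add: m_assoc[symmetric])
      moreover have "inv (z \<otimes> y) \<otimes> x = inv y \<otimes> (inv z \<otimes> x)" using x y z by (simp add: inv_mult_group m_assoc)
      ultimately show "F (z \<otimes> y) z = f z * (g y * h (inv y \<otimes> (inv z \<otimes> x)))" by (simp add: F_def)
    qed
    also have "\<dots> = f z * conv g h (inv z \<otimes> x)"
      using mean_scale[OF conv_bounded[OF g h]] x z by (simp add: conv_apply)
    finally show "m (\<lambda>y. F y z) = f z * conv g h (inv z \<otimes> x)" .
  qed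
  finally show "conv (conv f g) h x = conv f (conv g h) x" by (simp add: conv_apply[OF x])
qed (use assms conv_CX in auto)

lemma conv_add_right:
  assumes "f \<in> CX" "g \<in> CX" "h \<in> CX"
  shows "conv f (\<lambda>x. g x + h x) = (\<lambda>x. conv f g x + conv f h x)"
proof (rule CX_eqI)
  fix x assume x: "x \<in> carrier X"
  show "conv f (\<lambda>x. g x + h x) x = conv f g x + conv f h x"
    using mean_add[OF conv_bounded[OF assms(1,2) x] conv_bounded[OF assms(1,3) x]]
    by (simp add: conv_apply[OF x] distrib_left)
qed (use assms in \<open>auto intro: conv_CX CX_add\<close>)

lemma conv_scale_right:
  assumes "f \<in> CX" "g \<in> CX"
  shows "conv f (\<lambda>x. c * g x) = (\<lambda>x. c * conv f g x)"
proof (rule CX_eqI)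
  fix x assume x: "x \<in> carrier X"
  show "conv f (\<lambda>x. c * g x) x = c * conv f g x"
    using mean_scale[OF conv_bounded[OF assms(1,2) x], of c]
    by (simp add: conv_apply[OF x] mult_ac)
qed (use assms in \<open>auto intro: conv_CX CX_scale\<close>)

lemma conv_diff_right:
  assumes "f \<in> CX" "g \<in> CX" "h \<in> CX"
  shows "conv f (\<lambda>x. g x - h x) = (\<lambda>x. conv f g x - conv f h x)"
  using conv_add_right[OF assms(1,2) CX_scale[OF assms(3), of "-1"]] conv_scale_right[OF assms(1,3), of "-1"]
  by simp

lemma conv_add_left:
  assumes "f \<in> CX" "g \<in> CX" "h \<in> CX"
  shows "conv (\<lambda>x. g x + h x) f = (\<lambda>x. conv g f x + conv h f x)"
  using conv_add_right[OF assms] assms by (simp add: conv_commute CX_add)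

lemma conv_diff_left:
  assumes "f \<in> CX" "g \<in> CX" "h \<in> CX"
  shows "conv (\<lambda>x. g x - h x) f = (\<lambda>x. conv g f x - conv h f x)"
  using conv_diff_right[OF assms] assms by (simp add: conv_commute CX_diff)

lemma conv_scale_left:
  assumes "f \<in> CX" "g \<in> CX"
  shows "conv (\<lambda>x. c * g x) f = (\<lambda>x. c * conv g f x)"
  using conv_scale_right[OF assms] assms by (simp add: conv_commute CX_scale)

lemma star_conv:
  assumes f: "f \<in> CX" and g: "g \<in> CX"
  shows "star (conv f g) = conv (star f) (star g)"
proof (rule CX_eqI)
  fix x assume x: "x \<in> carrier X"
  have b: "bounded ((\<lambda>y. f y * g (inv y \<otimes> inv x)) ` carrier X)"
    by (rule conv_bounded[OF f g inv_closed[OF x]])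
  have "star (conv f g) x = m (\<lambda>y. cnj (f y * g (inv y \<otimes> inv x)))"
    using mean_cnj[OF b] x by (simp add: star_apply conv_apply)
  also have "\<dots> = m (\<lambda>y. cnj (f (inv y) * g (inv (inv y) \<otimes> inv x)))"
    by (rule mean_inv[symmetric, OF bounded_on_cnj[OF b]])
  also have "\<dots> = m (\<lambda>y. star f y * star g (inv y \<otimes> x))"
    by (rule mean_cong[OF bounded_on_inv[OF bounded_on_cnj[OF b]]])
       (use x in \<open>simp add: star_apply inv_mult\<close>)
  finally show "star (conv f g) x = conv (star f) (star g) x" by (simp add: conv_apply[OF x])
qed (use assms in \<open>auto intro: conv_CX star_CX\<close>)

section \<open>The inner product of the mean\<close>

definition inner :: "('x \<Rightarrow> complex) \<Rightarrow> ('x \<Rightarrow> complex) \<Rightarrow> complex" where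
  "inner f g = m (\<lambda>y. f y * cnj (g y))"

definition nrm :: "('x \<Rightarrow> complex) \<Rightarrow> real" where
  "nrm f = sqrt (Re (inner f f))"

text \<open>Turns identities for convolution powers of self-adjoint functions into statements about
  their mean square norms.\<close>

lemma inner_conv:
  assumes "f \<in> CX" "g \<in> CX"
  shows "conv f (star g) \<one> = inner f g"
  unfolding inner_def conv_apply[OF one_closed]
  by (rule mean_cong[OF conv_bounded[OF assms(1) star_CX[OF assms(2)] one_closed]])
     (simp add: star_apply)

lemma inner_self_nonneg: "bounded (f ` carrier X) \<Longrightarrow> 0 \<le> Re (inner f f)"
  unfolding inner_def by (intro mean_nonneg bounded_on_intros) (auto simp: complex_mult_cnj)

lemma inner_cnj:
  assumes "bounded (f ` carrier X)" "bounded (g ` carrier X)"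
  shows "cnj (inner f g) = inner g f"
  using mean_cnj[OF bounded_on_mult[OF assms(1) bounded_on_cnj[OF assms(2)]]]
  by (simp add: inner_def mult.commute)

lemma inner_self_real: "bounded (f ` carrier X) \<Longrightarrow> inner f f = of_real (Re (inner f f))"
  using inner_cnj[of f f] by (simp add: complex_eq_iff)

lemma nrm_power2: "bounded (f ` carrier X) \<Longrightarrow> (nrm f)\<^sup>2 = Re (inner f f)"
  by (simp add: nrm_def inner_self_nonneg)

lemma nrm_nonneg: "bounded (f ` carrier X) \<Longrightarrow> 0 \<le> nrm f"
  by (simp add: nrm_def inner_self_nonneg)

lemma nrm_diff_scale:
  assumes f: "bounded (f ` carrier X)" and g: "bounded (g ` carrier X)"
  shows "Re (inner (\<lambda>x. f x - c * g x) (\<lambda>x. f x - c * g x)) =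
    Re (inner f f) - 2 * Re (cnj c * inner f g) + (cmod c)\<^sup>2 * Re (inner g g)"
proof -
  have b: "bounded ((\<lambda>y. f y * cnj (f y)) ` carrier X)" "bounded ((\<lambda>y. f y * cnj (g y)) ` carrier X)"
    "bounded ((\<lambda>y. g y * cnj (f y)) ` carrier X)" "bounded ((\<lambda>y. g y * cnj (g y)) ` carrier X)"
    using f g by (auto intro!: bounded_on_intros)
  have "inner (\<lambda>x. f x - c * g x) (\<lambda>x. f x - c * g x)
      = m (\<lambda>y. (f y * cnj (f y) - cnj c * (f y * cnj (g y))) - c * (g y * cnj (f y)) + (c * cnj c) * (g y * cnj (g y)))"
    unfolding inner_def by (intro arg_cong[of _ _ m] ext) (simp add: algebra_simps)
  also have "\<dots> = inner f f - cnj c * inner f g - c * inner g f + (c * cnj c) * inner g g"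
    using b by (simp add: mean_add mean_diff mean_scale bounded_on_intros inner_def)
  also have "c * inner g f = cnj (cnj c * inner f g)" using inner_cnj[OF f g] by simp
  finally show ?thesis
    using inner_self_real[OF g] by (simp add: complex_mult_cnj cmod_power2)
qed

lemma Cauchy_Schwarz_mean:
  assumes f: "bounded (f ` carrier X)" and g: "bounded (g ` carrier X)"
  shows "cmod (inner f g) \<le> nrm f * nrm g"
proof -
  let ?z = "inner f g" and ?A = "Re (inner f f)" and ?B = "Re (inner g g)"
  \<comment> \<open>The squared norm of \<open>f - t * z * g\<close> as a quadratic in the real
    variable \<open>t\<close>; the factor \<open>z\<close> aligns the phase of the mixed
    term.\<close>
  have q: "0 \<le> ?A - 2 * t * (cmod ?z)\<^sup>2 + t\<^sup>2 * (cmod ?z)\<^sup>2 * ?B" for t :: real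
  proof -
    have "0 \<le> Re (inner (\<lambda>x. f x - (of_real t * ?z) * g x) (\<lambda>x. f x - (of_real t * ?z) * g x))"
      by (intro inner_self_nonneg bounded_on_intros f g)
    also have "Re (cnj (of_real t * ?z) * ?z) = t * (cmod ?z)\<^sup>2"
      unfolding cmod_power2 by (simp add: power2_eq_square algebra_simps)
    then have "Re (inner (\<lambda>x. f x - (of_real t * ?z) * g x) (\<lambda>x. f x - (of_real t * ?z) * g x))
        = ?A - 2 * t * (cmod ?z)\<^sup>2 + t\<^sup>2 * (cmod ?z)\<^sup>2 * ?B"
      by (subst nrm_diff_scale[OF f g]) (simp add: norm_mult power_mult_distrib)
    finally show ?thesis .
  qed
  have "(cmod ?z)\<^sup>2 \<le> ?A * ?B"
  proof (cases "?B = 0")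
    case True
    have "cmod ?z = 0"
    proof (rule ccontr)
      assume nz: "cmod ?z \<noteq> 0"
      then have "(cmod ?z)\<^sup>2 > 0" by simp
      \<comment> \<open>With \<open>?B = 0\<close> this value of \<open>t\<close> makes the
        quadratic equal to \<open>-1\<close>.\<close>
      then show False using q[of "(?A + 1) / (2 * (cmod ?z)\<^sup>2)"] True by (simp add: field_simps)
    qed
    then show ?thesis using True by simp
  next
    case False
    then have B: "?B > 0" using inner_self_nonneg[OF g] by simp
    \<comment> \<open>The quadratic has its minimum at \<open>t = 1 / ?B\<close>.\<close>
    then show ?thesis using q[of "1 / ?B"] by (simp add: field_simps power2_eq_square)
  qed
  also have "\<dots> = (nrm f * nrm g)\<^sup>2" by (simp add: power_mult_distrib nrm_power2 f g)
  finally show ?thesis by (rule power2_le_imp_le) (simp add: nrm_nonneg f g)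
qed

text \<open>The value at \<open>x\<close> is the inner product of \<open>f\<close> with a reflected
  translate of \<open>g\<close>, which has the norm of \<open>g\<close>. Convolution thus improves
  convergence in mean square to uniform convergence.\<close>

lemma norm_conv_le:
  assumes f: "f \<in> CX" and g: "g \<in> CX" and x: "x \<in> carrier X"
  shows "cmod (conv f g x) \<le> nrm f * nrm g"
proof -
  define k where "k y = cnj (g (inv y \<otimes> x))" for y
  have g': "bounded ((\<lambda>y. g y * cnj (g y)) ` carrier X)" using CX_bounded[OF g] by (intro bounded_on_intros)
  have "cont k" unfolding k_def using x
    by (intro cont_intros cont_comp[OF CX_cont[OF g]] continuous_map_ident) (simp add: topspace_eq)
  then have k: "bounded (k ` carrier X)" by (rule cont_bounded)
  have "inner k k = m (\<lambda>y. g (x \<otimes> inv y) * cnj (g (x \<otimes> inv y)))"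
    unfolding inner_def
    by (rule mean_cong[OF bounded_on_mult[OF k bounded_on_cnj[OF k]]])
       (use x in \<open>simp add: k_def m_comm mult.commute\<close>)
  also have "\<dots> = inner g g" unfolding inner_def by (rule mean_reflect[OF g' x])
  finally have "nrm k = nrm g" by (simp add: nrm_def)
  moreover have "conv f g x = inner f k" using x by (simp add: conv_apply inner_def k_def)
  ultimately show ?thesis using Cauchy_Schwarz_mean[OF CX_bounded[OF f] k] by simp
qed

text \<open>By compactness finitely many translates of \<open>U\<close> cover the group, and all of
  them have the same mean; were it not positive, the mean of \<open>1\<close> could not be
  \<open>1\<close>.\<close>

lemma mean_indicator_pos:
  assumes U: "openin T U" "u \<in> U"
  shows "0 < Re (m (\<lambda>x. if x \<in> U then 1 else 0))"
proof -
  have u: "u \<in> carrier X" using openin_subset[OF U(1)] U(2) by (auto simp: topspace_eq)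
  \<comment> \<open>Multiplication by \<open>u \<otimes> inv x\<close> moves \<open>x\<close> to
    \<open>u\<close>, so this translate of \<open>U\<close> is a neighbourhood of
    \<open>x\<close>.\<close>
  have op: "openin T {y \<in> carrier X. (u \<otimes> inv x) \<otimes> y \<in> U}" if "x \<in> carrier X" for x
  proof -
    have "continuous_map T T (\<lambda>y. (u \<otimes> inv x) \<otimes> y)"
      using that u by (intro cont_intros continuous_map_ident) (simp_all add: topspace_eq)
    from openin_continuous_map_preimage[OF this U(1)] show ?thesis by (simp add: topspace_eq)
  qed
  have self: "x \<in> {y \<in> carrier X. (u \<otimes> inv x) \<otimes> y \<in> U}" if "x \<in> carrier X" for x
    using that u U(2) by (simp add: m_assoc)
  obtain Z where Z: "finite Z" "Z \<subseteq> carrier X"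
    "\<And>x. x \<in> carrier X \<Longrightarrow> \<exists>z\<in>Z. x \<in> {y \<in> carrier X. (u \<otimes> inv z) \<otimes> y \<in> U}"
    using compact_cover[OF op self] by metis
  define I where "I x = (if x \<in> U then 1 else 0 :: complex)" for x
  have I: "bounded (I ` carrier X)" by (rule boundedI[of _ 1]) (auto simp: I_def)
  have bI: "bounded ((\<lambda>y. I ((u \<otimes> inv z) \<otimes> y)) ` carrier X)" if "z \<in> Z" for z
    using bounded_on_translate[OF I] that Z(2) u by auto
  have "Re (m (\<lambda>x. 1)) \<le> Re (m (\<lambda>y. \<Sum>z\<in>Z. I ((u \<otimes> inv z) \<otimes> y)))"
  proof (rule mean_mono_Re)
    fix y assume "y \<in> carrier X"
    then obtain z where z: "z \<in> Z" "(u \<otimes> inv z) \<otimes> y \<in> U" using Z(3) by blast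
    have "1 = (\<Sum>z'\<in>{z}. Re (I ((u \<otimes> inv z') \<otimes> y)))" using z by (simp add: I_def)
    also have "\<dots> \<le> (\<Sum>z'\<in>Z. Re (I ((u \<otimes> inv z') \<otimes> y)))"
      using z Z(1) by (intro sum_mono2) (auto simp: I_def)
    finally show "Re 1 \<le> Re (\<Sum>z\<in>Z. I ((u \<otimes> inv z) \<otimes> y))" by simp
  qed (use bI in \<open>auto intro: bounded_on_intros\<close>)
  also have "m (\<lambda>y. \<Sum>z\<in>Z. I ((u \<otimes> inv z) \<otimes> y)) = (\<Sum>z\<in>Z. m (\<lambda>y. I ((u \<otimes> inv z) \<otimes> y)))"
    by (rule mean_sum[OF Z(1)]) (rule bI)
  also have "\<dots> = (\<Sum>z\<in>Z. m I)"
  proof (rule sum.cong)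
    show "m (\<lambda>y. I ((u \<otimes> inv z) \<otimes> y)) = m I" if "z \<in> Z" for z
      using that Z(2) u by (intro mean_translate I) auto
  qed simp
  finally have "1 \<le> real (card Z) * Re (m I)" by (simp add: mean_one)
  then have "0 < Re (m I)" by (smt (verit) mult_nonneg_nonpos of_nat_0_le_iff)
  then show ?thesis by (simp add: I_def[abs_def])
qed

text \<open>On a neighbourhood of \<open>x\<close> the modulus stays above half of
  \<open>cmod (f x)\<close>, and open neighbourhoods have positive mean. Hence \<open>nrm\<close>
  separates the elements of \<open>CX\<close>.\<close>

lemma nrm_pos:
  assumes f: "f \<in> CX" and x: "x \<in> carrier X" "f x \<noteq> 0"
  shows "0 < nrm f"
proof -
  define d where "d = (cmod (f x) / 2)\<^sup>2"
  have d: "d > 0" using x(2) by (simp add: d_def)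
  obtain U where U: "openin T U" "x \<in> U" "\<And>y. y \<in> U \<Longrightarrow> dist (f y) (f x) < cmod (f x) / 2"
    using CX_cont[OF f, unfolded continuous_map_euclidean_iff] x
    by (metis half_gt_zero topspace_eq zero_less_norm_iff)
  have bI: "bounded ((\<lambda>x. if x \<in> U then 1 else 0 :: complex) ` carrier X)"
    by (rule boundedI[of _ 1]) auto
  have "Re (m (\<lambda>y. of_real d * (if y \<in> U then 1 else 0))) \<le> Re (inner f f)"
    unfolding inner_def
  proof (rule mean_mono_Re)
    fix y assume "y \<in> carrier X"
    show "Re (of_real d * (if y \<in> U then 1 else 0)) \<le> Re (f y * cnj (f y))"
    proof (cases "y \<in> U")
      case True
      have "cmod (f x) \<le> cmod (f y) + dist (f y) (f x)"
        by (metis dist_norm norm_minus_commute norm_triangle_sub)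
      then have "cmod (f x) / 2 \<le> cmod (f y)" using U(3)[OF True] by simp
      then have "d \<le> (cmod (f y))\<^sup>2" unfolding d_def by (intro power_mono) auto
      then show ?thesis using True by (simp add: cmod_power2 complex_mult_cnj)
    qed (simp add: complex_mult_cnj)
  qed (use bI CX_bounded[OF f] in \<open>auto intro: bounded_on_intros\<close>)
  moreover have "0 < d * Re (m (\<lambda>y. if y \<in> U then 1 else 0))"
    using d mean_indicator_pos[OF U(1,2)] by simp
  ultimately have "0 < Re (inner f f)" using mean_scale[OF bI, of "of_real d"] by simp
  then show ?thesis by (simp add: nrm_def)
qed

end

section \<open>Characters separate points\<close>

text \<open>Log-convexity makes the ratios of consecutive terms increase, submultiplicativity bounds
  them by \<open>a 0\<close>, and \<open>l\<close> is their limit. The normalised terms then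
  decrease. The bound \<open>L \<ge> 1\<close> will keep the limit of the rescaled convolution
  powers from vanishing.\<close>

lemma log_convex_submultiplicative_limit:
  fixes a :: "nat \<Rightarrow> real"
  assumes pos: "\<And>n. a n > 0"
    and convex: "\<And>n. (a (Suc n))\<^sup>2 \<le> a n * a (Suc (Suc n))"
    and submult: "\<And>n k. a (Suc (n + k)) \<le> a n * a k"
  obtains l L where "l > 0" "L \<ge> 1" "(\<lambda>n. a n / l ^ Suc n) \<longlonglongrightarrow> L"
proof -
  define r where "r n = a (Suc n) / a n" for n
  have "r n \<le> r (Suc n)" for n
    using convex[of n] pos[of n] pos[of "Suc n"] by (simp add: r_def field_simps power2_eq_square)
  then have r_mono: "incseq r" by (rule incseq_SucI)
  have "r n \<le> a 0" for n using submult[of n 0] pos[of n] by (simp add: r_def field_simps)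
  then obtain l where l: "r \<longlonglongrightarrow> l" "\<And>n. r n \<le> l" using incseq_convergent[OF r_mono] by metis
  have r_pos: "r n > 0" for n using pos by (simp add: r_def)
  have l_pos: "l > 0" using r_pos[of 0] l(2)[of 0] by simp
  \<comment> \<open>The exponent \<open>Suc n\<close> fits the shifted form of submultiplicativity:
    \<open>e (Suc (n + k)) \<le> e n * e k\<close>.\<close>
  define e where "e n = a n / l ^ Suc n" for n
  have e_pos: "e n > 0" for n using pos l_pos by (simp add: e_def)
  have e_ratio: "e (Suc n) / e n = r n / l" for n
    using pos[of n] l_pos by (simp add: e_def r_def field_simps)
  have e_dec: "e (Suc n) \<le> e n" for n
    using e_ratio[of n] l(2)[of n] l_pos e_pos[of n] by (simp add: field_simps)
      (metis mult.commute mult_left_mono less_imp_le mult_le_cancel_right not_less)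
  have "decseq e" by (rule decseq_SucI) (rule e_dec)
  moreover have "0 \<le> e n" for n using e_pos[of n] by simp
  ultimately obtain L where L: "e \<longlonglongrightarrow> L" "\<And>n. L \<le> e n" using decseq_convergent by metis
  have ratio_lim: "(\<lambda>n. e (n + j) / e n) \<longlonglongrightarrow> 1" for j
  proof (induction j)
    case 0 then show ?case using e_pos by (simp add: less_imp_neq[symmetric])
  next
    case (Suc j)
    have "(\<lambda>n. r (n + j) / l) \<longlonglongrightarrow> l / l"
      using LIMSEQ_ignore_initial_segment[OF l(1), of j] l_pos by (intro tendsto_intros) auto
    then have "(\<lambda>n. (r (n + j) / l) * (e (n + j) / e n)) \<longlonglongrightarrow> (l / l) * 1"
      by (intro tendsto_mult Suc)
    moreover have "(r (n + j) / l) * (e (n + j) / e n) = e (n + Suc j) / e n" for n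
      using e_ratio[of "n + j"] e_pos[of "n + j"] e_pos[of n] by (simp add: field_simps)
    ultimately show ?case using l_pos by simp
  qed
  \<comment> \<open>Divide the submultiplicativity of \<open>e\<close> by \<open>e n\<close> and let
    \<open>n\<close> grow; the left side tends to \<open>1\<close> for fixed
    \<open>k\<close>.\<close>
  have e_ge: "e k \<ge> 1" for k
  proof (rule LIMSEQ_le_const2[OF ratio_lim[of "Suc k"]])
    have "e (n + Suc k) / e n \<le> e k" for n
      using submult[of n k] e_pos[of n] l_pos pos by (simp add: e_def field_simps power_add)
    then show "\<exists>N. \<forall>n\<ge>N. e (n + Suc k) / e n \<le> e k" by blast
  qed
  have "L \<ge> 1" by (rule LIMSEQ_le_const[OF L(1)]) (use e_ge in blast)
  then show ?thesis using that[of l L] l_pos L(1) by (simp add: e_def[abs_def])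
qed

section \<open>Convolution powers and spectral idempotents\<close>

context compact_group_mean begin

text \<open>Convolution of continuous functions need not have a unit, so counting starts at the
  first power: \<open>conv_power h n\<close> has \<open>n + 1\<close> factors. This causes the
  \<open>Suc\<close> in all index sums below.\<close>

primrec conv_power :: "('x \<Rightarrow> complex) \<Rightarrow> nat \<Rightarrow> 'x \<Rightarrow> complex" where
  "conv_power h 0 = h"
| "conv_power h (Suc n) = conv h (conv_power h n)"

lemma conv_power_CX: "h \<in> CX \<Longrightarrow> conv_power h n \<in> CX"
  by (induction n) (auto intro: conv_CX)

lemma conv_power_add:
  "h \<in> CX \<Longrightarrow> conv (conv_power h n) (conv_power h k) = conv_power h (Suc (n + k))"
  by (induction n) (auto simp: conv_assoc conv_power_CX)

lemma star_conv_power: "h \<in> CX \<Longrightarrow> star h = h \<Longrightarrow> star (conv_power h n) = conv_power h n"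
  by (induction n) (auto simp: star_conv conv_power_CX)

lemma nrm_le_sup:
  assumes f: "f \<in> CX" and K: "\<And>x. x \<in> carrier X \<Longrightarrow> cmod (f x) \<le> K"
  shows "nrm f \<le> K"
proof -
  have K0: "K \<ge> 0" using K[OF one_closed] norm_ge_zero order.trans by blast
  have "Re (inner f f) \<le> cmod (inner f f)" by (rule complex_Re_le_cmod)
  also have "\<dots> \<le> K\<^sup>2" unfolding inner_def
  proof (rule norm_mean_le)
    show "cmod (f x * cnj (f x)) \<le> K\<^sup>2" if "x \<in> carrier X" for x
      using K[OF that] by (auto simp: norm_mult power2_eq_square intro!: mult_mono K0)
  qed (intro bounded_on_intros CX_bounded[OF f])
  finally show ?thesis unfolding nrm_def by (intro real_le_lsqrt K0)
qed

lemma uniform_limit_CX: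
  assumes g: "\<And>n. g n \<in> CX" and lim: "uniform_limit (carrier X) g p sequentially"
    and out: "\<And>x. x \<notin> carrier X \<Longrightarrow> p x = 0"
  shows "p \<in> CX"
proof -
  have "continuous_map T Met_TC.mtopology p"
  proof (rule Met_TC.continuous_map_uniform_limit)
    show "\<forall>\<^sub>F n in sequentially. continuous_map T Met_TC.mtopology (g n)" using CX_cont[OF g] by simp
    show "\<forall>\<^sub>F n in sequentially. \<forall>x\<in>topspace T. p x \<in> UNIV \<and> dist (g n x) (p x) < e" if "0 < e" for e
      using uniform_limitD[OF lim that] by (simp add: topspace_eq)
  qed simp
  then show ?thesis using out by (simp add: CX_def)
qed

lemma conv_limit:
  assumes g: "\<And>n. g n \<in> CX" and q: "q \<in> CX" and p: "p \<in> CX"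
    and lim: "uniform_limit (carrier X) g p sequentially" and x: "x \<in> carrier X"
  shows "(\<lambda>n. conv q (g n) x) \<longlonglongrightarrow> conv q p x"
proof (rule tendstoI)
  fix e :: real assume e: "e > 0"
  have n0: "nrm q \<ge> 0" using nrm_nonneg[OF CX_bounded[OF q]] .
  define d where "d = e / (2 * (nrm q + 1))"
  have d: "d > 0" using e n0 by (simp add: d_def)
  show "\<forall>\<^sub>F n in sequentially. dist (conv q (g n) x) (conv q p x) < e"
    using uniform_limitD[OF lim d]
  proof eventually_elim
    case (elim n)
    have gp: "(\<lambda>x. g n x - p x) \<in> CX" by (intro CX_diff g p)
    have "nrm (\<lambda>x. g n x - p x) \<le> d"
      by (rule nrm_le_sup[OF gp]) (use elim in \<open>auto simp: dist_norm intro: less_imp_le\<close>)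
    then have "nrm q * nrm (\<lambda>x. g n x - p x) \<le> nrm q * d" using n0 by (intro mult_left_mono)
    also have "\<dots> < e" using e n0 by (simp add: d_def field_simps add_pos_nonneg)
    finally have "cmod (conv q (\<lambda>x. g n x - p x) x) < e" using norm_conv_le[OF q gp x] by simp
    then show ?case by (simp add: conv_diff_right[OF q g p] dist_norm)
  qed
qed

lemma inner_self_sup:
  assumes "h \<in> CX" "x \<in> carrier X"
  shows "cmod (conv h h x) \<le> (nrm h)\<^sup>2"
  using norm_conv_le[OF assms(1,1,2)] by (simp add: power2_eq_square)

text \<open>The values at \<open>\<one>\<close> of the even convolution powers of a self-adjoint function are log-convex
  and submultiplicative, hence asymptotic to a geometric sequence; after rescaling, the powers
  therefore converge in mean square, and, by one more convolution, uniformly. This takes the place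
  of the spectral theorem for compact operators.\<close>

lemma spectral_idempotent:
  assumes h: "h \<in> CX" and self: "star h = h" and x0: "x0 \<in> carrier X" "h x0 \<noteq> 0"
  obtains p l where "p \<in> CX" "star p = p" "conv p p = p" "p \<noteq> (\<lambda>x. 0)" "l > 0"
    "conv (conv h h) p = (\<lambda>x. complex_of_real l * p x)"
    "\<And>q. q \<in> CX \<Longrightarrow> conv q h = h \<Longrightarrow> conv q p = p"
proof -
  define H where "H = conv_power h"
  have H: "H n \<in> CX" for n using conv_power_CX[OF h] by (simp add: H_def)
  have Hadd: "conv (H n) (H k) = H (Suc (n + k))" for n k using conv_power_add[OF h] by (simp add: H_def)
  have Hstar: "star (H n) = H n" for n using star_conv_power[OF h self] by (simp add: H_def)
  have Hinner: "inner (H n) (H k) = H (Suc (n + k)) \<one>" for n k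
    using inner_conv[OF H H, of n k] by (simp add: Hstar Hadd)
  \<comment> \<open>By \<open>H1\<close>, \<open>a n\<close> is also the value at
    \<open>\<one>\<close> of the power with \<open>2 * n + 2\<close> factors.\<close>
  define a where "a n = (nrm (H n))\<^sup>2" for n
  have a_nonneg: "a n \<ge> 0" for n by (simp add: a_def)
  have H1: "H (Suc (n + n)) \<one> = complex_of_real (a n)" for n
    using inner_self_real[OF CX_bounded[OF H], of n] Hinner[of n n]
    by (simp add: a_def nrm_power2 CX_bounded H)
  \<comment> \<open>Self-adjointness moves one factor across the inner product, so
    \<open>a (Suc n)\<close> is the inner product of \<open>H n\<close> with
    \<open>H (Suc (Suc n))\<close>, and Cauchy-Schwarz applies.\<close>
  have convex: "(a (Suc n))\<^sup>2 \<le> a n * a (Suc (Suc n))" for n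
  proof -
    have "a (Suc n) = cmod (inner (H n) (H (Suc (Suc n))))"
      using H1[of "Suc n"] Hinner[of n "Suc (Suc n)"] a_nonneg[of "Suc n"] by simp
    also have "\<dots> \<le> nrm (H n) * nrm (H (Suc (Suc n)))" by (intro Cauchy_Schwarz_mean CX_bounded H)
    finally have "(a (Suc n))\<^sup>2 \<le> (nrm (H n) * nrm (H (Suc (Suc n))))\<^sup>2"
      using a_nonneg by (intro power_mono) auto
    then show ?thesis by (simp add: a_def power_mult_distrib)
  qed
  have a0: "a 0 > 0" using nrm_pos[OF h x0] by (simp add: a_def H_def)
  have a1: "a 1 > 0"
  proof -
    have "H 1 \<one> \<noteq> 0" using H1[of 0] a0 by simp
    then show ?thesis using nrm_pos[OF H one_closed, of 1] by (simp add: a_def)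
  qed
  \<comment> \<open>Log-convexity passes positivity on from two consecutive terms, hence the
    strengthened induction.\<close>
  have "a n > 0 \<and> a (Suc n) > 0" for n
  proof (induction n)
    case (Suc n)
    then have "0 < a n * a (Suc (Suc n))" using convex[of n] by (smt (verit) zero_less_power2)
    then show ?case using Suc by (simp add: zero_less_mult_iff)
  qed (use a0 a1 in simp)
  then have a_pos: "a n > 0" for n by blast
  \<comment> \<open>The power of \<open>conv h h\<close> with \<open>n + 1\<close> factors. Its
    supremum is bounded by its value \<open>a n\<close> at \<open>\<one>\<close>, which gives
    submultiplicativity.\<close>
  define E where "E n = H (Suc (n + n))" for n
  have E: "E n \<in> CX" for n by (simp add: E_def H)
  have Eadd: "conv (E n) (E k) = E (Suc (n + k))" for n k by (simp add: E_def Hadd algebra_simps)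
  have Estar: "star (E n) = E n" for n by (simp add: E_def Hstar)
  have E1: "E n \<one> = complex_of_real (a n)" for n by (simp add: E_def H1)
  have Einner: "inner (E n) (E k) = complex_of_real (a (Suc (n + k)))" for n k
    using inner_conv[OF E E, of n k] by (simp add: Estar Eadd E1)
  have Esup: "cmod (E n x) \<le> a n" if "x \<in> carrier X" for n x
    using inner_self_sup[OF H that, of n] by (simp add: E_def Hadd a_def)
  have submult: "a (Suc (n + k)) \<le> a n * a k" for n k
  proof -
    have "a (Suc (n + k)) = cmod (inner (E n) (E k))" using a_nonneg by (simp add: Einner)
    also have "\<dots> \<le> nrm (E n) * nrm (E k)" by (intro Cauchy_Schwarz_mean CX_bounded E)
    also have "\<dots> \<le> a n * a k"
      using nrm_nonneg[OF CX_bounded[OF E]] a_nonneg by (intro mult_mono nrm_le_sup E Esup) auto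
    finally show ?thesis .
  qed
  obtain l L where l: "l > 0" and L: "L \<ge> 1" "(\<lambda>n. a n / l ^ Suc n) \<longlonglongrightarrow> L"
    using log_convex_submultiplicative_limit[OF a_pos convex submult] by metis
  define e where "e n = a n / l ^ Suc n" for n
  define g where "g n = (\<lambda>x. complex_of_real (1 / l ^ Suc n) * E n x)" for n
  have g: "g n \<in> CX" for n unfolding g_def by (intro CX_scale E)
  have gadd: "conv (g n) (g k) = g (Suc (n + k))" for n k
  proof -
    have *: "conv (\<lambda>x. c * E n x) (\<lambda>x. d * E k x) = (\<lambda>x. c * d * E (Suc (n + k)) x)" for c d
      by (simp only: conv_scale_left[OF CX_scale[OF E] E] conv_scale_right[OF E E] Eadd mult.assoc)
    show ?thesis unfolding g_def * by (simp add: power_add mult_ac)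
  qed
  have ginner: "inner (g n) (g k) = complex_of_real (e (Suc (n + k)))" for n k
  proof -
    have b: "bounded ((\<lambda>y. E n y * cnj (E k y)) ` carrier X)"
      by (intro bounded_on_intros CX_bounded E)
    have "inner (g n) (g k) = m (\<lambda>y. complex_of_real (1 / l ^ Suc n * (1 / l ^ Suc k)) * (E n y * cnj (E k y)))"
      unfolding inner_def g_def by (intro arg_cong[of _ _ m] ext) simp
    also have "\<dots> = complex_of_real (1 / l ^ Suc n * (1 / l ^ Suc k)) * inner (E n) (E k)"
      unfolding inner_def by (rule mean_scale[OF b])
    finally show ?thesis by (simp add: Einner e_def power_add mult_ac)
  qed
  have gdiff: "(nrm (\<lambda>x. g n x - g k x))\<^sup>2 = e (Suc (n + n)) - 2 * e (Suc (n + k)) + e (Suc (k + k))" for n k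
    using nrm_diff_scale[OF CX_bounded[OF g] CX_bounded[OF g], of n 1 k]
      nrm_power2[OF CX_bounded[OF CX_diff[OF g g]], of n k] by (simp add: ginner)
  have e_lim: "e \<longlonglongrightarrow> L" using L(2) by (simp add: e_def[abs_def])
  have "uniformly_Cauchy_on (carrier X) (\<lambda>n. g (Suc n))"
    unfolding uniformly_Cauchy_on_def
  proof (intro allI impI)
    fix d :: real assume d: "d > 0"
    define c where "c = nrm (g 0) + 1"
    have c: "c > 0" using nrm_nonneg[OF CX_bounded[OF g], of 0] by (simp add: c_def)
    have "(d / c)\<^sup>2 / 4 > 0" using c d by simp
    \<comment> \<open>The three terms of \<open>gdiff\<close> have weights 1, 2 and 1 and the same
      limit, so each deviation from \<open>L\<close> may use a quarter of the square of
      \<open>d / c\<close>.\<close>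
    then obtain N where N: "\<And>n. n \<ge> N \<Longrightarrow> \<bar>e n - L\<bar> < (d / c)\<^sup>2 / 4"
      using e_lim unfolding LIMSEQ_iff by (metis real_norm_def)
    have "dist (g (Suc n) x) (g (Suc k) x) < d" if x: "x \<in> carrier X" and nk: "n \<ge> N" "k \<ge> N" for x n k
    proof -
      have D: "(\<lambda>x. g n x - g k x) \<in> CX" by (intro CX_diff g)
      have "(nrm (\<lambda>x. g n x - g k x))\<^sup>2 < (d / c)\<^sup>2"
        unfolding gdiff using N[of "Suc (n + n)"] N[of "Suc (n + k)"] N[of "Suc (k + k)"] nk
        unfolding abs_less_iff by linarith
      then have nd: "nrm (\<lambda>x. g n x - g k x) < d / c"
        by (rule power_less_imp_less_base) (use c d in simp)
      have "dist (g (Suc n) x) (g (Suc k) x) = cmod (conv (g 0) (\<lambda>x. g n x - g k x) x)"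
        by (simp add: conv_diff_right[OF g g g] gadd dist_norm)
      also have "\<dots> \<le> nrm (g 0) * nrm (\<lambda>x. g n x - g k x)" by (rule norm_conv_le[OF g D x])
      also have "\<dots> \<le> c * nrm (\<lambda>x. g n x - g k x)"
        using nrm_nonneg[OF CX_bounded[OF D]] by (intro mult_right_mono) (auto simp: c_def)
      also have "\<dots> < d" using nd c by (simp add: field_simps)
      finally show ?thesis .
    qed
    then show "\<exists>M. \<forall>x\<in>carrier X. \<forall>n\<ge>M. \<forall>k\<ge>M. dist (g (Suc n) x) (g (Suc k) x) < d" by blast
  qed
  then obtain p' where p': "uniform_limit (carrier X) (\<lambda>n. g (Suc n)) p' sequentially"
    using Cauchy_uniformly_convergent unfolding uniformly_convergent_on_def by blast
  define p where "p = cut p'"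
  have lim1: "uniform_limit (carrier X) (\<lambda>n. g (Suc n)) p sequentially"
    using p' by (rule uniform_limit_cong'[THEN iffD1, rotated 2]) (auto simp: p_def cut_def)
  have p: "p \<in> CX" by (rule uniform_limit_CX[OF _ lim1]) (auto simp: g p_def cut_def)
  have lim: "(\<lambda>n. g (Suc (n + k)) x) \<longlonglongrightarrow> p x" if "x \<in> carrier X" for x k
    using LIMSEQ_ignore_initial_segment[OF tendsto_uniform_limitI[OF lim1 that], of k] by simp
  have convg: "conv (g k) p = p" for k
  proof (rule CX_eqI[OF conv_CX[OF g p] p])
    fix x assume x: "x \<in> carrier X"
    have "(\<lambda>n. conv (g k) (g (Suc n)) x) \<longlonglongrightarrow> conv (g k) p x"
      by (rule conv_limit[OF _ g p lim1 x]) (rule g)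
    moreover have "(\<lambda>n. conv (g k) (g (Suc n)) x) \<longlonglongrightarrow> p x"
      using lim[OF x, of "Suc k"] by (simp add: gadd add.commute)
    ultimately show "conv (g k) p x = p x" by (rule LIMSEQ_unique)
  qed
  have idem: "conv p p = p"
  proof (rule CX_eqI[OF conv_CX[OF p p] p])
    fix x assume x: "x \<in> carrier X"
    have "(\<lambda>n. conv p (g (Suc n)) x) \<longlonglongrightarrow> conv p p x"
      by (rule conv_limit[OF _ p p lim1 x]) (rule g)
    then show "conv p p x = p x" by (simp add: conv_commute[OF p g] convg LIMSEQ_const_iff)
  qed
  have starp: "star p = p"
  proof (rule CX_eqI[OF star_CX[OF p] p])
    fix x assume x: "x \<in> carrier X"
    have gs: "star (g n) x = g n x" for n
      using Estar[of n] x by (metis (no_types, lifting) complex_cnj_complex_of_real complex_cnj_mult g_def star_apply)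
    have "(\<lambda>n. cnj (g (Suc (n + 0)) (inv x))) \<longlonglongrightarrow> cnj (p (inv x))"
      by (intro tendsto_cnj lim inv_closed x)
    then have "(\<lambda>n. g (Suc (n + 0)) x) \<longlonglongrightarrow> star p x"
      using gs x by (simp add: star_apply)
    then show "star p x = p x" using lim[OF x, of 0] LIMSEQ_unique by blast
  qed
  have "p \<one> = complex_of_real L"
  proof (rule LIMSEQ_unique[OF lim[OF one_closed, of 0]])
    have "g n \<one> = complex_of_real (e n)" for n by (simp add: g_def E1 e_def)
    then show "(\<lambda>n. g (Suc (n + 0)) \<one>) \<longlonglongrightarrow> complex_of_real L"
      using LIMSEQ_Suc[OF e_lim] by (simp add: tendsto_of_real)
  qed
  then have "p \<noteq> (\<lambda>x. 0)" using L(1) by auto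
  moreover have "conv (conv h h) p = (\<lambda>x. complex_of_real l * p x)"
  proof -
    have "g 0 = (\<lambda>x. complex_of_real (1 / l) * conv h h x)" by (simp add: g_def E_def H_def)
    then have "(\<lambda>x. complex_of_real (1 / l) * conv (conv h h) p x) = p"
      using convg[of 0] conv_scale_left[OF p conv_CX[OF h h], of "complex_of_real (1 / l)"] by simp
    then have "complex_of_real (1 / l) * conv (conv h h) p x = p x" for x by metis
    then show ?thesis using l by (auto simp: field_simps)
  qed
  \<comment> \<open>What acts as the identity on \<open>h\<close> does so on its powers and on their
    limit; this is how \<open>p\<close> inherits membership in an ideal containing
    \<open>h\<close>.\<close>
  moreover have "conv q p = p" if q: "q \<in> CX" "conv q h = h" for q
  proof -
    have "conv q (H n) = H n" for n
    proof (cases n)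
      case (Suc k)
      have "conv q (conv h (conv_power h k)) = conv (conv q h) (conv_power h k)"
        by (rule conv_assoc[symmetric, OF q(1) h conv_power_CX[OF h]])
      then show ?thesis using q(2) Suc by (simp add: H_def)
    qed (use q in \<open>simp add: H_def\<close>)
    then have qg: "conv q (g n) = g n" for n by (simp only: g_def E_def conv_scale_right[OF q(1) H])
    show ?thesis
    proof (rule CX_eqI[OF conv_CX[OF q(1) p] p])
      fix x assume x: "x \<in> carrier X"
      have "(\<lambda>n. conv q (g (Suc n)) x) \<longlonglongrightarrow> conv q p x"
        by (rule conv_limit[OF _ q(1) p lim1 x]) (rule g)
      then have "(\<lambda>n. g (Suc (n + 0)) x) \<longlonglongrightarrow> conv q p x" by (simp add: qg)
      then show "conv q p x = p x" using lim[OF x, of 0] LIMSEQ_unique by blast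
    qed
  qed
  ultimately show ?thesis using that p starp idem l by blast
qed

section \<open>Minimal idempotents and characters\<close>

definition idem :: "('x \<Rightarrow> complex) \<Rightarrow> bool" where
  "idem p \<longleftrightarrow> p \<in> CX \<and> star p = p \<and> conv p p = p \<and> p \<noteq> (\<lambda>x. 0)"

lemma idem_nonzero:
  assumes "p \<in> CX" "p \<noteq> (\<lambda>x. 0)"
  obtains x where "x \<in> carrier X" "p x \<noteq> 0"
  using assms by (auto simp: CX_def)

text \<open>The value at \<open>\<one>\<close> is the square of \<open>nrm p\<close>, which also
  bounds \<open>p\<close> uniformly. Hence \<open>nrm p\<close> is at most its own square, and it is
  positive.\<close>

lemma idem_at_one:
  assumes p: "idem p"
  shows "p \<one> = complex_of_real (Re (p \<one>))" and "Re (p \<one>) \<ge> 1"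
proof -
  have pC: "p \<in> CX" using p by (simp add: idem_def)
  have "p \<one> = inner p p" using inner_conv[OF pC pC] p by (simp add: idem_def)
  then show "p \<one> = complex_of_real (Re (p \<one>))" using inner_self_real[OF CX_bounded[OF pC]] by simp
  have 1: "Re (p \<one>) = (nrm p)\<^sup>2" using \<open>p \<one> = inner p p\<close> by (simp add: nrm_power2 CX_bounded pC)
  have "nrm p \<le> (nrm p)\<^sup>2"
    using inner_self_sup[OF pC] p by (intro nrm_le_sup pC) (simp add: idem_def)
  moreover have "nrm p > 0" using nrm_pos[OF pC] idem_nonzero[OF pC] p by (metis idem_def)
  ultimately have "nrm p \<ge> 1" by (simp add: power2_eq_square)
  then show "Re (p \<one>) \<ge> 1" unfolding 1 by simp
qed

text \<open>If \<open>q\<close> is a proper subidempotent of \<open>p\<close>, then \<open>p - q\<close> is idempotent, so the value at \<open>\<one>\<close> drops by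
  at least \<open>1\<close>; therefore a minimal idempotent exists.\<close>

lemma minimal_idempotent:
  assumes p0: "idem p0"
  obtains p where "idem p" "conv p p0 = p" "\<And>q. idem q \<Longrightarrow> conv q p = q \<Longrightarrow> q = p"
proof -
  let ?P = "\<lambda>p. idem p \<and> conv p p0 = p"
  have "?P p0" using p0 by (simp add: idem_def)
  then obtain p where p: "?P p" and least: "\<And>q. ?P q \<Longrightarrow> nat \<lfloor>Re (p \<one>)\<rfloor> \<le> nat \<lfloor>Re (q \<one>)\<rfloor>"
    using ex_has_least_nat[of ?P p0 "\<lambda>p. nat \<lfloor>Re (p \<one>)\<rfloor>"] by blast
  have C: "p \<in> CX" "p0 \<in> CX" using p p0 by (auto simp: idem_def)
  have "q = p" if q: "idem q" "conv q p = q" for q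
  proof (rule ccontr)
    assume "q \<noteq> p"
    then obtain x where "q x \<noteq> p x" by auto
    then have ne: "(\<lambda>x. p x - q x) \<noteq> (\<lambda>x. 0)" by (metis eq_iff_diff_eq_0)
    have qC: "q \<in> CX" using q by (simp add: idem_def)
    have D: "(\<lambda>x. p x - q x) \<in> CX" by (intro CX_diff C qC)
    have "star (\<lambda>x. p x - q x) = (\<lambda>x. star p x - star q x)" by (auto simp: star_def cut_def)
    moreover have "conv (\<lambda>x. p x - q x) (\<lambda>x. p x - q x) = (\<lambda>x. p x - q x)"
      using q p conv_commute[OF C(1) qC]
      by (simp add: conv_diff_left[OF D C(1) qC] conv_diff_right C(1) qC idem_def)
    ultimately have "idem (\<lambda>x. p x - q x)" using D ne p q by (simp add: idem_def)
    then have "Re (p \<one>) - Re (q \<one>) \<ge> 1" using idem_at_one(2) by fastforce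
    moreover have "?P q"
      using q p conv_assoc[OF qC C(1) C(2)] by simp
    then have "nat \<lfloor>Re (p \<one>)\<rfloor> \<le> nat \<lfloor>Re (q \<one>)\<rfloor>" by (rule least)
    \<comment> \<open>A drop by at least \<open>1\<close> lowers the integer part, and
      \<open>Re (q \<one>) \<ge> 1\<close> excludes truncation by \<open>nat\<close>.\<close>
    ultimately show False using idem_at_one(2)[OF q(1)] by linarith
  qed
  then show ?thesis using that p by blast
qed

lemma zero_CX: "(\<lambda>x. 0) \<in> CX" by (simp add: CX_def)

lemma conv_zero_right: "f \<in> CX \<Longrightarrow> conv f (\<lambda>x. 0) = (\<lambda>x. 0)"
  using conv_scale_right[OF _ zero_CX, of f 0] by simp

text \<open>The spectral idempotent of a nonzero self-adjoint \<open>v\<close> in the ideal of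
  \<open>p\<close> lies below \<open>p\<close>, hence equals \<open>p\<close>, and
  \<open>conv v v\<close> is a positive multiple of \<open>p\<close>. For \<open>u\<close> this
  gives \<open>(u - s p) (u + s p) = 0\<close> with \<open>s\<close> a square root of the multiple.
  If \<open>v = u - s p\<close> is nonzero, multiplying once more by \<open>v\<close> shows
  \<open>u + s p = 0\<close>.\<close>

lemma minimal_idempotent_selfadjoint:
  assumes p: "idem p" and min: "\<And>q. idem q \<Longrightarrow> conv q p = q \<Longrightarrow> q = p"
    and u: "u \<in> CX" "star u = u" "conv u p = u"
  obtains c where "u = (\<lambda>x. complex_of_real c * p x)"
proof -
  have pC: "p \<in> CX" using p by (simp add: idem_def)
  have sq: "\<exists>l>0. conv v v = (\<lambda>x. complex_of_real l * p x)"
    if v: "v \<in> CX" "star v = v" "conv v p = v" and ne: "v \<noteq> (\<lambda>x. 0)" for v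
  proof -
    obtain x where x: "x \<in> carrier X" "v x \<noteq> 0" using idem_nonzero[OF v(1) ne] .
    obtain q l where q: "q \<in> CX" "star q = q" "conv q q = q" "q \<noteq> (\<lambda>x. 0)" "l > 0"
      "conv (conv v v) q = (\<lambda>x. complex_of_real l * q x)"
      "\<And>r. r \<in> CX \<Longrightarrow> conv r v = v \<Longrightarrow> conv r q = q"
      using spectral_idempotent[OF v(1,2) x] by metis
    have "conv p q = q" using q(7)[OF pC] v(3) conv_commute[OF pC v(1)] by simp
    then have "q = p" using min[of q] q conv_commute[OF pC q(1)] by (simp add: idem_def)
    moreover have "conv (conv v v) p = conv v v" using conv_assoc[OF v(1,1) pC] v(3) by simp
    ultimately show ?thesis using q(5,6) by auto
  qed
  show ?thesis
  proof (cases "u = (\<lambda>x. 0)")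
    case True then show ?thesis using that[of 0] by simp
  next
    case False
    then obtain l where l: "l > 0" "conv u u = (\<lambda>x. complex_of_real l * p x)" using sq[OF u] by blast
    define s where "s = complex_of_real (sqrt l)"
    have ss: "s * s = complex_of_real l" using l(1) by (simp add: s_def flip: of_real_mult)
    have pp: "conv p p = p" "star p = p" using p by (auto simp: idem_def)
    have sp: "(\<lambda>x. s * p x) \<in> CX" by (intro CX_scale pC)
    define v where "v = (\<lambda>x. u x - s * p x)"
    define w where "w = (\<lambda>x. u x + s * p x)"
    have v: "v \<in> CX" and w: "w \<in> CX" unfolding v_def w_def by (intro CX_diff CX_add u sp)+
    have "star v = (\<lambda>x. star u x - s * star p x)" by (auto simp: star_def cut_def v_def s_def)
    then have vs: "star v = v" using u pp by (simp add: v_def)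
    have vp: "conv v p = v"
      unfolding v_def using u pp by (simp add: conv_diff_left[OF pC u(1) sp] conv_scale_left pC)
    have wp: "conv w p = w"
      unfolding w_def using u pp by (simp add: conv_add_left[OF pC u(1) sp] conv_scale_left pC)
    have vw: "conv v w = (\<lambda>x. 0)"
    proof -
      have pu: "conv p u = u" using u(3) conv_commute[OF pC u(1)] by simp
      have "conv v w = (\<lambda>x. conv v u x + s * conv v p x)"
        unfolding w_def by (simp add: conv_add_right[OF v u(1) sp] conv_scale_right[OF v pC])
      also have "conv v u = (\<lambda>x. complex_of_real l * p x - s * u x)"
        unfolding v_def by (simp add: conv_diff_left[OF u(1) u(1) sp] conv_scale_left[OF u(1) pC] pu l(2))
      also have "conv v p = v" by (rule vp)
      finally show ?thesis by (simp add: v_def algebra_simps flip: ss)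
    qed
    show ?thesis
    proof (cases "v = (\<lambda>x. 0)")
      case True
      then have "v x = 0" for x by simp
      then have "u x = s * p x" for x by (simp add: v_def)
      then show ?thesis using that[of "sqrt l"] by (auto simp: s_def)
    next
      case False
      then obtain k where k: "k > 0" "conv v v = (\<lambda>x. complex_of_real k * p x)" using sq[OF v vs vp] by blast
      have "(\<lambda>x. 0) = conv (conv v v) w"
        by (simp add: conv_assoc[OF v v w] vw conv_zero_right[OF v])
      also have "\<dots> = (\<lambda>x. complex_of_real k * w x)"
        using wp conv_commute[OF pC w] by (simp add: k(2) conv_scale_left[OF w pC])
      finally have "complex_of_real k * w x = 0" for x by metis
      then have "u x = - s * p x" for x using k(1) by (simp add: w_def add_eq_0_iff2)
      then show ?thesis using that[of "- sqrt l"] by (auto simp: s_def)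
    qed
  qed
qed

text \<open>Reduction to the self-adjoint case by \<open>w = u1 + \<i> * u2\<close>; the involution
  preserves the ideal because \<open>p\<close> is self-adjoint.\<close>

lemma minimal_idempotent_ideal:
  assumes p: "idem p" and min: "\<And>q. idem q \<Longrightarrow> conv q p = q \<Longrightarrow> q = p"
    and w: "w \<in> CX" "conv w p = w"
  obtains c where "w = (\<lambda>x. c * p x)"
proof -
  have pC: "p \<in> CX" "star p = p" using p by (auto simp: idem_def)
  note sw = star_CX[OF w(1)]
  have swp: "conv (star w) p = star w" using star_conv[OF w(1) pC(1)] w(2) pC(2) by simp
  have ss: "star (star w) = w"
    by (rule CX_eqI[OF star_CX[OF sw] w(1)]) (simp add: star_apply)
  define u1 where "u1 = (\<lambda>x. (1/2) * w x + (1/2) * star w x)"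
  define u2 where "u2 = (\<lambda>x. (- \<i>/2) * w x + (\<i>/2) * star w x)"
  have C: "u1 \<in> CX" "u2 \<in> CX" unfolding u1_def u2_def by (intro CX_add CX_scale w sw)+
  have "star u1 = (\<lambda>x. (1/2) * star w x + (1/2) * star (star w) x)"
    unfolding u1_def by (auto simp: star_def cut_def)
  then have s1: "star u1 = u1" unfolding ss by (auto simp: u1_def)
  have "star u2 = (\<lambda>x. (\<i>/2) * star w x + (- \<i>/2) * star (star w) x)"
    unfolding u2_def by (auto simp: star_def cut_def)
  then have s2: "star u2 = u2" unfolding ss by (auto simp: u2_def)
  have c1: "conv u1 p = u1" "conv u2 p = u2"
    unfolding u1_def u2_def using w swp
    by (simp_all only: conv_add_left[OF pC(1) CX_scale[OF w(1)] CX_scale[OF sw]] conv_scale_left[OF pC(1)] sw)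
  obtain a where a: "u1 = (\<lambda>x. complex_of_real a * p x)"
    using minimal_idempotent_selfadjoint[OF p min C(1) s1 c1(1)] by blast
  obtain b where b: "u2 = (\<lambda>x. complex_of_real b * p x)"
    using minimal_idempotent_selfadjoint[OF p min C(2) s2 c1(2)] by blast
  have "w x = u1 x + \<i> * u2 x" for x unfolding u1_def u2_def by (simp add: field_simps)
  then have "w = (\<lambda>x. (complex_of_real a + \<i> * complex_of_real b) * p x)"
    unfolding a b by (auto simp: algebra_simps)
  then show ?thesis by (rule that)
qed

lemma conv_translate:
  assumes f: "f \<in> CX" and g: "g \<in> CX" and a: "a \<in> carrier X"
  shows "conv f (translate a g) = translate a (conv f g)"
proof (rule CX_eqI)
  fix x assume x: "x \<in> carrier X"
  have "conv f (translate a g) x = m (\<lambda>y. f y * g (inv y \<otimes> (a \<otimes> x)))"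
    unfolding conv_apply[OF x]
    by (rule mean_cong[OF conv_bounded[OF f translate_CX[OF a g] x]])
       (use x a in \<open>simp add: translate_apply m_lcomm\<close>)
  then show "conv f (translate a g) x = translate a (conv f g) x"
    using x a by (simp add: translate_apply conv_apply)
qed (use assms in \<open>auto intro: conv_CX translate_CX\<close>)

text \<open>The ideal of \<open>p\<close> is invariant under translations and consists of the
  multiples of \<open>p\<close>, so translations act on \<open>p\<close> by scalars; these scalars
  are the values of the character.\<close>

lemma minimal_idempotent_character:
  assumes p: "idem p" and min: "\<And>q. idem q \<Longrightarrow> conv q p = q \<Longrightarrow> q = p"
  shows "(\<lambda>x\<in>carrier X. p x / p \<one>) \<in> characters X T"
proof -
  have pC: "p \<in> CX" and sp: "star p = p" and pp: "conv p p = p" using p by (auto simp: idem_def)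
  define r where "r = Re (p \<one>)"
  have r: "p \<one> = complex_of_real r" "r \<ge> 1" using idem_at_one[OF p] by (simp_all add: r_def)
  have mult: "p (a \<otimes> x) * p \<one> = p a * p x" if a: "a \<in> carrier X" and x: "x \<in> carrier X" for a x
  proof -
    have "conv (translate a p) p = translate a p"
      using conv_translate[OF pC pC a] conv_commute[OF pC translate_CX[OF a pC]] pp by simp
    then obtain c where c: "translate a p = (\<lambda>x. c * p x)"
      using minimal_idempotent_ideal[OF p min translate_CX[OF a pC]] by metis
    have "p (a \<otimes> x) = c * p x" "p a = c * p \<one>"
      using fun_cong[OF c, of x] fun_cong[OF c, of \<one>] a x by (simp_all add: translate_apply)
    then show ?thesis by simp
  qed
  \<comment> \<open>Self-adjointness gives \<open>p (inv x) = cnj (p x)\<close>; multiplicativity at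
    \<open>x\<close> and \<open>inv x\<close> then shows that \<open>p\<close> has constant
    modulus.\<close>
  have norm1: "cmod (p x / p \<one>) = 1" if x: "x \<in> carrier X" for x
  proof -
    have "p (inv x) = cnj (p x)"
      using fun_cong[OF sp, of x] x by (simp add: star_apply) (metis complex_cnj_cnj)
    then have "p \<one> * p \<one> = p x * cnj (p x)" using mult[OF x inv_closed[OF x]] x by simp
    then have "(cmod (p x))\<^sup>2 = r\<^sup>2" unfolding r(1)
      by (metis complex_norm_square of_real_eq_iff of_real_mult power2_eq_square)
    then have "cmod (p x) = r" using r(2) by (simp add: power2_eq_iff_nonneg)
    then show ?thesis using r by (simp add: norm_divide)
  qed
  have ne: "p \<one> \<noteq> 0" using r by simp
  have "(\<lambda>x\<in>carrier X. p x / p \<one>) \<in> hom X circle_group"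
  proof (rule homI)
    fix x y assume xy: "x \<in> carrier X" "y \<in> carrier X"
    show "(\<lambda>x\<in>carrier X. p x / p \<one>) x \<in> carrier circle_group"
      using norm1 xy by (simp add: circle_group_def)
    show "(\<lambda>x\<in>carrier X. p x / p \<one>) (x \<otimes> y) = (\<lambda>x\<in>carrier X. p x / p \<one>) x \<otimes>\<^bsub>circle_group\<^esub> (\<lambda>x\<in>carrier X. p x / p \<one>) y"
      using mult[OF xy] xy ne by (simp add: circle_group_def field_simps)
  qed
  moreover have "cont (\<lambda>x\<in>carrier X. p x / p \<one>)"
  proof (rule continuous_map_eq)
    show "cont (\<lambda>x. (1 / p \<one>) * p x)" using CX_cont[OF CX_scale[OF pC]] .
  qed (auto simp: topspace_eq)
  ultimately show ?thesis by (simp add: characters_def)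
qed

lemma star_translate:
  assumes a: "a \<in> carrier X" and g: "g \<in> CX"
  shows "star (translate a g) = translate (inv a) (star g)"
  by (rule CX_eqI)
     (use assms in \<open>auto intro: star_CX translate_CX simp: star_apply translate_apply inv_mult\<close>)

text \<open>The distance to \<open>\<one>\<close>, symmetrised under inversion. It is real and
  symmetric, hence self-adjoint, and its second difference in direction \<open>a\<close> is negative
  at \<open>\<one>\<close> because it vanishes there and is positive at \<open>a\<close>.\<close>

lemma separating_function:
  assumes a: "a \<in> carrier X" "a \<noteq> \<one>"
  obtains g where "g \<in> CX" "star g = g" "2 * g \<one> - g a - g (inv a) \<noteq> 0"
proof -
  obtain M d where M: "Metric_space M d" "T = Metric_space.mtopology M d"
    using metrizable by (auto simp: metrizable_space_def)
  interpret Metric_space M d by (rule M(1))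
  have MX: "M = carrier X" using topspace_eq M(2) by (metis topspace_mtopology)
  define g0 where "g0 x = complex_of_real (d x \<one>)" for x
  have "cont g0"
    unfolding continuous_map_euclidean_iff
  proof (intro ballI allI impI)
    fix x and e :: real assume x: "x \<in> topspace T" and e: "e > 0"
    have xM: "x \<in> M" using x MX topspace_eq by simp
    have "dist (g0 y) (g0 x) < e" if "y \<in> mball x e" for y
    proof -
      have "y \<in> M" "d x y < e" using that by auto
      moreover have oM: "\<one> \<in> M" using MX by simp
      ultimately have "\<bar>d y \<one> - d x \<one>\<bar> < e"
        using triangle[OF \<open>y \<in> M\<close> xM oM] triangle[OF xM \<open>y \<in> M\<close> oM] commute[of x y] by linarith
      then show ?thesis by (simp add: g0_def dist_norm flip: of_real_diff)
    qed
    then show "\<exists>U. openin T U \<and> x \<in> U \<and> (\<forall>y\<in>U. dist (g0 y) (g0 x) < e)"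
      using M(2) xM e by (intro exI[of _ "mball x e"]) auto
  qed
  from this this have "cont (\<lambda>x. g0 x + g0 (inv x))"
    by (rule continuous_map_add[OF _ cont_comp[OF _ continuous_map_inverse[OF continuous_map_ident]]])
  then have g: "cut (\<lambda>x. g0 x + g0 (inv x)) \<in> CX" by (rule cut_CX)
  have "star (cut (\<lambda>x. g0 x + g0 (inv x))) = cut (\<lambda>x. g0 x + g0 (inv x))"
    by (auto simp: star_def cut_def g0_def)
  moreover have "d a \<one> > 0" "d (inv a) \<one> \<ge> 0" "d \<one> \<one> = 0"
    using a MX by (auto simp: mdist_pos_eq)
  then have "2 * (2 * d \<one> \<one>) - (d a \<one> + d (inv a) \<one>) - (d (inv a) \<one> + d a \<one>) < 0" by linarith
  then have "2 * cut (\<lambda>x. g0 x + g0 (inv x)) \<one> - cut (\<lambda>x. g0 x + g0 (inv x)) a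
      - cut (\<lambda>x. g0 x + g0 (inv x)) (inv a) \<noteq> 0"
    using a by (simp add: cut_def g0_def complex_eq_iff)
  ultimately show ?thesis using that g by blast
qed

text \<open>The second difference \<open>h\<close> of \<open>g\<close> in direction \<open>a\<close>
  is self-adjoint and nonzero. A minimal idempotent \<open>p\<close> below a spectral idempotent of
  \<open>h\<close> yields a character. If it were trivial at \<open>a\<close>, then \<open>p\<close>
  would be invariant under translation by \<open>a\<close>, the three terms of \<open>h\<close>
  would cancel against \<open>p\<close>, and \<open>l * p = 0\<close> would follow.\<close>

theorem characters_separate:
  assumes a: "a \<in> carrier X" "a \<noteq> \<one>"
  obtains \<phi> where "\<phi> \<in> characters X T" "\<phi> a \<noteq> 1"
proof -
  obtain g where g: "g \<in> CX" "star g = g" "2 * g \<one> - g a - g (inv a) \<noteq> 0"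
    using separating_function[OF a] .
  have ia: "inv a \<in> carrier X" using a by simp
  note tr = translate_CX[OF a(1) g(1)] translate_CX[OF ia g(1)]
  define h where "h = (\<lambda>x. 2 * g x - translate a g x - translate (inv a) g x)"
  have h: "h \<in> CX" unfolding h_def by (intro CX_diff CX_scale g tr)
  have "star h = (\<lambda>x. 2 * star g x - star (translate a g) x - star (translate (inv a) g) x)"
    unfolding h_def by (auto simp: star_def cut_def)
  then have hs: "star h = h"
    using star_translate[OF a(1) g(1)] star_translate[OF ia g(1)] a g(2) by (simp add: h_def algebra_simps)
  have "h \<one> \<noteq> 0" using g(3) a by (simp add: h_def translate_apply)
  then obtain p0 l where p0: "p0 \<in> CX" "star p0 = p0" "conv p0 p0 = p0" "p0 \<noteq> (\<lambda>x. 0)" "l > 0"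
      "conv (conv h h) p0 = (\<lambda>x. complex_of_real l * p0 x)"
    using spectral_idempotent[OF h hs one_closed] by metis
  have "idem p0" using p0 by (simp add: idem_def)
  then obtain p where p: "idem p" "conv p p0 = p" and min: "\<And>q. idem q \<Longrightarrow> conv q p = q \<Longrightarrow> q = p"
    using minimal_idempotent by metis
  have pC: "p \<in> CX" using p by (simp add: idem_def)
  let ?\<phi> = "\<lambda>x\<in>carrier X. p x / p \<one>"
  have ch: "?\<phi> \<in> characters X T" by (rule minimal_idempotent_character[OF p(1) min])
  have p1: "p \<one> \<noteq> 0" using idem_at_one[OF p(1)] by auto
  have "?\<phi> a \<noteq> 1"
  proof
    assume eq: "?\<phi> a = 1"
    have "?\<phi> (a \<otimes> x) = ?\<phi> a * ?\<phi> x" if "x \<in> carrier X" for x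
      using ch a(1) that by (auto simp: characters_def circle_group_def hom_def)
    then have inv1: "p (a \<otimes> x) = p x" if "x \<in> carrier X" for x
      using that a(1) eq p1 by (auto simp: field_simps)
    have inv2: "p (inv a \<otimes> x) = p x" if "x \<in> carrier X" for x
      using inv1[of "inv a \<otimes> x"] that a(1) by (simp add: m_assoc[symmetric])
    have t: "translate a p = p" "translate (inv a) p = p"
      by (rule CX_eqI[OF translate_CX[OF a(1) pC] pC], simp add: translate_apply inv1)
         (rule CX_eqI[OF translate_CX[OF ia pC] pC], simp add: translate_apply inv2)
    have "conv p (translate a g) = conv p g" "conv p (translate (inv a) g) = conv p g"
      using conv_translate[OF pC g(1)] conv_translate[OF g(1) pC] conv_commute[OF pC g(1)] t a(1) ia by metis+
    then have "conv p h = (\<lambda>x. 2 * conv p g x - conv p g x - conv p g x)"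
      unfolding h_def
      by (simp add: conv_diff_right[OF pC CX_diff[OF CX_scale[OF g(1)] tr(1)] tr(2)]
          conv_diff_right[OF pC CX_scale[OF g(1)] tr(1)] conv_scale_right[OF pC g(1)])
    then have ph: "conv p h = (\<lambda>x. 0)" by simp
    have hh: "conv h h \<in> CX" by (rule conv_CX[OF h h])
    have "conv p (conv h h) = conv h (conv p h)"
      by (metis conv_assoc conv_commute h pC conv_CX)
    then have z: "conv p (conv h h) = (\<lambda>x. 0)" using ph conv_zero_right[OF h] by simp
    have "(\<lambda>x. complex_of_real l * p x) = conv p (\<lambda>x. complex_of_real l * p0 x)"
      using p(2) by (simp add: conv_scale_right[OF pC p0(1)])
    also have "\<dots> = conv (conv p (conv h h)) p0"
      using p0(6) conv_assoc[OF pC hh p0(1)] by simp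
    also have "\<dots> = (\<lambda>x. 0)" using z conv_commute[OF zero_CX p0(1)] conv_zero_right[OF p0(1)] by simp
    finally have "complex_of_real l * p \<one> = 0" by metis
    then show False using p0(5) p1 by simp
  qed
  then show ?thesis using ch that by blast
qed

end

section \<open>The dual group\<close>

lemma power_ratio_dominates:
  fixes a b c K :: real
  assumes "0 \<le> b" "b < a" "c > 0"
  obtains n where "K * b ^ n < c * a ^ n"
proof -
  have "(\<lambda>n. K * (b / a) ^ n) \<longlonglongrightarrow> K * 0"
    using assms by (intro tendsto_intros LIMSEQ_realpow_zero) auto
  then have "\<forall>\<^sub>F n in sequentially. K * (b / a) ^ n < c"
    using assms(3) by (intro order_tendstoD) auto
  then obtain n where "K * (b / a) ^ n < c" by (auto simp: eventually_sequentially)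
  moreover have "a ^ n > 0" using assms by simp
  ultimately have "K * (b / a) ^ n * a ^ n < c * a ^ n" by (intro mult_strict_right_mono)
  moreover have "a > 0" using assms by simp
  ultimately show ?thesis using that[of n] by (simp add: power_divide)
qed

context compact_group_mean begin

section \<open>Characters and their orthogonality\<close>

abbreviation chars where "chars \<equiv> characters X T"

definition char_mult :: "('x \<Rightarrow> complex) \<Rightarrow> ('x \<Rightarrow> complex) \<Rightarrow> 'x \<Rightarrow> complex" where
  "char_mult \<phi> \<psi> = (\<lambda>x\<in>carrier X. \<phi> x * \<psi> x)"

definition char_one :: "'x \<Rightarrow> complex" where "char_one = (\<lambda>x\<in>carrier X. 1)"

definition char_cnj :: "('x \<Rightarrow> complex) \<Rightarrow> 'x \<Rightarrow> complex" where
  "char_cnj \<phi> = (\<lambda>x\<in>carrier X. cnj (\<phi> x))"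

lemma char_cont: "\<phi> \<in> chars \<Longrightarrow> cont \<phi>" by (simp add: characters_def)
lemma char_norm: "\<phi> \<in> chars \<Longrightarrow> x \<in> carrier X \<Longrightarrow> cmod (\<phi> x) = 1"
  by (auto simp: characters_def hom_def circle_group_def)
lemma char_hom: "\<phi> \<in> chars \<Longrightarrow> x \<in> carrier X \<Longrightarrow> y \<in> carrier X \<Longrightarrow> \<phi> (x \<otimes> y) = \<phi> x * \<phi> y"
  by (auto simp: characters_def hom_def circle_group_def)
lemma char_ext: "\<phi> \<in> chars \<Longrightarrow> \<phi> \<in> extensional (carrier X)" by (simp add: characters_def)
lemma char_bounded: "\<phi> \<in> chars \<Longrightarrow> bounded (\<phi> ` carrier X)" by (simp add: char_cont cont_bounded)

lemma char_eqI: "\<phi> \<in> chars \<Longrightarrow> \<psi> \<in> chars \<Longrightarrow> (\<And>x. x \<in> carrier X \<Longrightarrow> \<phi> x = \<psi> x) \<Longrightarrow> \<phi> = \<psi>"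
  by (rule extensionalityI[OF char_ext char_ext])

lemma charI:
  assumes "\<And>x. x \<in> carrier X \<Longrightarrow> cmod (\<phi> x) = 1" "cont \<phi>" "\<phi> \<in> extensional (carrier X)"
    "\<And>x y. x \<in> carrier X \<Longrightarrow> y \<in> carrier X \<Longrightarrow> \<phi> (x \<otimes> y) = \<phi> x * \<phi> y"
  shows "\<phi> \<in> chars"
  using assms by (auto simp: characters_def circle_group_def intro!: homI)

lemma char_at_one: "\<phi> \<in> chars \<Longrightarrow> \<phi> \<one> = 1"
  using char_hom[of \<phi> \<one> \<one>] char_norm[of \<phi> \<one>] by force

lemma cont_restrict: "cont f \<Longrightarrow> cont (restrict f (carrier X))"
  by (rule continuous_map_eq[of T euclidean f]) (auto simp: topspace_eq)

lemma char_mult_closed: "\<phi> \<in> chars \<Longrightarrow> \<psi> \<in> chars \<Longrightarrow> char_mult \<phi> \<psi> \<in> chars"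
  unfolding char_mult_def
  by (rule charI, simp add: norm_mult char_norm, intro cont_restrict continuous_map_mult_algebra char_cont)
     (simp_all add: char_hom mult_ac)

lemma char_one_closed: "char_one \<in> chars"
  unfolding char_one_def by (rule charI) (auto intro!: cont_restrict)

lemma char_cnj_closed: "\<phi> \<in> chars \<Longrightarrow> char_cnj \<phi> \<in> chars"
  unfolding char_cnj_def
  by (rule charI, simp add: char_norm, intro cont_restrict continuous_map_cnj char_cont)
     (simp_all add: char_hom)

lemma char_mult_apply: "x \<in> carrier X \<Longrightarrow> char_mult \<phi> \<psi> x = \<phi> x * \<psi> x"
  and char_one_apply: "x \<in> carrier X \<Longrightarrow> char_one x = 1"
  and char_cnj_apply: "x \<in> carrier X \<Longrightarrow> char_cnj \<phi> x = cnj (\<phi> x)"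
  by (simp_all add: char_mult_def char_one_def char_cnj_def)

lemma continuous_char_dist:
  "\<phi> \<in> chars \<Longrightarrow> continuous_map T euclideanreal (\<lambda>y. cmod (\<phi> y - c))"
  by (rule continuous_map_norm, rule continuous_map_diff, erule char_cont) simp

text \<open>Translation by a point \<open>a\<close> with \<open>\<phi> a \<noteq> 1\<close>
  multiplies the mean by \<open>\<phi> a\<close> and leaves it unchanged.\<close>

lemma mean_char:
  assumes \<phi>: "\<phi> \<in> chars"
  shows "m \<phi> = (if \<phi> = char_one then 1 else 0)"
proof (cases "\<phi> = char_one")
  case True
  have "m \<phi> = m (\<lambda>x. 1)" using True by (intro mean_cong char_bounded \<phi>) (simp add: char_one_def)
  then show ?thesis using True mean_one by simp
next
  case False
  then obtain a where a: "a \<in> carrier X" "\<phi> a \<noteq> 1"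
    using char_eqI[OF \<phi> char_one_closed] by (auto simp: char_one_def)
  have "m \<phi> = m (\<lambda>x. \<phi> (a \<otimes> x))" by (rule mean_translate[symmetric, OF char_bounded[OF \<phi>] a(1)])
  also have "\<dots> = m (\<lambda>x. \<phi> a * \<phi> x)"
    by (rule mean_cong[OF bounded_on_translate[OF char_bounded[OF \<phi>] a(1)]]) (simp add: char_hom \<phi> a)
  also have "\<dots> = \<phi> a * m \<phi>" by (rule mean_scale[OF char_bounded[OF \<phi>]])
  finally show ?thesis using a(2) False by simp
qed

text \<open>Each point outside \<open>U\<close> has a neighbourhood on which one character stays
  away from \<open>1\<close>; compactness leaves finitely many characters. So the given topology is
  the one induced by characters, at least near \<open>\<one>\<close>.\<close>

lemma char_neighbourhood:
  assumes U: "openin T U" "\<one> \<in> U"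
  obtains F e where "finite F" "F \<subseteq> chars" "e > 0"
    "\<And>z. z \<in> carrier X \<Longrightarrow> (\<And>\<phi>. \<phi> \<in> F \<Longrightarrow> cmod (\<phi> z - 1) < e) \<Longrightarrow> z \<in> U"
proof -
  have "\<exists>\<phi>\<in>chars. x \<notin> U \<longrightarrow> \<phi> x \<noteq> 1" if "x \<in> carrier X" for x
    using characters_separate[OF that] U(2) char_one_closed by metis
  then obtain \<Phi> where \<Phi>: "\<And>x. x \<in> carrier X \<Longrightarrow> \<Phi> x \<in> chars"
    "\<And>x. x \<in> carrier X \<Longrightarrow> x \<notin> U \<Longrightarrow> \<Phi> x x \<noteq> 1" by metis
  define r where "r x = cmod (\<Phi> x x - 1) / 2" for x
  define O' where "O' x = (if x \<in> U then U else {y \<in> carrier X. cmod (\<Phi> x y - 1) > r x})" for x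
  have op: "openin T (O' x)" if x: "x \<in> carrier X" for x
  proof -
    have "continuous_map T euclideanreal (\<lambda>y. norm (\<Phi> x y - 1))"
      by (intro continuous_char_dist \<Phi> x)
    from openin_continuous_map_preimage[OF this, of "{r x<..}"] show ?thesis
      using U(1) by (auto simp: O'_def topspace_eq)
  qed
  have self: "x \<in> O' x" if "x \<in> carrier X" for x
    using \<Phi>(2)[OF that] that by (auto simp: O'_def r_def)
  obtain Z where Z: "finite Z" "Z \<subseteq> carrier X" "\<And>x. x \<in> carrier X \<Longrightarrow> \<exists>z\<in>Z. x \<in> O' z"
    using compact_cover[OF op self] by metis
  \<comment> \<open>Inserting \<open>1\<close> keeps the minimum meaningful when all chosen points
    lie in \<open>U\<close>.\<close>
  define e where "e = Min (insert 1 (r ` (Z - U)))"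
  have e: "e > 0" unfolding e_def using Z(1,2) \<Phi>(2) by (auto simp: r_def)
  show ?thesis
  proof (rule that[of "\<Phi> ` Z" e])
    show "\<Phi> ` Z \<subseteq> chars" using \<Phi>(1) Z(2) by auto
    fix x assume x: "x \<in> carrier X" and small: "\<And>\<phi>. \<phi> \<in> \<Phi> ` Z \<Longrightarrow> cmod (\<phi> x - 1) < e"
    obtain z where z: "z \<in> Z" "x \<in> O' z" using Z(3)[OF x] by blast
    show "x \<in> U"
    proof (rule ccontr)
      assume "x \<notin> U"
      then have "z \<notin> U" "cmod (\<Phi> z x - 1) > r z" using z(2) by (auto simp: O'_def split: if_splits)
      moreover have "e \<le> r z" unfolding e_def using z(1) \<open>z \<notin> U\<close> Z(1) by (intro Min_le) auto
      ultimately show False using small[of "\<Phi> z"] z(1) by simp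
    qed
  qed (use Z(1) e in auto)
qed

text \<open>A list of pairs \<open>(c, \<phi>)\<close> encodes the trigonometric polynomial \<open>\<Sum> c \<phi>\<close>; twisting by a
  homomorphism \<open>\<psi>\<close> on the dual plays the role of a translation by a point at which the
  characters would take the values \<open>\<psi> \<phi>\<close>.\<close>

definition trig_poly :: "(('x \<Rightarrow> complex) \<Rightarrow> complex) \<Rightarrow> (complex \<times> ('x \<Rightarrow> complex)) list \<Rightarrow> 'x \<Rightarrow> complex"
  where "trig_poly \<psi> L x = (\<Sum>(c, \<phi>)\<leftarrow>L. c * cnj (\<psi> \<phi>) * \<phi> x)"

definition dual_hom :: "(('x \<Rightarrow> complex) \<Rightarrow> complex) \<Rightarrow> bool" where
  "dual_hom \<psi> \<longleftrightarrow> (\<forall>\<phi>\<in>chars. cmod (\<psi> \<phi>) = 1) \<and>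
     (\<forall>\<phi>\<in>chars. \<forall>\<phi>'\<in>chars. \<psi> (char_mult \<phi> \<phi>') = \<psi> \<phi> * \<psi> \<phi>')"

lemma dual_hom_one: "dual_hom \<psi> \<Longrightarrow> \<psi> char_one = 1"
proof -
  assume \<psi>: "dual_hom \<psi>"
  have "char_mult char_one char_one = char_one"
    by (auto simp: char_mult_def char_one_def)
  then have "\<psi> char_one * \<psi> char_one = \<psi> char_one"
    using \<psi> char_one_closed unfolding dual_hom_def by metis
  moreover have "\<psi> char_one \<noteq> 0" using \<psi> char_one_closed unfolding dual_hom_def by force
  ultimately show ?thesis by simp
qed

lemma dual_hom_cnj: "dual_hom \<psi> \<Longrightarrow> \<phi> \<in> chars \<Longrightarrow> \<psi> (char_cnj \<phi>) = cnj (\<psi> \<phi>)"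
proof -
  assume \<psi>: "dual_hom \<psi>" and \<phi>: "\<phi> \<in> chars"
  have "\<phi> x * cnj (\<phi> x) = 1" if "x \<in> carrier X" for x
    using char_norm[OF \<phi> that] by (simp add: complex_norm_square[symmetric])
  then have "char_mult \<phi> (char_cnj \<phi>) = char_one"
    by (auto simp: char_mult_def char_one_def char_cnj_def)
  then have "\<psi> \<phi> * \<psi> (char_cnj \<phi>) = 1"
    using \<psi> \<phi> char_cnj_closed[OF \<phi>] dual_hom_one[OF \<psi>] unfolding dual_hom_def by metis
  moreover have "cnj (\<psi> \<phi>) * \<psi> \<phi> = 1"
    using \<psi> \<phi> complex_norm_square[of "\<psi> \<phi>"] by (simp add: dual_hom_def mult.commute)
  ultimately show ?thesis by (metis mult.assoc mult.right_neutral mult.left_neutral)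
qed

text \<open>The product list does not mention \<open>\<psi>\<close>; multiplicativity of
  \<open>\<psi>\<close> makes it correct for every twist. Lists also avoid collecting equal
  characters in a product.\<close>

lemma trig_poly_mult:
  assumes \<psi>: "dual_hom \<psi>" and L: "snd ` set L \<subseteq> chars" "snd ` set L' \<subseteq> chars" and x: "x \<in> carrier X"
  shows "trig_poly \<psi> [(c * c', char_mult \<phi> \<phi>'). (c, \<phi>) \<leftarrow> L, (c', \<phi>') \<leftarrow> L'] x
    = trig_poly \<psi> L x * trig_poly \<psi> L' x"
  using L(1)
proof (induction L)
  case Nil then show ?case by (simp add: trig_poly_def)
next
  case (Cons p L)
  obtain c \<phi> where p: "p = (c, \<phi>)" by force
  have \<phi>: "\<phi> \<in> chars" using Cons(2) p by simp
  have "(\<Sum>(c', \<phi>')\<leftarrow>map (\<lambda>(c', \<phi>'). (c * c', char_mult \<phi> \<phi>')) L'. c' * cnj (\<psi> \<phi>') * \<phi>' x)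
      = c * cnj (\<psi> \<phi>) * \<phi> x * trig_poly \<psi> L' x"
    using L(2)
  proof (induction L')
    case Nil then show ?case by (simp add: trig_poly_def)
  next
    case (Cons q L')
    obtain c' \<phi>' where q: "q = (c', \<phi>')" by force
    have "\<psi> (char_mult \<phi> \<phi>') = \<psi> \<phi> * \<psi> \<phi>'" using \<psi> \<phi> Cons(2) q by (simp add: dual_hom_def)
    then show ?case using Cons q x by (simp add: trig_poly_def char_mult_apply algebra_simps)
  qed
  then show ?case using Cons p by (simp add: trig_poly_def algebra_simps)
qed

text \<open>One list serves all twists, which makes their means comparable. The set \<open>M\<close>
  records which characters can occur, for the orthogonality argument in
  \<open>separating_subgroup_full\<close>.\<close>

lemma trig_poly_power:
  assumes M: "M \<subseteq> chars" "char_one \<in> M" "\<And>\<phi> \<psi>. \<phi> \<in> M \<Longrightarrow> \<psi> \<in> M \<Longrightarrow> char_mult \<phi> \<psi> \<in> M"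
    and L: "snd ` set L \<subseteq> M"
  obtains L' where "snd ` set L' \<subseteq> M"
    "\<And>\<psi> x. dual_hom \<psi> \<Longrightarrow> x \<in> carrier X \<Longrightarrow> trig_poly \<psi> L' x = trig_poly \<psi> L x ^ n"
proof -
  have "\<exists>L'. snd ` set L' \<subseteq> M \<and>
      (\<forall>\<psi> x. dual_hom \<psi> \<longrightarrow> x \<in> carrier X \<longrightarrow> trig_poly \<psi> L' x = trig_poly \<psi> L x ^ n)"
  proof (induction n)
    case 0
    show ?case
      by (rule exI[of _ "[(1, char_one)]"]) (use M(2) in \<open>simp add: trig_poly_def dual_hom_one char_one_apply\<close>)
  next
    case (Suc n)
    then obtain L' where L': "snd ` set L' \<subseteq> M"
      "\<And>\<psi> x. dual_hom \<psi> \<Longrightarrow> x \<in> carrier X \<Longrightarrow> trig_poly \<psi> L' x = trig_poly \<psi> L x ^ n" by blast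
    let ?L = "[(c * c', char_mult \<phi> \<phi>'). (c, \<phi>) \<leftarrow> L, (c', \<phi>') \<leftarrow> L']"
    have "snd ` set ?L \<subseteq> M"
    proof
      fix \<phi> assume "\<phi> \<in> snd ` set ?L"
      then obtain p q where pq: "p \<in> set L" "q \<in> set L'" "\<phi> = char_mult (snd p) (snd q)" by force
      then show "\<phi> \<in> M" using M(3) L L'(1) by (simp add: image_subset_iff)
    qed
    moreover have "trig_poly \<psi> ?L x = trig_poly \<psi> L x ^ Suc n" if "dual_hom \<psi>" "x \<in> carrier X" for \<psi> x
      using trig_poly_mult[OF that(1) order.trans[OF L M(1)] order.trans[OF L'(1) M(1)] that(2)]
        L'(2)[OF that] by simp
    ultimately show ?case by blast
  qed
  then show ?thesis using that by blast
qed

lemma trig_poly_bounded: "snd ` set L \<subseteq> chars \<Longrightarrow> bounded (trig_poly \<psi> L ` carrier X)"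
proof (induction L)
  case Nil show ?case by (auto simp: trig_poly_def[abs_def] bounded_on_const)
next
  case (Cons p L)
  obtain c \<phi> where p: "p = (c, \<phi>)" by force
  have "trig_poly \<psi> (p # L) = (\<lambda>x. c * cnj (\<psi> \<phi>) * \<phi> x + trig_poly \<psi> L x)"
    by (auto simp: p trig_poly_def)
  then show ?case using Cons p char_bounded[of \<phi>]
    by (simp only:) (intro bounded_on_add bounded_on_mult bounded_on_const; simp)
qed

lemma mean_trig_poly:
  "snd ` set L \<subseteq> chars \<Longrightarrow> \<kappa> \<in> chars \<Longrightarrow> m (\<lambda>x. \<kappa> x * trig_poly \<psi> L x) =
     (\<Sum>(c, \<phi>)\<leftarrow>L. c * cnj (\<psi> \<phi>) * (if char_mult \<kappa> \<phi> = char_one then 1 else 0))"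
proof (induction L)
  case Nil show ?case by (simp add: trig_poly_def mean_const)
next
  case (Cons p L)
  obtain c \<phi> where p: "p = (c, \<phi>)" by force
  have \<phi>: "\<phi> \<in> chars" using Cons(2) p by simp
  have b: "bounded ((\<lambda>x. \<kappa> x * \<phi> x) ` carrier X)" using Cons \<phi> by (intro bounded_on_mult char_bounded)
  have b1: "bounded ((\<lambda>x. c * cnj (\<psi> \<phi>) * (\<kappa> x * \<phi> x)) ` carrier X)"
    by (intro bounded_on_mult[OF bounded_on_const b])
  have b2: "bounded ((\<lambda>x. \<kappa> x * trig_poly \<psi> L x) ` carrier X)"
    using Cons(2,3) by (intro bounded_on_mult char_bounded trig_poly_bounded) auto
  have "m (\<lambda>x. \<kappa> x * trig_poly \<psi> (p # L) x)
      = m (\<lambda>x. c * cnj (\<psi> \<phi>) * (\<kappa> x * \<phi> x) + \<kappa> x * trig_poly \<psi> L x)"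
    by (intro arg_cong[of _ _ m] ext) (simp add: p trig_poly_def algebra_simps)
  also have "\<dots> = c * cnj (\<psi> \<phi>) * m (\<lambda>x. \<kappa> x * \<phi> x) + m (\<lambda>x. \<kappa> x * trig_poly \<psi> L x)"
    using mean_add[OF b1 b2] mean_scale[OF b] by simp
  also have "m (\<lambda>x. \<kappa> x * \<phi> x) = m (char_mult \<kappa> \<phi>)"
    by (rule mean_cong[OF b]) (simp add: char_mult_def)
  finally show ?case using Cons p mean_char[OF char_mult_closed[OF Cons(3) \<phi>]] by simp
qed

text \<open>The average over \<open>F\<close> of \<open>(1 + Re z) / 2\<close> with
  \<open>Re z\<close> written as half the sum of \<open>z\<close> and its conjugate; this accounts
  for the coefficients \<open>1/2\<close> and \<open>1 / (4 * n)\<close>.\<close>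

definition kernel_list :: "('x \<Rightarrow> complex) set \<Rightarrow> (complex \<times> ('x \<Rightarrow> complex)) list" where
  "kernel_list F = (let L = (SOME L. set L = F \<and> distinct L); n = card F in
     (1/2, char_one) # concat (map (\<lambda>\<phi>. [(1 / (4 * of_nat n), \<phi>), (1 / (4 * of_nat n), char_cnj \<phi>)]) L))"

lemma kernel_list:
  assumes F: "finite F" "F \<subseteq> chars" "F \<noteq> {}"
  shows "set (kernel_list F) \<subseteq> UNIV \<times> (insert char_one (F \<union> char_cnj ` F))"
    and "\<And>\<psi> x. dual_hom \<psi> \<Longrightarrow> x \<in> carrier X \<Longrightarrow> trig_poly \<psi> (kernel_list F) x =
      complex_of_real ((\<Sum>\<phi>\<in>F. (1 + Re (cnj (\<psi> \<phi>) * \<phi> x)) / 2) / real (card F))"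
proof -
  define L where "L = (SOME L. set L = F \<and> distinct L)"
  have L: "set L = F" "distinct L"
    using someI_ex[OF finite_distinct_list[OF F(1)]] by (auto simp: L_def)
  have k: "kernel_list F = (1/2, char_one) # concat (map (\<lambda>\<phi>. [(1 / (4 * of_nat (card F)), \<phi>), (1 / (4 * of_nat (card F)), char_cnj \<phi>)]) L)"
    by (simp add: kernel_list_def L_def Let_def)
  show "set (kernel_list F) \<subseteq> UNIV \<times> (insert char_one (F \<union> char_cnj ` F))"
    unfolding k using L(1) by auto
  fix \<psi> x assume \<psi>: "dual_hom \<psi>" and x: "x \<in> carrier X"
  have n: "card F > 0" using F by (simp add: card_gt_0_iff)
  have "trig_poly \<psi> (concat (map (\<lambda>\<phi>. [(c, \<phi>), (c, char_cnj \<phi>)]) K)) x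
      = (\<Sum>\<phi>\<leftarrow>K. 2 * c * complex_of_real (Re (cnj (\<psi> \<phi>) * \<phi> x)))" if "set K \<subseteq> chars" for K c
    using that
  proof (induction K)
    case Nil then show ?case by (simp add: trig_poly_def)
  next
    case (Cons \<phi> K)
    have "cnj (\<psi> \<phi>) * \<phi> x + cnj (\<psi> (char_cnj \<phi>)) * char_cnj \<phi> x = 2 * complex_of_real (Re (cnj (\<psi> \<phi>) * \<phi> x))"
      using dual_hom_cnj[OF \<psi>, of \<phi>] Cons(2) x complex_add_cnj[of "cnj (\<psi> \<phi>) * \<phi> x"]
      by (simp add: char_cnj_apply)
    then have "c * cnj (\<psi> \<phi>) * \<phi> x + c * cnj (\<psi> (char_cnj \<phi>)) * char_cnj \<phi> x
        = 2 * c * complex_of_real (Re (cnj (\<psi> \<phi>) * \<phi> x))"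
      by (metis (no_types, opaque_lifting) distrib_left mult.assoc mult.left_commute)
    then show ?case using Cons by (simp add: trig_poly_def algebra_simps)
  qed
  from this[of L "1 / (4 * of_nat (card F))"] L F(2)
  have "trig_poly \<psi> (kernel_list F) x = 1/2 + (\<Sum>\<phi>\<in>F. complex_of_real (Re (cnj (\<psi> \<phi>) * \<phi> x)) / (2 * of_nat (card F)))"
    using x dual_hom_one[OF \<psi>] unfolding k
    by (simp add: trig_poly_def char_one_apply sum_list_distinct_conv_sum_set sum_distrib_left)
  also have "\<dots> = complex_of_real ((\<Sum>\<phi>\<in>F. (1 + Re (cnj (\<psi> \<phi>) * \<phi> x)) / 2) / real (card F))"
  proof -
    define R where "R \<phi> = Re (cnj (\<psi> \<phi>) * \<phi> x)" for \<phi>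
    have "(\<Sum>\<phi>\<in>F. (1 + R \<phi>) / 2) = (real (card F) + (\<Sum>\<phi>\<in>F. R \<phi>)) / 2"
      by (simp add: sum.distrib flip: sum_divide_distrib)
    then have "(\<Sum>\<phi>\<in>F. (1 + R \<phi>) / 2) / real (card F) = 1 / 2 + (\<Sum>\<phi>\<in>F. R \<phi>) / (2 * real (card F))"
      using n by (simp add: add_divide_distrib)
    moreover have "(\<Sum>\<phi>\<in>F. complex_of_real (R \<phi>) / (2 * of_nat (card F)))
        = complex_of_real ((\<Sum>\<phi>\<in>F. R \<phi>) / (2 * real (card F)))"
      by (simp add: sum_divide_distrib)
    ultimately have "1 / 2 + (\<Sum>\<phi>\<in>F. complex_of_real (R \<phi>) / (2 * of_nat (card F)))
        = complex_of_real ((\<Sum>\<phi>\<in>F. (1 + R \<phi>) / 2) / real (card F))" by simp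
    then show ?thesis by (simp only: R_def)
  qed
  finally show "trig_poly \<psi> (kernel_list F) x =
      complex_of_real ((\<Sum>\<phi>\<in>F. (1 + Re (cnj (\<psi> \<phi>) * \<phi> x)) / 2) / real (card F))" .
qed

text \<open>Each summand lies between \<open>0\<close> and \<open>1\<close> and is \<open>1\<close>
  exactly if \<open>\<phi> x = \<psi> \<phi>\<close>. High powers therefore concentrate where
  \<open>x\<close> nearly realises \<open>\<psi>\<close> on \<open>F\<close>.\<close>

definition kernel :: "(('x \<Rightarrow> complex) \<Rightarrow> complex) \<Rightarrow> ('x \<Rightarrow> complex) set \<Rightarrow> 'x \<Rightarrow> real" where
  "kernel \<psi> F x = (\<Sum>\<phi>\<in>F. (1 + Re (cnj (\<psi> \<phi>) * \<phi> x)) / 2) / real (card F)"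

lemma Re_unit_eq:
  assumes "cmod u = 1" "cmod v = 1"
  shows "Re (cnj u * v) = 1 - (cmod (v - u))\<^sup>2 / 2"
proof -
  have "(cmod (v - u))\<^sup>2 = (cmod v)\<^sup>2 + (cmod u)\<^sup>2 - 2 * Re (cnj u * v)"
    unfolding cmod_power2 by (simp add: power2_eq_square algebra_simps)
  then show ?thesis using assms by (simp add: field_simps)
qed

text \<open>By \<open>Re_unit_eq\<close> the summand of \<open>\<phi>\<close> falls short of
  \<open>1\<close> by a quarter of the squared distance between \<open>\<phi> x\<close> and
  \<open>\<psi> \<phi>\<close>; a single deviating character lowers the average by its share
  \<open>1 / card F\<close> of this.\<close>

lemma kernel_bounds:
  assumes F: "finite F" "F \<subseteq> chars" "F \<noteq> {}" and \<psi>: "dual_hom \<psi>" and x: "x \<in> carrier X"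
  shows "0 \<le> kernel \<psi> F x" "kernel \<psi> F x \<le> 1"
    "\<And>\<phi> e. \<phi> \<in> F \<Longrightarrow> e \<le> cmod (\<phi> x - \<psi> \<phi>) \<Longrightarrow> e \<ge> 0 \<Longrightarrow> kernel \<psi> F x \<le> 1 - e\<^sup>2 / (4 * real (card F))"
proof -
  have n: "real (card F) > 0" using F by (simp add: card_gt_0_iff)
  define R where "R \<phi> = Re (cnj (\<psi> \<phi>) * \<phi> x)" for \<phi>
  have k: "kernel \<psi> F x = (\<Sum>\<phi>\<in>F. (1 + R \<phi>) / 2) / real (card F)" by (simp only: kernel_def R_def)
  have re: "R \<phi> = 1 - (cmod (\<phi> x - \<psi> \<phi>))\<^sup>2 / 2" if "\<phi> \<in> F" for \<phi>
    unfolding R_def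
    using that F(2) \<psi> x by (intro Re_unit_eq) (auto simp: dual_hom_def char_norm subset_iff)
  have abs: "- 1 \<le> R \<phi>" "R \<phi> \<le> 1" if "\<phi> \<in> F" for \<phi>
  proof -
    have "cmod (cnj (\<psi> \<phi>) * \<phi> x) = 1"
      using that F(2) \<psi> x by (auto simp: dual_hom_def char_norm norm_mult subset_iff)
    then have "\<bar>R \<phi>\<bar> \<le> 1" unfolding R_def by (metis abs_Re_le_cmod)
    then show "- 1 \<le> R \<phi>" "R \<phi> \<le> 1" by auto
  qed
  show "0 \<le> kernel \<psi> F x" unfolding k
    using abs(1) by (intro divide_nonneg_nonneg sum_nonneg) force+
  have "(\<Sum>\<phi>\<in>F. (1 + R \<phi>) / 2) \<le> (\<Sum>\<phi>\<in>F. 1)"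
    using abs(2) by (intro sum_mono) auto
  then show "kernel \<psi> F x \<le> 1" unfolding k using n by (simp add: field_simps)
  fix \<phi> e assume \<phi>: "\<phi> \<in> F" and e: "e \<le> cmod (\<phi> x - \<psi> \<phi>)" "e \<ge> 0"
  have 1: "(\<Sum>\<phi>\<in>F. (1 + R \<phi>) / 2) = (1 + R \<phi>) / 2 + (\<Sum>\<phi>\<in>F - {\<phi>}. (1 + R \<phi>) / 2)"
    using F(1) \<phi> by (simp add: sum.remove)
  have 2: "(\<Sum>\<phi>\<in>F - {\<phi>}. (1 + R \<phi>) / 2) \<le> (\<Sum>\<phi>\<in>F - {\<phi>}. 1)"
    using abs(2) by (intro sum_mono) auto
  have 3: "(\<Sum>\<phi>\<in>F - {\<phi>}. 1) = real (card F) - 1"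
    using F(1) \<phi> n by (simp add: card_Diff_singleton of_nat_diff)
  have 4: "(1 + R \<phi>) / 2 \<le> 1 - e\<^sup>2 / 4"
    using re[OF \<phi>] power_mono[OF e, of 2] by simp
  have "(\<Sum>\<phi>\<in>F. (1 + R \<phi>) / 2) \<le> real (card F) - e\<^sup>2 / 4" using 1 2 3 4 by linarith
  then show "kernel \<psi> F x \<le> 1 - e\<^sup>2 / (4 * real (card F))"
    unfolding k using n by (simp add: field_simps)
qed

lemma dual_hom_trivial: "dual_hom (\<lambda>\<phi>. 1)" by (simp add: dual_hom_def)

lemma mean_kernel_power:
  assumes F: "finite F" "F \<subseteq> chars" "F \<noteq> {}" and \<psi>: "dual_hom \<psi>"
  shows "m (\<lambda>x. complex_of_real (kernel \<psi> F x ^ n)) = m (\<lambda>x. complex_of_real (kernel (\<lambda>\<phi>. 1) F x ^ n))"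
proof -
  have "snd ` set (kernel_list F) \<subseteq> insert char_one (F \<union> char_cnj ` F)"
    using kernel_list(1)[OF F] by force
  also have "\<dots> \<subseteq> chars" using F(2) char_cnj_closed char_one_closed by auto
  finally have "snd ` set (kernel_list F) \<subseteq> chars" .
  then obtain L where L: "snd ` set L \<subseteq> chars"
    "\<And>\<psi> x. dual_hom \<psi> \<Longrightarrow> x \<in> carrier X \<Longrightarrow> trig_poly \<psi> L x = trig_poly \<psi> (kernel_list F) x ^ n"
    using trig_poly_power[OF order.refl char_one_closed char_mult_closed] by metis
  have eq: "m (\<lambda>x. complex_of_real (kernel \<psi> F x ^ n)) = m (\<lambda>x. char_one x * trig_poly \<psi> L x)"
    if "dual_hom \<psi>" for \<psi>
  proof (rule mean_cong[symmetric])
    show "bounded ((\<lambda>x. char_one x * trig_poly \<psi> L x) ` carrier X)"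
      by (intro bounded_on_mult trig_poly_bounded L char_bounded char_one_closed)
    show "char_one x * trig_poly \<psi> L x = complex_of_real (kernel \<psi> F x ^ n)" if "x \<in> carrier X" for x
      using L(2)[OF \<open>dual_hom \<psi>\<close> that] kernel_list(2)[OF F \<open>dual_hom \<psi>\<close> that] that
      by (simp add: char_one_def kernel_def)
  qed
  have one: "char_mult char_one \<phi> = \<phi>" if "\<phi> \<in> chars" for \<phi>
    by (rule char_eqI[OF char_mult_closed[OF char_one_closed that] that]) (simp add: char_mult_def char_one_def)
  \<comment> \<open>Only entries with \<open>\<phi> = char_one\<close> contribute, and there
    \<open>\<psi>\<close> has the value \<open>1\<close>.\<close>
  have sums: "(\<Sum>(c, \<phi>)\<leftarrow>K. c * cnj (\<psi> \<phi>) * (if char_mult char_one \<phi> = char_one then 1 else 0)) =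
      (\<Sum>(c, \<phi>)\<leftarrow>K. c * cnj 1 * (if char_mult char_one \<phi> = char_one then 1 else 0))"
    if "snd ` set K \<subseteq> chars" for K
    using that by (induction K) (auto simp: one dual_hom_one[OF \<psi>])
  show ?thesis
    unfolding eq[OF \<psi>] eq[OF dual_hom_trivial] mean_trig_poly[OF L(1) char_one_closed]
    by (rule sums[OF L(1)])
qed

text \<open>The means of the powers of the kernel depend only on the trivial coefficient of a
  trigonometric polynomial and hence not on \<open>\<psi>\<close>, so they may be bounded from below at \<open>\<psi> = 1\<close>, where
  the kernel is close to \<open>1\<close> on a neighbourhood of \<open>\<one>\<close>.\<close>

lemma kernel_concentration:
  assumes F: "finite F" "F \<subseteq> chars" "F \<noteq> {}" and d: "d > 0" "d \<le> 1"
  obtains c where "c > 0" "\<And>n. c * (1 - d) ^ n \<le> Re (m (\<lambda>x. complex_of_real (kernel (\<lambda>\<phi>. 1) F x ^ n)))"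
proof -
  let ?k = "kernel (\<lambda>\<phi>. 1) F"
  note kb = kernel_bounds[OF F dual_hom_trivial]
  have "continuous_map T euclidean (\<lambda>x. trig_poly (\<lambda>\<phi>. 1) (kernel_list F) x)" 
  proof -
    have "cont (\<lambda>x. trig_poly (\<lambda>\<phi>. 1) L x)" if "snd ` set L \<subseteq> chars" for L
      using that
    proof (induction L)
      case Nil show ?case by (simp add: trig_poly_def)
    next
      case (Cons p L)
      have "trig_poly (\<lambda>\<phi>. 1) (p # L) x = fst p * snd p x + trig_poly (\<lambda>\<phi>. 1) L x" for x
        by (simp add: trig_poly_def case_prod_unfold)
      moreover have "cont (\<lambda>x. fst p * snd p x)"
        using continuous_map_mult_algebra[OF _ char_cont[of "snd p"], of "\<lambda>x. fst p"] Cons(2) by simp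
      ultimately show ?case using continuous_map_add[of T "\<lambda>x. fst p * snd p x"] Cons by simp
    qed
    moreover have "snd ` set (kernel_list F) \<subseteq> chars"
      using kernel_list(1)[OF F] F(2) char_cnj_closed char_one_closed by fastforce
    ultimately show ?thesis by blast
  qed
  then have kc: "cont (\<lambda>x. complex_of_real (?k x))"
    by (rule continuous_map_eq)
       (simp add: kernel_list(2)[OF F dual_hom_trivial] topspace_eq kernel_def)
  have k1: "?k \<one> = 1"
    using F by (simp add: kernel_def char_at_one subset_iff cong: sum.cong) 
  obtain U where U: "openin T U" "\<one> \<in> U" "\<And>y. y \<in> U \<Longrightarrow> dist (complex_of_real (?k y)) (complex_of_real (?k \<one>)) < d"
    using kc[unfolded continuous_map_euclidean_iff, rule_format, of \<one> d] d by (auto simp: topspace_eq)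
  have kU: "1 - d \<le> ?k y" if "y \<in> U" for y
    using U(3)[OF that] unfolding dist_of_real dist_real_def k1 by linarith
  define c where "c = Re (m (\<lambda>x. if x \<in> U then 1 else 0))"
  have c: "c > 0" unfolding c_def by (rule mean_indicator_pos[OF U(1,2)])
  have bI: "bounded ((\<lambda>x. if x \<in> U then 1 else 0 :: complex) ` carrier X)"
    by (rule boundedI[of _ 1]) auto
  have bk: "bounded ((\<lambda>x. complex_of_real (?k x ^ n)) ` carrier X)" for n
    by (rule boundedI[of _ 1]) (use kb in \<open>auto simp: norm_power power_le_one\<close>)
  have "c * (1 - d) ^ n \<le> Re (m (\<lambda>x. complex_of_real (?k x ^ n)))" for n
  proof -
    have "Re (m (\<lambda>x. complex_of_real ((1 - d) ^ n) * (if x \<in> U then 1 else 0))) \<le> Re (m (\<lambda>x. complex_of_real (?k x ^ n)))"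
    proof (rule mean_mono_Re[OF bounded_on_mult[OF bounded_on_const bI] bk])
      fix x assume x: "x \<in> carrier X"
      show "Re (complex_of_real ((1 - d) ^ n) * (if x \<in> U then 1 else 0)) \<le> Re (complex_of_real (?k x ^ n))"
        using kU[of x] kb(1)[OF x] d by (cases "x \<in> U") (auto simp flip: of_real_power intro!: power_mono)
    qed
    also have "m (\<lambda>x. complex_of_real ((1 - d) ^ n) * (if x \<in> U then 1 else 0))
        = complex_of_real ((1 - d) ^ n) * m (\<lambda>x. if x \<in> U then 1 else 0)"
      by (rule mean_scale[OF bI])
    finally show ?thesis by (simp add: c_def mult.commute flip: of_real_power)
  qed
  then show ?thesis using that c by blast
qed

text \<open>If no point realises \<open>\<psi>\<close>, compactness gives a finite \<open>F\<close>
  for which the twisted kernel is at most some \<open>b < 1\<close> everywhere, so the means of its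
  powers are at most \<open>b^n\<close>. They equal the means for the trivial twist, which decay
  more slowly than any such geometric sequence.\<close>

theorem dual_hom_is_evaluation:
  assumes \<psi>: "dual_hom \<psi>"
  shows "\<exists>x\<in>carrier X. \<forall>\<phi>\<in>chars. \<phi> x = \<psi> \<phi>"
proof (rule ccontr)
  assume "\<not> ?thesis"
  then have "\<exists>\<phi>\<in>chars. \<phi> x \<noteq> \<psi> \<phi>" if "x \<in> carrier X" for x using that by blast
  then obtain \<Phi> where \<Phi>: "\<And>x. x \<in> carrier X \<Longrightarrow> \<Phi> x \<in> chars" "\<And>x. x \<in> carrier X \<Longrightarrow> \<Phi> x x \<noteq> \<psi> (\<Phi> x)"
    by metis
  define r where "r x = cmod (\<Phi> x x - \<psi> (\<Phi> x)) / 2" for x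
  define O' where "O' x = {y \<in> carrier X. cmod (\<Phi> x y - \<psi> (\<Phi> x)) > r x}" for x
  have op: "openin T (O' x)" if x: "x \<in> carrier X" for x
  proof -
    have "continuous_map T euclideanreal (\<lambda>y. norm (\<Phi> x y - \<psi> (\<Phi> x)))"
      by (intro continuous_char_dist \<Phi> x)
    from openin_continuous_map_preimage[OF this, of "{r x<..}"] show ?thesis
      by (simp add: O'_def topspace_eq)
  qed
  have self: "x \<in> O' x" if "x \<in> carrier X" for x
    using \<Phi>(2)[OF that] that by (auto simp: O'_def r_def)
  obtain Z where Z: "finite Z" "Z \<subseteq> carrier X" "\<And>x. x \<in> carrier X \<Longrightarrow> \<exists>z\<in>Z. x \<in> O' z"
    using compact_cover[OF op self] by metis
  define F where "F = \<Phi> ` Z"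
  have Zne: "Z \<noteq> {}" using Z(3)[OF one_closed] by blast
  have F: "finite F" "F \<subseteq> chars" "F \<noteq> {}" using Z(1,2) \<Phi>(1) Zne by (auto simp: F_def)
  have n: "real (card F) > 0" using F by (simp add: card_gt_0_iff)
  define e where "e = Min (r ` Z)"
  have e: "e > 0" unfolding e_def using Z(1,2) \<Phi>(2) Zne by (auto simp: r_def)
  define b where "b = 1 - e\<^sup>2 / (4 * real (card F))"
  have small: "kernel \<psi> F x \<le> b" if x: "x \<in> carrier X" for x
  proof -
    obtain z where z: "z \<in> Z" "x \<in> O' z" using Z(3)[OF x] by blast
    have "e \<le> r z" unfolding e_def using z(1) Z(1) by (intro Min_le) auto
    then have "e \<le> cmod (\<Phi> z x - \<psi> (\<Phi> z))" using z(2) by (auto simp: O'_def)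
    then show ?thesis unfolding b_def
      using kernel_bounds(3)[OF F \<psi> x, of "\<Phi> z" e] z(1) e by (auto simp: F_def)
  qed
  have b: "0 \<le> b" "b < 1"
    using order.trans[OF kernel_bounds(1)[OF F \<psi> one_closed] small[OF one_closed]] e n by (auto simp: b_def)
  \<comment> \<open>The midpoint between \<open>b\<close> and \<open>1\<close> as value of
    \<open>1 - d\<close>, so that \<open>(1 - d)^n\<close> outgrows \<open>b^n\<close>.\<close>
  define d where "d = (1 - b) / 2"
  have d: "d > 0" "d \<le> 1" "b < 1 - d" using b by (auto simp: d_def field_simps)
  obtain c where c: "c > 0" "\<And>n. c * (1 - d) ^ n \<le> Re (m (\<lambda>x. complex_of_real (kernel (\<lambda>\<phi>. 1) F x ^ n)))"
    using kernel_concentration[OF F d(1,2)] by metis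
  obtain n where nn: "1 * b ^ n < c * (1 - d) ^ n" using power_ratio_dominates[OF b(1) d(3) c(1)] by metis
  have "c * (1 - d) ^ n \<le> Re (m (\<lambda>x. complex_of_real (kernel \<psi> F x ^ n)))"
    using c(2)[of n] mean_kernel_power[OF F \<psi>, of n] by simp
  also have "\<dots> \<le> cmod (m (\<lambda>x. complex_of_real (kernel \<psi> F x ^ n)))" by (rule complex_Re_le_cmod)
  also have "\<dots> \<le> b ^ n"
  proof (rule norm_mean_le)
    show bd: "cmod (complex_of_real (kernel \<psi> F x ^ n)) \<le> b ^ n" if "x \<in> carrier X" for x
      using kernel_bounds(1)[OF F \<psi> that] small[OF that]
      by (simp add: norm_power power_mono)
    then show "bounded ((\<lambda>x. complex_of_real (kernel \<psi> F x ^ n)) ` carrier X)"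
      by (intro boundedI[of _ "b ^ n"]) auto
  qed
  finally show False using nn by simp
qed

text \<open>A character \<open>\<kappa>\<close> outside \<open>M\<close> is orthogonal to all
  trigonometric polynomials over \<open>M\<close>. Since \<open>M\<close> separates points, powers
  of a kernel over \<open>M\<close> are small wherever \<open>\<kappa>\<close> is away from
  \<open>1\<close>, so their integral against \<open>\<kappa>\<close> cannot vanish.\<close>

theorem separating_subgroup_full:
  assumes M: "M \<subseteq> chars" "char_one \<in> M" "\<And>\<phi> \<psi>. \<phi> \<in> M \<Longrightarrow> \<psi> \<in> M \<Longrightarrow> char_mult \<phi> \<psi> \<in> M"
      "\<And>\<phi>. \<phi> \<in> M \<Longrightarrow> char_cnj \<phi> \<in> M"
    and sep: "\<And>x. x \<in> carrier X \<Longrightarrow> x \<noteq> \<one> \<Longrightarrow> \<exists>\<phi>\<in>M. \<phi> x \<noteq> 1"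
  shows "M = chars"
proof (rule ccontr)
  assume "M \<noteq> chars"
  then obtain \<kappa> where \<kappa>: "\<kappa> \<in> chars" "\<kappa> \<notin> M" using M(1) by blast
  have "\<exists>\<phi>\<in>M. x \<noteq> \<one> \<longrightarrow> \<phi> x \<noteq> 1" if "x \<in> carrier X" for x
    using sep[OF that] M(2) by blast
  then obtain \<Phi> where \<Phi>: "\<And>x. x \<in> carrier X \<Longrightarrow> \<Phi> x \<in> M" "\<And>x. x \<in> carrier X \<Longrightarrow> x \<noteq> \<one> \<Longrightarrow> \<Phi> x x \<noteq> 1"
    by metis
  define r where "r x = cmod (\<Phi> x x - 1) / 2" for x
  \<comment> \<open>Near \<open>\<one>\<close> it is \<open>\<kappa>\<close> that is controlled;
    around any other point a character of \<open>M\<close> stays away from \<open>1\<close> and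
    makes the kernel small.\<close>
  define O' where "O' x = (if x = \<one> then {y \<in> carrier X. cmod (\<kappa> y - 1) < 1} else {y \<in> carrier X. cmod (\<Phi> x y - 1) > r x})" for x
  have op: "openin T (O' x)" if x: "x \<in> carrier X" for x
  proof -
    have "continuous_map T euclideanreal (\<lambda>y. norm (\<Phi> x y - 1))"
      by (intro continuous_char_dist subsetD[OF M(1) \<Phi>(1)[OF x]])
    moreover have "continuous_map T euclideanreal (\<lambda>y. norm (\<kappa> y - 1))"
      by (intro continuous_char_dist \<kappa>)
    ultimately show ?thesis
      using openin_continuous_map_preimage[of T euclideanreal "\<lambda>y. norm (\<Phi> x y - 1)" "{r x<..}"]
        openin_continuous_map_preimage[of T euclideanreal "\<lambda>y. norm (\<kappa> y - 1)" "{..<1}"]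
      by (simp add: O'_def topspace_eq)
  qed
  have self: "x \<in> O' x" if "x \<in> carrier X" for x
    using \<Phi>(2)[OF that] that char_at_one[OF \<kappa>(1)] by (auto simp: O'_def r_def)
  obtain Z where Z: "finite Z" "Z \<subseteq> carrier X" "\<And>x. x \<in> carrier X \<Longrightarrow> \<exists>z\<in>Z. x \<in> O' z"
    using compact_cover[OF op self] by metis
  define F where "F = \<Phi> ` Z"
  have Zne: "Z \<noteq> {}" using Z(3)[OF one_closed] by blast
  have FM: "F \<subseteq> M" using Z(2) \<Phi>(1) by (auto simp: F_def)
  have F: "finite F" "F \<subseteq> chars" "F \<noteq> {}" using Z(1) FM M(1) Zne by (auto simp: F_def)
  have n: "real (card F) > 0" using F by (simp add: card_gt_0_iff)
  define e where "e = Min (insert 1 (r ` (Z - {\<one>})))"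
  have e: "e > 0" unfolding e_def using Z(1,2) \<Phi>(2) by (auto simp: r_def)
  \<comment> \<open>The bound \<open>small\<close> may be vacuous, so nonnegativity of
    \<open>b\<close> is built in.\<close>
  define b where "b = max 0 (1 - e\<^sup>2 / (4 * real (card F)))"
  have b: "0 \<le> b" "b < 1" using e n by (auto simp: b_def)
  let ?k = "kernel (\<lambda>\<phi>. 1) F"
  note kb = kernel_bounds[OF F dual_hom_trivial]
  have small: "?k x \<le> b" if x: "x \<in> carrier X" and bad: "\<not> cmod (\<kappa> x - 1) < 1" for x
  proof -
    obtain z where z: "z \<in> Z" "x \<in> O' z" using Z(3)[OF x] by blast
    have z1: "z \<noteq> \<one>" using z(2) bad by (auto simp: O'_def)
    have "e \<le> r z" unfolding e_def using z(1) z1 Z(1) by (intro Min_le) auto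
    then have "e \<le> cmod (\<Phi> z x - 1)" using z(2) z1 by (auto simp: O'_def)
    then have "?k x \<le> 1 - e\<^sup>2 / (4 * real (card F))"
      using kb(3)[OF x, of "\<Phi> z" e] z(1) e by (auto simp: F_def)
    then show ?thesis by (simp add: b_def)
  qed
  define d where "d = (1 - b) / 2"
  have d: "d > 0" "d \<le> 1" "b < 1 - d" using b by (auto simp: d_def field_simps)
  obtain c where c: "c > 0" "\<And>n. c * (1 - d) ^ n \<le> Re (m (\<lambda>x. complex_of_real (?k x ^ n)))"
    using kernel_concentration[OF F d(1,2)] by metis
  \<comment> \<open>Integrating \<open>k^n / 2 - 3/2 * b^n \<le> Re \<kappa> * k^n\<close>, with
    \<open>k\<close> the kernel, against the orthogonality relation gives \<open>3 * b^n\<close> as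
    upper bound for the mean of \<open>k^n\<close>.\<close>
  obtain n where nn: "3 * b ^ n < c * (1 - d) ^ n" using power_ratio_dominates[OF b(1) d(3) c(1)] by metis
  have bk: "bounded ((\<lambda>x. complex_of_real (?k x ^ n)) ` carrier X)"
    by (rule boundedI[of _ 1]) (use kb in \<open>auto simp: norm_power power_le_one\<close>)
  have b\<kappa>: "bounded ((\<lambda>x. \<kappa> x * complex_of_real (?k x ^ n)) ` carrier X)"
    by (intro bounded_on_mult char_bounded \<kappa> bk)
  have "snd ` set (kernel_list F) \<subseteq> M"
    using kernel_list(1)[OF F] FM M(2,4) by fastforce
  then obtain L where L: "snd ` set L \<subseteq> M"
    "\<And>\<psi> x. dual_hom \<psi> \<Longrightarrow> x \<in> carrier X \<Longrightarrow> trig_poly \<psi> L x = trig_poly \<psi> (kernel_list F) x ^ n"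
    using trig_poly_power[OF M(1,2,3)] by metis
  have "m (\<lambda>x. \<kappa> x * complex_of_real (?k x ^ n)) = m (\<lambda>x. \<kappa> x * trig_poly (\<lambda>\<phi>. 1) L x)"
    by (rule mean_cong[OF b\<kappa>])
       (simp add: L(2)[OF dual_hom_trivial] kernel_list(2)[OF F dual_hom_trivial] kernel_def)
  also have "\<dots> = (\<Sum>(c, \<phi>)\<leftarrow>L. c * cnj 1 * (if char_mult \<kappa> \<phi> = char_one then 1 else 0))"
    using L(1) M(1) by (intro mean_trig_poly \<kappa>) auto
  also have "\<dots> = 0"
  proof -
    have "char_mult \<kappa> \<phi> \<noteq> char_one" if \<phi>: "\<phi> \<in> M" for \<phi>
    proof
      assume eq: "char_mult \<kappa> \<phi> = char_one"
      have \<phi>c: "\<phi> \<in> chars" using \<phi> M(1) by blast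
      have "\<kappa> = char_cnj \<phi>"
      proof (rule char_eqI[OF \<kappa>(1) char_cnj_closed[OF \<phi>c]])
        fix x assume x: "x \<in> carrier X"
        have "\<kappa> x * \<phi> x = 1" using fun_cong[OF eq, of x] x by (simp add: char_mult_def char_one_def)
        moreover have "\<phi> x * cnj (\<phi> x) = 1"
          using char_norm[OF \<phi>c x] by (simp add: complex_norm_square[symmetric])
        ultimately show "\<kappa> x = char_cnj \<phi> x" using x
          by (simp add: char_cnj_def) (metis mult.assoc mult.right_neutral mult.left_neutral)
      qed
      then show False using \<kappa>(2) M(4)[OF \<phi>] by simp
    qed
    then show ?thesis using L(1) by (induction L) auto
  qed
  finally have zero: "m (\<lambda>x. \<kappa> x * complex_of_real (?k x ^ n)) = 0" .
  have "Re (m (\<lambda>x. complex_of_real (1/2) * complex_of_real (?k x ^ n) - complex_of_real (3/2 * b ^ n)))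
      \<le> Re (m (\<lambda>x. \<kappa> x * complex_of_real (?k x ^ n)))"
  proof (rule mean_mono_Re[OF bounded_on_diff[OF bounded_on_mult[OF bounded_on_const bk] bounded_on_const] b\<kappa>])
    fix x assume x: "x \<in> carrier X"
    have k0: "?k x ^ n \<ge> 0" using kb(1)[OF x] by simp
    \<comment> \<open>If \<open>\<kappa> x\<close> is within \<open>1\<close> of \<open>1\<close>,
      its real part is at least \<open>1/2\<close>. Otherwise it is at least \<open>-1\<close> and
      the kernel is at most \<open>b\<close>, so the two terms \<open>k^n\<close> and
      \<open>k^n / 2\<close> are paid for by \<open>3/2 * b^n\<close>.\<close>
    have "?k x ^ n / 2 - 3/2 * b ^ n \<le> Re (\<kappa> x) * ?k x ^ n"
    proof (cases "cmod (\<kappa> x - 1) < 1")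
      case True
      have "Re (\<kappa> x) = 1 - (cmod (\<kappa> x - 1))\<^sup>2 / 2"
        using Re_unit_eq[of 1 "\<kappa> x"] char_norm[OF \<kappa>(1) x] by simp
      moreover have "(cmod (\<kappa> x - 1))\<^sup>2 \<le> 1" using True by (simp add: power_le_one)
      ultimately have "1/2 \<le> Re (\<kappa> x)" by simp
      then have "1/2 * ?k x ^ n \<le> Re (\<kappa> x) * ?k x ^ n" using k0 by (rule mult_right_mono)
      then show ?thesis using zero_le_power[OF b(1), of n] by linarith
    next
      case False
      have "- 1 \<le> Re (\<kappa> x)" using abs_Re_le_cmod[of "\<kappa> x"] char_norm[OF \<kappa>(1) x] by simp
      then have "- 1 * ?k x ^ n \<le> Re (\<kappa> x) * ?k x ^ n" using k0 by (rule mult_right_mono)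
      moreover have "?k x ^ n \<le> b ^ n" using small[OF x False] kb(1)[OF x] by (intro power_mono)
      ultimately show ?thesis by simp
    qed
    then show "Re (complex_of_real (1/2) * complex_of_real (?k x ^ n) - complex_of_real (3/2 * b ^ n))
        \<le> Re (\<kappa> x * complex_of_real (?k x ^ n))" by (simp flip: of_real_power)
  qed
  also have "\<dots> = 0" using zero by simp
  also have "m (\<lambda>x. complex_of_real (1/2) * complex_of_real (?k x ^ n) - complex_of_real (3/2 * b ^ n))
      = complex_of_real (1/2) * m (\<lambda>x. complex_of_real (?k x ^ n)) - complex_of_real (3/2 * b ^ n)"
    by (simp only: mean_diff[OF bounded_on_mult[OF bounded_on_const bk] bounded_on_const] mean_scale[OF bk] mean_const)
  finally have "Re (m (\<lambda>x. complex_of_real (?k x ^ n))) \<le> 3 * b ^ n" by simp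
  then show False using c(2)[of n] nn by simp
qed

end

section \<open>The convolution algebra of a discrete group\<close>

lemma real_abs_summable_iff:
  fixes f :: "'i \<Rightarrow> real"
  shows "(\<lambda>x. \<bar>f x\<bar>) summable_on A \<longleftrightarrow> f summable_on A"
  using summable_on_iff_abs_summable_on_real[of f A] by simp

lemma double_infsum_real:
  fixes a :: "'i \<Rightarrow> 'j \<Rightarrow> real"
  assumes 1: "\<And>t. t \<in> A \<Longrightarrow> a t summable_on B"
    and 2: "(\<lambda>t. \<Sum>\<^sub>\<infinity>s\<in>B. \<bar>a t s\<bar>) summable_on A"
  shows "(\<Sum>\<^sub>\<infinity>t\<in>A. \<Sum>\<^sub>\<infinity>s\<in>B. a t s) = (\<Sum>\<^sub>\<infinity>s\<in>B. \<Sum>\<^sub>\<infinity>t\<in>A. a t s)"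
    and "\<And>s. s \<in> B \<Longrightarrow> (\<lambda>t. a t s) summable_on A"
    and "(\<lambda>s. \<Sum>\<^sub>\<infinity>t\<in>A. \<bar>a t s\<bar>) summable_on B"
proof -
  have abs2: "(\<lambda>t. norm (\<Sum>\<^sub>\<infinity>s\<in>B. \<bar>a t s\<bar>)) summable_on A"
    using 2 by (simp add: real_abs_summable_iff)
  have "(\<lambda>s. norm (a t s)) summable_on B" if "t \<in> A" for t
    using 1[OF that] summable_on_iff_abs_summable_on_real by blast
  then have abs: "(\<lambda>p. norm (case p of (t, s) \<Rightarrow> a t s)) summable_on (A \<times> B)"
    unfolding Infinite_Sum.abs_summable_on_Sigma_iff using abs2 by simp
  then have "(\<lambda>(t, s). a t s) summable_on (A \<times> B)" by (rule abs_summable_summable)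
  then show "(\<Sum>\<^sub>\<infinity>t\<in>A. \<Sum>\<^sub>\<infinity>s\<in>B. a t s) = (\<Sum>\<^sub>\<infinity>s\<in>B. \<Sum>\<^sub>\<infinity>t\<in>A. a t s)"
    by (rule infsum_swap_banach)
  have "bij_betw (\<lambda>p. (snd p, fst p)) (B \<times> A) (A \<times> B)"
    by (rule bij_betwI[where g = "\<lambda>p. (snd p, fst p)"]) auto
  from summable_on_reindex_bij_betw[OF this, of "\<lambda>x. norm (case x of (t, s) \<Rightarrow> a t s)"] abs
  have "(\<lambda>p. norm (case p of (s, t) \<Rightarrow> a t s)) summable_on (B \<times> A)" by (simp add: split_beta)
  then have sw: "(\<forall>s\<in>B. (\<lambda>t. norm (a t s)) summable_on A) \<and> (\<lambda>s. norm (\<Sum>\<^sub>\<infinity>t\<in>A. norm (a t s))) summable_on B"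
    unfolding Infinite_Sum.abs_summable_on_Sigma_iff by simp
  then show "\<And>s. s \<in> B \<Longrightarrow> (\<lambda>t. a t s) summable_on A" by (auto intro: abs_summable_summable)
  show "(\<lambda>s. \<Sum>\<^sub>\<infinity>t\<in>A. \<bar>a t s\<bar>) summable_on B" using sw by (simp add: real_abs_summable_iff)
qed

lemma abs_infsum_le:
  fixes f :: "'i \<Rightarrow> real"
  assumes "f summable_on A"
  shows "\<bar>infsum f A\<bar> \<le> (\<Sum>\<^sub>\<infinity>x\<in>A. \<bar>f x\<bar>)"
  using norm_infsum_bound[of f A] assms summable_on_iff_abs_summable_on_real[of f A] by simp

locale discrete_group = group \<Gamma> for \<Gamma> :: "'g monoid" (structure)
begin

abbreviation G where "G \<equiv> carrier \<Gamma>"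
abbreviation L1 where "L1 \<equiv> carrier (l1_ring \<Gamma>)"
abbreviation conv where "conv f h \<equiv> f \<otimes>\<^bsub>l1_ring \<Gamma>\<^esub> h"
abbreviation unit1 :: "'g \<Rightarrow> real" where "unit1 \<equiv> \<one>\<^bsub>l1_ring \<Gamma>\<^esub>"

definition pairing :: "('g \<Rightarrow> real) \<Rightarrow> ('g \<Rightarrow> real) \<Rightarrow> real" where
  "pairing f y = (\<Sum>\<^sub>\<infinity>s\<in>G. f s * y s)"

definition l1_norm :: "('g \<Rightarrow> real) \<Rightarrow> real" where
  "l1_norm f = (\<Sum>\<^sub>\<infinity>s\<in>G. \<bar>f s\<bar>)"

definition bdd :: "('g \<Rightarrow> real) \<Rightarrow> bool" where
  "bdd y \<longleftrightarrow> (\<exists>K\<ge>0. \<forall>s\<in>G. \<bar>y s\<bar> \<le> K)"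

lemma L1_iff: "f \<in> L1 \<longleftrightarrow> f summable_on G \<and> (\<forall>s. s \<notin> G \<longrightarrow> f s = 0)"
  by (auto simp: l1_ring_def real_abs_summable_iff)

lemma L1_summable: "f \<in> L1 \<Longrightarrow> f summable_on G" by (simp add: L1_iff)
lemma L1_abs_summable: "f \<in> L1 \<Longrightarrow> (\<lambda>s. \<bar>f s\<bar>) summable_on G" by (simp add: L1_iff real_abs_summable_iff)
lemma L1_outside: "f \<in> L1 \<Longrightarrow> s \<notin> G \<Longrightarrow> f s = 0" by (simp add: L1_iff)

lemma L1_eqI: "f \<in> L1 \<Longrightarrow> h \<in> L1 \<Longrightarrow> (\<And>s. s \<in> G \<Longrightarrow> f s = h s) \<Longrightarrow> f = h"
  by (rule ext) (metis L1_outside)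

lemma L1_add: "f \<in> L1 \<Longrightarrow> h \<in> L1 \<Longrightarrow> (\<lambda>s. f s + h s) \<in> L1"
  by (auto simp: L1_iff intro: summable_on_add)
lemma L1_scale: "f \<in> L1 \<Longrightarrow> (\<lambda>s. c * f s) \<in> L1"
  by (auto simp: L1_iff intro: summable_on_cmult_right)
lemma L1_zero: "(\<lambda>s. 0) \<in> L1" by (simp add: L1_iff)
lemma L1_diff: "f \<in> L1 \<Longrightarrow> h \<in> L1 \<Longrightarrow> (\<lambda>s. f s - h s) \<in> L1"
  using L1_add[of f "\<lambda>s. (-1) * h s"] L1_scale[of h "-1"] by simp
lemma L1_sum: "(\<And>i. i \<in> I \<Longrightarrow> f i \<in> L1) \<Longrightarrow> (\<lambda>s. \<Sum>i\<in>I. f i s) \<in> L1"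
  by (induction I rule: infinite_finite_induct) (auto simp: L1_zero intro: L1_add)

lemma L1_finite_support:
  assumes "finite {s. f s \<noteq> 0}" "{s. f s \<noteq> 0} \<subseteq> G"
  shows "f \<in> L1"
proof -
  have "f summable_on {s. f s \<noteq> 0}" using assms(1) by simp
  then have "f summable_on G" by (rule summable_on_cong_neutral[THEN iffD1, rotated -1]) (use assms(2) in auto)
  then show ?thesis using assms by (auto simp: L1_iff)
qed

lemma infsum_finite_support:
  fixes f :: "'g \<Rightarrow> real"
  assumes "finite S" "S \<subseteq> G" "\<And>s. s \<in> G - S \<Longrightarrow> f s = 0"
  shows "infsum f G = sum f S"
  using infsum_cong_neutral[of S G f f] assms by auto

lemma one_L1: "unit1 \<in> L1"
  by (rule L1_finite_support) (auto simp: l1_ring_def)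

lemma bddI: "(\<And>s. s \<in> G \<Longrightarrow> \<bar>y s\<bar> \<le> K) \<Longrightarrow> bdd y"
  unfolding bdd_def by (metis abs_ge_zero one_closed order.trans)

lemma bdd_L1: "f \<in> L1 \<Longrightarrow> bdd f"
proof (rule bddI)
  fix s assume f: "f \<in> L1" and s: "s \<in> G"
  have "(\<Sum>\<^sub>\<infinity>s\<in>{s}. \<bar>f s\<bar>) \<le> (\<Sum>\<^sub>\<infinity>s\<in>G. \<bar>f s\<bar>)"
    using L1_abs_summable[OF f] s by (intro infsum_mono_neutral) auto
  then show "\<bar>f s\<bar> \<le> l1_norm f" by (simp add: l1_norm_def)
qed

lemma bdd_reindex: "bdd y \<Longrightarrow> (\<And>s. s \<in> G \<Longrightarrow> p s \<in> G) \<Longrightarrow> bdd (\<lambda>s. y (p s))"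
  unfolding bdd_def by blast

lemma bdd_const: "bdd (\<lambda>s. c)" by (rule bddI[of _ "\<bar>c\<bar>"]) simp
lemma bdd_add: "bdd y \<Longrightarrow> bdd z \<Longrightarrow> bdd (\<lambda>s. y s + z s)"
  unfolding bdd_def by (metis abs_triangle_ineq add_mono add_nonneg_nonneg order.trans)
lemma bdd_sum: "(\<And>i. i \<in> I \<Longrightarrow> bdd (y i)) \<Longrightarrow> bdd (\<lambda>s. \<Sum>i\<in>I. y i s)"
  by (induction I rule: infinite_finite_induct) (auto intro: bdd_add bdd_const)

lemma pairing_summable:
  assumes f: "f \<in> L1" and y: "bdd y"
  shows "(\<lambda>s. f s * y s) summable_on G"
proof -
  obtain K where K: "K \<ge> 0" "\<And>s. s \<in> G \<Longrightarrow> \<bar>y s\<bar> \<le> K" using y by (auto simp: bdd_def)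
  have "(\<lambda>s. norm (K * f s)) summable_on G"
    using L1_summable[OF L1_scale[OF f, of K]] unfolding real_norm_def real_abs_summable_iff .
  then have "(\<lambda>s. norm (f s * y s)) summable_on G"
  proof (rule Infinite_Sum.abs_summable_on_comparison_test)
    show "norm (f s * y s) \<le> norm (K * f s)" if "s \<in> G" for s
      using mult_left_mono[OF K(2)[OF that], of "\<bar>f s\<bar>"] K(1) by (simp add: abs_mult mult.commute)
  qed
  then show ?thesis by (rule abs_summable_summable)
qed

lemma pairing_bound:
  assumes f: "f \<in> L1" and y: "\<And>s. s \<in> G \<Longrightarrow> \<bar>y s\<bar> \<le> K"
  shows "\<bar>pairing f y\<bar> \<le> K * l1_norm f"
proof -
  have s: "(\<lambda>s. f s * y s) summable_on G" by (rule pairing_summable[OF f bddI[OF y]])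
  have "\<bar>pairing f y\<bar> \<le> (\<Sum>\<^sub>\<infinity>s\<in>G. \<bar>f s * y s\<bar>)"
    unfolding pairing_def by (rule abs_infsum_le[OF s])
  also have "\<dots> \<le> (\<Sum>\<^sub>\<infinity>s\<in>G. K * \<bar>f s\<bar>)"
  proof (rule infsum_mono)
    show "(\<lambda>s. \<bar>f s * y s\<bar>) summable_on G" using s by (simp add: real_abs_summable_iff)
    show "(\<lambda>s. K * \<bar>f s\<bar>) summable_on G" by (rule summable_on_cmult_right[OF L1_abs_summable[OF f]])
    show "\<bar>f s * y s\<bar> \<le> K * \<bar>f s\<bar>" if "s \<in> G" for s
      using mult_left_mono[OF y[OF that], of "\<bar>f s\<bar>"] by (simp add: abs_mult mult.commute)
  qed
  also have "\<dots> = K * l1_norm f" by (simp add: l1_norm_def infsum_cmult_right')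
  finally show ?thesis .
qed

lemma pairing_add_left: "f \<in> L1 \<Longrightarrow> h \<in> L1 \<Longrightarrow> bdd y \<Longrightarrow> pairing (\<lambda>s. f s + h s) y = pairing f y + pairing h y"
  by (simp add: pairing_def distrib_right infsum_add pairing_summable)

lemma pairing_add_right: "f \<in> L1 \<Longrightarrow> bdd y \<Longrightarrow> bdd z \<Longrightarrow> pairing f (\<lambda>s. y s + z s) = pairing f y + pairing f z"
  by (simp add: pairing_def distrib_left infsum_add pairing_summable)

text \<open>Holds without summability: a nonzero factor does not change it, and
  \<open>infsum\<close> is \<open>0\<close> on families that are not summable.\<close>

lemma pairing_scale_left: "pairing (\<lambda>s. c * f s) y = c * pairing f y"
  by (simp add: pairing_def mult.assoc infsum_cmult_right')

lemma pairing_scale_right: "pairing f (\<lambda>s. c * y s) = c * pairing f y"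
  by (simp add: pairing_def mult.left_commute infsum_cmult_right')

lemma pairing_zero: "pairing (\<lambda>s. 0) y = 0" "pairing f (\<lambda>s. 0) = 0"
  by (simp_all add: pairing_def)

lemma pairing_sum_left:
  "finite I \<Longrightarrow> (\<And>i. i \<in> I \<Longrightarrow> f i \<in> L1) \<Longrightarrow> bdd y \<Longrightarrow> pairing (\<lambda>s. \<Sum>i\<in>I. f i s) y = (\<Sum>i\<in>I. pairing (f i) y)"
  by (induction I rule: finite_induct) (auto simp: pairing_zero pairing_add_left L1_sum)

lemma pairing_sum_right:
  "finite I \<Longrightarrow> f \<in> L1 \<Longrightarrow> (\<And>i. i \<in> I \<Longrightarrow> bdd (y i)) \<Longrightarrow> pairing f (\<lambda>s. \<Sum>i\<in>I. y i s) = (\<Sum>i\<in>I. pairing f (y i))"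
  by (induction I rule: finite_induct) (auto simp: pairing_zero pairing_add_right bdd_sum)

lemma pairing_cong: "(\<And>s. s \<in> G \<Longrightarrow> f s * y s = h s * z s) \<Longrightarrow> pairing f y = pairing h z"
  unfolding pairing_def by (rule infsum_cong)

lemma pairing_one: "pairing unit1 y = y \<one>"
proof -
  have "pairing unit1 y = (\<Sum>s\<in>{\<one>}. unit1 s * y s)"
    unfolding pairing_def by (rule infsum_finite_support) (auto simp: l1_ring_def)
  then show ?thesis by (simp add: l1_ring_def)
qed

lemma conv_apply: "s \<in> G \<Longrightarrow> conv f h s = pairing f (\<lambda>t. h (inv t \<otimes> s))"
  by (simp add: l1_ring_def pairing_def)

lemma conv_outside: "s \<notin> G \<Longrightarrow> conv f h s = 0"
  by (simp add: l1_ring_def)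

lemma bij_left: "t \<in> G \<Longrightarrow> bij_betw (\<lambda>s. t \<otimes> s) G G"
  by (rule bij_betwI[where g = "\<lambda>s. inv t \<otimes> s"]) (auto simp: m_assoc[symmetric])

lemma bij_reflect: "s \<in> G \<Longrightarrow> bij_betw (\<lambda>r. s \<otimes> inv r) G G"
  by (rule bij_betwI[where g = "\<lambda>t. inv t \<otimes> s"]) (auto simp: inv_mult_group m_assoc, simp add: m_assoc[symmetric])

text \<open>Convolution is the adjoint of translation; associativity and all further rules for
  products in \<open>\<ell>\<^sup>1(\<Gamma>)\<close> come out of this single interchange of summations.\<close>

lemma conv_pairing:
  assumes f: "f \<in> L1" and h: "h \<in> L1"
  shows "conv f h \<in> L1"
    and "\<And>y. bdd y \<Longrightarrow> pairing (conv f h) y = pairing f (\<lambda>t. pairing h (\<lambda>r. y (t \<otimes> r)))"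
proof -
  have re: "(\<Sum>\<^sub>\<infinity>s\<in>G. h' (inv t \<otimes> s) * y s) = pairing h' (\<lambda>r. y (t \<otimes> r))" if "t \<in> G" for t y h'
  proof -
    have "(\<Sum>\<^sub>\<infinity>s\<in>G. h' (inv t \<otimes> s) * y s) = (\<Sum>\<^sub>\<infinity>r\<in>G. h' (inv t \<otimes> (t \<otimes> r)) * y (t \<otimes> r))"
      by (rule infsum_reindex_bij_betw[OF bij_left[OF that], symmetric])
    also have "\<dots> = pairing h' (\<lambda>r. y (t \<otimes> r))"
      unfolding pairing_def using that by (intro infsum_cong) (simp add: m_assoc[symmetric])
    finally show ?thesis .
  qed
  have row: "(\<lambda>s. f t * h (inv t \<otimes> s) * y s) summable_on G" if t: "t \<in> G" and y: "bdd y" for t y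
  proof -
    have "(\<lambda>r. h (inv t \<otimes> (t \<otimes> r)) * y (t \<otimes> r)) summable_on G"
      using pairing_summable[OF h bdd_reindex[OF y, of "\<lambda>r. t \<otimes> r"]] t
      by (simp add: m_assoc[symmetric] cong: summable_on_cong)
    then have "(\<lambda>s. h (inv t \<otimes> s) * y s) summable_on G"
      using summable_on_reindex_bij_betw[OF bij_left[OF t], of "\<lambda>s. h (inv t \<otimes> s) * y s"] by simp
    from summable_on_cmult_right[OF this, of "f t"] show ?thesis by (simp add: mult.assoc)
  qed
  have col: "(\<lambda>t. \<Sum>\<^sub>\<infinity>s\<in>G. \<bar>f t * h (inv t \<otimes> s) * y s\<bar>) summable_on G" if y: "bdd y" for y
  proof -
    have h': "(\<lambda>s. \<bar>h s\<bar>) \<in> L1" and f': "(\<lambda>s. \<bar>f s\<bar>) \<in> L1" using f h by (auto simp: L1_iff real_abs_summable_iff)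
    obtain K where K: "\<And>s. s \<in> G \<Longrightarrow> \<bar>\<bar>y s\<bar>\<bar> \<le> K" using y by (auto simp: bdd_def)
    have "\<bar>pairing (\<lambda>s. \<bar>h s\<bar>) (\<lambda>r. \<bar>y (t \<otimes> r)\<bar>)\<bar> \<le> K * l1_norm (\<lambda>s. \<bar>h s\<bar>)" if "t \<in> G" for t
      using K that by (intro pairing_bound[OF h']) auto
    then have "bdd (\<lambda>t. pairing (\<lambda>s. \<bar>h s\<bar>) (\<lambda>r. \<bar>y (t \<otimes> r)\<bar>))" by (rule bddI)
    from pairing_summable[OF f' this]
    have "(\<lambda>t. \<bar>f t\<bar> * (\<Sum>\<^sub>\<infinity>s\<in>G. \<bar>h (inv t \<otimes> s)\<bar> * \<bar>y s\<bar>)) summable_on G"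
      by (rule summable_on_cong[THEN iffD1, rotated]) (simp add: re[of _ "\<lambda>s. \<bar>h s\<bar>" "\<lambda>s. \<bar>y s\<bar>"])
    then show ?thesis
      by (simp add: abs_mult mult.assoc infsum_cmult_right')
  qed
  have D: "(\<Sum>\<^sub>\<infinity>t\<in>G. \<Sum>\<^sub>\<infinity>s\<in>G. f t * h (inv t \<otimes> s) * y s) = (\<Sum>\<^sub>\<infinity>s\<in>G. \<Sum>\<^sub>\<infinity>t\<in>G. f t * h (inv t \<otimes> s) * y s)"
    "(\<lambda>s. \<Sum>\<^sub>\<infinity>t\<in>G. \<bar>f t * h (inv t \<otimes> s) * y s\<bar>) summable_on G" 
    "\<And>s. s \<in> G \<Longrightarrow> (\<lambda>t. f t * h (inv t \<otimes> s) * y s) summable_on G" if y: "bdd y" for y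
    using double_infsum_real[of G "\<lambda>t s. f t * h (inv t \<otimes> s) * y s" G, OF row[OF _ y] col[OF y]] by blast+
  \<comment> \<open>The test function \<open>1\<close> gives the absolute summability of the
    convolution itself.\<close>
  have "(\<lambda>s. \<Sum>\<^sub>\<infinity>t\<in>G. \<bar>f t * h (inv t \<otimes> s)\<bar>) summable_on G" using D(2)[OF bdd_const[of 1]] by simp
  then have "(\<lambda>s. norm (conv f h s)) summable_on G"
  proof (rule Infinite_Sum.abs_summable_on_comparison_test')
    fix s assume s: "s \<in> G"
    show "norm (conv f h s) \<le> (\<Sum>\<^sub>\<infinity>t\<in>G. \<bar>f t * h (inv t \<otimes> s)\<bar>)"
      unfolding conv_apply[OF s] pairing_def real_norm_def
      using D(3)[OF bdd_const[of 1] s] by (intro abs_infsum_le) simp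
  qed
  then show "conv f h \<in> L1" by (simp add: L1_iff conv_outside real_abs_summable_iff)
  fix y assume y: "bdd y"
  have "pairing (conv f h) y = (\<Sum>\<^sub>\<infinity>s\<in>G. \<Sum>\<^sub>\<infinity>t\<in>G. f t * h (inv t \<otimes> s) * y s)"
    unfolding pairing_def[of "conv f h"]
    by (intro infsum_cong) (simp add: conv_apply pairing_def infsum_cmult_left')
  also have "\<dots> = (\<Sum>\<^sub>\<infinity>t\<in>G. f t * (\<Sum>\<^sub>\<infinity>s\<in>G. h (inv t \<otimes> s) * y s))"
    unfolding D(1)[OF y, symmetric] by (simp add: mult.assoc infsum_cmult_right')
  also have "\<dots> = pairing f (\<lambda>t. pairing h (\<lambda>r. y (t \<otimes> r)))"
    unfolding pairing_def[of f] by (intro infsum_cong) (simp add: re)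
  finally show "pairing (conv f h) y = pairing f (\<lambda>t. pairing h (\<lambda>r. y (t \<otimes> r)))" .
qed

lemmas conv_L1 = conv_pairing(1)

lemma conv_assoc:
  assumes f: "f \<in> L1" and g: "g \<in> L1" and h: "h \<in> L1"
  shows "conv (conv f g) h = conv f (conv g h)"
proof (rule L1_eqI)
  fix s assume s: "s \<in> G"
  have b: "bdd (\<lambda>u. h (inv u \<otimes> s))" by (rule bdd_reindex[OF bdd_L1[OF h]]) (use s in simp)
  have "conv (conv f g) h s = pairing f (\<lambda>t. pairing g (\<lambda>r. h (inv (t \<otimes> r) \<otimes> s)))"
    unfolding conv_apply[OF s] by (rule conv_pairing(2)[OF f g b])
  also have "\<dots> = pairing f (\<lambda>t. conv g h (inv t \<otimes> s))"
    using s by (intro pairing_cong) (simp add: conv_apply inv_mult_group m_assoc cong: pairing_cong)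
  finally show "conv (conv f g) h s = conv f (conv g h) s" by (simp add: conv_apply[OF s])
qed (auto intro!: conv_L1 f g h)

text \<open>Places the right factor in the first argument of the pairing, so that sums, series and
  scalars in the right factor are treated by the same rules as in the left one.\<close>

lemma conv_reflect:
  assumes "s \<in> G"
  shows "conv f h s = pairing h (\<lambda>r. f (s \<otimes> inv r))"
proof -
  have "conv f h s = (\<Sum>\<^sub>\<infinity>r\<in>G. f (s \<otimes> inv r) * h (inv (s \<otimes> inv r) \<otimes> s))"
    unfolding conv_apply[OF assms] pairing_def
    by (rule infsum_reindex_bij_betw[OF bij_reflect[OF assms], symmetric])
  also have "\<dots> = pairing h (\<lambda>r. f (s \<otimes> inv r))"
    unfolding pairing_def using assms
    by (intro infsum_cong) (simp add: inv_mult_group m_assoc mult.commute)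
  finally show ?thesis .
qed

lemma bdd_conv_arg: "f \<in> L1 \<Longrightarrow> s \<in> G \<Longrightarrow> bdd (\<lambda>r. f (s \<otimes> inv r))"
  "f \<in> L1 \<Longrightarrow> s \<in> G \<Longrightarrow> bdd (\<lambda>t. f (inv t \<otimes> s))"
  by (rule bdd_reindex[OF bdd_L1]; simp)+

lemma conv_sum_left:
  assumes "finite I" "\<And>i. i \<in> I \<Longrightarrow> f i \<in> L1" "h \<in> L1"
  shows "conv (\<lambda>s. \<Sum>i\<in>I. f i s) h = (\<lambda>s. \<Sum>i\<in>I. conv (f i) h s)"
proof (rule L1_eqI)
  show "conv (\<lambda>s. \<Sum>i\<in>I. f i s) h s = (\<Sum>i\<in>I. conv (f i) h s)" if "s \<in> G" for s
    using assms bdd_conv_arg(2)[OF assms(3) that] that by (simp add: conv_apply pairing_sum_left)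
qed (auto intro!: conv_L1 L1_sum assms)

lemma conv_sum_right:
  assumes "finite I" "\<And>i. i \<in> I \<Longrightarrow> h i \<in> L1" "f \<in> L1"
  shows "conv f (\<lambda>s. \<Sum>i\<in>I. h i s) = (\<lambda>s. \<Sum>i\<in>I. conv f (h i) s)"
proof (rule L1_eqI)
  show "conv f (\<lambda>s. \<Sum>i\<in>I. h i s) s = (\<Sum>i\<in>I. conv f (h i) s)" if "s \<in> G" for s
    using assms bdd_conv_arg(1)[OF assms(3) that] that by (simp add: conv_reflect pairing_sum_left)
qed (auto intro!: conv_L1 L1_sum assms)

lemma conv_scale_left: "conv (\<lambda>s. c * f s) h = (\<lambda>s. c * conv f h s)"
proof
  show "conv (\<lambda>s. c * f s) h s = c * conv f h s" for s
    by (cases "s \<in> G") (simp_all add: conv_apply conv_outside pairing_scale_left)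
qed

lemma conv_scale_right: "conv f (\<lambda>s. c * h s) = (\<lambda>s. c * conv f h s)"
proof
  show "conv f (\<lambda>s. c * h s) s = c * conv f h s" for s
    by (cases "s \<in> G") (simp_all add: conv_apply conv_outside pairing_scale_right)
qed

lemma conv_add_left: "f \<in> L1 \<Longrightarrow> g \<in> L1 \<Longrightarrow> h \<in> L1 \<Longrightarrow> conv (\<lambda>s. f s + g s) h = (\<lambda>s. conv f h s + conv g h s)"
  using conv_sum_left[of "{True, False}" "\<lambda>b. if b then f else g" h] by (simp split: if_splits)

lemma conv_add_right: "f \<in> L1 \<Longrightarrow> g \<in> L1 \<Longrightarrow> h \<in> L1 \<Longrightarrow> conv f (\<lambda>s. g s + h s) = (\<lambda>s. conv f g s + conv f h s)"
  using conv_sum_right[of "{True, False}" "\<lambda>b. if b then g else h" f] by (simp split: if_splits)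

lemma conv_one_left: "h \<in> L1 \<Longrightarrow> conv unit1 h = h"
  by (rule L1_eqI) (auto simp: conv_apply pairing_one intro: conv_L1 one_L1)

lemma conv_one_right: "h \<in> L1 \<Longrightarrow> conv h unit1 = h"
  by (rule L1_eqI) (auto simp: conv_reflect pairing_one intro: conv_L1 one_L1)

lemma conv_zero: "conv (\<lambda>s. 0) h = (\<lambda>s. 0)" "conv f (\<lambda>s. 0) = (\<lambda>s. 0)"
proof -
  show "conv (\<lambda>s. 0) h = (\<lambda>s. 0)"
    using conv_scale_left[of 0 "\<lambda>s. 0" h] by simp
  show "conv f (\<lambda>s. 0) = (\<lambda>s. 0)"
    using conv_scale_right[of f 0 "\<lambda>s. 0"] by simp
qed

section \<open>Norm estimates and series in l1\<close>

lemma l1_norm_nonneg: "0 \<le> l1_norm f" unfolding l1_norm_def by (intro infsum_nonneg) simp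

text \<open>For nonnegative functions the norm is the pairing with the constant \<open>1\<close>,
  and \<open>conv_pairing\<close> shows that it is then multiplicative.\<close>

lemma l1_norm_conv:
  assumes f: "f \<in> L1" and h: "h \<in> L1"
  shows "l1_norm (conv f h) \<le> l1_norm f * l1_norm h"
proof -
  have h': "(\<lambda>s. \<bar>h s\<bar>) \<in> L1" and f': "(\<lambda>s. \<bar>f s\<bar>) \<in> L1" using f h by (auto simp: L1_iff real_abs_summable_iff)
  have "l1_norm (conv f h) \<le> pairing (conv (\<lambda>s. \<bar>f s\<bar>) (\<lambda>s. \<bar>h s\<bar>)) (\<lambda>s. 1)"
    unfolding l1_norm_def pairing_def[of "conv (\<lambda>s. \<bar>f s\<bar>) _"] mult_1_right
  proof (rule infsum_mono[OF L1_abs_summable[OF conv_L1[OF f h]] L1_summable[OF conv_L1[OF f' h']]])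
    fix s assume s: "s \<in> G"
    have "\<bar>conv f h s\<bar> \<le> (\<Sum>\<^sub>\<infinity>t\<in>G. \<bar>f t * h (inv t \<otimes> s)\<bar>)"
      unfolding conv_apply[OF s] pairing_def
      by (rule abs_infsum_le[OF pairing_summable[OF f bdd_conv_arg(2)[OF h s]]])
    then show "\<bar>conv f h s\<bar> \<le> conv (\<lambda>s. \<bar>f s\<bar>) (\<lambda>s. \<bar>h s\<bar>) s"
      by (simp add: conv_apply[OF s] pairing_def abs_mult)
  qed
  also have "\<dots> = l1_norm f * l1_norm h"
    by (subst conv_pairing(2)[OF f' h' bdd_const])
       (simp add: pairing_def l1_norm_def infsum_cmult_left')
  finally show ?thesis .
qed

lemma l1_norm_add: "f \<in> L1 \<Longrightarrow> h \<in> L1 \<Longrightarrow> l1_norm (\<lambda>s. f s + h s) \<le> l1_norm f + l1_norm h"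
  unfolding l1_norm_def
  by (subst infsum_add[symmetric])
     (auto intro!: infsum_mono L1_abs_summable L1_add summable_on_add abs_triangle_ineq)

lemma l1_norm_scale: "l1_norm (\<lambda>s. c * f s) = \<bar>c\<bar> * l1_norm f"
  by (simp add: l1_norm_def abs_mult infsum_cmult_right')

lemma l1_norm_zero: "l1_norm (\<lambda>s. 0) = 0" by (simp add: l1_norm_def)

lemma l1_norm_sum:
  "finite I \<Longrightarrow> (\<And>i. i \<in> I \<Longrightarrow> f i \<in> L1) \<Longrightarrow> l1_norm (\<lambda>s. \<Sum>i\<in>I. f i s) \<le> (\<Sum>i\<in>I. l1_norm (f i))"
proof (induction I rule: finite_induct)
  case (insert i I)
  have "l1_norm (\<lambda>s. f i s + (\<Sum>i\<in>I. f i s)) \<le> l1_norm (f i) + l1_norm (\<lambda>s. \<Sum>i\<in>I. f i s)"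
    by (intro l1_norm_add L1_sum) (use insert in auto)
  then show ?case using insert by simp
qed (simp add: l1_norm_zero)

lemma l1_norm_one: "l1_norm unit1 = 1"
proof -
  have "l1_norm unit1 = (\<Sum>s\<in>{\<one>}. \<bar>unit1 s\<bar>)"
    unfolding l1_norm_def by (rule infsum_finite_support) (auto simp: l1_ring_def)
  then show ?thesis by (simp add: l1_ring_def)
qed

text \<open>The sum is taken pointwise. Summability of the norms permits exchanging it with the sum
  over the group, so pairings with bounded functions, and with them convolutions, are computed term
  by term.\<close>

lemma L1_series:
  fixes f :: "nat \<Rightarrow> 'g \<Rightarrow> real"
  assumes f: "\<And>n. f n \<in> L1" and sm: "(\<lambda>n. l1_norm (f n)) summable_on UNIV"
  shows "(\<lambda>s. \<Sum>\<^sub>\<infinity>n. f n s) \<in> L1"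
    and "\<And>s. (\<lambda>n. f n s) summable_on UNIV"
    and "\<And>y. bdd y \<Longrightarrow> pairing (\<lambda>s. \<Sum>\<^sub>\<infinity>n. f n s) y = (\<Sum>\<^sub>\<infinity>n. pairing (f n) y)"
proof -
  have sm_y: "(\<lambda>n. \<Sum>\<^sub>\<infinity>s\<in>G. \<bar>f n s * y s\<bar>) summable_on UNIV" if y: "bdd y" for y
  proof -
    obtain K where K: "K \<ge> 0" "\<And>s. s \<in> G \<Longrightarrow> \<bar>y s\<bar> \<le> K" using y by (auto simp: bdd_def)
    have "(\<lambda>n. norm (\<Sum>\<^sub>\<infinity>s\<in>G. \<bar>f n s * y s\<bar>)) summable_on UNIV"
    proof (rule Infinite_Sum.abs_summable_on_comparison_test')
      show "(\<lambda>n. K * l1_norm (f n)) summable_on UNIV" by (rule summable_on_cmult_right[OF sm])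
      fix n
      have f': "(\<lambda>s. \<bar>f n s\<bar>) \<in> L1" using f by (auto simp: L1_iff real_abs_summable_iff)
      have "\<bar>pairing (\<lambda>s. \<bar>f n s\<bar>) (\<lambda>s. \<bar>y s\<bar>)\<bar> \<le> K * l1_norm (\<lambda>s. \<bar>f n s\<bar>)"
        using K by (intro pairing_bound[OF f']) auto
      then show "norm (\<Sum>\<^sub>\<infinity>s\<in>G. \<bar>f n s * y s\<bar>) \<le> K * l1_norm (f n)"
        by (simp add: pairing_def l1_norm_def abs_mult)
    qed
    then show ?thesis by (rule abs_summable_summable)
  qed
  note D = double_infsum_real[of UNIV "\<lambda>n s. f n s * y s" G for y, OF pairing_summable[OF f] sm_y]
  show fs: "(\<lambda>n. f n s) summable_on UNIV" for s
    using D(2)[OF bdd_const[of 1] bdd_const[of 1], of s] by (cases "s \<in> G") (simp_all add: L1_outside[OF f])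
  have "(\<lambda>s. \<Sum>\<^sub>\<infinity>n. \<bar>f n s\<bar>) summable_on G"
    using D(3)[OF bdd_const[of 1] bdd_const[of 1]] by simp
  then have "(\<lambda>s. norm (\<Sum>\<^sub>\<infinity>n. f n s)) summable_on G"
    by (rule Infinite_Sum.abs_summable_on_comparison_test') (use abs_infsum_le[OF fs] in auto)
  then show "(\<lambda>s. \<Sum>\<^sub>\<infinity>n. f n s) \<in> L1"
    by (simp add: L1_iff L1_outside[OF f] real_abs_summable_iff)
  fix y assume y: "bdd y"
  show "pairing (\<lambda>s. \<Sum>\<^sub>\<infinity>n. f n s) y = (\<Sum>\<^sub>\<infinity>n. pairing (f n) y)"
    using D(1)[OF y y] by (simp add: pairing_def infsum_cmult_left')
qed

lemma conv_series:
  fixes f :: "nat \<Rightarrow> 'g \<Rightarrow> real"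
  assumes f: "\<And>n. f n \<in> L1" and sm: "(\<lambda>n. l1_norm (f n)) summable_on UNIV" and h: "h \<in> L1"
  shows "conv (\<lambda>s. \<Sum>\<^sub>\<infinity>n. f n s) h s = (\<Sum>\<^sub>\<infinity>n. conv (f n) h s)"
    and "conv h (\<lambda>s. \<Sum>\<^sub>\<infinity>n. f n s) s = (\<Sum>\<^sub>\<infinity>n. conv h (f n) s)"
proof -
  show "conv (\<lambda>s. \<Sum>\<^sub>\<infinity>n. f n s) h s = (\<Sum>\<^sub>\<infinity>n. conv (f n) h s)"
    by (cases "s \<in> G") (simp_all add: conv_outside conv_apply L1_series(3)[OF f sm bdd_conv_arg(2)[OF h]])
  show "conv h (\<lambda>s. \<Sum>\<^sub>\<infinity>n. f n s) s = (\<Sum>\<^sub>\<infinity>n. conv h (f n) s)"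
    by (cases "s \<in> G") (simp_all add: conv_outside conv_reflect L1_series(3)[OF f sm bdd_conv_arg(1)[OF h]])
qed

section \<open>Matrices over l1 and the Neumann series\<close>

definition mat_mult :: "nat \<Rightarrow> (nat \<Rightarrow> nat \<Rightarrow> 'g \<Rightarrow> real) \<Rightarrow> (nat \<Rightarrow> nat \<Rightarrow> 'g \<Rightarrow> real) \<Rightarrow> nat \<Rightarrow> nat \<Rightarrow> 'g \<Rightarrow> real"
  where "mat_mult k A B i j = (\<lambda>s. \<Sum>l<k. conv (A i l) (B l j) s)"

definition mat_one :: "nat \<Rightarrow> nat \<Rightarrow> 'g \<Rightarrow> real" where
  "mat_one i j = (if i = j then unit1 else (\<lambda>s. 0))"

definition mat_L1 :: "nat \<Rightarrow> (nat \<Rightarrow> nat \<Rightarrow> 'g \<Rightarrow> real) \<Rightarrow> bool" where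
  "mat_L1 k A \<longleftrightarrow> (\<forall>i<k. \<forall>j<k. A i j \<in> L1)"

lemma mat_L1D: "mat_L1 k A \<Longrightarrow> i < k \<Longrightarrow> j < k \<Longrightarrow> A i j \<in> L1" by (simp add: mat_L1_def)

lemma mat_L1_mult: "mat_L1 k A \<Longrightarrow> mat_L1 k B \<Longrightarrow> mat_L1 k (mat_mult k A B)"
  by (auto simp: mat_L1_def mat_mult_def intro!: L1_sum conv_L1)

lemma mat_L1_one: "mat_L1 k mat_one" by (auto simp: mat_L1_def mat_one_def one_L1 L1_zero)

lemma mat_mult_assoc:
  assumes A: "mat_L1 k A" and B: "mat_L1 k B" and C: "mat_L1 k C" and ij: "i < k" "j < k"
  shows "mat_mult k (mat_mult k A B) C i j = mat_mult k A (mat_mult k B C) i j"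
proof -
  have "mat_mult k (mat_mult k A B) C i j = (\<lambda>s. \<Sum>l<k. \<Sum>r<k. conv (conv (A i r) (B r l)) (C l j) s)"
    unfolding mat_mult_def using ij
    by (intro ext sum.cong refl fun_cong[OF conv_sum_left])
       (auto intro!: conv_L1 mat_L1D[OF A] mat_L1D[OF B] mat_L1D[OF C])
  also have "(\<lambda>s. \<Sum>l<k. \<Sum>r<k. conv (conv (A i r) (B r l)) (C l j) s) =
      (\<lambda>s. \<Sum>r<k. \<Sum>l<k. conv (A i r) (conv (B r l) (C l j)) s)"
    using ij by (subst sum.swap) (auto intro!: ext sum.cong fun_cong[OF conv_assoc]
        mat_L1D[OF A] mat_L1D[OF B] mat_L1D[OF C])
  also have "(\<lambda>s. \<Sum>r<k. \<Sum>l<k. conv (A i r) (conv (B r l) (C l j)) s) = mat_mult k A (mat_mult k B C) i j"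
    unfolding mat_mult_def using ij
    by (intro ext sum.cong refl fun_cong[OF conv_sum_right, symmetric])
       (auto intro!: conv_L1 mat_L1D[OF A] mat_L1D[OF B] mat_L1D[OF C])
  finally show ?thesis .
qed

lemma mat_mult_one_left:
  assumes "mat_L1 k A" "i < k" "j < k"
  shows "mat_mult k mat_one A i j = A i j"
proof
  fix s
  have "mat_mult k mat_one A i j s = (\<Sum>l<k. if i = l then A l j s else 0)"
    unfolding mat_mult_def using assms
    by (intro sum.cong) (auto simp: mat_one_def conv_one_left conv_zero mat_L1D)
  then show "mat_mult k mat_one A i j s = A i j s" using assms by simp
qed

lemma mat_mult_one_right:
  assumes "mat_L1 k A" "i < k" "j < k"
  shows "mat_mult k A mat_one i j = A i j"
proof
  fix s
  have "mat_mult k A mat_one i j s = (\<Sum>l<k. if l = j then A i l s else 0)"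
    unfolding mat_mult_def using assms
    by (intro sum.cong) (auto simp: mat_one_def conv_one_right conv_zero mat_L1D)
  then show "mat_mult k A mat_one i j s = A i j s" using assms by simp
qed

text \<open>Entries with an index of at least \<open>k\<close> are arbitrary here, unlike in the
  extensional \<open>matrix_ring\<close>; equality of matrices is therefore equality of the entries
  below \<open>k\<close>.\<close>

lemma mat_mult_cong:
  "(\<And>i j. i < k \<Longrightarrow> j < k \<Longrightarrow> A i j = A' i j) \<Longrightarrow> (\<And>i j. i < k \<Longrightarrow> j < k \<Longrightarrow> B i j = B' i j) \<Longrightarrow>
    i < k \<Longrightarrow> j < k \<Longrightarrow> mat_mult k A B i j = mat_mult k A' B' i j"
  unfolding mat_mult_def by (intro ext sum.cong) auto

definition mat_power :: "nat \<Rightarrow> (nat \<Rightarrow> nat \<Rightarrow> 'g \<Rightarrow> real) \<Rightarrow> nat \<Rightarrow> nat \<Rightarrow> nat \<Rightarrow> 'g \<Rightarrow> real" where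
  "mat_power k E n = ((\<lambda>P. mat_mult k E P) ^^ n) mat_one"

lemma mat_power_simps: "mat_power k E 0 = mat_one" "mat_power k E (Suc n) = mat_mult k E (mat_power k E n)"
  by (simp_all add: mat_power_def)

lemma mat_power_L1: "mat_L1 k E \<Longrightarrow> mat_L1 k (mat_power k E n)"
  by (induction n) (auto simp: mat_power_simps mat_L1_one mat_L1_mult)

text \<open>Powers are built by multiplication from the left; this form is needed for the product of
  the Neumann series with \<open>E\<close> on the right.\<close>

lemma mat_power_commute:
  assumes E: "mat_L1 k E" and "i < k" "j < k"
  shows "mat_mult k (mat_power k E n) E i j = mat_power k E (Suc n) i j"
  using assms(2,3)
proof (induction n arbitrary: i j)
  case 0 then show ?case using E by (simp add: mat_power_simps mat_mult_one_left mat_mult_one_right)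
next
  case (Suc n)
  have "mat_mult k (mat_power k E (Suc n)) E i j = mat_mult k E (mat_mult k (mat_power k E n) E) i j"
    unfolding mat_power_simps using mat_mult_assoc[OF E mat_power_L1[OF E] E] Suc by blast
  also have "\<dots> = mat_mult k E (mat_power k E (Suc n)) i j"
    by (rule mat_mult_cong) (use Suc in auto)
  finally show ?case by (simp add: mat_power_simps)
qed

text \<open>The maximal row sum of norms is submultiplicative.\<close>

lemma mat_power_norm:
  assumes E: "mat_L1 k E" and q: "\<And>i. i < k \<Longrightarrow> (\<Sum>j<k. l1_norm (E i j)) \<le> q" "q \<ge> 0" and i: "i < k"
  shows "(\<Sum>j<k. l1_norm (mat_power k E n i j)) \<le> q ^ n"
  using i
proof (induction n arbitrary: i)
  case 0
  have "(\<Sum>j<k. l1_norm (mat_one i j)) = (\<Sum>j<k. if i = j then 1 else 0)"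
    by (intro sum.cong) (auto simp: mat_one_def l1_norm_one l1_norm_zero)
  then show ?case using 0 by (simp add: mat_power_simps)
next
  case (Suc n)
  note P = mat_power_L1[OF E, of n]
  have "(\<Sum>j<k. l1_norm (mat_power k E (Suc n) i j)) \<le> (\<Sum>j<k. \<Sum>l<k. l1_norm (E i l) * l1_norm (mat_power k E n l j))"
  proof (rule sum_mono)
    fix j assume j: "j \<in> {..<k}"
    have "l1_norm (mat_power k E (Suc n) i j) \<le> (\<Sum>l<k. l1_norm (conv (E i l) (mat_power k E n l j)))"
      unfolding mat_power_simps mat_mult_def
      by (rule l1_norm_sum) (use j Suc in \<open>auto intro!: conv_L1 mat_L1D[OF E] mat_L1D[OF P]\<close>)
    also have "\<dots> \<le> (\<Sum>l<k. l1_norm (E i l) * l1_norm (mat_power k E n l j))"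
      by (rule sum_mono) (use j Suc in \<open>auto intro!: l1_norm_conv mat_L1D[OF E] mat_L1D[OF P]\<close>)
    finally show "l1_norm (mat_power k E (Suc n) i j) \<le> \<dots>" .
  qed
  also have "\<dots> = (\<Sum>l<k. l1_norm (E i l) * (\<Sum>j<k. l1_norm (mat_power k E n l j)))"
    by (subst sum.swap) (simp add: sum_distrib_left)
  also have "\<dots> \<le> (\<Sum>l<k. l1_norm (E i l) * q ^ n)"
    by (intro sum_mono mult_left_mono Suc.IH l1_norm_nonneg) simp
  also have "\<dots> = (\<Sum>l<k. l1_norm (E i l)) * q ^ n" by (simp add: sum_distrib_right)
  also have "\<dots> \<le> q * q ^ n" using q Suc by (intro mult_right_mono) auto
  finally show ?case by simp
qed

text \<open>With \<open>B\<close> the sum of all powers of \<open>E\<close>, both products of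
  \<open>E\<close> and \<open>B\<close> are the series without its term of index \<open>0\<close>,
  that is \<open>B - mat_one\<close>. Row sums of at most \<open>1/2\<close> make the series
  geometrically convergent.\<close>

lemma Neumann_inverse:
  assumes E: "mat_L1 k E" and q: "\<And>i. i < k \<Longrightarrow> (\<Sum>j<k. l1_norm (E i j)) \<le> 1/2"
  obtains B where "mat_L1 k B"
    "\<And>i j. i < k \<Longrightarrow> j < k \<Longrightarrow> mat_mult k B (\<lambda>i j s. mat_one i j s - E i j s) i j = mat_one i j"
    "\<And>i j. i < k \<Longrightarrow> j < k \<Longrightarrow> mat_mult k (\<lambda>i j s. mat_one i j s - E i j s) B i j = mat_one i j"
proof -
  define P where "P = mat_power k E"
  have P: "mat_L1 k (P n)" for n by (simp add: P_def mat_power_L1[OF E])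
  have Pn: "l1_norm (P n i j) \<le> (1/2) ^ n" if ij: "i < k" "j < k" for n i j
  proof -
    have "l1_norm (P n i j) \<le> (\<Sum>j<k. l1_norm (P n i j))"
      using ij by (intro member_le_sum) (auto simp: l1_norm_nonneg)
    then show ?thesis using mat_power_norm[OF E q, of i n] ij by (simp add: P_def)
  qed
  have geo: "(\<lambda>n. (1/2::real) ^ n) summable_on UNIV"
    by (subst summable_on_UNIV_nonneg_real_iff) (auto intro: summable_geometric)
  have sm: "(\<lambda>n. l1_norm (P n i j)) summable_on UNIV" if "i < k" "j < k" for i j
    by (rule summable_on_comparison_test[OF geo]) (use Pn[OF that] in \<open>auto simp: l1_norm_nonneg\<close>)
  define B where "B i j s = (\<Sum>\<^sub>\<infinity>n. P n i j s)" for i j s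
  note ser = L1_series[OF mat_L1D[OF P] sm]
  have B: "mat_L1 k B" unfolding mat_L1_def B_def using ser(1) by blast
  have tail: "(\<Sum>\<^sub>\<infinity>n. P (Suc n) i j s) = B i j s - mat_one i j s" if "i < k" "j < k" for i j s
  proof -
    have s: "(\<lambda>n. P n i j s) summable_on UNIV" using ser(2) that by blast
    have s1: "(\<lambda>n. P (Suc n) i j s) summable_on UNIV"
    proof -
      have "(\<lambda>n. P n i j s) summable_on (Suc ` UNIV)" by (rule summable_on_subset_banach[OF s]) simp
      then show ?thesis by (subst (asm) summable_on_reindex) (auto simp: o_def)
    qed
    have "(\<lambda>n. P n i j s) sums B i j s" unfolding B_def by (rule has_sum_imp_sums[OF has_sum_infsum[OF s]])
    then have "(\<lambda>n. P (Suc n) i j s) sums (B i j s - P 0 i j s)" by (subst sums_Suc_iff) simp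
    moreover have "(\<lambda>n. P (Suc n) i j s) sums (\<Sum>\<^sub>\<infinity>n. P (Suc n) i j s)"
      by (rule has_sum_imp_sums[OF has_sum_infsum[OF s1]])
    ultimately show ?thesis by (metis sums_unique2 P_def mat_power_simps(1))
  qed
  have "(\<lambda>n. \<Sum>l\<in>S. Q n l) summable_on UNIV \<and> (\<Sum>\<^sub>\<infinity>n. \<Sum>l\<in>S. Q n l) = (\<Sum>l\<in>S. \<Sum>\<^sub>\<infinity>n. Q n l)"
    if "finite S" "\<And>l. l \<in> S \<Longrightarrow> (\<lambda>n. Q n l) summable_on UNIV" for Q :: "nat \<Rightarrow> nat \<Rightarrow> real" and S
    using that by (induction S rule: finite_induct) (auto simp: infsum_add intro: summable_on_add)
  then have convsum: "(\<Sum>l<k. \<Sum>\<^sub>\<infinity>n. Q n l) = (\<Sum>\<^sub>\<infinity>n. \<Sum>l<k. Q n l)"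
    if "\<And>l. l < k \<Longrightarrow> (\<lambda>n. Q n l) summable_on UNIV" for Q :: "nat \<Rightarrow> nat \<Rightarrow> real"
    using that by (metis finite_lessThan lessThan_iff)
  have sc: "(\<lambda>n. conv f (P n i j) s) summable_on UNIV" "(\<lambda>n. conv (P n i j) f s) summable_on UNIV"
    if f: "f \<in> L1" and ij: "i < k" "j < k" for f i j s
  proof -
    have a: "(\<lambda>n. l1_norm (conv f (P n i j))) summable_on UNIV" "(\<lambda>n. l1_norm (conv (P n i j) f)) summable_on UNIV"
      by (rule summable_on_comparison_test[OF summable_on_cmult_right[OF sm[OF ij], of "l1_norm f"]];
          use l1_norm_conv[OF f mat_L1D[OF P ij]] l1_norm_conv[OF mat_L1D[OF P ij] f] in \<open>simp add: l1_norm_nonneg mult.commute\<close>)+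
    show "(\<lambda>n. conv f (P n i j) s) summable_on UNIV"
      by (rule L1_series(2)[OF conv_L1[OF f mat_L1D[OF P ij]] a(1)])
    show "(\<lambda>n. conv (P n i j) f s) summable_on UNIV"
      by (rule L1_series(2)[OF conv_L1[OF mat_L1D[OF P ij] f] a(2)])
  qed
  have EB: "mat_mult k E B i j s = B i j s - mat_one i j s" if ij: "i < k" "j < k" for i j s
  proof -
    have "mat_mult k E B i j s = (\<Sum>l<k. \<Sum>\<^sub>\<infinity>n. conv (E i l) (P n l j) s)"
      unfolding mat_mult_def B_def[abs_def] using ij
      by (intro sum.cong conv_series(2) mat_L1D[OF P] sm mat_L1D[OF E]) auto
    also have "\<dots> = (\<Sum>\<^sub>\<infinity>n. \<Sum>l<k. conv (E i l) (P n l j) s)"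
      by (rule convsum) (use ij in \<open>auto intro!: sc mat_L1D[OF E]\<close>)
    also have "\<dots> = (\<Sum>\<^sub>\<infinity>n. P (Suc n) i j s)" by (simp add: P_def mat_power_simps mat_mult_def)
    finally show ?thesis using tail[OF ij] by simp
  qed
  have BE: "mat_mult k B E i j s = B i j s - mat_one i j s" if ij: "i < k" "j < k" for i j s
  proof -
    have "mat_mult k B E i j s = (\<Sum>l<k. \<Sum>\<^sub>\<infinity>n. conv (P n i l) (E l j) s)"
      unfolding mat_mult_def B_def[abs_def] using ij
      by (intro sum.cong conv_series(1) mat_L1D[OF P] sm mat_L1D[OF E]) auto
    also have "\<dots> = (\<Sum>\<^sub>\<infinity>n. \<Sum>l<k. conv (P n i l) (E l j) s)"
      by (rule convsum) (use ij in \<open>auto intro!: sc mat_L1D[OF E]\<close>)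
    also have "\<dots> = (\<Sum>\<^sub>\<infinity>n. P (Suc n) i j s)"
      using fun_cong[OF mat_power_commute[OF E ij]] by (simp add: P_def mat_mult_def)
    finally show ?thesis using tail[OF ij] by simp
  qed
  have diffl: "conv (\<lambda>s. a s - b s) c = (\<lambda>s. conv a c s - conv b c s)"
    and diffr: "conv c (\<lambda>s. a s - b s) = (\<lambda>s. conv c a s - conv c b s)"
    if "a \<in> L1" "b \<in> L1" "c \<in> L1" for a b c
    using conv_add_left[OF that(1) L1_scale[OF that(2), of "-1"] that(3)] conv_scale_left[of "-1" b c]
      conv_add_right[OF that(3,1) L1_scale[OF that(2), of "-1"]] conv_scale_right[of c "-1" b] by simp_all
  show ?thesis
  proof (rule that[OF B])
    fix i j assume ij: "i < k" "j < k"
    have "mat_mult k B (\<lambda>i j s. mat_one i j s - E i j s) i j = (\<lambda>s. mat_mult k B mat_one i j s - mat_mult k B E i j s)"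
      unfolding mat_mult_def using ij
      by (simp add: diffr mat_L1D[OF B] mat_L1D[OF E] mat_L1D[OF mat_L1_one] sum_subtractf)
    then show "mat_mult k B (\<lambda>i j s. mat_one i j s - E i j s) i j = mat_one i j"
      by (simp add: mat_mult_one_right[OF B ij] BE[OF ij])
    have "mat_mult k (\<lambda>i j s. mat_one i j s - E i j s) B i j = (\<lambda>s. mat_mult k mat_one B i j s - mat_mult k E B i j s)"
      unfolding mat_mult_def using ij
      by (simp add: diffl mat_L1D[OF B] mat_L1D[OF E] mat_L1D[OF mat_L1_one] sum_subtractf)
    then show "mat_mult k (\<lambda>i j s. mat_one i j s - E i j s) B i j = mat_one i j"
      by (simp add: mat_mult_one_left[OF B ij] EB[OF ij])
  qed
qed

end

section \<open>Integral matrices invertible over $\ell^1(\Gamma)$\<close>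

lemma linear_functional_onD:
  assumes "linear_functional_on V F"
  shows "\<And>v w. v \<in> V \<Longrightarrow> w \<in> V \<Longrightarrow> F (\<lambda>i. v i + w i) = F v + F w"
    "\<And>v t. v \<in> V \<Longrightarrow> F (\<lambda>i. t * v i) = t * F v"
  using assms by (auto simp: linear_functional_on_def)

lemma linear_functional_on_finite_support:
  fixes V :: "('i \<Rightarrow> real) set"
  assumes V: "function_subspace V" and F: "linear_functional_on V F"
    and d: "\<And>i. i \<in> S \<Longrightarrow> (\<lambda>j. if j = i then 1 else 0) \<in> V" and S: "finite S"
  shows "F (\<lambda>j. \<Sum>i\<in>S. c i * (if j = i then 1 else 0)) = (\<Sum>i\<in>S. c i * F (\<lambda>j. if j = i then 1 else 0)) \<and>
    (\<lambda>j. \<Sum>i\<in>S. c i * (if j = i then 1 else 0)) \<in> V"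
  using S d
proof (induction S rule: finite_induct)
  case empty
  show ?case
    using linear_functional_onD(2)[OF F function_subspaceD(1)[OF V], of 0] function_subspaceD(1)[OF V] by simp
next
  case (insert i S)
  let ?d = "\<lambda>j. if j = i then 1 else 0 :: real"
  let ?r = "\<lambda>j. \<Sum>i\<in>S. c i * (if j = i then 1 else 0)"
  have IH: "F ?r = (\<Sum>i\<in>S. c i * F (\<lambda>j. if j = i then 1 else 0))" "?r \<in> V"
    using insert.IH insert.prems by auto
  have dV: "?d \<in> V" using insert.prems by simp
  have cV: "(\<lambda>j. c i * ?d j) \<in> V" by (rule function_subspaceD(3)[OF V dV])
  have E: "(\<lambda>j. \<Sum>i\<in>insert i S. c i * (if j = i then 1 else 0)) = (\<lambda>j. c i * ?d j + ?r j)"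
    by (rule ext) (rule sum.insert[OF insert.hyps])
  have E': "F (\<lambda>j. c i * ?d j + ?r j) = c i * F ?d + F ?r"
    using linear_functional_onD(1)[OF F cV IH(2)] linear_functional_onD(2)[OF F dV, of "c i"] by simp
  have "(\<lambda>j. c i * ?d j + ?r j) \<in> V" by (rule function_subspaceD(2)[OF V cV IH(2)])
  then show ?case unfolding E E' IH(1) by (simp only: sum.insert[OF insert.hyps])
qed

text \<open>The seminorm of the quotient of \<open>V\<close> by \<open>W\<close>. A linear
  functional below it is bounded by the given seminorm and vanishes on \<open>W\<close>.\<close>

lemma sublinear_distance:
  fixes \<nu> :: "('i \<Rightarrow> real) \<Rightarrow> real"
  assumes V: "function_subspace V" and W: "function_subspace W" "W \<subseteq> V"
    and tri: "\<And>v w. v \<in> V \<Longrightarrow> w \<in> V \<Longrightarrow> \<nu> (\<lambda>i. v i + w i) \<le> \<nu> v + \<nu> w"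
    and scale: "\<And>v t. v \<in> V \<Longrightarrow> \<nu> (\<lambda>i. t * v i) = \<bar>t\<bar> * \<nu> v"
  shows "sublinear_on V (\<lambda>v. INF w\<in>W. \<nu> (\<lambda>i. v i - w i))"
    and "\<And>v w. v \<in> V \<Longrightarrow> w \<in> W \<Longrightarrow> (INF w\<in>W. \<nu> (\<lambda>i. v i - w i)) \<le> \<nu> (\<lambda>i. v i - w i)"
proof -
  note VD = function_subspaceD[OF V] and WD = function_subspaceD[OF W(1)]
  define p where "p v = (INF w\<in>W. \<nu> (\<lambda>i. v i - w i))" for v
  have zero: "\<nu> (\<lambda>i. 0) = 0" using scale[OF VD(1), of 0] by simp
  have nonneg: "\<nu> v \<ge> 0" if "v \<in> V" for v
    using tri[OF that VD(4)[OF that]] scale[OF that, of "-1"] zero by simp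
  have diff: "(\<lambda>i. v i - w i) \<in> V" if "v \<in> V" "w \<in> W" for v w
    using VD(5)[OF that(1)] that(2) W(2) by blast
  have W0: "W \<noteq> {}" using WD(1) by blast
  have le: "p v \<le> \<nu> (\<lambda>i. v i - w i)" if "v \<in> V" "w \<in> W" for v w
    unfolding p_def using that(2) by (intro cINF_lower bdd_belowI2[where m=0] nonneg diff[OF that(1)])
  then show "\<And>v w. v \<in> V \<Longrightarrow> w \<in> W \<Longrightarrow> (INF w\<in>W. \<nu> (\<lambda>i. v i - w i)) \<le> \<nu> (\<lambda>i. v i - w i)"
    by (simp add: p_def)
  have ge: "c \<le> p v" if "\<And>w. w \<in> W \<Longrightarrow> c \<le> \<nu> (\<lambda>i. v i - w i)" for c v
    unfolding p_def by (rule cINF_greatest[OF W0 that])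
  have add: "p (\<lambda>i. v i + u i) \<le> p v + p u" if v: "v \<in> V" and u: "u \<in> V" for v u
  proof -
    have key: "p (\<lambda>i. v i + u i) \<le> \<nu> (\<lambda>i. v i - w i) + \<nu> (\<lambda>i. u i - w' i)" if w: "w \<in> W" "w' \<in> W" for w w'
    proof -
      have "p (\<lambda>i. v i + u i) \<le> \<nu> (\<lambda>i. (v i + u i) - (w i + w' i))"
        by (rule le[OF VD(2)[OF v u] WD(2)[OF w]])
      also have "(\<lambda>i. (v i + u i) - (w i + w' i)) = (\<lambda>i. (v i - w i) + (u i - w' i))" by auto
      also have "\<nu> \<dots> \<le> \<nu> (\<lambda>i. v i - w i) + \<nu> (\<lambda>i. u i - w' i)"
        by (rule tri[OF diff[OF v w(1)] diff[OF u w(2)]])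
      finally show ?thesis .
    qed
    have "p (\<lambda>i. v i + u i) - \<nu> (\<lambda>i. v i - w i) \<le> p u" if "w \<in> W" for w
    proof (rule ge)
      fix w' assume "w' \<in> W"
      from key[OF that this] show "p (\<lambda>i. v i + u i) - \<nu> (\<lambda>i. v i - w i) \<le> \<nu> (\<lambda>i. u i - w' i)" by simp
    qed
    then have "p (\<lambda>i. v i + u i) - p u \<le> p v"
      by (intro ge) (simp add: diff_le_eq add.commute)
    then show ?thesis by simp
  qed
  have scale_le: "p (\<lambda>i. t * v i) \<le> t * p v" if t: "t > 0" and v: "v \<in> V" for t v
  proof -
    have "p (\<lambda>i. t * v i) / t \<le> p v"
    proof (rule ge)
      fix w assume w: "w \<in> W"
      have "p (\<lambda>i. t * v i) \<le> \<nu> (\<lambda>i. t * v i - t * w i)" by (rule le[OF VD(3)[OF v] WD(3)[OF w]])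
      also have "\<dots> = t * \<nu> (\<lambda>i. v i - w i)"
        using scale[OF diff[OF v w], of t] t by (simp add: right_diff_distrib)
      finally show "p (\<lambda>i. t * v i) / t \<le> \<nu> (\<lambda>i. v i - w i)" using t by (simp add: field_simps)
    qed
    then show ?thesis using t by (simp add: field_simps)
  qed
  have scl: "p (\<lambda>i. t * v i) = t * p v" if t: "t \<ge> 0" and v: "v \<in> V" for t v
  proof (cases "t = 0")
    case True
    have "p (\<lambda>i. 0) \<le> 0" using le[OF VD(1) WD(1)] zero by simp
    moreover have "0 \<le> p (\<lambda>i. 0)" by (rule ge) (rule nonneg[OF diff[OF VD(1)]])
    ultimately show ?thesis using True by simp
  next
    case False
    then have t: "t > 0" using t by simp
    have "p (\<lambda>i. inverse t * (t * v i)) \<le> inverse t * p (\<lambda>i. t * v i)"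
      using scale_le[OF _ VD(3)[OF v]] t by simp
    moreover have "(\<lambda>i. inverse t * (t * v i)) = v" using t by (auto simp: field_simps)
    ultimately have "t * p v \<le> p (\<lambda>i. t * v i)" using t by (simp add: field_simps)
    then show ?thesis using scale_le[OF t v] by simp
  qed
  show "sublinear_on V (\<lambda>v. INF w\<in>W. \<nu> (\<lambda>i. v i - w i))"
    using add scl by (simp add: sublinear_on_def p_def)
qed

definition finite_support :: "'i set \<Rightarrow> ('i \<Rightarrow> real) set" where
  "finite_support I = {v. finite {i. v i \<noteq> 0} \<and> {i. v i \<noteq> 0} \<subseteq> I}"

lemma finite_support_subspace: "function_subspace (finite_support I)"
  unfolding function_subspace_def
proof (intro conjI ballI allI)
  show "(\<lambda>i. 0) \<in> finite_support I" by (simp add: finite_support_def)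
  show "(\<lambda>i. v i + w i) \<in> finite_support I" if "v \<in> finite_support I" "w \<in> finite_support I" for v w
  proof -
    have sub: "{i. v i + w i \<noteq> 0} \<subseteq> {i. v i \<noteq> 0} \<union> {i. w i \<noteq> 0}" by auto
    have fin: "finite ({i. v i \<noteq> 0} \<union> {i. w i \<noteq> 0})" "{i. v i \<noteq> 0} \<union> {i. w i \<noteq> 0} \<subseteq> I"
      using that by (auto simp: finite_support_def)
    show ?thesis unfolding finite_support_def
      by (intro CollectI conjI finite_subset[OF sub fin(1)] order.trans[OF sub fin(2)])
  qed
  show "(\<lambda>i. t * v i) \<in> finite_support I" if "v \<in> finite_support I" for t v
  proof -
    have sub: "{i. t * v i \<noteq> 0} \<subseteq> {i. v i \<noteq> 0}" by auto
    have fin: "finite {i. v i \<noteq> 0}" "{i. v i \<noteq> 0} \<subseteq> I" using that by (auto simp: finite_support_def)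
    show ?thesis unfolding finite_support_def
      by (intro CollectI conjI finite_subset[OF sub fin(1)] order.trans[OF sub fin(2)])
  qed
qed

text \<open>Otherwise Hahn-Banach, applied to the distance from \<open>W\<close>, gives a functional
  that vanishes on \<open>W\<close> but not at the unit vector of \<open>i0\<close>. On finitely
  supported vectors a functional is a row of coefficients, bounded by \<open>1\<close> because of
  \<open>unit\<close>, so it contradicts \<open>ann\<close>.\<close>

lemma dense_of_trivial_annihilator:
  fixes \<nu> :: "('i \<Rightarrow> real) \<Rightarrow> real"
  assumes W: "function_subspace W" "W \<subseteq> finite_support I"
    and tri: "\<And>v w. v \<in> finite_support I \<Longrightarrow> w \<in> finite_support I \<Longrightarrow>
        \<nu> (\<lambda>i. v i + w i) \<le> \<nu> v + \<nu> w"
    and scale: "\<And>v t. v \<in> finite_support I \<Longrightarrow> \<nu> (\<lambda>i. t * v i) = \<bar>t\<bar> * \<nu> v"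
    and unit: "\<And>i. i \<in> I \<Longrightarrow> \<nu> (\<lambda>j. if j = i then 1 else 0) \<le> 1"
    and ann: "\<And>y. (\<And>i. i \<in> I \<Longrightarrow> \<bar>y i\<bar> \<le> 1) \<Longrightarrow>
        (\<And>w. w \<in> W \<Longrightarrow> (\<Sum>i\<in>{i. w i \<noteq> 0}. w i * y i) = 0) \<Longrightarrow> \<forall>i\<in>I. y i = 0"
    and i0: "i0 \<in> I" and e: "e > 0"
  shows "\<exists>w\<in>W. \<nu> (\<lambda>j. (if j = i0 then 1 else 0) - w j) < e"
proof (rule ccontr)
  assume neg: "\<not> ?thesis"
  let ?V = "finite_support I"
  note V = finite_support_subspace[of I]
  note WD = function_subspaceD[OF W(1)]
  let ?d = "\<lambda>i j. if j = i then 1 else 0 :: real"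
  have dV: "?d i \<in> ?V" if "i \<in> I" for i using that by (simp add: finite_support_def)
  define p where "p v = (INF w\<in>W. \<nu> (\<lambda>i. v i - w i))" for v
  have p: "sublinear_on ?V p" unfolding p_def[abs_def] by (rule sublinear_distance(1)[OF V W tri scale])
  have ple: "p v \<le> \<nu> (\<lambda>i. v i - w i)" if "v \<in> ?V" "w \<in> W" for v w
    unfolding p_def using that by (intro sublinear_distance(2)[OF V W tri scale])
  obtain F where F: "linear_functional_on ?V F" "\<And>v. v \<in> ?V \<Longrightarrow> F v \<le> p v" "F (?d i0) = p (?d i0)"
    using Hahn_Banach[OF V p dV[OF i0]] by metis
  have Fneg: "F (\<lambda>i. - v i) = - F v" if "v \<in> ?V" for v
    using linear_functional_onD(2)[OF F(1) that, of "-1"] by simp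
  have pe: "e \<le> p (?d i0)"
    unfolding p_def
  proof (rule cINF_greatest)
    show "W \<noteq> {}" using WD(1) by blast
    show "e \<le> \<nu> (\<lambda>j. ?d i0 j - w j)" if "w \<in> W" for w using neg that by force
  qed
  have nu_le: "\<bar>F v\<bar> \<le> \<nu> v" if v: "v \<in> ?V" for v
  proof -
    have "p v \<le> \<nu> v" using ple[OF v WD(1)] by simp
    moreover have "p (\<lambda>i. - v i) \<le> \<nu> v"
      using ple[OF function_subspaceD(4)[OF V v] WD(1)] scale[OF v, of "-1"] by simp
    ultimately show ?thesis
      using F(2)[OF v] F(2)[OF function_subspaceD(4)[OF V v]] Fneg[OF v] by linarith
  qed
  have FW: "F w = 0" if w: "w \<in> W" for w
  proof -
    have wV: "w \<in> ?V" using w W(2) by blast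
    have z: "\<nu> (\<lambda>i. 0) = 0" using scale[OF function_subspaceD(1)[OF V], of 0] by simp
    have "F w \<le> 0" using F(2)[OF wV] ple[OF wV w] z by simp
    moreover have "F (\<lambda>i. - w i) \<le> 0"
      using F(2)[OF function_subspaceD(4)[OF V wV]] ple[OF function_subspaceD(4)[OF V wV] WD(4)[OF w]] z by simp
    ultimately show ?thesis using Fneg[OF wV] by simp
  qed
  define y where "y i = F (?d i)" for i
  have "\<forall>i\<in>I. y i = 0"
  proof (rule ann)
    show "\<bar>y i\<bar> \<le> 1" if "i \<in> I" for i
      using nu_le[OF dV[OF that]] unit[OF that] by (simp add: y_def)
    fix w assume w: "w \<in> W"
    then have S: "finite {i. w i \<noteq> 0}" "{i. w i \<noteq> 0} \<subseteq> I" using W(2) by (auto simp: finite_support_def)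
    have "(\<Sum>i\<in>{i. w i \<noteq> 0}. w i * (if j = i then 1 else 0)) = w j" for j
      using S(1) by (cases "w j = 0") (auto simp: if_distrib[of "\<lambda>x. _ * x"] sum.delta cong: if_cong)
    then have "F w = (\<Sum>i\<in>{i. w i \<noteq> 0}. w i * F (?d i))"
      using linear_functional_on_finite_support[OF V F(1) dV S(1), of w] S(2) by auto
    then show "(\<Sum>i\<in>{i. w i \<noteq> 0}. w i * y i) = 0" using FW[OF w] by (simp add: y_def)
  qed
  then have "F (?d i0) = 0" using i0 by (simp add: y_def)
  then show False using F(3) pe e by simp
qed

text \<open>Built by adding one multiple at a time, which suits rounding the coefficients one by
  one.\<close>

inductive_set real_span :: "('i \<Rightarrow> real) set \<Rightarrow> ('i \<Rightarrow> real) set" for S where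
  real_span_zero: "(\<lambda>i. 0) \<in> real_span S"
| real_span_step: "v \<in> real_span S \<Longrightarrow> f \<in> S \<Longrightarrow> (\<lambda>i. c * f i + v i) \<in> real_span S"

lemma real_span_subspace: "function_subspace (real_span S)"
  unfolding function_subspace_def
proof (intro conjI ballI allI real_span_zero)
  show "(\<lambda>i. v i + w i) \<in> real_span S" if "v \<in> real_span S" "w \<in> real_span S" for v w
    using that
  proof (induction rule: real_span.induct)
    case (real_span_step v f c)
    then have "(\<lambda>i. c * f i + (v i + w i)) \<in> real_span S" by (intro real_span.real_span_step)
    then show ?case by (simp add: add.assoc)
  qed simp
  show "(\<lambda>i. t * v i) \<in> real_span S" if "v \<in> real_span S" for t v
    using that
  proof (induction rule: real_span.induct)
    case (real_span_step v f c)
    then have "(\<lambda>i. (t * c) * f i + t * v i) \<in> real_span S" by (intro real_span.real_span_step)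
    then show ?case by (simp add: algebra_simps)
  qed (simp add: real_span_zero)
qed

lemma real_span_incl: "f \<in> S \<Longrightarrow> f \<in> real_span S"
  using real_span_step[OF real_span_zero, of f S 1] by simp

context discrete_group begin

section \<open>The integral group ring and its free modules\<close>

abbreviation ZG where "ZG \<equiv> carrier (group_ring \<Gamma>)"
abbreviation FM where "FM k \<equiv> free_left_module (group_ring \<Gamma>) k"

lemma ZG_iff: "a \<in> ZG \<longleftrightarrow> finite {s. a s \<noteq> 0} \<and> {s. a s \<noteq> 0} \<subseteq> G"
  by (simp add: group_ring_def)

lemma ZG_L1: "a \<in> ZG \<Longrightarrow> l1_of a \<in> L1"
  by (rule L1_finite_support) (simp_all add: ZG_iff l1_of_def)

lemma pairing_ZG:
  assumes "a \<in> ZG"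
  shows "pairing (l1_of a) y = (\<Sum>s\<in>{s. a s \<noteq> 0}. of_int (a s) * y s)"
  unfolding pairing_def l1_of_def using assms
  by (intro infsum_finite_support) (auto simp: ZG_iff)

lemma l1_of_mult:
  assumes "a \<in> ZG"
  shows "l1_of (a \<otimes>\<^bsub>group_ring \<Gamma>\<^esub> b) = conv (l1_of a) (l1_of b)"
proof
  fix s
  show "l1_of (a \<otimes>\<^bsub>group_ring \<Gamma>\<^esub> b) s = conv (l1_of a) (l1_of b) s"
  proof (cases "s \<in> G")
    case True
    then show ?thesis unfolding conv_apply[OF True] pairing_ZG[OF assms] by (simp add: group_ring_def l1_of_def)
  next
    case False
    then show ?thesis by (simp add: conv_outside) (simp add: group_ring_def l1_of_def)
  qed
qed

lemma ZG_mult_closed: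
  assumes a: "a \<in> ZG" and b: "b \<in> ZG"
  shows "a \<otimes>\<^bsub>group_ring \<Gamma>\<^esub> b \<in> ZG"
proof -
  let ?S = "(\<lambda>(t, r). t \<otimes> r) ` ({t. a t \<noteq> 0} \<times> {r. b r \<noteq> 0})"
  have "s \<in> ?S \<and> s \<in> G" if "(a \<otimes>\<^bsub>group_ring \<Gamma>\<^esub> b) s \<noteq> 0" for s
  proof -
    have s: "s \<in> G" "(\<Sum>t\<in>{t. a t \<noteq> 0}. a t * b (inv t \<otimes> s)) \<noteq> 0"
      using that by (auto simp: group_ring_def split: if_splits)
    then obtain t where t: "a t \<noteq> 0" "b (inv t \<otimes> s) \<noteq> 0"
      by (metis (mono_tags, lifting) mem_Collect_eq mult_zero_right sum.neutral)
    then have "t \<in> G" using a by (auto simp: ZG_iff)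
    then have "s = t \<otimes> (inv t \<otimes> s)" using s(1) by (simp add: m_assoc[symmetric])
    then show ?thesis using t s(1) by (auto intro!: image_eqI[of _ _ "(t, inv t \<otimes> s)"])
  qed
  then have sub: "{s. (a \<otimes>\<^bsub>group_ring \<Gamma>\<^esub> b) s \<noteq> 0} \<subseteq> ?S \<inter> G" by blast
  have fin: "finite (?S \<inter> G)" using a b by (simp add: ZG_iff)
  show ?thesis unfolding ZG_iff
    by (intro conjI finite_subset[OF sub fin] order.trans[OF sub]) simp
qed

lemma ZG_add_closed:
  assumes "a \<in> ZG" "b \<in> ZG"
  shows "(\<lambda>s. a s + b s) \<in> ZG"
proof -
  have sub: "{s. a s + b s \<noteq> 0} \<subseteq> {s. a s \<noteq> 0} \<union> {s. b s \<noteq> 0}" by auto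
  have fin: "finite ({s. a s \<noteq> 0} \<union> {s. b s \<noteq> 0})" "{s. a s \<noteq> 0} \<union> {s. b s \<noteq> 0} \<subseteq> G"
    using assms by (auto simp: ZG_iff)
  show ?thesis unfolding ZG_iff
    by (intro conjI finite_subset[OF sub fin(1)] order.trans[OF sub fin(2)])
qed

lemma ZG_outside: "a \<in> ZG \<Longrightarrow> s \<notin> G \<Longrightarrow> a s = 0"
  by (auto simp: ZG_iff)

lemma ZG_zero: "(\<lambda>s. 0) \<in> ZG" by (simp add: ZG_iff)
lemma ZG_minus: "a \<in> ZG \<Longrightarrow> (\<lambda>s. - a s) \<in> ZG" by (simp add: ZG_iff)

definition point :: "'g \<Rightarrow> int \<Rightarrow> 'g \<Rightarrow> int" where "point t n = (\<lambda>s. if s = t then n else 0)"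

lemma point_ZG: "t \<in> G \<Longrightarrow> point t n \<in> ZG" by (auto simp: ZG_iff point_def)

lemma point_mult:
  assumes t: "t \<in> G" and s: "s \<in> G"
  shows "(point t n \<otimes>\<^bsub>group_ring \<Gamma>\<^esub> b) s = n * b (inv t \<otimes> s)"
proof (cases "n = 0")
  case True then show ?thesis using s by (simp add: group_ring_def point_def)
next
  case False
  then have "{u. point t n u \<noteq> 0} = {t}" by (auto simp: point_def)
  then show ?thesis using s by (simp add: group_ring_def) (simp add: point_def)
qed

lemma group_ring_add: "a \<oplus>\<^bsub>group_ring \<Gamma>\<^esub> b = (\<lambda>s. a s + b s)"
  and group_ring_zero: "\<zero>\<^bsub>group_ring \<Gamma>\<^esub> = (\<lambda>s. 0)"
  and l1_ring_add: "f \<oplus>\<^bsub>l1_ring \<Gamma>\<^esub> h = (\<lambda>s. f s + h s)"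
  and l1_ring_zero: "\<zero>\<^bsub>l1_ring \<Gamma>\<^esub> = (\<lambda>s. 0)"
  by (simp_all add: group_ring_def l1_ring_def point_def)

lemma FM_carrier: "carrier (FM k) = {..<k} \<rightarrow>\<^sub>E ZG"
  and FM_add: "v \<oplus>\<^bsub>FM k\<^esub> w = (\<lambda>i\<in>{..<k}. \<lambda>s. v i s + w i s)"
  and FM_zero: "\<zero>\<^bsub>FM k\<^esub> = (\<lambda>i\<in>{..<k}. \<lambda>s. 0)"
  and FM_smult: "a \<odot>\<^bsub>FM k\<^esub> v = (\<lambda>i\<in>{..<k}. a \<otimes>\<^bsub>group_ring \<Gamma>\<^esub> v i)"
  by (simp_all add: free_left_module_def group_ring_add group_ring_zero)

lemma FM_add_closed: "v \<in> carrier (FM k) \<Longrightarrow> w \<in> carrier (FM k) \<Longrightarrow> v \<oplus>\<^bsub>FM k\<^esub> w \<in> carrier (FM k)"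
  by (auto simp: FM_carrier FM_add intro!: ZG_add_closed)

lemma FM_smult_closed: "a \<in> ZG \<Longrightarrow> v \<in> carrier (FM k) \<Longrightarrow> a \<odot>\<^bsub>FM k\<^esub> v \<in> carrier (FM k)"
  by (auto simp: FM_carrier FM_smult intro!: ZG_mult_closed)

lemma submoduleD:
  assumes "submodule J (group_ring \<Gamma>) (FM k)"
  shows "J \<subseteq> carrier (FM k)" "\<And>v w. v \<in> J \<Longrightarrow> w \<in> J \<Longrightarrow> v \<oplus>\<^bsub>FM k\<^esub> w \<in> J"
    "\<zero>\<^bsub>FM k\<^esub> \<in> J" "\<And>a v. a \<in> ZG \<Longrightarrow> v \<in> J \<Longrightarrow> a \<odot>\<^bsub>FM k\<^esub> v \<in> J"
  using assms subgroup.subset[of J "add_monoid (FM k)"] subgroup.m_closed[of J "add_monoid (FM k)"]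
    subgroup.one_closed[of J "add_monoid (FM k)"]
  by (auto simp: submodule_def submodule_axioms_def)

lemma submodule_entry: "submodule J (group_ring \<Gamma>) (FM k) \<Longrightarrow> w \<in> J \<Longrightarrow> j < k \<Longrightarrow> w j \<in> ZG"
  using submoduleD(1) by (fastforce simp: FM_carrier)

lemma abelian_monoid_l1: "abelian_monoid (l1_ring \<Gamma>)"
  by (rule abelian_monoidI) (auto simp: l1_ring_add l1_ring_zero L1_zero L1_add add.assoc add.commute)

lemma finsum_l1:
  assumes "finite I" "\<And>i. i \<in> I \<Longrightarrow> f i \<in> L1"
  shows "(\<Oplus>\<^bsub>l1_ring \<Gamma>\<^esub>i\<in>I. f i) = (\<lambda>s. \<Sum>i\<in>I. f i s)"
proof -
  interpret abelian_monoid "l1_ring \<Gamma>" by (rule abelian_monoid_l1)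
  show ?thesis using assms
    by (induction I rule: finite_induct) (auto simp: l1_ring_add l1_ring_zero)
qed

section \<open>Units of the matrix ring\<close>

abbreviation MatL where "MatL k \<equiv> matrix_ring (l1_ring \<Gamma>) k"

lemma matrix_ring_mult:
  assumes "mat_L1 k A" "mat_L1 k B"
  shows "A \<otimes>\<^bsub>MatL k\<^esub> B = (\<lambda>i\<in>{..<k}. \<lambda>j\<in>{..<k}. mat_mult k A B i j)"
  unfolding matrix_ring_def monoid.simps
  by (intro restrict_ext, subst finsum_l1)
     (auto intro!: conv_L1 mat_L1D[OF assms(1)] mat_L1D[OF assms(2)] simp: mat_mult_def)

lemma matrix_ring_one: "\<one>\<^bsub>MatL k\<^esub> = (\<lambda>i\<in>{..<k}. \<lambda>j\<in>{..<k}. mat_one i j)"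
  by (auto simp: matrix_ring_def mat_one_def l1_ring_zero intro!: restrict_ext)

lemma matrix_ring_carrier: "A \<in> carrier (MatL k) \<Longrightarrow> mat_L1 k A"
  by (auto simp: matrix_ring_def mat_L1_def PiE_def Pi_def)

lemma matrix_unitI:
  assumes A: "A \<in> carrier (MatL k)" and B: "mat_L1 k B"
    and BA: "\<And>i j. i < k \<Longrightarrow> j < k \<Longrightarrow> mat_mult k B A i j = mat_one i j"
    and AB: "\<And>i j. i < k \<Longrightarrow> j < k \<Longrightarrow> mat_mult k A B i j = mat_one i j"
  shows "A \<in> Units (MatL k)"
proof -
  define B' where "B' = (\<lambda>i\<in>{..<k}. \<lambda>j\<in>{..<k}. B i j)"
  have B': "B' \<in> carrier (MatL k)" using B by (auto simp: B'_def matrix_ring_def mat_L1_def)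
  have "mat_mult k B' A i j = mat_one i j" "mat_mult k A B' i j = mat_one i j" if "i < k" "j < k" for i j
    using BA[OF that] AB[OF that] that by (simp_all add: mat_mult_def B'_def)
  then have "B' \<otimes>\<^bsub>MatL k\<^esub> A = \<one>\<^bsub>MatL k\<^esub>" "A \<otimes>\<^bsub>MatL k\<^esub> B' = \<one>\<^bsub>MatL k\<^esub>"
    unfolding matrix_ring_mult[OF matrix_ring_carrier[OF B'] matrix_ring_carrier[OF A]]
      matrix_ring_mult[OF matrix_ring_carrier[OF A] matrix_ring_carrier[OF B']] matrix_ring_one
    by (auto intro!: restrict_ext)
  then show ?thesis using A B' unfolding Units_def by blast
qed

lemma matrix_unitE:
  assumes "A \<in> Units (MatL k)"
  obtains B where "mat_L1 k B" "\<And>i j. i < k \<Longrightarrow> j < k \<Longrightarrow> mat_mult k B A i j = mat_one i j"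
proof -
  obtain B where B: "A \<in> carrier (MatL k)" "B \<in> carrier (MatL k)" "B \<otimes>\<^bsub>MatL k\<^esub> A = \<one>\<^bsub>MatL k\<^esub>"
    using assms unfolding Units_def by blast
  have "mat_mult k B A i j = mat_one i j" if "i < k" "j < k" for i j
    using fun_cong[OF fun_cong[OF B(3)], of i j] that
    unfolding matrix_ring_mult[OF matrix_ring_carrier[OF B(2)] matrix_ring_carrier[OF B(1)]] matrix_ring_one
    by simp
  then show ?thesis using that matrix_ring_carrier[OF B(2)] by blast
qed

text \<open>Turns a row into a real function on pairs of a position and a group element, the form in
  which the Hahn-Banach lemmas apply; the value \<open>0\<close> from position \<open>k\<close> on
  keeps supports finite and inside the index set.\<close>

definition flatten :: "nat \<Rightarrow> (nat \<Rightarrow> 'g \<Rightarrow> int) \<Rightarrow> nat \<times> 'g \<Rightarrow> real" where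
  "flatten k w = (\<lambda>(j, s). if j < k then of_int (w j s) else 0)"

definition row_norm :: "nat \<Rightarrow> (nat \<times> 'g \<Rightarrow> real) \<Rightarrow> real" where
  "row_norm k v = (\<Sum>j<k. l1_norm (\<lambda>s. v (j, s)))"

abbreviation rows :: "nat \<Rightarrow> (nat \<times> 'g \<Rightarrow> real) set" where
  "rows k \<equiv> finite_support ({..<k} \<times> G)"

lemma rows_L1:
  assumes "v \<in> rows k"
  shows "(\<lambda>s. v (j, s)) \<in> L1"
proof (rule L1_finite_support)
  have "{s. v (j, s) \<noteq> 0} \<subseteq> snd ` {i. v i \<noteq> 0}" by force
  moreover have "finite {i. v i \<noteq> 0}" "snd ` {i. v i \<noteq> 0} \<subseteq> G" using assms by (auto simp: finite_support_def)
  ultimately show "finite {s. v (j, s) \<noteq> 0}" "{s. v (j, s) \<noteq> 0} \<subseteq> G"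
    by (meson finite_imageI finite_subset, blast)
qed

lemma row_norm_add: "v \<in> rows k \<Longrightarrow> w \<in> rows k \<Longrightarrow> row_norm k (\<lambda>i. v i + w i) \<le> row_norm k v + row_norm k w"
  unfolding row_norm_def sum.distrib[symmetric] by (intro sum_mono l1_norm_add rows_L1)

lemma row_norm_scale: "row_norm k (\<lambda>i. t * v i) = \<bar>t\<bar> * row_norm k v"
  unfolding row_norm_def by (simp add: l1_norm_scale sum_distrib_left)

lemma flatten_rows:
  assumes w: "w \<in> carrier (FM k)"
  shows "flatten k w \<in> rows k"
proof -
  have wj: "w j \<in> ZG" if "j < k" for j using w that by (auto simp: FM_carrier)
  have "{i. flatten k w i \<noteq> 0} = (SIGMA j:{..<k}. {s. w j s \<noteq> 0})"
    by (auto simp: flatten_def split: if_splits)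
  moreover have "finite (SIGMA j:{..<k}. {s. w j s \<noteq> 0})"
    using wj by (intro finite_SigmaI) (auto simp: ZG_iff)
  moreover have "(SIGMA j:{..<k}. {s. w j s \<noteq> 0}) \<subseteq> {..<k} \<times> G" using wj by (auto simp: ZG_iff)
  ultimately show ?thesis by (simp add: finite_support_def)
qed

lemma flatten_pairing:
  assumes w: "w \<in> carrier (FM k)"
  shows "(\<Sum>i\<in>{i. flatten k w i \<noteq> 0}. flatten k w i * y i) = (\<Sum>j<k. pairing (l1_of (w j)) (\<lambda>s. y (j, s)))"
proof -
  have wj: "w j \<in> ZG" if "j < k" for j using w that by (auto simp: FM_carrier)
  have "{i. flatten k w i \<noteq> 0} = (SIGMA j:{..<k}. {s. w j s \<noteq> 0})"
    by (auto simp: flatten_def split: if_splits)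
  then have "(\<Sum>i\<in>{i. flatten k w i \<noteq> 0}. flatten k w i * y i)
      = (\<Sum>j<k. \<Sum>s\<in>{s. w j s \<noteq> 0}. flatten k w (j, s) * y (j, s))"
    using wj by (simp add: sum.Sigma ZG_iff split_beta)
  then show ?thesis using wj by (simp add: pairing_ZG flatten_def)
qed

lemma real_span_rows:
  assumes "J \<subseteq> carrier (FM k)"
  shows "real_span (flatten k ` J) \<subseteq> rows k"
proof
  show "v \<in> rows k" if "v \<in> real_span (flatten k ` J)" for v
    using that
  proof (induction rule: real_span.induct)
    case real_span_zero show ?case by (rule function_subspaceD(1)[OF finite_support_subspace])
  next
    case (real_span_step v f c)
    then have "f \<in> rows k" using flatten_rows assms by auto
    then show ?case by (intro function_subspaceD(2,3)[OF finite_support_subspace] real_span_step)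
  qed
qed

text \<open>Rounding the coefficients of a fixed real combination costs a bounded amount, which becomes
  negligible after division by a large \<open>N\<close>.\<close>

lemma real_span_integral_approx:
  assumes J: "submodule J (group_ring \<Gamma>) (FM k)" and v: "v \<in> real_span (flatten k ` J)"
  obtains K where "\<And>N::nat. \<exists>w\<in>J. row_norm k (\<lambda>i. real N * v i - flatten k w i) \<le> K"
proof -
  note JD = submoduleD[OF J]
  have "\<exists>K. \<forall>N::nat. \<exists>w\<in>J. row_norm k (\<lambda>i. real N * v i - flatten k w i) \<le> K"
    using v
  proof (induction rule: real_span.induct)
    case real_span_zero
    have "flatten k \<zero>\<^bsub>FM k\<^esub> = (\<lambda>i. 0)" by (auto simp: flatten_def FM_zero)
    then have "\<forall>N::nat. \<exists>w\<in>J. row_norm k (\<lambda>i. real N * 0 - flatten k w i) \<le> 0"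
      using JD(3) by (intro allI bexI[of _ "\<zero>\<^bsub>FM k\<^esub>"]) (simp_all add: row_norm_def l1_norm_zero)
    then show ?case by blast
  next
    case (real_span_step v f c)
    then obtain K where K: "\<And>N::nat. \<exists>w\<in>J. row_norm k (\<lambda>i. real N * v i - flatten k w i) \<le> K" by blast
    obtain w0 where w0: "w0 \<in> J" "f = flatten k w0" using real_span_step by blast
    have w0r: "f \<in> rows k" using flatten_rows[of w0 k] w0 JD(1) by auto
    have vr: "v \<in> rows k" using real_span_step(1) real_span_rows[OF JD(1)] by blast
    have "\<exists>w\<in>J. row_norm k (\<lambda>i. real N * (c * f i + v i) - flatten k w i) \<le> row_norm k f + K" for N :: nat
    proof -
      obtain w where w: "w \<in> J" "row_norm k (\<lambda>i. real N * v i - flatten k w i) \<le> K" using K by blast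
      \<comment> \<open>Rounding down costs at most one copy of \<open>f\<close>, whatever
        \<open>N\<close> is; the bound grows by \<open>row_norm k f\<close> at each step of the
        induction.\<close>
      define n where "n = \<lfloor>real N * c\<rfloor>"
      define w' where "w' = (point \<one> n \<odot>\<^bsub>FM k\<^esub> w0) \<oplus>\<^bsub>FM k\<^esub> w"
      have w'J: "w' \<in> J" unfolding w'_def by (intro JD point_ZG w0 w one_closed)
      have pt: "(point \<one> n \<otimes>\<^bsub>group_ring \<Gamma>\<^esub> w0 j) s = n * w0 j s" if "j < k" for j s
      proof (cases "s \<in> G")
        case True then show ?thesis by (simp add: point_mult)
      next
        case False
        then show ?thesis using submodule_entry[OF J w0(1) that]
          by (simp add: ZG_outside ZG_mult_closed point_ZG)
      qed
      have fl: "flatten k w' i = of_int n * f i + flatten k w i" for i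
        by (cases i) (simp add: flatten_def w'_def FM_add FM_smult pt w0(2))
      have wr: "(\<lambda>i. real N * v i - flatten k w i) \<in> rows k"
        using w JD(1) vr by (intro function_subspaceD(3,5)[OF finite_support_subspace] flatten_rows) auto
      have "(\<lambda>i. real N * (c * f i + v i) - flatten k w' i)
          = (\<lambda>i. (real N * c - of_int n) * f i + (real N * v i - flatten k w i))"
        unfolding fl by (auto simp: algebra_simps)
      then have "row_norm k (\<lambda>i. real N * (c * f i + v i) - flatten k w' i)
          \<le> \<bar>real N * c - of_int n\<bar> * row_norm k f + row_norm k (\<lambda>i. real N * v i - flatten k w i)"
        using row_norm_add[OF function_subspaceD(3)[OF finite_support_subspace w0r] wr] by (simp add: row_norm_scale)
      also have "\<dots> \<le> 1 * row_norm k f + K"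
      proof (intro add_mono mult_right_mono w(2))
        show "\<bar>real N * c - of_int n\<bar> \<le> 1" unfolding n_def by linarith
        show "0 \<le> row_norm k f" unfolding row_norm_def by (intro sum_nonneg l1_norm_nonneg)
      qed
      finally show ?thesis using w'J by auto
    qed
    then show ?case by blast
  qed
  then show ?thesis using that by blast
qed

theorem exists_invertible_matrix:
  assumes J: "submodule J (group_ring \<Gamma>) (FM k)"
    and ann: "\<And>y j s. (\<And>j. j < k \<Longrightarrow> bdd (y j)) \<Longrightarrow>
        (\<And>w. w \<in> J \<Longrightarrow> (\<Sum>j<k. pairing (l1_of (w j)) (y j)) = 0) \<Longrightarrow> j < k \<Longrightarrow> s \<in> G \<Longrightarrow> y j s = 0"
  shows "\<exists>A\<in>carrier (matrix_ring (group_ring \<Gamma>) k). matrix_l1_of k A \<in> Units (MatL k) \<and> (\<forall>i<k. A i \<in> J)"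
proof -
  note JD = submoduleD[OF J]
  let ?W = "real_span (flatten k ` J)"
  let ?d = "\<lambda>i j. if j = i then 1 else 0 :: real"
  have row_unit: "(\<lambda>s. ?d (i, \<one>) (j, s)) = mat_one i j" for i j
    by (auto simp: mat_one_def l1_ring_def)
  \<comment> \<open>A tolerance of \<open>1/4\<close> here and of \<open>1/4\<close> for the
    rounding add up to the \<open>1/2\<close> required by \<open>Neumann_inverse\<close>.\<close>
  have "\<exists>w\<in>?W. row_norm k (\<lambda>j. ?d (i, \<one>) j - w j) < 1/4" if i: "i < k" for i
  proof (rule dense_of_trivial_annihilator[of ?W "{..<k} \<times> G"])
    show "function_subspace ?W" by (rule real_span_subspace)
    show "?W \<subseteq> rows k" by (rule real_span_rows[OF JD(1)])
    show "row_norm k (\<lambda>i. v i + w i) \<le> row_norm k v + row_norm k w"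
      if "v \<in> rows k" "w \<in> rows k" for v w using that by (rule row_norm_add)
    show "row_norm k (\<lambda>i. t * v i) = \<bar>t\<bar> * row_norm k v" for t v by (rule row_norm_scale)
    show "row_norm k (?d p) \<le> 1" if p: "p \<in> {..<k} \<times> G" for p
    proof -
      obtain i s where ps: "p = (i, s)" "i < k" "s \<in> G" using p by auto
      have "l1_norm (\<lambda>t. ?d p (j, t)) = (if j = i then 1 else 0)" for j
      proof -
        have "l1_norm (\<lambda>t. ?d p (j, t)) = (\<Sum>t\<in>{s}. \<bar>?d p (j, t)\<bar>)"
          unfolding l1_norm_def using ps by (intro infsum_finite_support) auto
        then show ?thesis using ps by simp
      qed
      then show ?thesis using ps by (simp add: row_norm_def)
    qed
    show "(i, \<one>) \<in> {..<k} \<times> G" using i by simp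
    fix y assume y: "\<And>i. i \<in> {..<k} \<times> G \<Longrightarrow> \<bar>y i\<bar> \<le> 1"
      and an: "\<And>w. w \<in> ?W \<Longrightarrow> (\<Sum>i\<in>{i. w i \<noteq> 0}. w i * y i) = 0"
    have "y (j, s) = 0" if "j < k" "s \<in> G" for j s
    proof (rule ann[of "\<lambda>j s. y (j, s)", OF _ _ that])
      show "bdd (\<lambda>s. y (j, s))" if "j < k" for j using y that by (intro bddI[of _ 1]) auto
      show "(\<Sum>j<k. pairing (l1_of (w j)) (\<lambda>s. y (j, s))) = 0" if "w \<in> J" for w
        using an[OF real_span_incl, of "flatten k w"] that flatten_pairing[of w k y] JD(1) by auto
    qed
    then show "\<forall>i\<in>{..<k} \<times> G. y i = 0" by auto
  qed simp
  then have "\<forall>i\<in>{..<k}. \<exists>w. w \<in> ?W \<and> row_norm k (\<lambda>j. ?d (i, \<one>) j - w j) < 1/4" by blast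
  from bchoice[OF this] obtain v where "\<forall>i\<in>{..<k}. v i \<in> ?W \<and> row_norm k (\<lambda>j. ?d (i, \<one>) j - v i j) < 1/4" ..
  then have v: "\<And>i. i < k \<Longrightarrow> v i \<in> ?W"
    "\<And>i. i < k \<Longrightarrow> row_norm k (\<lambda>j. ?d (i, \<one>) j - v i j) < 1/4" by blast+
  have "\<exists>K. \<forall>N::nat. \<exists>w\<in>J. row_norm k (\<lambda>j. real N * v i j - flatten k w j) \<le> K" if "i < k" for i
    by (rule real_span_integral_approx[OF J v(1)[OF that]]) blast
  then have "\<forall>i\<in>{..<k}. \<exists>K. \<forall>N::nat. \<exists>w\<in>J. row_norm k (\<lambda>j. real N * v i j - flatten k w j) \<le> K" by blast
  from bchoice[OF this] obtain K where "\<forall>i\<in>{..<k}. \<forall>N::nat. \<exists>w\<in>J. row_norm k (\<lambda>j. real N * v i j - flatten k w j) \<le> K i" ..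
  then have K: "\<exists>w\<in>J. row_norm k (\<lambda>j. real N * v i j - flatten k w j) \<le> K i" if "i < k" for i N
    using that by blast
  \<comment> \<open>Large enough that each rounding error, at most \<open>K i\<close>, is at most
    \<open>1/4\<close> after division by \<open>N\<close>; \<open>Suc\<close> keeps \<open>N\<close>
    positive even if all errors are \<open>0\<close>.\<close>
  define N where "N = Suc (nat \<lceil>\<Sum>i<k. 4 * \<bar>K i\<bar>\<rceil>)"
  have N: "real N > 0" by (simp add: N_def)
  have NK: "4 * K i \<le> real N" if "i < k" for i
  proof -
    have "4 * K i \<le> 4 * \<bar>K i\<bar>" by simp
    also have "\<dots> \<le> (\<Sum>i<k. 4 * \<bar>K i\<bar>)" using that by (intro member_le_sum) auto
    also have "\<dots> \<le> real N" unfolding N_def by linarith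
    finally show ?thesis .
  qed
  have "\<forall>i\<in>{..<k}. \<exists>w. w \<in> J \<and> row_norm k (\<lambda>j. real N * v i j - flatten k w j) \<le> K i"
    using K[of _ N] by blast
  from bchoice[OF this] obtain w where
    "\<forall>i\<in>{..<k}. w i \<in> J \<and> row_norm k (\<lambda>j. real N * v i j - flatten k (w i) j) \<le> K i" ..
  then have w: "\<And>i. i < k \<Longrightarrow> w i \<in> J"
    "\<And>i. i < k \<Longrightarrow> row_norm k (\<lambda>j. real N * v i j - flatten k (w i) j) \<le> K i" by blast+
  \<comment> \<open>The deviation from the identity of the matrix with rows \<open>w i\<close>,
    divided by \<open>N\<close>.\<close>
  define E where "E i j s = mat_one i j s - (1 / real N) * l1_of (w i j) s" for i j s
  have wL: "l1_of (w i j) \<in> L1" if "i < k" "j < k" for i j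
    by (rule ZG_L1[OF submodule_entry[OF J w(1)[OF that(1)] that(2)]])
  have E: "mat_L1 k E"
    unfolding mat_L1_def E_def by (intro allI impI L1_diff L1_scale wL mat_L1D[OF mat_L1_one])
  have EN: "(\<Sum>j<k. l1_norm (E i j)) \<le> 1/2" if i: "i < k" for i
  proof -
    have vr: "v i \<in> rows k" using v(1)[OF i] real_span_rows[OF JD(1)] by blast
    have wr: "flatten k (w i) \<in> rows k" using flatten_rows w(1)[OF i] JD(1) by blast
    have dr: "?d (i, \<one>) \<in> rows k" using i by (simp add: finite_support_def)
    have r1: "(\<lambda>j. ?d (i, \<one>) j - v i j) \<in> rows k" by (rule function_subspaceD(5)[OF finite_support_subspace dr vr])
    have r2: "(\<lambda>j. real N * v i j - flatten k (w i) j) \<in> rows k"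
      by (intro function_subspaceD(3,5)[OF finite_support_subspace] vr wr)
    have "(\<Sum>j<k. l1_norm (E i j)) = row_norm k (\<lambda>j. ?d (i, \<one>) j - (1 / real N) * flatten k (w i) j)"
      unfolding row_norm_def
    proof (intro sum.cong refl)
      fix j assume j: "j \<in> {..<k}"
      have "E i j = (\<lambda>s. ?d (i, \<one>) (j, s) - (1 / real N) * flatten k (w i) (j, s))"
        using j by (intro ext) (simp add: E_def row_unit[symmetric] flatten_def l1_of_def)
      then show "l1_norm (E i j) = l1_norm (\<lambda>s. ?d (i, \<one>) (j, s) - (1 / real N) * flatten k (w i) (j, s))" by simp
    qed
    also have "(\<lambda>j. ?d (i, \<one>) j - (1 / real N) * flatten k (w i) j)
        = (\<lambda>j. (?d (i, \<one>) j - v i j) + (1 / real N) * (real N * v i j - flatten k (w i) j))"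
      using N by (auto simp: field_simps)
    also have "row_norm k \<dots> \<le> row_norm k (\<lambda>j. ?d (i, \<one>) j - v i j)
        + row_norm k (\<lambda>j. (1 / real N) * (real N * v i j - flatten k (w i) j))"
      by (rule row_norm_add[OF r1 function_subspaceD(3)[OF finite_support_subspace r2]])
    also have "\<dots> \<le> 1/4 + (1 / real N) * K i"
    proof -
      have "\<bar>1 / real N\<bar> * row_norm k (\<lambda>j. real N * v i j - flatten k (w i) j) \<le> \<bar>1 / real N\<bar> * K i"
        by (rule mult_left_mono[OF w(2)[OF i]]) simp
      then show ?thesis unfolding row_norm_scale using v(2)[OF i] by simp
    qed
    also have "\<dots> \<le> 1/4 + 1/4" using NK[OF i] N by (simp add: field_simps)
    finally show ?thesis by simp
  qed
  have "\<exists>B. mat_L1 k B \<and>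
      (\<forall>i<k. \<forall>j<k. mat_mult k B (\<lambda>i j s. mat_one i j s - E i j s) i j = mat_one i j) \<and>
      (\<forall>i<k. \<forall>j<k. mat_mult k (\<lambda>i j s. mat_one i j s - E i j s) B i j = mat_one i j)"
    by (rule Neumann_inverse[OF E EN]) blast+
  then obtain B where B: "mat_L1 k B"
    "\<And>i j. i < k \<Longrightarrow> j < k \<Longrightarrow> mat_mult k B (\<lambda>i j s. mat_one i j s - E i j s) i j = mat_one i j"
    "\<And>i j. i < k \<Longrightarrow> j < k \<Longrightarrow> mat_mult k (\<lambda>i j s. mat_one i j s - E i j s) B i j = mat_one i j"
    by blast
  have IE: "(\<lambda>i j s. mat_one i j s - E i j s) = (\<lambda>i j s. (1 / real N) * l1_of (w i j) s)"
    by (auto simp: E_def)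
  define A where "A = (\<lambda>i\<in>{..<k}. w i)"
  have A: "A \<in> carrier (matrix_ring (group_ring \<Gamma>) k)"
    using w(1) JD(1) by (auto simp: A_def matrix_ring_def FM_carrier)
  have Al: "matrix_l1_of k A i j = l1_of (w i j)" if "i < k" "j < k" for i j
    using that by (simp add: matrix_l1_of_def A_def)
  \<comment> \<open>The Neumann series inverts the matrix divided by \<open>N\<close>; the missing
    factor is put into the inverse.\<close>
  define C where "C i j = (\<lambda>s. (1 / real N) * B i j s)" for i j
  have "matrix_l1_of k A \<in> Units (MatL k)"
  proof (rule matrix_unitI)
    show "matrix_l1_of k A \<in> carrier (MatL k)"
      using wL by (auto simp: matrix_l1_of_def matrix_ring_def A_def)
    show "mat_L1 k C" unfolding mat_L1_def C_def by (intro allI impI L1_scale mat_L1D[OF B(1)])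
    fix i j assume ij: "i < k" "j < k"
    have "mat_mult k C (matrix_l1_of k A) i j = mat_mult k B (\<lambda>i j s. (1 / real N) * l1_of (w i j) s) i j"
      unfolding mat_mult_def using ij
      by (intro ext sum.cong refl) (simp only: Al C_def conv_scale_left conv_scale_right lessThan_iff)
    then show "mat_mult k C (matrix_l1_of k A) i j = mat_one i j" using B(2)[OF ij] IE by simp
    have "mat_mult k (matrix_l1_of k A) C i j = mat_mult k (\<lambda>i j s. (1 / real N) * l1_of (w i j) s) B i j"
      unfolding mat_mult_def using ij
      by (intro ext sum.cong refl) (simp only: Al C_def conv_scale_left conv_scale_right lessThan_iff)
    then show "mat_mult k (matrix_l1_of k A) C i j = mat_one i j" using B(3)[OF ij] IE by simp
  qed
  moreover have "\<forall>i<k. A i \<in> J" using w(1) by (simp add: A_def)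
  ultimately show ?thesis using A by blast
qed

end

section \<open>Presentations of the dual module\<close>

context discrete_group begin

lemma l1_of_add: "l1_of (\<lambda>s. a s + b s) = (\<lambda>s. l1_of a s + l1_of b s)"
  by (simp add: l1_of_def)

text \<open>Laws of the group ring are pulled back from l1 along this embedding.\<close>

lemma l1_of_inj: "l1_of a = l1_of b \<Longrightarrow> a = b"
  by (auto simp: l1_of_def fun_eq_iff)

lemma ZG_distrib:
  assumes "a \<in> ZG" "b \<in> ZG" "c \<in> ZG"
  shows "a \<otimes>\<^bsub>group_ring \<Gamma>\<^esub> (\<lambda>s. b s + c s)
    = (\<lambda>s. (a \<otimes>\<^bsub>group_ring \<Gamma>\<^esub> b) s + (a \<otimes>\<^bsub>group_ring \<Gamma>\<^esub> c) s)"
  by (rule l1_of_inj) (simp add: l1_of_mult assms l1_of_add conv_add_right ZG_L1)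

lemma ZG_mult_zero: "a \<otimes>\<^bsub>group_ring \<Gamma>\<^esub> (\<lambda>s. 0) = (\<lambda>s. 0)"
  by (auto simp: group_ring_def)

lemma ZG_mult_one: "a \<in> ZG \<Longrightarrow> a \<otimes>\<^bsub>group_ring \<Gamma>\<^esub> point \<one> 1 = a"
proof (rule l1_of_inj)
  assume a: "a \<in> ZG"
  have "l1_of (point \<one> 1) = unit1" by (auto simp: l1_of_def point_def l1_ring_def)
  then show "l1_of (a \<otimes>\<^bsub>group_ring \<Gamma>\<^esub> point \<one> 1) = l1_of a"
    using a by (simp add: l1_of_mult conv_one_right ZG_L1)
qed

lemma FM_entry: "w \<in> carrier (FM k) \<Longrightarrow> j < k \<Longrightarrow> w j \<in> ZG"
  by (auto simp: FM_carrier)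

lemma FM_uminus_closed: "v \<in> carrier (FM k) \<Longrightarrow> (\<lambda>i\<in>{..<k}. \<lambda>s. - v i s) \<in> carrier (FM k)"
  unfolding FM_carrier restrict_PiE_iff by (intro ballI ZG_minus) (rule PiE_mem)

lemma abelian_group_FM: "abelian_group (FM k)"
proof (rule abelian_groupI)
  show "\<zero>\<^bsub>FM k\<^esub> \<in> carrier (FM k)" by (simp add: FM_carrier FM_zero ZG_zero)
  fix x assume x: "x \<in> carrier (FM k)"
  have "(\<lambda>i\<in>{..<k}. \<lambda>s. - x i s) \<oplus>\<^bsub>FM k\<^esub> x = \<zero>\<^bsub>FM k\<^esub>"
    unfolding FM_add FM_zero by (intro restrict_ext) simp
  then show "\<exists>y\<in>carrier (FM k). y \<oplus>\<^bsub>FM k\<^esub> x = \<zero>\<^bsub>FM k\<^esub>" using FM_uminus_closed[OF x] by blast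
  show "\<zero>\<^bsub>FM k\<^esub> \<oplus>\<^bsub>FM k\<^esub> x = x"
    by (rule extensionalityI[of _ "{..<k}"]) (use x in \<open>simp_all add: FM_carrier FM_add FM_zero PiE_def\<close>)
  fix y assume y: "y \<in> carrier (FM k)"
  show "x \<oplus>\<^bsub>FM k\<^esub> y \<in> carrier (FM k)" by (rule FM_add_closed[OF x y])
  show "x \<oplus>\<^bsub>FM k\<^esub> y = y \<oplus>\<^bsub>FM k\<^esub> x" unfolding FM_add by (intro restrict_ext) (simp add: add.commute)
  show "x \<oplus>\<^bsub>FM k\<^esub> y \<oplus>\<^bsub>FM k\<^esub> z = x \<oplus>\<^bsub>FM k\<^esub> (y \<oplus>\<^bsub>FM k\<^esub> z)" for z
    unfolding FM_add by (intro restrict_ext) (simp add: add.assoc)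
qed

lemma FM_smult_distrib:
  assumes "a \<in> ZG" "v \<in> carrier (FM k)" "w \<in> carrier (FM k)"
  shows "a \<odot>\<^bsub>FM k\<^esub> (v \<oplus>\<^bsub>FM k\<^esub> w) = (a \<odot>\<^bsub>FM k\<^esub> v) \<oplus>\<^bsub>FM k\<^esub> (a \<odot>\<^bsub>FM k\<^esub> w)"
  unfolding FM_smult FM_add
  using assms by (intro restrict_ext) (simp add: ZG_distrib FM_entry)

lemma submodule_abelian_subgroup:
  assumes "submodule J (group_ring \<Gamma>) (FM k)"
  shows "abelian_subgroup J (FM k)"
  using assms by (intro abelian_subgroupI3 abelian_group_FM) (simp add: additive_subgroup_def submodule_def)

abbreviation QM where "QM k J \<equiv> quotient_left_module (FM k) J"

lemma QM_carrier: "carrier (QM k J) = {J +>\<^bsub>FM k\<^esub> v | v. v \<in> carrier (FM k)}"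
  by (auto simp: quotient_left_module_def A_RCOSETS_def RCOSETS_def a_r_coset_def)

lemma FM_coset_iff: "w \<in> J +>\<^bsub>FM k\<^esub> v \<longleftrightarrow> (\<exists>u\<in>J. w = u \<oplus>\<^bsub>FM k\<^esub> v)"
  by (auto simp: a_r_coset_def')

context
  fixes k J assumes J: "submodule J (group_ring \<Gamma>) (FM k)"
begin

interpretation F: abelian_group "FM k" by (rule abelian_group_FM)
interpretation S: abelian_subgroup J "FM k" by (rule submodule_abelian_subgroup[OF J])

lemma coset_eqD:
  assumes "v \<in> carrier (FM k)" "w \<in> carrier (FM k)" "J +>\<^bsub>FM k\<^esub> v = J +>\<^bsub>FM k\<^esub> w"
  obtains u where "u \<in> J" "v = u \<oplus>\<^bsub>FM k\<^esub> w"
proof -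
  have "v \<in> J +>\<^bsub>FM k\<^esub> w" using S.a_rcos_self[OF assms(1)] assms(3) by simp
  then show ?thesis using that unfolding FM_coset_iff by blast
qed

lemma coset_add_member:
  assumes "u \<in> J" "w \<in> carrier (FM k)"
  shows "J +>\<^bsub>FM k\<^esub> (u \<oplus>\<^bsub>FM k\<^esub> w) = J +>\<^bsub>FM k\<^esub> w"
proof -
  have "u \<oplus>\<^bsub>FM k\<^esub> w \<in> J +>\<^bsub>FM k\<^esub> w" using assms(1) unfolding FM_coset_iff by blast
  from F.a_repr_independence[OF this assms(2) S.a_subgroup] show ?thesis by simp
qed

lemma coset_eq_submodule_iff:
  assumes "v \<in> carrier (FM k)"
  shows "J +>\<^bsub>FM k\<^esub> v = J \<longleftrightarrow> v \<in> J"
  using F.a_coset_join1[OF _ assms S.a_subgroup] F.a_coset_join2[OF assms S.a_subgroup] by blast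

lemma QM_add:
  assumes "v \<in> carrier (FM k)" "w \<in> carrier (FM k)"
  shows "(J +>\<^bsub>FM k\<^esub> v) \<oplus>\<^bsub>QM k J\<^esub> (J +>\<^bsub>FM k\<^esub> w) = J +>\<^bsub>FM k\<^esub> (v \<oplus>\<^bsub>FM k\<^esub> w)"
  using S.a_rcos_sum[OF assms] by (simp add: quotient_left_module_def)

text \<open>Changing \<open>v\<close> inside its coset changes \<open>a v\<close> by an element of
  \<open>J\<close>, so the union that defines the product is over copies of a single coset.\<close>

lemma QM_smult:
  assumes a: "a \<in> ZG" and v: "v \<in> carrier (FM k)"
  shows "a \<odot>\<^bsub>QM k J\<^esub> (J +>\<^bsub>FM k\<^esub> v) = J +>\<^bsub>FM k\<^esub> (a \<odot>\<^bsub>FM k\<^esub> v)"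
proof -
  have "J +>\<^bsub>FM k\<^esub> (a \<odot>\<^bsub>FM k\<^esub> u) = J +>\<^bsub>FM k\<^esub> (a \<odot>\<^bsub>FM k\<^esub> v)" if "u \<in> J +>\<^bsub>FM k\<^esub> v" for u
  proof -
    from that have "\<exists>j\<in>J. u = j \<oplus>\<^bsub>FM k\<^esub> v" by (rule FM_coset_iff[THEN iffD1])
    then obtain j where j: "j \<in> J" "u = j \<oplus>\<^bsub>FM k\<^esub> v" by (rule bexE)
    have jF: "j \<in> carrier (FM k)" using j(1) submoduleD(1)[OF J] by blast
    have "a \<odot>\<^bsub>FM k\<^esub> u = (a \<odot>\<^bsub>FM k\<^esub> j) \<oplus>\<^bsub>FM k\<^esub> (a \<odot>\<^bsub>FM k\<^esub> v)"
      unfolding j(2) by (rule FM_smult_distrib[OF a jF v])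
    then show ?thesis using coset_add_member[OF submoduleD(4)[OF J a j(1)] FM_smult_closed[OF a v]] by simp
  qed
  moreover have "v \<in> J +>\<^bsub>FM k\<^esub> v" by (rule S.a_rcos_self[OF v])
  moreover have "(\<Union>u\<in>C. f u) = K" if "\<And>u. u \<in> C \<Longrightarrow> f u = K" "u \<in> C" for C K u and f :: "(nat \<Rightarrow> 'g \<Rightarrow> int) \<Rightarrow> (nat \<Rightarrow> 'g \<Rightarrow> int) set"
    using that by blast
  ultimately have "(\<Union>u\<in>J +>\<^bsub>FM k\<^esub> v. J +>\<^bsub>FM k\<^esub> (a \<odot>\<^bsub>FM k\<^esub> u)) = J +>\<^bsub>FM k\<^esub> (a \<odot>\<^bsub>FM k\<^esub> v)" by blast
  then show ?thesis by (simp add: quotient_left_module_def)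
qed

end

text \<open>The exponential turns products of integral powers into sums, and so the multiplicatively
  written module action into the real pairing.\<close>

lemma cis_pairing:
  assumes "a \<in> ZG"
  shows "(\<Prod>s\<in>{s. a s \<noteq> 0}. cis (y s) powi a s) = cis (pairing (l1_of a) y)"
proof -
  have "(\<Prod>s\<in>S. cis (y s) powi a s) = cis (\<Sum>s\<in>S. of_int (a s) * y s)" if "finite S" for S
    using that by (induction S rule: finite_induct) (auto simp: cis_power_int cis_mult)
  then show ?thesis using assms by (simp add: pairing_ZG ZG_iff)
qed

text \<open>Integral coefficients make the result depend on \<open>y\<close> modulo
  \<open>2 * pi\<close> only. Any choice of arguments for the values of a character is therefore as
  good as any other.\<close>

lemma cis_pairing_cong:
  assumes "a \<in> ZG" "\<And>s. s \<in> G \<Longrightarrow> cis (y s) = cis (z s)"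
  shows "cis (pairing (l1_of a) y) = cis (pairing (l1_of a) z)"
  unfolding cis_pairing[OF assms(1), symmetric]
  using assms by (intro prod.cong) (auto simp: ZG_iff)

end

lemma cis_Arg_unit: "cmod z = 1 \<Longrightarrow> cis (Arg z) = z"
  by (subst cis_Arg) (auto simp: sgn_div_norm)

locale algebraic_action = D: discrete_group \<Gamma> + C: compact_group_mean X T m
  for \<Gamma> :: "'g monoid" and X :: "'x monoid" and T and m +
  fixes \<alpha> :: "'g \<Rightarrow> 'x \<Rightarrow> 'x"
  assumes action: "acts_by_automorphisms \<Gamma> X T \<alpha>"
begin

abbreviation "M \<equiv> dual_module \<Gamma> X T \<alpha>"
abbreviation "chars \<equiv> characters X T"

section \<open>The action on points and on characters\<close>

lemma act_auto: "s \<in> carrier \<Gamma> \<Longrightarrow> \<alpha> s \<in> auto X"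
  using action by (auto simp: acts_by_automorphisms_def hom_def AutoGroup_def)

lemma act_closed: "s \<in> carrier \<Gamma> \<Longrightarrow> x \<in> carrier X \<Longrightarrow> \<alpha> s x \<in> carrier X"
  using act_auto by (force simp: auto_def hom_def)

lemma act_mult: "s \<in> carrier \<Gamma> \<Longrightarrow> x \<in> carrier X \<Longrightarrow> y \<in> carrier X \<Longrightarrow>
    \<alpha> s (x \<otimes>\<^bsub>X\<^esub> y) = \<alpha> s x \<otimes>\<^bsub>X\<^esub> \<alpha> s y"
  using act_auto by (force simp: auto_def hom_def)

lemma act_inj: "s \<in> carrier \<Gamma> \<Longrightarrow> inj_on (\<alpha> s) (carrier X)"
  using act_auto by (force simp: auto_def Bij_def bij_betw_def)

lemma act_comp:
  assumes s: "s \<in> carrier \<Gamma>" "t \<in> carrier \<Gamma>" and x: "x \<in> carrier X"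
  shows "\<alpha> (s \<otimes>\<^bsub>\<Gamma>\<^esub> t) x = \<alpha> s (\<alpha> t x)"
proof -
  have B: "\<alpha> s \<in> Bij (carrier X)" "\<alpha> t \<in> Bij (carrier X)" using act_auto s by (auto simp: auto_def)
  have "\<alpha> (s \<otimes>\<^bsub>\<Gamma>\<^esub> t) = \<alpha> s \<otimes>\<^bsub>AutoGroup X\<^esub> \<alpha> t"
    using action s by (auto simp: acts_by_automorphisms_def hom_def)
  also have "\<dots> = compose (carrier X) (\<alpha> s) (\<alpha> t)" using B by (simp add: AutoGroup_def BijGroup_def)
  finally show ?thesis using x by (simp add: compose_def)
qed

lemma act_one: "x \<in> carrier X \<Longrightarrow> \<alpha> \<one>\<^bsub>\<Gamma>\<^esub> x = x"
  using act_comp[of "\<one>\<^bsub>\<Gamma>\<^esub>" "\<one>\<^bsub>\<Gamma>\<^esub>" x] act_inj[of "\<one>\<^bsub>\<Gamma>\<^esub>"] act_closed[of "\<one>\<^bsub>\<Gamma>\<^esub>" x]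
  by (simp add: inj_on_eq_iff)

lemma act_cont: "s \<in> carrier \<Gamma> \<Longrightarrow> continuous_map T T (\<alpha> s)"
  using action by (simp add: acts_by_automorphisms_def)

lemma act_id: "s \<in> carrier \<Gamma> \<Longrightarrow> \<alpha> s \<one>\<^bsub>X\<^esub> = \<one>\<^bsub>X\<^esub>"
  using act_mult[of s "\<one>\<^bsub>X\<^esub>" "\<one>\<^bsub>X\<^esub>"] act_closed[of s "\<one>\<^bsub>X\<^esub>"] C.l_cancel_one by simp

lemma act_inv: "s \<in> carrier \<Gamma> \<Longrightarrow> x \<in> carrier X \<Longrightarrow> \<alpha> s (inv\<^bsub>X\<^esub> x) = inv\<^bsub>X\<^esub> (\<alpha> s x)"
proof -
  assume s: "s \<in> carrier \<Gamma>" and x: "x \<in> carrier X"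
  have "\<alpha> s (inv\<^bsub>X\<^esub> x) \<otimes>\<^bsub>X\<^esub> \<alpha> s x = \<one>\<^bsub>X\<^esub>"
    using act_mult[OF s, of "inv\<^bsub>X\<^esub> x" x] x act_id[OF s] by simp
  then show ?thesis using C.inv_equality act_closed[OF s] x by simp
qed

text \<open>With real angles, the action of group ring elements on characters becomes the pairing of
  \<open>\<ell>\<^sup>1(\<Gamma>)\<close> with bounded functions.\<close>

definition ang :: "('x \<Rightarrow> complex) \<Rightarrow> 'x \<Rightarrow> 'g \<Rightarrow> real" where
  "ang \<phi> x s = Arg (\<phi> (\<alpha> (inv\<^bsub>\<Gamma>\<^esub> s) x))"

lemma ang_bound: "\<bar>ang \<phi> x s\<bar> \<le> pi"
  using Arg_bounded[of "\<phi> (\<alpha> (inv\<^bsub>\<Gamma>\<^esub> s) x)"] by (auto simp: ang_def)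

lemma ang_bdd: "D.bdd (ang \<phi> x)"
  by (rule D.bddI[OF ang_bound])

lemma cis_ang:
  assumes "\<phi> \<in> chars" "x \<in> carrier X" "s \<in> carrier \<Gamma>"
  shows "cis (ang \<phi> x s) = \<phi> (\<alpha> (inv\<^bsub>\<Gamma>\<^esub> s) x)"
  unfolding ang_def using assms by (intro cis_Arg_unit C.char_norm act_closed) auto

lemma M_simps: "carrier M = chars" "\<phi> \<oplus>\<^bsub>M\<^esub> \<psi> = C.char_mult \<phi> \<psi>" "\<zero>\<^bsub>M\<^esub> = C.char_one"
  by (simp_all add: dual_module_def C.char_mult_def C.char_one_def)

lemma smult_apply:
  assumes a: "a \<in> D.ZG" and \<phi>: "\<phi> \<in> chars" and x: "x \<in> carrier X"
  shows "(a \<odot>\<^bsub>M\<^esub> \<phi>) x = cis (D.pairing (l1_of a) (ang \<phi> x))"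
proof -
  have "(a \<odot>\<^bsub>M\<^esub> \<phi>) x = (\<Prod>s\<in>{s. a s \<noteq> 0}. cis (ang \<phi> x s) powi a s)"
    using x a \<phi> by (auto simp: dual_module_def D.ZG_iff cis_ang subset_iff intro!: prod.cong)
  then show ?thesis using D.cis_pairing[OF a] by simp
qed

lemma smult_ext: "a \<odot>\<^bsub>M\<^esub> \<phi> \<in> extensional (carrier X)"
  by (simp add: dual_module_def)

lemma char_power_closed:
  assumes \<phi>: "\<phi> \<in> chars"
  shows "(\<lambda>x\<in>carrier X. \<phi> x powi n) \<in> chars"
proof -
  have nat: "(\<lambda>x\<in>carrier X. \<phi> x ^ n) \<in> chars" for n
  proof (induction n)
    case 0 then show ?case using C.char_one_closed unfolding C.char_one_def by (simp only: power_0)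
  next
    case (Suc n)
    have eq: "(\<lambda>x\<in>carrier X. \<phi> x ^ Suc n) = C.char_mult \<phi> (\<lambda>x\<in>carrier X. \<phi> x ^ n)"
      by (auto simp: C.char_mult_def)
    show ?case unfolding eq by (rule C.char_mult_closed[OF \<phi> Suc])
  qed
  show ?thesis
  proof (cases "n \<ge> 0")
    case True then show ?thesis using nat[of "nat n"] by (simp add: power_int_def)
  next
    case False
    have inv: "inverse (\<phi> x) = cnj (\<phi> x)" if "x \<in> carrier X" for x
      using C.char_norm[OF \<phi> that] by (intro inverse_unique) (simp flip: complex_norm_square)
    have "(\<lambda>x\<in>carrier X. \<phi> x powi n) = C.char_cnj (\<lambda>x\<in>carrier X. \<phi> x ^ nat (- n))"
      using False by (auto simp: C.char_cnj_def power_int_def inv)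
    then show ?thesis using C.char_cnj_closed[OF nat] by simp
  qed
qed

lemma char_prod_closed:
  assumes "finite S" "\<And>s. s \<in> S \<Longrightarrow> f s \<in> chars"
  shows "(\<lambda>x\<in>carrier X. \<Prod>s\<in>S. f s x) \<in> chars"
  using assms
proof (induction S rule: finite_induct)
  case empty then show ?case using C.char_one_closed unfolding C.char_one_def by (simp only: prod.empty)
next
  case (insert s S)
  then have eq: "(\<lambda>x\<in>carrier X. \<Prod>s\<in>insert s S. f s x) = C.char_mult (f s) (\<lambda>x\<in>carrier X. \<Prod>s\<in>S. f s x)"
    by (auto simp: C.char_mult_def)
  have "(\<lambda>x\<in>carrier X. \<Prod>s\<in>S. f s x) \<in> chars" by (rule insert.IH) (use insert.prems in auto)
  then show ?case unfolding eq by (rule C.char_mult_closed[rotated]) (use insert.prems in auto)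
qed

lemma translate_closed:
  assumes s: "s \<in> carrier \<Gamma>" and \<phi>: "\<phi> \<in> chars"
  shows "(\<lambda>x\<in>carrier X. \<phi> (\<alpha> s x)) \<in> chars"
  by (rule C.charI)
     (use s \<phi> act_closed in \<open>auto simp: C.char_norm C.char_hom act_mult
        intro!: C.cont_restrict C.cont_comp[OF C.char_cont act_cont]\<close>)

lemma smult_closed:
  assumes a: "a \<in> D.ZG" and \<phi>: "\<phi> \<in> chars"
  shows "a \<odot>\<^bsub>M\<^esub> \<phi> \<in> chars"
proof -
  let ?f = "\<lambda>s. (\<lambda>x\<in>carrier X. (\<lambda>x\<in>carrier X. \<phi> (\<alpha> (inv\<^bsub>\<Gamma>\<^esub> s) x)) x powi a s)"
  have "a \<odot>\<^bsub>M\<^esub> \<phi> = (\<lambda>x\<in>carrier X. \<Prod>s\<in>{s. a s \<noteq> 0}. ?f s x)"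
    by (auto simp: dual_module_def)
  moreover have "(\<lambda>x\<in>carrier X. \<Prod>s\<in>{s. a s \<noteq> 0}. ?f s x) \<in> chars"
    using a by (intro char_prod_closed char_power_closed translate_closed \<phi>) (auto simp: D.ZG_iff)
  ultimately show ?thesis by simp
qed

text \<open>The inverse in the definition of \<open>ang\<close> makes the action on points a left
  translation of the angle function.\<close>

lemma ang_shift:
  assumes "t \<in> carrier \<Gamma>" "s \<in> carrier \<Gamma>" "x \<in> carrier X"
  shows "ang \<phi> (\<alpha> (inv\<^bsub>\<Gamma>\<^esub> t) x) s = ang \<phi> x (t \<otimes>\<^bsub>\<Gamma>\<^esub> s)"
  using assms by (simp add: ang_def D.inv_mult_group act_comp)

text \<open>The module homomorphism from the free module to the dual with images
  \<open>\<phi> j\<close> of the basis vectors. Written with angles, its additivity is that of the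
  pairing.\<close>

definition lin :: "nat \<Rightarrow> (nat \<Rightarrow> 'x \<Rightarrow> complex) \<Rightarrow> (nat \<Rightarrow> 'g \<Rightarrow> int) \<Rightarrow> 'x \<Rightarrow> complex" where
  "lin k \<phi> w = (\<lambda>x\<in>carrier X. cis (\<Sum>j<k. D.pairing (l1_of (w j)) (ang (\<phi> j) x)))"

lemma lin_0: "lin 0 \<phi> w = C.char_one"
  by (auto simp: lin_def C.char_one_def)

lemma lin_Suc:
  assumes "w k \<in> D.ZG" "\<phi> k \<in> chars"
  shows "lin (Suc k) \<phi> w = C.char_mult (lin k \<phi> w) (w k \<odot>\<^bsub>M\<^esub> \<phi> k)"
proof
  fix x show "lin (Suc k) \<phi> w x = C.char_mult (lin k \<phi> w) (w k \<odot>\<^bsub>M\<^esub> \<phi> k) x"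
    using smult_apply[OF assms, of x] by (simp add: lin_def C.char_mult_def cis_mult)
qed

lemma lin_closed: "(\<And>j. j < k \<Longrightarrow> w j \<in> D.ZG) \<Longrightarrow> (\<And>j. j < k \<Longrightarrow> \<phi> j \<in> chars) \<Longrightarrow> lin k \<phi> w \<in> chars"
  by (induction k) (auto simp: lin_0 lin_Suc C.char_one_closed intro!: C.char_mult_closed smult_closed)

lemma lin_add:
  assumes "v \<in> carrier (D.FM k)" "w \<in> carrier (D.FM k)"
  shows "lin k \<phi> (v \<oplus>\<^bsub>D.FM k\<^esub> w) = C.char_mult (lin k \<phi> v) (lin k \<phi> w)"
proof
  fix x
  have "D.pairing (l1_of (\<lambda>s. v j s + w j s)) (ang (\<phi> j) x)
      = D.pairing (l1_of (v j)) (ang (\<phi> j) x) + D.pairing (l1_of (w j)) (ang (\<phi> j) x)" if "j < k" for j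
    unfolding D.l1_of_add using D.FM_entry[OF assms(1) that] D.FM_entry[OF assms(2) that]
    by (intro D.pairing_add_left D.ZG_L1 ang_bdd)
  then show "lin k \<phi> (v \<oplus>\<^bsub>D.FM k\<^esub> w) x = C.char_mult (lin k \<phi> v) (lin k \<phi> w) x"
    by (simp add: lin_def C.char_mult_def cis_mult D.FM_add sum.distrib)
qed

lemma lin_uminus:
  assumes "w \<in> carrier (D.FM k)"
  shows "lin k \<phi> (\<lambda>j\<in>{..<k}. \<lambda>s. - w j s) = C.char_cnj (lin k \<phi> w)"
proof
  fix x
  have "D.pairing (l1_of (\<lambda>s. - w j s)) (ang (\<phi> j) x) = - D.pairing (l1_of (w j)) (ang (\<phi> j) x)" for j
    using D.pairing_scale_left[of "-1" "l1_of (w j)"] by (simp add: l1_of_def)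
  then show "lin k \<phi> (\<lambda>j\<in>{..<k}. \<lambda>s. - w j s) x = C.char_cnj (lin k \<phi> w) x"
    by (simp add: lin_def C.char_cnj_def sum_negf cis_cnj)
qed

lemma lin_smult:
  assumes a: "a \<in> D.ZG" and w: "w \<in> carrier (D.FM k)" and \<phi>: "\<And>j. j < k \<Longrightarrow> \<phi> j \<in> chars"
  shows "lin k \<phi> (a \<odot>\<^bsub>D.FM k\<^esub> w) = a \<odot>\<^bsub>M\<^esub> lin k \<phi> w"
proof (rule extensionalityI[of _ "carrier X"])
  show "lin k \<phi> (a \<odot>\<^bsub>D.FM k\<^esub> w) \<in> extensional (carrier X)" by (simp add: lin_def)
  show "a \<odot>\<^bsub>M\<^esub> lin k \<phi> w \<in> extensional (carrier X)" by (rule smult_ext)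
  fix x assume x: "x \<in> carrier X"
  note wj = D.FM_entry[OF w]
  have lc: "lin k \<phi> w \<in> chars" by (rule lin_closed[OF wj \<phi>])
  let ?y = "\<lambda>j t. D.pairing (l1_of (w j)) (\<lambda>s. ang (\<phi> j) x (t \<otimes>\<^bsub>\<Gamma>\<^esub> s))"
  have yb: "D.bdd (?y j)" if "j < k" for j
  proof (rule D.bddI)
    fix t assume t: "t \<in> carrier \<Gamma>"
    show "\<bar>?y j t\<bar> \<le> pi * D.l1_norm (l1_of (w j))"
      by (intro D.pairing_bound D.ZG_L1 wj that ang_bound)
  qed
  have "(a \<odot>\<^bsub>M\<^esub> lin k \<phi> w) x = cis (D.pairing (l1_of a) (ang (lin k \<phi> w) x))"
    by (rule smult_apply[OF a lc x])
  \<comment> \<open>The angles of \<open>lin k \<phi> w\<close> and the sums of pairings agree only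
    modulo \<open>2 * pi\<close>, which suffices because \<open>a\<close> is integral.\<close>
  also have "\<dots> = cis (D.pairing (l1_of a) (\<lambda>t. \<Sum>j<k. ?y j t))"
  proof (rule D.cis_pairing_cong[OF a])
    fix t assume t: "t \<in> carrier \<Gamma>"
    have "D.pairing (l1_of (w j)) (ang (\<phi> j) (\<alpha> (inv\<^bsub>\<Gamma>\<^esub> t) x)) = ?y j t" for j
      using t x by (intro D.pairing_cong) (simp add: ang_shift)
    then show "cis (ang (lin k \<phi> w) x t) = cis (\<Sum>j<k. ?y j t)"
      unfolding cis_ang[OF lc x t] using t x act_closed by (simp add: lin_def)
  qed
  also have "D.pairing (l1_of a) (\<lambda>t. \<Sum>j<k. ?y j t) = (\<Sum>j<k. D.pairing (l1_of a) (?y j))"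
    using yb by (intro D.pairing_sum_right D.ZG_L1 a) auto
  also have "\<dots> = (\<Sum>j<k. D.pairing (l1_of (a \<otimes>\<^bsub>group_ring \<Gamma>\<^esub> w j)) (ang (\<phi> j) x))"
    by (intro sum.cong refl) (simp add: D.l1_of_mult a D.conv_pairing(2) D.ZG_L1 wj ang_bdd)
  also have "cis \<dots> = lin k \<phi> (a \<odot>\<^bsub>D.FM k\<^esub> w) x" using x by (simp add: lin_def D.FM_smult)
  finally show "lin k \<phi> (a \<odot>\<^bsub>D.FM k\<^esub> w) x = (a \<odot>\<^bsub>M\<^esub> lin k \<phi> w) x" by (rule sym)
qed

definition basis :: "nat \<Rightarrow> nat \<Rightarrow> nat \<Rightarrow> 'g \<Rightarrow> int" where
  "basis k j = (\<lambda>i\<in>{..<k}. if i = j then D.point \<one>\<^bsub>\<Gamma>\<^esub> 1 else (\<lambda>s. 0))"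

lemma basis_closed: "basis k j \<in> carrier (D.FM k)"
  by (auto simp: basis_def D.FM_carrier D.ZG_zero intro!: D.point_ZG)

lemma lin_basis:
  assumes j: "j < k" and \<phi>: "\<phi> j \<in> chars"
  shows "lin k \<phi> (basis k j) = \<phi> j"
proof (rule extensionalityI[of _ "carrier X"])
  show "lin k \<phi> (basis k j) \<in> extensional (carrier X)" by (simp add: lin_def)
  show "\<phi> j \<in> extensional (carrier X)" by (rule C.char_ext[OF \<phi>])
  fix x assume x: "x \<in> carrier X"
  have p: "l1_of (D.point \<one>\<^bsub>\<Gamma>\<^esub> 1) = D.unit1" "l1_of (\<lambda>s. 0) = (\<lambda>s. 0)"
    by (auto simp: l1_of_def D.point_def l1_ring_def)
  have "(\<Sum>i<k. D.pairing (l1_of (basis k j i)) (ang (\<phi> i) x)) = (\<Sum>i<k. if i = j then ang (\<phi> i) x \<one>\<^bsub>\<Gamma>\<^esub> else 0)"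
    by (intro sum.cong) (auto simp: basis_def p D.pairing_one D.pairing_zero)
  then show "lin k \<phi> (basis k j) x = \<phi> j x"
    using j x cis_ang[OF \<phi> x D.one_closed] by (simp add: lin_def act_one)
qed

text \<open>A presentation by generators: \<open>lin k \<phi>\<close> is onto and has kernel
  \<open>J\<close>. It stands in for the isomorphisms with quotients, to which
  \<open>presents_isomorphic\<close> and \<open>isomorphic_presents\<close> relate it.\<close>

definition presents :: "nat \<Rightarrow> (nat \<Rightarrow> 'x \<Rightarrow> complex) \<Rightarrow> (nat \<Rightarrow> 'g \<Rightarrow> int) set \<Rightarrow> bool" where
  "presents k \<phi> J \<longleftrightarrow> (\<forall>j<k. \<phi> j \<in> chars) \<and>
     (\<forall>\<kappa>\<in>chars. \<exists>w\<in>carrier (D.FM k). lin k \<phi> w = \<kappa>) \<and>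
     J = {w \<in> carrier (D.FM k). lin k \<phi> w = C.char_one}"

lemma FM_zero_closed: "\<zero>\<^bsub>D.FM k\<^esub> \<in> carrier (D.FM k)"
  using D.abelian_group_FM abelian_groupE(2) by blast

lemma lin_zero: "lin k \<phi> \<zero>\<^bsub>D.FM k\<^esub> = C.char_one"
proof -
  have z: "l1_of (\<lambda>s. 0) = (\<lambda>s. 0)" by (auto simp: l1_of_def)
  show ?thesis by (auto simp: lin_def C.char_one_def D.FM_zero z D.pairing_zero)
qed

lemma char_mult_one: "\<phi> \<in> chars \<Longrightarrow> C.char_mult C.char_one \<phi> = \<phi>" "\<phi> \<in> chars \<Longrightarrow> C.char_mult \<phi> C.char_one = \<phi>"
  by (auto intro!: C.char_eqI C.char_mult_closed C.char_one_closed simp: C.char_mult_apply C.char_one_apply)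

lemma smult_one_char:
  assumes "a \<in> D.ZG"
  shows "a \<odot>\<^bsub>M\<^esub> C.char_one = C.char_one"
proof (rule extensionalityI[OF smult_ext C.char_ext[OF C.char_one_closed]])
  fix x assume x: "x \<in> carrier X"
  have "D.pairing (l1_of a) (ang C.char_one x) = D.pairing (l1_of a) (\<lambda>s. 0)"
    by (rule D.pairing_cong) (use x act_closed in \<open>simp add: ang_def C.char_one_apply\<close>)
  then show "(a \<odot>\<^bsub>M\<^esub> C.char_one) x = C.char_one x"
    using smult_apply[OF assms C.char_one_closed x] x by (simp add: D.pairing_zero C.char_one_apply)
qed

lemma presents_submodule:
  assumes P: "presents k \<phi> J"
  shows "submodule J (group_ring \<Gamma>) (D.FM k)"
proof -
  interpret F: abelian_group "D.FM k" by (rule D.abelian_group_FM)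
  have \<phi>: "\<And>j. j < k \<Longrightarrow> \<phi> j \<in> chars" and J: "J = {w \<in> carrier (D.FM k). lin k \<phi> w = C.char_one}"
    using P by (auto simp: presents_def)
  have "subgroup J (add_monoid (D.FM k))"
  proof (rule group.subgroupI[OF F.a_group])
    show "J \<subseteq> carrier (add_monoid (D.FM k))" using J by auto
    show "J \<noteq> {}" using J lin_zero FM_zero_closed by blast
    fix v w assume v: "v \<in> J"
    show "v \<otimes>\<^bsub>add_monoid (D.FM k)\<^esub> w \<in> J" if w: "w \<in> J"
      using v w unfolding J by (simp add: lin_add D.FM_add_closed char_mult_one C.char_one_closed)
    let ?n = "\<lambda>j\<in>{..<k}. \<lambda>s. - v j s"
    have vF: "v \<in> carrier (D.FM k)" using v J by simp
    have nF: "?n \<in> carrier (D.FM k)" by (rule D.FM_uminus_closed[OF vF])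
    have "?n \<oplus>\<^bsub>D.FM k\<^esub> v = \<zero>\<^bsub>D.FM k\<^esub>" unfolding D.FM_add D.FM_zero by (intro restrict_ext) simp
    then have "\<ominus>\<^bsub>D.FM k\<^esub> v = ?n" using F.minus_equality[OF _ vF nF] by simp
    moreover have "?n \<in> J" using nF vF v lin_uminus[OF vF, of \<phi>]
      unfolding J by (auto simp: C.char_cnj_def C.char_one_def)
    ultimately show "inv\<^bsub>add_monoid (D.FM k)\<^esub> v \<in> J" by (simp add: a_inv_def)
  qed
  moreover have "a \<odot>\<^bsub>D.FM k\<^esub> v \<in> J" if "a \<in> D.ZG" "v \<in> J" for a v
    using that unfolding J by (simp add: lin_smult \<phi> D.FM_smult_closed smult_one_char)
  ultimately show ?thesis by (simp add: submodule_def submodule_axioms_def)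
qed

lemma presents_coset:
  assumes P: "presents k \<phi> J" and v: "v \<in> carrier (D.FM k)"
  shows "J +>\<^bsub>D.FM k\<^esub> v = {w \<in> carrier (D.FM k). lin k \<phi> w = lin k \<phi> v}"
proof -
  interpret F: abelian_group "D.FM k" by (rule D.abelian_group_FM)
  note J = presents_submodule[OF P]
  have \<phi>: "\<And>j. j < k \<Longrightarrow> \<phi> j \<in> chars" and Jd: "J = {w \<in> carrier (D.FM k). lin k \<phi> w = C.char_one}"
    using P by (auto simp: presents_def)
  have lc: "lin k \<phi> w \<in> chars" if "w \<in> carrier (D.FM k)" for w by (rule lin_closed[OF D.FM_entry[OF that] \<phi>])
  show ?thesis
  proof (intro equalityI subsetI)
    fix w assume "w \<in> J +>\<^bsub>D.FM k\<^esub> v"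
    then obtain u where "u \<in> J" "w = u \<oplus>\<^bsub>D.FM k\<^esub> v" unfolding D.FM_coset_iff by blast
    then show "w \<in> {w \<in> carrier (D.FM k). lin k \<phi> w = lin k \<phi> v}"
      using v by (simp add: Jd lin_add D.FM_add_closed char_mult_one lc)
  next
    fix w assume w: "w \<in> {w \<in> carrier (D.FM k). lin k \<phi> w = lin k \<phi> v}"
    define u where "u = w \<ominus>\<^bsub>D.FM k\<^esub> v"
    have u: "u \<in> carrier (D.FM k)" using w v by (simp add: u_def)
    have uv: "u \<oplus>\<^bsub>D.FM k\<^esub> v = w" using w v by (simp add: u_def a_minus_def F.a_assoc F.l_neg)
    have "C.char_mult (lin k \<phi> u) (lin k \<phi> v) = lin k \<phi> v" using lin_add[OF u v, of \<phi>] uv w by simp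
    then have "lin k \<phi> u x * lin k \<phi> v x = lin k \<phi> v x" if "x \<in> carrier X" for x
      using that by (metis C.char_mult_apply)
    then have "lin k \<phi> u x = 1" if "x \<in> carrier X" for x
      using that C.char_norm[OF lc[OF v] that] by (metis mult_cancel_right2 norm_zero zero_neq_one)
    then have "lin k \<phi> u = C.char_one"
      by (intro C.char_eqI lc u C.char_one_closed) (simp add: C.char_one_apply)
    then have "u \<in> J" using u Jd by simp
    then show "w \<in> J +>\<^bsub>D.FM k\<^esub> v" using uv unfolding D.FM_coset_iff by blast
  qed
qed

text \<open>The isomorphism sends a character to its fibre under \<open>lin k \<phi>\<close>, which
  is a coset by \<open>presents_coset\<close>; this avoids choosing representatives.\<close>

lemma presents_isomorphic:
  assumes P: "presents k \<phi> J"
  shows "left_module_isomorphic (group_ring \<Gamma>) M (D.QM k J)"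
proof -
  note J = presents_submodule[OF P]
  have \<phi>: "\<And>j. j < k \<Longrightarrow> \<phi> j \<in> chars" and Jd: "J = {w \<in> carrier (D.FM k). lin k \<phi> w = C.char_one}"
    and sur: "\<And>\<kappa>. \<kappa> \<in> chars \<Longrightarrow> \<exists>w\<in>carrier (D.FM k). lin k \<phi> w = \<kappa>"
    using P by (auto simp: presents_def)
  have lc: "lin k \<phi> w \<in> chars" if "w \<in> carrier (D.FM k)" for w by (rule lin_closed[OF D.FM_entry[OF that] \<phi>])
  define h where "h \<kappa> = {w \<in> carrier (D.FM k). lin k \<phi> w = \<kappa>}" for \<kappa>
  have hl: "h (lin k \<phi> v) = J +>\<^bsub>D.FM k\<^esub> v" if "v \<in> carrier (D.FM k)" for v
    using presents_coset[OF P that] by (simp add: h_def)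
  have hc: "h \<kappa> \<in> carrier (D.QM k J)" if "\<kappa> \<in> chars" for \<kappa>
    using sur[OF that] hl unfolding D.QM_carrier by blast
  have "h \<in> iso (add_monoid M) (add_monoid (D.QM k J))"
    unfolding iso_def
  proof (intro CollectI conjI homI bij_betwI')
    fix \<kappa> \<kappa>' assume "\<kappa> \<in> carrier (add_monoid M)" "\<kappa>' \<in> carrier (add_monoid M)"
    then have c: "\<kappa> \<in> chars" "\<kappa>' \<in> chars" by (simp_all add: M_simps)
    obtain v w where vw: "v \<in> carrier (D.FM k)" "lin k \<phi> v = \<kappa>" "w \<in> carrier (D.FM k)" "lin k \<phi> w = \<kappa>'"
      using sur c by metis
    show "h \<kappa> \<in> carrier (add_monoid (D.QM k J))" using hc c by simp
    show "h (\<kappa> \<otimes>\<^bsub>add_monoid M\<^esub> \<kappa>') = h \<kappa> \<otimes>\<^bsub>add_monoid (D.QM k J)\<^esub> h \<kappa>'"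
      using D.QM_add[OF J vw(1,3)] hl[OF vw(1)] hl[OF vw(3)] hl[OF D.FM_add_closed[OF vw(1,3)]]
      by (simp add: vw(2,4) lin_add[OF vw(1,3)] M_simps)
    show "h \<kappa> = h \<kappa>' \<longleftrightarrow> \<kappa> = \<kappa>'"
      using vw unfolding h_def by blast
  next
    fix K assume "K \<in> carrier (add_monoid (D.QM k J))"
    then obtain v where v: "v \<in> carrier (D.FM k)" "K = J +>\<^bsub>D.FM k\<^esub> v" unfolding D.QM_carrier by auto
    then show "\<exists>\<kappa>\<in>carrier (add_monoid M). K = h \<kappa>"
      using hl[OF v(1)] lc[OF v(1)] by (intro bexI[of _ "lin k \<phi> v"]) (simp_all add: M_simps)
  qed (simp add: hc M_simps)
  moreover have "h (a \<odot>\<^bsub>M\<^esub> \<kappa>) = a \<odot>\<^bsub>D.QM k J\<^esub> h \<kappa>" if a: "a \<in> D.ZG" and c: "\<kappa> \<in> chars" for a \<kappa>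
  proof -
    obtain v where v: "v \<in> carrier (D.FM k)" "lin k \<phi> v = \<kappa>" using sur[OF c] by blast
    show ?thesis
      using D.QM_smult[OF J a v(1)] hl[OF v(1)] hl[OF D.FM_smult_closed[OF a v(1)]] lin_smult[OF a v(1) \<phi>]
      by (simp add: v(2))
  qed
  ultimately show ?thesis unfolding left_module_isomorphic_def by (auto simp: M_simps)
qed

text \<open>The generators are the characters that \<open>h\<close> sends to the cosets of the basis
  vectors. Adding one coordinate at a time, \<open>main\<close> shows that \<open>h\<close> maps
  \<open>lin k \<phi> w\<close> to the coset of \<open>w\<close>; bijectivity of \<open>h\<close>
  then gives surjectivity and the kernel.\<close>

lemma isomorphic_presents:
  assumes J: "submodule J (group_ring \<Gamma>) (D.FM k)"
    and I: "left_module_isomorphic (group_ring \<Gamma>) M (D.QM k J)"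
  obtains \<phi> where "presents k \<phi> J"
proof -
  interpret F: abelian_group "D.FM k" by (rule D.abelian_group_FM)
  obtain h where h: "h \<in> iso (add_monoid M) (add_monoid (D.QM k J))"
    and hs: "\<And>a \<kappa>. a \<in> D.ZG \<Longrightarrow> \<kappa> \<in> chars \<Longrightarrow> h (a \<odot>\<^bsub>M\<^esub> \<kappa>) = a \<odot>\<^bsub>D.QM k J\<^esub> h \<kappa>"
    using I by (auto simp: left_module_isomorphic_def M_simps)
  have hb: "bij_betw h chars (carrier (D.QM k J))" using h by (simp add: iso_def M_simps)
  have hm: "h (C.char_mult \<kappa> \<kappa>') = h \<kappa> \<oplus>\<^bsub>D.QM k J\<^esub> h \<kappa>'" if "\<kappa> \<in> chars" "\<kappa>' \<in> chars" for \<kappa> \<kappa>'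
    using h that by (auto simp: iso_def hom_def M_simps)
  have "\<exists>\<kappa>\<in>chars. h \<kappa> = J +>\<^bsub>D.FM k\<^esub> v" if "v \<in> carrier (D.FM k)" for v
    using hb that unfolding bij_betw_def D.QM_carrier by (auto simp: image_iff set_eq_iff) metis
  then have ex: "\<exists>\<kappa>. \<kappa> \<in> chars \<and> h \<kappa> = J +>\<^bsub>D.FM k\<^esub> basis k j" for j using basis_closed by blast
  define \<phi> where "\<phi> j = (SOME \<kappa>. \<kappa> \<in> chars \<and> h \<kappa> = J +>\<^bsub>D.FM k\<^esub> basis k j)" for j
  have \<phi>: "\<phi> j \<in> chars" "h (\<phi> j) = J +>\<^bsub>D.FM k\<^esub> basis k j" for j
    using someI_ex[OF ex[of j]] by (auto simp: \<phi>_def)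
  \<comment> \<open>The image of the neutral character is idempotent under addition, so its
    representative lies in \<open>J\<close>.\<close>
  have h1: "h C.char_one = J +>\<^bsub>D.FM k\<^esub> \<zero>\<^bsub>D.FM k\<^esub>"
  proof -
    obtain v where v: "v \<in> carrier (D.FM k)" "h C.char_one = J +>\<^bsub>D.FM k\<^esub> v"
      using bij_betw_apply[OF hb C.char_one_closed] unfolding D.QM_carrier by blast
    have "J +>\<^bsub>D.FM k\<^esub> (v \<oplus>\<^bsub>D.FM k\<^esub> v) = J +>\<^bsub>D.FM k\<^esub> v"
      using hm[OF C.char_one_closed C.char_one_closed] D.QM_add[OF J v(1) v(1)] v(2)
      by (simp add: char_mult_one C.char_one_closed)
    then obtain u where u: "u \<in> J" "v \<oplus>\<^bsub>D.FM k\<^esub> v = u \<oplus>\<^bsub>D.FM k\<^esub> v"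
      using D.coset_eqD[OF J] v(1) by (metis F.a_closed)
    have "u \<in> carrier (D.FM k)" using u(1) D.submoduleD(1)[OF J] by blast
    then have "v = u" using u(2) v(1) by simp
    then show ?thesis using u(1) v D.coset_eq_submodule_iff[OF J v(1)]
        D.coset_eq_submodule_iff[OF J FM_zero_closed] D.submoduleD(3)[OF J] by simp
  qed
  have main: "h (lin n \<phi> w) = J +>\<^bsub>D.FM k\<^esub> (\<lambda>i\<in>{..<k}. if i < n then w i else (\<lambda>s. 0))"
    if w: "w \<in> carrier (D.FM k)" and n: "n \<le> k" for n w
    using n
  proof (induction n)
    case 0
    have "(\<lambda>i\<in>{..<k}. if i < 0 then w i else (\<lambda>s. 0)) = \<zero>\<^bsub>D.FM k\<^esub>"
      unfolding D.FM_zero by (intro restrict_ext) simp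
    then show ?case using h1 by (simp only: lin_0)
  next
    case (Suc n)
    let ?t = "\<lambda>n. (\<lambda>i\<in>{..<k}. if i < n then w i else (\<lambda>s. 0))"
    have wn: "w n \<in> D.ZG" using D.FM_entry[OF w] Suc by simp
    have t: "?t n \<in> carrier (D.FM k)"
      unfolding D.FM_carrier restrict_PiE_iff using D.FM_entry[OF w] by (simp add: D.ZG_zero)
    have ln: "lin n \<phi> w \<in> chars" using Suc D.FM_entry[OF w] \<phi>(1) by (intro lin_closed) auto
    have "h (lin (Suc n) \<phi> w) = h (lin n \<phi> w) \<oplus>\<^bsub>D.QM k J\<^esub> h (w n \<odot>\<^bsub>M\<^esub> \<phi> n)"
      using hm[OF ln smult_closed[OF wn \<phi>(1)]] by (simp add: lin_Suc[where k=n and w=w and \<phi>=\<phi>, OF wn \<phi>(1)])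
    also have "\<dots> = (J +>\<^bsub>D.FM k\<^esub> ?t n) \<oplus>\<^bsub>D.QM k J\<^esub> (J +>\<^bsub>D.FM k\<^esub> (w n \<odot>\<^bsub>D.FM k\<^esub> basis k n))"
    proof -
      have 1: "h (lin n \<phi> w) = J +>\<^bsub>D.FM k\<^esub> ?t n" by (rule Suc.IH) (use Suc.prems in simp)
      have 2: "h (w n \<odot>\<^bsub>M\<^esub> \<phi> n) = J +>\<^bsub>D.FM k\<^esub> (w n \<odot>\<^bsub>D.FM k\<^esub> basis k n)"
        using hs[OF wn \<phi>(1), of n] D.QM_smult[OF J wn basis_closed] by (simp add: \<phi>(2))
      show ?thesis unfolding 1 2 ..
    qed
    also have "\<dots> = J +>\<^bsub>D.FM k\<^esub> (?t n \<oplus>\<^bsub>D.FM k\<^esub> (w n \<odot>\<^bsub>D.FM k\<^esub> basis k n))"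
      by (rule D.QM_add[OF J t D.FM_smult_closed[OF wn basis_closed]])
    also have "?t n \<oplus>\<^bsub>D.FM k\<^esub> (w n \<odot>\<^bsub>D.FM k\<^esub> basis k n) = ?t (Suc n)"
      using wn by (auto simp: D.FM_add D.FM_smult basis_def D.ZG_mult_one D.ZG_mult_zero less_Suc_eq intro!: restrict_ext)
    finally show ?case .
  qed
  have hl: "h (lin k \<phi> w) = J +>\<^bsub>D.FM k\<^esub> w" if w: "w \<in> carrier (D.FM k)" for w
  proof -
    have "(\<lambda>i\<in>{..<k}. if i < k then w i else (\<lambda>s. 0)) = w"
      using w by (auto simp: D.FM_carrier PiE_def extensional_def)
    then show ?thesis using main[OF w order.refl] by simp
  qed
  have lc: "lin k \<phi> w \<in> chars" if "w \<in> carrier (D.FM k)" for w by (rule lin_closed[OF D.FM_entry[OF that] \<phi>(1)])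
  have inj: "\<kappa> = \<kappa>'" if "\<kappa> \<in> chars" "\<kappa>' \<in> chars" "h \<kappa> = h \<kappa>'" for \<kappa> \<kappa>'
    using hb that by (auto simp: bij_betw_def inj_on_def)
  have "presents k \<phi> J"
    unfolding presents_def
  proof (intro conjI allI impI ballI)
    fix \<kappa> assume c: "\<kappa> \<in> chars"
    obtain w where w: "w \<in> carrier (D.FM k)" "h \<kappa> = J +>\<^bsub>D.FM k\<^esub> w"
      using bij_betw_apply[OF hb c] unfolding D.QM_carrier by blast
    then show "\<exists>w\<in>carrier (D.FM k). lin k \<phi> w = \<kappa>" using inj[OF lc[OF w(1)] c] hl[OF w(1)] by auto
  next
    have "lin k \<phi> w = C.char_one \<longleftrightarrow> w \<in> J" if w: "w \<in> carrier (D.FM k)" for w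
    proof -
      have J0: "J +>\<^bsub>D.FM k\<^esub> \<zero>\<^bsub>D.FM k\<^esub> = J"
        using D.coset_eq_submodule_iff[OF J FM_zero_closed] D.submoduleD(3)[OF J] by simp
      have "lin k \<phi> w = C.char_one \<longleftrightarrow> h (lin k \<phi> w) = h C.char_one"
        using inj[OF lc[OF w] C.char_one_closed] by auto
      also have "\<dots> \<longleftrightarrow> w \<in> J" unfolding hl[OF w] h1 J0 by (rule D.coset_eq_submodule_iff[OF J w])
      finally show ?thesis .
    qed
    then show "J = {w \<in> carrier (D.FM k). lin k \<phi> w = C.char_one}" using D.submoduleD(1)[OF J] by auto
  qed (simp add: \<phi>)
  then show ?thesis using that by blast
qed

section \<open>Finite generation\<close>

lemma abelian_monoid_M: "abelian_monoid M"
  by (rule abelian_monoidI)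
     (auto simp: M_simps C.char_mult_closed C.char_one_closed char_mult_one, auto simp: C.char_mult_def mult_ac)

lemma finsum_M_apply:
  assumes "finite S" "\<And>s. s \<in> S \<Longrightarrow> f s \<in> chars" "x \<in> carrier X"
  shows "(\<Oplus>\<^bsub>M\<^esub>s\<in>S. f s) x = (\<Prod>s\<in>S. f s x)"
proof -
  interpret abelian_monoid M by (rule abelian_monoid_M)
  show ?thesis using assms
    by (induction S rule: finite_induct) (auto simp: M_simps C.char_one_apply C.char_mult_apply)
qed

lemma finsum_M_closed:
  assumes "finite S" "\<And>s. s \<in> S \<Longrightarrow> f s \<in> chars"
  shows "(\<Oplus>\<^bsub>M\<^esub>s\<in>S. f s) \<in> chars"
proof -
  interpret abelian_monoid M by (rule abelian_monoid_M)
  show ?thesis using finsum_closed[of f S] assms by (auto simp: M_simps)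
qed

lemma cis_sum: "finite S \<Longrightarrow> cis (\<Sum>s\<in>S. f s) = (\<Prod>s\<in>S. cis (f s))"
  by (induction S rule: finite_induct) (auto simp: cis_mult[symmetric])

lemma finitely_generated_presents:
  assumes "finitely_generated_left_module (group_ring \<Gamma>) M"
  obtains k \<phi> J where "presents k \<phi> J"
proof -
  obtain S where S: "finite S" "S \<subseteq> chars"
    and gen: "\<And>x. x \<in> chars \<Longrightarrow> \<exists>c\<in>S \<rightarrow> D.ZG. x = (\<Oplus>\<^bsub>M\<^esub>y\<in>S. c y \<odot>\<^bsub>M\<^esub> y)"
    using assms by (auto simp: finitely_generated_left_module_def M_simps)
  define k where "k = card S"
  obtain \<phi> where b: "bij_betw \<phi> {..<k} S"
    using ex_bij_betw_nat_finite[OF S(1)] by (auto simp: k_def atLeast0LessThan)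
  have \<phi>S: "\<phi> j \<in> S" if "j < k" for j using b that by (auto simp: bij_betw_def)
  have \<phi>: "\<phi> j \<in> chars" if "j < k" for j using \<phi>S[OF that] S(2) by blast
  have "\<exists>w\<in>carrier (D.FM k). lin k \<phi> w = \<kappa>" if \<kappa>: "\<kappa> \<in> chars" for \<kappa>
  proof -
    obtain c where c: "c \<in> S \<rightarrow> D.ZG" "\<kappa> = (\<Oplus>\<^bsub>M\<^esub>y\<in>S. c y \<odot>\<^bsub>M\<^esub> y)" using gen[OF \<kappa>] by blast
    let ?w = "\<lambda>j\<in>{..<k}. c (\<phi> j)"
    have w: "?w \<in> carrier (D.FM k)" using c(1) \<phi>S by (auto simp: D.FM_carrier)
    have "lin k \<phi> ?w = \<kappa>"
    proof (rule C.char_eqI[OF lin_closed[OF D.FM_entry[OF w] \<phi>] \<kappa>])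
      fix x assume x: "x \<in> carrier X"
      have "\<kappa> x = (\<Prod>y\<in>S. (c y \<odot>\<^bsub>M\<^esub> y) x)"
        unfolding c(2) using S c(1) by (intro finsum_M_apply[OF S(1) smult_closed x]) auto
      also have "\<dots> = (\<Prod>j<k. (c (\<phi> j) \<odot>\<^bsub>M\<^esub> \<phi> j) x)" by (rule prod.reindex_bij_betw[OF b, symmetric])
      also have "\<dots> = (\<Prod>j<k. cis (D.pairing (l1_of (c (\<phi> j))) (ang (\<phi> j) x)))"
        using c(1) \<phi>S \<phi> x by (intro prod.cong refl smult_apply) auto
      finally show "lin k \<phi> ?w x = \<kappa> x" using x by (simp add: lin_def cis_sum)
    qed
    then show ?thesis using w by blast
  qed
  then have "presents k \<phi> {w \<in> carrier (D.FM k). lin k \<phi> w = C.char_one}"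
    using \<phi> by (simp add: presents_def)
  then show ?thesis by (rule that)
qed

lemma generated_finitely_generated:
  assumes \<phi>: "\<And>j. j < k \<Longrightarrow> \<phi> j \<in> chars"
    and sur: "\<And>\<kappa>. \<kappa> \<in> chars \<Longrightarrow> \<exists>w\<in>carrier (D.FM k). lin k \<phi> w = \<kappa>"
  shows "finitely_generated_left_module (group_ring \<Gamma>) M"
  unfolding finitely_generated_left_module_def
proof (intro exI[of _ "\<phi> ` {..<k}"] conjI ballI)
  let ?S = "\<phi> ` {..<k}"
  show "finite ?S" by simp
  show "?S \<subseteq> carrier M" using \<phi> by (auto simp: M_simps)
  fix \<kappa> assume "\<kappa> \<in> carrier M"
  then have \<kappa>: "\<kappa> \<in> chars" by (simp add: M_simps)
  obtain w where w: "w \<in> carrier (D.FM k)" "lin k \<phi> w = \<kappa>" using sur[OF \<kappa>] by blast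
  \<comment> \<open>The family \<open>\<phi>\<close> may repeat a character, so the coefficients of
    equal generators are collected.\<close>
  define c where "c y = (\<lambda>s. \<Sum>j\<in>{j\<in>{..<k}. \<phi> j = y}. w j s)" for y
  have c: "c y \<in> D.ZG" for y
  proof -
    have *: "(\<lambda>s. \<Sum>j\<in>A. w j s) \<in> D.ZG" if "finite A" "A \<subseteq> {..<k}" for A
      using that by (induction A rule: finite_induct) (auto simp: D.ZG_zero intro!: D.ZG_add_closed D.FM_entry[OF w(1)])
    show ?thesis unfolding c_def by (rule *) (simp, blast)
  qed
  have lc: "l1_of (c y) = (\<lambda>s. \<Sum>j\<in>{j\<in>{..<k}. \<phi> j = y}. l1_of (w j) s)" for y
    by (simp add: c_def l1_of_def)
  have Sch: "y \<in> chars" if "y \<in> ?S" for y using that \<phi> by auto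
  have "\<kappa> = (\<Oplus>\<^bsub>M\<^esub>y\<in>?S. c y \<odot>\<^bsub>M\<^esub> y)"
  proof (rule C.char_eqI[OF \<kappa> finsum_M_closed])
    fix x assume x: "x \<in> carrier X"
    have "(\<Sum>y\<in>?S. D.pairing (l1_of (c y)) (ang y x))
        = (\<Sum>y\<in>?S. \<Sum>j\<in>{j\<in>{..<k}. \<phi> j = y}. D.pairing (l1_of (w j)) (ang (\<phi> j) x))"
    proof (intro sum.cong refl)
      fix y
      have "D.pairing (l1_of (c y)) (ang y x) = (\<Sum>j\<in>{j\<in>{..<k}. \<phi> j = y}. D.pairing (l1_of (w j)) (ang y x))"
        unfolding lc by (rule D.pairing_sum_left) (auto intro!: D.ZG_L1 D.FM_entry[OF w(1)] ang_bdd)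
      then show "D.pairing (l1_of (c y)) (ang y x)
          = (\<Sum>j\<in>{j\<in>{..<k}. \<phi> j = y}. D.pairing (l1_of (w j)) (ang (\<phi> j) x))" by simp
    qed
    also have "\<dots> = (\<Sum>j<k. D.pairing (l1_of (w j)) (ang (\<phi> j) x))"
      by (rule sum.group) auto
    finally have eq: "(\<Sum>y\<in>?S. D.pairing (l1_of (c y)) (ang y x)) = (\<Sum>j<k. D.pairing (l1_of (w j)) (ang (\<phi> j) x))" .
    have "(\<Oplus>\<^bsub>M\<^esub>y\<in>?S. c y \<odot>\<^bsub>M\<^esub> y) x = (\<Prod>y\<in>?S. (c y \<odot>\<^bsub>M\<^esub> y) x)"
      by (rule finsum_M_apply[OF _ smult_closed[OF c Sch] x]) auto
    also have "\<dots> = cis (\<Sum>y\<in>?S. D.pairing (l1_of (c y)) (ang y x))"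
      by (simp add: cis_sum smult_apply[OF c Sch x])
    finally show "\<kappa> x = (\<Oplus>\<^bsub>M\<^esub>y\<in>?S. c y \<odot>\<^bsub>M\<^esub> y) x" using x w(2) by (auto simp: eq lin_def)
  qed (auto intro: smult_closed[OF c Sch])
  then show "\<exists>c\<in>?S \<rightarrow> D.ZG. \<kappa> = (\<Oplus>\<^bsub>M\<^esub>y\<in>?S. c y \<odot>\<^bsub>M\<^esub> y)" using c by blast
qed

end

section \<open>Expansive actions\<close>

lemma cis_eq_one_small:
  assumes "cis a = 1" "\<bar>a\<bar> < 2 * pi"
  shows "a = 0"
proof -
  have "cos a = 1" using assms(1) by (metis cis.simps(1) one_complex.simps(1))
  then obtain n :: int where n: "a = of_int n * 2 * pi" unfolding cos_one_2pi_int by blast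
  have "\<bar>of_int n :: real\<bar> * (2 * pi) < 1 * (2 * pi)" using assms(2) n by (simp add: abs_mult mult.assoc)
  then have "\<bar>n\<bar> < 1" by (simp add: mult_less_cancel_right)
  then show ?thesis using n by simp
qed

lemma norm_cis_minus_one_le: "cmod (cis a - 1) \<le> \<bar>a\<bar>"
proof (rule power2_le_imp_le)
  have "(cmod (cis a - 1))\<^sup>2 = (cos a - 1)\<^sup>2 + (sin a)\<^sup>2" by (simp add: cmod_power2)
  also have "\<dots> = 2 - 2 * cos a"
    using sin_cos_squared_add[of a] by (simp add: power2_eq_square algebra_simps)
  also have "cos a = 1 - 2 * (sin (a / 2))\<^sup>2" using cos_double_sin[of "a / 2"] by simp
  also have "2 - 2 * (1 - 2 * (sin (a / 2))\<^sup>2) = (2 * \<bar>sin (a / 2)\<bar>)\<^sup>2" by (simp add: power2_eq_square)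
  also have "\<dots> \<le> \<bar>a\<bar>\<^sup>2"
    using abs_sin_x_le_abs_x[of "a / 2"] by (intro power_mono) auto
  finally show "(cmod (cis a - 1))\<^sup>2 \<le> \<bar>a\<bar>\<^sup>2" .
qed simp

lemma Arg_small:
  fixes d :: real
  assumes "d > 0"
  obtains e where "e > 0" "\<And>z. cmod (z - 1) < e \<Longrightarrow> \<bar>Arg z\<bar> < d"
proof -
  have "continuous (at 1) Arg" by (rule continuous_at_Arg) (simp add: complex_nonpos_Reals_iff)
  then obtain e where "e > 0" "\<And>z. dist z 1 < e \<Longrightarrow> dist (Arg z) (Arg 1) < d"
    unfolding continuous_at_eps_delta using assms by blast
  then show ?thesis using that[of e] by (simp add: dist_norm Arg_eq_0 [THEN iffD2])
qed

section \<open>Bounded rows and annihilators\<close>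

context discrete_group begin

lemma pairing_point: "t \<in> G \<Longrightarrow> pairing (l1_of (point t 1)) y = y t"
proof -
  assume t: "t \<in> G"
  have "{s. point t 1 s \<noteq> 0} = {t}" by (auto simp: point_def)
  then show ?thesis using pairing_ZG[OF point_ZG[OF t, of 1], of y] by (simp add: point_def)
qed

lemma pairing_shift:
  assumes "t \<in> G" "b \<in> ZG" "bdd y"
  shows "pairing (l1_of (point t 1 \<otimes>\<^bsub>group_ring \<Gamma>\<^esub> b)) y = pairing (l1_of b) (\<lambda>r. y (t \<otimes> r))"
  using assms by (simp add: l1_of_mult point_ZG conv_pairing(2) ZG_L1 pairing_point)

definition row_pairing :: "nat \<Rightarrow> (nat \<Rightarrow> 'g \<Rightarrow> int) \<Rightarrow> (nat \<Rightarrow> 'g \<Rightarrow> real) \<Rightarrow> real" where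
  "row_pairing k w y = (\<Sum>j<k. pairing (l1_of (w j)) (y j))"

text \<open>Bounded rows form the dual of \<open>\<ell>\<^sup>1(\<Gamma>)\<^sup>k\<close>, so the following says that \<open>J\<close> spans a dense
  subspace of it.\<close>

definition trivial_annihilator :: "nat \<Rightarrow> (nat \<Rightarrow> 'g \<Rightarrow> int) set \<Rightarrow> bool" where
  "trivial_annihilator k J \<longleftrightarrow> (\<forall>y. (\<forall>j<k. bdd (y j)) \<longrightarrow> (\<forall>w\<in>J. row_pairing k w y = 0) \<longrightarrow>
     (\<forall>j<k. \<forall>s\<in>G. y j s = 0))"

lemma row_pairing_add:
  assumes "v \<in> carrier (FM k)" "w \<in> carrier (FM k)" "\<And>j. j < k \<Longrightarrow> bdd (y j)"
  shows "row_pairing k (v \<oplus>\<^bsub>FM k\<^esub> w) y = row_pairing k v y + row_pairing k w y"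
  unfolding row_pairing_def sum.distrib[symmetric]
  using assms by (intro sum.cong refl) (simp add: FM_add l1_of_add pairing_add_left ZG_L1 FM_entry)

lemma row_pairing_uminus:
  "row_pairing k (\<lambda>i\<in>{..<k}. \<lambda>s. - w i s) y = - row_pairing k w y"
proof -
  have "pairing (l1_of (\<lambda>s. - w j s)) (y j) = - pairing (l1_of (w j)) (y j)" for j
    using pairing_scale_left[of "-1" "l1_of (w j)"] by (simp add: l1_of_def)
  then show ?thesis by (simp add: row_pairing_def sum_negf)
qed

lemma row_pairing_shift:
  assumes "t \<in> G" "w \<in> carrier (FM k)" "\<And>j. j < k \<Longrightarrow> bdd (y j)"
  shows "row_pairing k (point t 1 \<odot>\<^bsub>FM k\<^esub> w) y = row_pairing k w (\<lambda>j r. y j (t \<otimes> r))"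
  unfolding row_pairing_def
  using assms by (intro sum.cong refl) (simp add: FM_smult pairing_shift FM_entry)

lemma row_pairing_bound:
  assumes "w \<in> carrier (FM k)" "\<And>j s. j < k \<Longrightarrow> s \<in> G \<Longrightarrow> \<bar>y j s\<bar> \<le> K"
  shows "\<bar>row_pairing k w y\<bar> \<le> K * (\<Sum>j<k. l1_norm (l1_of (w j)))"
  unfolding row_pairing_def sum_distrib_left
  using assms by (intro order.trans[OF sum_abs] sum_mono pairing_bound ZG_L1 FM_entry) auto

lemma exists_matrix_of_trivial_annihilator:
  assumes "submodule J (group_ring \<Gamma>) (FM k)" "trivial_annihilator k J"
  shows "\<exists>A\<in>carrier (matrix_ring (group_ring \<Gamma>) k). matrix_l1_of k A \<in> Units (MatL k) \<and> (\<forall>i<k. A i \<in> J)"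
proof (rule exists_invertible_matrix[OF assms(1)])
  fix y j s assume "\<And>j. j < k \<Longrightarrow> bdd (y j)"
    and "\<And>w. w \<in> J \<Longrightarrow> (\<Sum>j<k. pairing (l1_of (w j)) (y j)) = 0" and "j < k" "s \<in> G"
  then show "y j s = 0" using assms(2) by (simp add: trivial_annihilator_def row_pairing_def)
qed

text \<open>The value \<open>y l s\<close> is the pairing of row \<open>l\<close> of the identity
  with \<open>y\<close> translated by \<open>s\<close>. Writing the identity as \<open>B A\<close>
  and moving \<open>B\<close> across by \<open>conv_pairing\<close> leaves pairings of rows of
  \<open>A\<close> with translates of \<open>y\<close>, all of them zero.\<close>

lemma invertible_annihilator:
  assumes U: "matrix_l1_of k A \<in> Units (MatL k)" and A: "\<And>i. i < k \<Longrightarrow> A i \<in> carrier (FM k)"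
    and y: "\<And>j. j < k \<Longrightarrow> bdd (y j)"
    and zero: "\<And>i t. i < k \<Longrightarrow> t \<in> G \<Longrightarrow> row_pairing k (A i) (\<lambda>j r. y j (t \<otimes> r)) = 0"
    and l: "l < k" and s: "s \<in> G"
  shows "y l s = 0"
proof -
  obtain B where B: "mat_L1 k B"
    "\<And>i j. i < k \<Longrightarrow> j < k \<Longrightarrow> mat_mult k B (matrix_l1_of k A) i j = mat_one i j"
    using matrix_unitE[OF U] by blast
  have Am: "matrix_l1_of k A i j = l1_of (A i j)" if "i < k" "j < k" for i j
    using that by (simp add: matrix_l1_of_def)
  have AL: "l1_of (A i j) \<in> L1" if "i < k" "j < k" for i j using ZG_L1[OF FM_entry[OF A]] that by blast
  have yt: "bdd (\<lambda>r. y j (t \<otimes> r))" if "j < k" "t \<in> G" for j t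
    using bdd_reindex[OF y[OF that(1)], of "\<lambda>r. t \<otimes> r"] that(2) by simp
  have pb: "bdd (\<lambda>t. pairing (l1_of (A i j)) (\<lambda>r. y j (s \<otimes> (t \<otimes> r))))" if ij: "i < k" "j < k" for i j
  proof -
    obtain K where K: "\<And>s. s \<in> G \<Longrightarrow> \<bar>y j s\<bar> \<le> K" using y[OF ij(2)] unfolding bdd_def by blast
    show ?thesis
      by (rule bddI, rule pairing_bound[OF AL[OF ij] K]) (use s in simp)
  qed
  have "y l s = (\<Sum>j<k. if l = j then y j s else 0)" using l by simp
  also have "\<dots> = (\<Sum>j<k. pairing (mat_one l j) (\<lambda>r. y j (s \<otimes> r)))"
    by (intro sum.cong refl) (use s in \<open>simp add: mat_one_def pairing_one pairing_zero\<close>)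
  also have "\<dots> = (\<Sum>j<k. \<Sum>i<k. pairing (conv (B l i) (l1_of (A i j))) (\<lambda>r. y j (s \<otimes> r)))"
  proof (intro sum.cong refl)
    fix j assume "j \<in> {..<k}"
    then have j: "j < k" by simp
    have "mat_one l j = (\<lambda>s. \<Sum>i<k. conv (B l i) (l1_of (A i j)) s)"
      unfolding B(2)[OF l j, symmetric] mat_mult_def
      by (intro ext sum.cong refl) (simp add: Am j)
    moreover have "pairing (\<lambda>s. \<Sum>i<k. conv (B l i) (l1_of (A i j)) s) (\<lambda>r. y j (s \<otimes> r))
        = (\<Sum>i<k. pairing (conv (B l i) (l1_of (A i j))) (\<lambda>r. y j (s \<otimes> r)))"
      by (rule pairing_sum_left[OF _ _ yt[OF j s]]) (auto intro!: conv_L1 mat_L1D[OF B(1) l] AL j)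
    ultimately show "pairing (mat_one l j) (\<lambda>r. y j (s \<otimes> r)) = (\<Sum>i<k. pairing (conv (B l i) (l1_of (A i j))) (\<lambda>r. y j (s \<otimes> r)))"
      by (simp only:)
  qed
  also have "\<dots> = (\<Sum>i<k. \<Sum>j<k. pairing (conv (B l i) (l1_of (A i j))) (\<lambda>r. y j (s \<otimes> r)))"
    by (rule sum.swap)
  also have "\<dots> = (\<Sum>i<k. 0)"
  proof (intro sum.cong refl)
    fix i assume "i \<in> {..<k}"
    then have i: "i < k" by simp
    have "(\<Sum>j<k. pairing (conv (B l i) (l1_of (A i j))) (\<lambda>r. y j (s \<otimes> r)))
        = (\<Sum>j<k. pairing (B l i) (\<lambda>t. pairing (l1_of (A i j)) (\<lambda>r. y j (s \<otimes> (t \<otimes> r)))))"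
      using i s by (intro sum.cong refl conv_pairing(2) mat_L1D[OF B(1) l] AL yt) auto
    also have "\<dots> = pairing (B l i) (\<lambda>t. \<Sum>j<k. pairing (l1_of (A i j)) (\<lambda>r. y j (s \<otimes> (t \<otimes> r))))"
      using i pb by (intro pairing_sum_right[symmetric] mat_L1D[OF B(1) l]) auto
    also have "\<dots> = pairing (B l i) (\<lambda>t. 0)"
    proof (rule pairing_cong)
      fix t assume t: "t \<in> G"
      have "(\<Sum>j<k. pairing (l1_of (A i j)) (\<lambda>r. y j (s \<otimes> (t \<otimes> r)))) = row_pairing k (A i) (\<lambda>j r. y j ((s \<otimes> t) \<otimes> r))"
        unfolding row_pairing_def using s t by (intro sum.cong refl pairing_cong) (simp add: m_assoc)
      then show "B l i t * (\<Sum>j<k. pairing (l1_of (A i j)) (\<lambda>r. y j (s \<otimes> (t \<otimes> r)))) = B l i t * 0"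
        using zero[OF i, of "s \<otimes> t"] s t by simp
    qed
    finally show "(\<Sum>j<k. pairing (conv (B l i) (l1_of (A i j))) (\<lambda>r. y j (s \<otimes> r))) = 0" by (simp add: pairing_zero)
  qed
  finally show ?thesis by simp
qed

end

context algebraic_action begin

text \<open>Automorphisms reduce pairs of points to a point and \<open>\<one>\<close>. The
  compatible metric need not be translation invariant, so the way back uses compactness: points at
  distance less than a constant \<open>c\<close> have quotient in \<open>U\<close>.\<close>

lemma expansive_iff:
  "expansive \<Gamma> X T \<alpha> \<longleftrightarrow> (\<exists>U. openin T U \<and> \<one>\<^bsub>X\<^esub> \<in> U \<and>
     (\<forall>x\<in>carrier X. (\<forall>s\<in>carrier \<Gamma>. \<alpha> s x \<in> U) \<longrightarrow> x = \<one>\<^bsub>X\<^esub>))"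
proof
  assume "expansive \<Gamma> X T \<alpha>"
  then obtain \<rho> c where \<rho>: "Metric_space (carrier X) \<rho>" "Metric_space.mtopology (carrier X) \<rho> = T"
    and c: "c > 0" "\<And>x y. x \<in> carrier X \<Longrightarrow> y \<in> carrier X \<Longrightarrow> x \<noteq> y \<Longrightarrow>
        (SUP s\<in>carrier \<Gamma>. \<rho> (\<alpha> s x) (\<alpha> s y)) > c"
    unfolding expansive_def by blast
  interpret R: Metric_space "carrier X" \<rho> by (rule \<rho>(1))
  have "x = \<one>\<^bsub>X\<^esub>" if x: "x \<in> carrier X" and in_ball: "\<forall>s\<in>carrier \<Gamma>. \<alpha> s x \<in> R.mball \<one>\<^bsub>X\<^esub> c" for x
  proof (rule ccontr)
    assume "x \<noteq> \<one>\<^bsub>X\<^esub>"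
    then have "(SUP s\<in>carrier \<Gamma>. \<rho> (\<alpha> s x) (\<alpha> s \<one>\<^bsub>X\<^esub>)) > c" using c(2)[OF x] by simp
    moreover have "(SUP s\<in>carrier \<Gamma>. \<rho> (\<alpha> s x) (\<alpha> s \<one>\<^bsub>X\<^esub>)) \<le> c"
    proof (rule cSUP_least)
      show "carrier \<Gamma> \<noteq> {}" using D.one_closed by blast
      fix s assume s: "s \<in> carrier \<Gamma>"
      have "\<rho> \<one>\<^bsub>X\<^esub> (\<alpha> s x) < c" using in_ball s by simp
      then show "\<rho> (\<alpha> s x) (\<alpha> s \<one>\<^bsub>X\<^esub>) \<le> c" using R.commute[of "\<alpha> s x" "\<one>\<^bsub>X\<^esub>"] s by (simp add: act_id)
    qed
    ultimately show False by simp
  qed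
  moreover have "openin T (R.mball \<one>\<^bsub>X\<^esub> c)" using R.openin_mball \<rho>(2) by simp
  moreover have "\<one>\<^bsub>X\<^esub> \<in> R.mball \<one>\<^bsub>X\<^esub> c" using c(1) by simp
  ultimately show "\<exists>U. openin T U \<and> \<one>\<^bsub>X\<^esub> \<in> U \<and>
     (\<forall>x\<in>carrier X. (\<forall>s\<in>carrier \<Gamma>. \<alpha> s x \<in> U) \<longrightarrow> x = \<one>\<^bsub>X\<^esub>)" by blast
next
  assume "\<exists>U. openin T U \<and> \<one>\<^bsub>X\<^esub> \<in> U \<and>
     (\<forall>x\<in>carrier X. (\<forall>s\<in>carrier \<Gamma>. \<alpha> s x \<in> U) \<longrightarrow> x = \<one>\<^bsub>X\<^esub>)"
  then obtain U where U: "openin T U" "\<one>\<^bsub>X\<^esub> \<in> U"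
    "\<And>x. x \<in> carrier X \<Longrightarrow> (\<And>s. s \<in> carrier \<Gamma> \<Longrightarrow> \<alpha> s x \<in> U) \<Longrightarrow> x = \<one>\<^bsub>X\<^esub>" by blast
  obtain N \<rho> where N: "Metric_space N \<rho>" "T = Metric_space.mtopology N \<rho>"
    using C.metrizable by (auto simp: metrizable_space_def)
  have NX: "N = carrier X" using C.topspace_eq N by (metis Metric_space.topspace_mtopology)
  have \<rho>: "Metric_space (carrier X) \<rho>" "Metric_space.mtopology (carrier X) \<rho> = T" using N NX by auto
  interpret R: Metric_space "carrier X" \<rho> by (rule \<rho>(1))
  have near: "\<exists>r>0. \<forall>x\<in>carrier X. \<forall>y'\<in>carrier X. \<rho> y x < 2 * r \<longrightarrow> \<rho> y y' < 2 * r \<longrightarrow> x \<otimes>\<^bsub>X\<^esub> inv\<^bsub>X\<^esub> y' \<in> U"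
    if y: "y \<in> carrier X" for y
  proof -
    have cm: "continuous_map (prod_topology T T) T (\<lambda>p. fst p \<otimes>\<^bsub>X\<^esub> inv\<^bsub>X\<^esub> (snd p))"
      by (intro C.continuous_map_op C.continuous_map_inverse continuous_map_fst continuous_map_snd)
    have op: "openin (prod_topology T T) {p \<in> topspace (prod_topology T T). fst p \<otimes>\<^bsub>X\<^esub> inv\<^bsub>X\<^esub> (snd p) \<in> U}"
      by (rule openin_continuous_map_preimage[OF cm U(1)])
    have "(y, y) \<in> {p \<in> topspace (prod_topology T T). fst p \<otimes>\<^bsub>X\<^esub> inv\<^bsub>X\<^esub> (snd p) \<in> U}"
      using y U(2) by (simp add: C.topspace_eq)
    from op[unfolded openin_prod_topology_alt, rule_format, OF this]
    obtain V W where VW: "openin T V" "openin T W" "y \<in> V" "y \<in> W"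
      "V \<times> W \<subseteq> {p \<in> topspace (prod_topology T T). fst p \<otimes>\<^bsub>X\<^esub> inv\<^bsub>X\<^esub> (snd p) \<in> U}" by blast
    have "openin R.mtopology V" "openin R.mtopology W" using VW \<rho>(2) by auto
    then obtain a b where ab: "a > 0" "R.mball y a \<subseteq> V" "b > 0" "R.mball y b \<subseteq> W"
      using VW(3,4) unfolding R.openin_mtopology by blast
    define r where "r = min a b / 2"
    have r: "r > 0" "2 * r \<le> a" "2 * r \<le> b" using ab by (auto simp: r_def)
    show ?thesis
    proof (intro exI[of _ r] conjI ballI impI)
      fix x y' assume xy: "x \<in> carrier X" "y' \<in> carrier X" "\<rho> y x < 2 * r" "\<rho> y y' < 2 * r"
      have "x \<in> R.mball y a" "y' \<in> R.mball y b" using xy r y by simp_all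
      then have "(x, y') \<in> V \<times> W" using ab(2,4) by blast
      then have "(x, y') \<in> {p \<in> topspace (prod_topology T T). fst p \<otimes>\<^bsub>X\<^esub> inv\<^bsub>X\<^esub> (snd p) \<in> U}" using VW(5) by blast
      then show "x \<otimes>\<^bsub>X\<^esub> inv\<^bsub>X\<^esub> y' \<in> U" by simp
    qed (rule r(1))
  qed
  then obtain r where r: "\<And>y. y \<in> carrier X \<Longrightarrow> r y > 0"
    "\<And>y x y'. y \<in> carrier X \<Longrightarrow> x \<in> carrier X \<Longrightarrow> y' \<in> carrier X \<Longrightarrow> \<rho> y x < 2 * r y \<Longrightarrow> \<rho> y y' < 2 * r y \<Longrightarrow>
       x \<otimes>\<^bsub>X\<^esub> inv\<^bsub>X\<^esub> y' \<in> U" by metis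
  have opb: "openin T (R.mball y (r y))" for y using R.openin_mball \<rho>(2) by simp
  have inb: "y \<in> R.mball y (r y)" if "y \<in> carrier X" for y using that r(1) by simp
  obtain Z where Z: "finite Z" "Z \<subseteq> carrier X" "\<And>x. x \<in> carrier X \<Longrightarrow> \<exists>z\<in>Z. x \<in> R.mball z (r z)"
    using C.compact_cover[of "\<lambda>y. R.mball y (r y)", OF opb inb] by metis
  \<comment> \<open>A Lebesgue number: if \<open>y\<close> lies in the ball of radius
    \<open>r z\<close> and \<open>x\<close> is closer than \<open>c\<close> to \<open>y\<close>,
    both lie in the ball of radius \<open>2 * r z\<close>.\<close>
  define c where "c = Min (insert 1 (r ` Z))"
  have c: "c > 0" unfolding c_def using Z(1,2) r(1) by (auto simp: subset_iff)
  have close: "x \<otimes>\<^bsub>X\<^esub> inv\<^bsub>X\<^esub> y \<in> U" if xy: "x \<in> carrier X" "y \<in> carrier X" "\<rho> x y < c" for x y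
  proof -
    obtain z where z: "z \<in> Z" "y \<in> R.mball z (r z)" using Z(3)[OF xy(2)] by blast
    have zX: "z \<in> carrier X" using z Z(2) by blast
    have "c \<le> r z" unfolding c_def using z(1) Z(1) by (intro Min_le) auto
    then have "\<rho> z x < 2 * r z" "\<rho> z y < 2 * r z"
      using R.triangle[OF zX xy(2) xy(1)] R.commute[of x y] xy(3) z(2) r(1)[OF zX] by auto
    then show ?thesis using r(2)[OF zX xy(1,2)] by blast
  qed
  have "compactin R.mtopology (carrier X)"
    using C.compact \<rho>(2) by (simp add: compact_space_def C.topspace_eq)
  then have "R.mbounded (carrier X)" by (rule R.compactin_imp_mbounded)
  then obtain b where b: "\<And>x y. x \<in> carrier X \<Longrightarrow> y \<in> carrier X \<Longrightarrow> \<rho> x y \<le> b"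
    unfolding R.mbounded_alt by blast
  \<comment> \<open>Some \<open>s\<close> gives distance at least \<open>c\<close>, so the supremum
    is at least \<open>c\<close>; the strict inequality in \<open>expansive\<close> is met by
    \<open>c / 2\<close>.\<close>
  have "(SUP s\<in>carrier \<Gamma>. \<rho> (\<alpha> s x) (\<alpha> s y)) > c / 2" if xy: "x \<in> carrier X" "y \<in> carrier X" "x \<noteq> y" for x y
  proof -
    have "x \<otimes>\<^bsub>X\<^esub> inv\<^bsub>X\<^esub> y \<noteq> \<one>\<^bsub>X\<^esub>"
    proof
      assume "x \<otimes>\<^bsub>X\<^esub> inv\<^bsub>X\<^esub> y = \<one>\<^bsub>X\<^esub>"
      then have "x = inv\<^bsub>X\<^esub> (inv\<^bsub>X\<^esub> y)" using C.inv_equality[of x "inv\<^bsub>X\<^esub> y"] xy by simp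
      then show False using xy by simp
    qed
    then obtain s where s: "s \<in> carrier \<Gamma>" "\<alpha> s (x \<otimes>\<^bsub>X\<^esub> inv\<^bsub>X\<^esub> y) \<notin> U"
      using U(3)[of "x \<otimes>\<^bsub>X\<^esub> inv\<^bsub>X\<^esub> y"] xy by auto
    have "\<alpha> s (x \<otimes>\<^bsub>X\<^esub> inv\<^bsub>X\<^esub> y) = \<alpha> s x \<otimes>\<^bsub>X\<^esub> inv\<^bsub>X\<^esub> (\<alpha> s y)"
      using s(1) xy by (simp add: act_mult act_inv)
    then have "\<not> \<rho> (\<alpha> s x) (\<alpha> s y) < c" using close[of "\<alpha> s x" "\<alpha> s y"] s act_closed xy by auto
    moreover have "\<rho> (\<alpha> s x) (\<alpha> s y) \<le> (SUP s\<in>carrier \<Gamma>. \<rho> (\<alpha> s x) (\<alpha> s y))"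
      using b act_closed xy s(1) by (intro cSUP_upper bdd_aboveI2[where M=b]) auto
    ultimately show ?thesis using c by linarith
  qed
  then show "expansive \<Gamma> X T \<alpha>"
    unfolding expansive_def using \<rho> c by (intro exI[of _ \<rho>] conjI exI[of _ "c / 2"]) auto
qed

lemma lin_apply: "x \<in> carrier X \<Longrightarrow> lin k \<phi> w x = cis (D.row_pairing k w (\<lambda>j. ang (\<phi> j) x))"
  by (simp add: lin_def D.row_pairing_def)

lemma lin_closed_FM:
  "w \<in> carrier (D.FM k) \<Longrightarrow> (\<And>j. j < k \<Longrightarrow> \<phi> j \<in> chars) \<Longrightarrow> lin k \<phi> w \<in> chars"
  by (rule lin_closed[OF D.FM_entry])

lemma lin_shift:
  assumes "t \<in> carrier \<Gamma>" "w \<in> carrier (D.FM k)" "\<And>j. j < k \<Longrightarrow> \<phi> j \<in> chars" "x \<in> carrier X"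
  shows "lin k \<phi> (D.point t 1 \<odot>\<^bsub>D.FM k\<^esub> w) x = lin k \<phi> w (\<alpha> (inv\<^bsub>\<Gamma>\<^esub> t) x)"
proof -
  have lc: "lin k \<phi> w \<in> chars" using lin_closed_FM assms(2,3) by blast
  have eq: "lin k \<phi> (D.point t 1 \<odot>\<^bsub>D.FM k\<^esub> w) = D.point t 1 \<odot>\<^bsub>M\<^esub> lin k \<phi> w"
    by (rule lin_smult[OF D.point_ZG[OF assms(1)] assms(2,3)])
  show ?thesis
    unfolding eq
      smult_apply[OF D.point_ZG[OF assms(1)] lc assms(4)] D.pairing_point[OF assms(1)]
    by (rule cis_ang[OF lc assms(4,1)])
qed

text \<open>Take finitely many characters that cut out a neighbourhood inside \<open>U\<close>. A
  point at which the submodule they generate is trivial has its whole orbit in \<open>U\<close>,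
  hence is \<open>\<one>\<close>; so this submodule separates points and is the whole dual.\<close>

theorem expansive_finitely_generated:
  assumes "expansive \<Gamma> X T \<alpha>"
  shows "finitely_generated_left_module (group_ring \<Gamma>) M"
proof -
  obtain U where U: "openin T U" "\<one>\<^bsub>X\<^esub> \<in> U"
    "\<And>x. x \<in> carrier X \<Longrightarrow> (\<And>s. s \<in> carrier \<Gamma> \<Longrightarrow> \<alpha> s x \<in> U) \<Longrightarrow> x = \<one>\<^bsub>X\<^esub>"
    using assms unfolding expansive_iff by blast
  obtain F e where F: "finite F" "F \<subseteq> chars" "e > 0"
    "\<And>z. z \<in> carrier X \<Longrightarrow> (\<And>\<phi>. \<phi> \<in> F \<Longrightarrow> cmod (\<phi> z - 1) < e) \<Longrightarrow> z \<in> U"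
    using C.char_neighbourhood[OF U(1,2)] by metis
  define k where "k = card F"
  obtain \<phi> where b: "bij_betw \<phi> {..<k} F"
    using ex_bij_betw_nat_finite[OF F(1)] by (auto simp: k_def atLeast0LessThan)
  have \<phi>: "\<phi> j \<in> chars" if "j < k" for j using bij_betw_apply[OF b] that F(2) by blast
  let ?S = "lin k \<phi> ` carrier (D.FM k)"
  have lc: "lin k \<phi> w \<in> chars" if "w \<in> carrier (D.FM k)" for w by (rule lin_closed_FM[OF that \<phi>])
  have "?S = chars"
  proof (rule C.separating_subgroup_full)
    show "?S \<subseteq> chars" using lc by blast
    show "C.char_one \<in> ?S" using lin_zero[of k \<phi>] FM_zero_closed[of k] by (metis imageI)
    show "C.char_mult \<kappa> \<kappa>' \<in> ?S" if in_S: "\<kappa> \<in> ?S" "\<kappa>' \<in> ?S" for \<kappa> \<kappa>'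
    proof -
      obtain v where "\<kappa> = lin k \<phi> v" "v \<in> carrier (D.FM k)" using in_S(1) by (rule imageE)
      moreover obtain w where "\<kappa>' = lin k \<phi> w" "w \<in> carrier (D.FM k)" using in_S(2) by (rule imageE)
      ultimately show ?thesis using lin_add[of v k w \<phi>] D.FM_add_closed[of v k w] by (metis imageI)
    qed
    show "C.char_cnj \<kappa> \<in> ?S" if in_S: "\<kappa> \<in> ?S" for \<kappa>
    proof -
      obtain v where "\<kappa> = lin k \<phi> v" "v \<in> carrier (D.FM k)" using in_S by (rule imageE)
      then show ?thesis using lin_uminus[of v k \<phi>] D.FM_uminus_closed[of v k] by (metis imageI)
    qed
    fix x assume x: "x \<in> carrier X" "x \<noteq> \<one>\<^bsub>X\<^esub>"
    show "\<exists>\<kappa>\<in>?S. \<kappa> x \<noteq> 1"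
    proof (rule ccontr)
      assume "\<not> (\<exists>\<kappa>\<in>?S. \<kappa> x \<noteq> 1)"
      then have one: "lin k \<phi> w x = 1" if "w \<in> carrier (D.FM k)" for w using that by blast
      have "\<alpha> s x \<in> U" if s: "s \<in> carrier \<Gamma>" for s
      proof (rule F(4)[OF act_closed[OF s x(1)]])
        fix \<psi> assume "\<psi> \<in> F"
        then obtain j where j: "j < k" "\<psi> = \<phi> j" using b by (auto simp: bij_betw_def)
        \<comment> \<open>The module action inverts group elements, so evaluation at
          \<open>\<alpha> s x\<close> is the action of \<open>inv s\<close>.\<close>
        have s': "inv\<^bsub>\<Gamma>\<^esub> s \<in> carrier \<Gamma>" using s by simp
        have "lin k \<phi> (D.point (inv\<^bsub>\<Gamma>\<^esub> s) 1 \<odot>\<^bsub>D.FM k\<^esub> basis k j) x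
            = lin k \<phi> (basis k j) (\<alpha> (inv\<^bsub>\<Gamma>\<^esub> (inv\<^bsub>\<Gamma>\<^esub> s)) x)"
          by (rule lin_shift[OF s' basis_closed \<phi> x(1)])
        then have "lin k \<phi> (basis k j) (\<alpha> (inv\<^bsub>\<Gamma>\<^esub> (inv\<^bsub>\<Gamma>\<^esub> s)) x) = 1"
          using one[OF D.FM_smult_closed[OF D.point_ZG[OF s'] basis_closed]]
          by simp
        then have "\<phi> j (\<alpha> s x) = 1" using lin_basis[of j k \<phi>, OF j(1) \<phi>[OF j(1)]] s by simp
        then show "cmod (\<psi> (\<alpha> s x) - 1) < e" using j F(3) by simp
      qed
      then show False using U(3)[OF x(1)] x(2) by blast
    qed
  qed
  then have "\<exists>w\<in>carrier (D.FM k). lin k \<phi> w = \<kappa>" if \<kappa>: "\<kappa> \<in> chars" for \<kappa>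
    using \<kappa> by (metis imageE)
  then show ?thesis using generated_finitely_generated[of k \<phi>] \<phi> by blast
qed

text \<open>Pairing with a row that annihilates \<open>J\<close> is well defined on the dual: two
  representatives of a character differ by an element of \<open>J\<close>.\<close>

lemma presents_row_pairing_eq:
  assumes P: "presents k \<phi> J" and y: "\<And>j. j < k \<Longrightarrow> D.bdd (y j)" and zero: "\<And>w. w \<in> J \<Longrightarrow> D.row_pairing k w y = 0"
    and vw: "v \<in> carrier (D.FM k)" "w \<in> carrier (D.FM k)" "lin k \<phi> v = lin k \<phi> w"
  shows "D.row_pairing k v y = D.row_pairing k w y"
proof -
  have \<phi>: "\<And>j. j < k \<Longrightarrow> \<phi> j \<in> chars" and Jd: "J = {w \<in> carrier (D.FM k). lin k \<phi> w = C.char_one}"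
    using P by (auto simp: presents_def)
  let ?n = "\<lambda>i\<in>{..<k}. \<lambda>s. - w i s"
  have n: "?n \<in> carrier (D.FM k)" by (rule D.FM_uminus_closed[OF vw(2)])
  have lw: "lin k \<phi> w \<in> chars" by (rule lin_closed_FM[where \<phi>=\<phi>, OF vw(2) \<phi>])
  have "lin k \<phi> (v \<oplus>\<^bsub>D.FM k\<^esub> ?n) = C.char_one"
  proof (rule C.char_eqI[OF lin_closed_FM[where \<phi>=\<phi>, OF D.FM_add_closed[OF vw(1) n] \<phi>] C.char_one_closed])
    fix x assume x: "x \<in> carrier X"
    show "lin k \<phi> (v \<oplus>\<^bsub>D.FM k\<^esub> ?n) x = C.char_one x"
      unfolding lin_add[OF vw(1) n] lin_uminus[OF vw(2)] vw(3)
      using x C.char_norm[OF lw x]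
      by (simp add: C.char_mult_apply C.char_cnj_apply C.char_one_apply flip: complex_norm_square)
  qed
  then have "v \<oplus>\<^bsub>D.FM k\<^esub> ?n \<in> J" using D.FM_add_closed[OF vw(1) n] unfolding Jd by blast
  then have "D.row_pairing k v y + D.row_pairing k ?n y = 0"
    using zero D.row_pairing_add[where y=y, OF vw(1) n y] by simp
  then show ?thesis by (simp add: D.row_pairing_uminus)
qed

lemma row_pairing_basis:
  assumes j: "j < k"
  shows "D.row_pairing k (basis k j) y = y j \<one>\<^bsub>\<Gamma>\<^esub>"
proof -
  have z: "l1_of (\<lambda>s. 0) = (\<lambda>s. 0)" by (auto simp: l1_of_def)
  have "D.row_pairing k (basis k j) y = (\<Sum>i<k. if i = j then y i \<one>\<^bsub>\<Gamma>\<^esub> else 0)"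
    unfolding D.row_pairing_def
    by (intro sum.cong refl) (auto simp: basis_def D.pairing_point z D.pairing_zero)
  then show ?thesis using j by simp
qed

text \<open>A bounded row \<open>y\<close> annihilating \<open>J\<close> defines, for each real \<open>\<tau>\<close>, a homomorphism from the dual to the
  circle, hence a point of \<open>X\<close>. For small \<open>\<tau>\<close> its whole orbit is close to \<open>\<one>\<close>.\<close>

theorem expansive_trivial_annihilator:
  assumes ex: "expansive \<Gamma> X T \<alpha>" and P: "presents k \<phi> J"
  shows "D.trivial_annihilator k J"
  unfolding D.trivial_annihilator_def
proof (intro allI impI ballI)
  fix y j0 s0 assume y: "\<forall>j<k. D.bdd (y j)" and zero: "\<forall>w\<in>J. D.row_pairing k w y = 0"
    and j0: "j0 < k" and s0: "s0 \<in> carrier \<Gamma>"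
  have yb: "\<And>j. j < k \<Longrightarrow> D.bdd (y j)" using y by blast
  have \<phi>: "\<And>j. j < k \<Longrightarrow> \<phi> j \<in> chars" and Jd: "J = {w \<in> carrier (D.FM k). lin k \<phi> w = C.char_one}"
    and sur: "\<And>\<kappa>. \<kappa> \<in> chars \<Longrightarrow> \<exists>w\<in>carrier (D.FM k). lin k \<phi> w = \<kappa>"
    using P by (auto simp: presents_def)
  have lc: "lin k \<phi> w \<in> chars" if "w \<in> carrier (D.FM k)" for w by (rule lin_closed_FM[OF that \<phi>])
  define w where "w \<kappa> = (SOME w. w \<in> carrier (D.FM k) \<and> lin k \<phi> w = \<kappa>)" for \<kappa>
  have w: "w \<kappa> \<in> carrier (D.FM k)" "lin k \<phi> (w \<kappa>) = \<kappa>" if "\<kappa> \<in> chars" for \<kappa>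
    using someI_ex[of "\<lambda>w. w \<in> carrier (D.FM k) \<and> lin k \<phi> w = \<kappa>"] sur[OF that] by (auto simp: w_def)
  have rp_eq: "D.row_pairing k v y = D.row_pairing k w y"
    if "v \<in> carrier (D.FM k)" "w \<in> carrier (D.FM k)" "lin k \<phi> v = lin k \<phi> w" for v w
    by (rule presents_row_pairing_eq[OF P yb zero[rule_format] that])
  define \<psi> where "\<psi> \<tau> \<kappa> = cis (\<tau> * D.row_pairing k (w \<kappa>) y)" for \<tau> \<kappa>
  have \<psi>_lin: "\<psi> \<tau> (lin k \<phi> v) = cis (\<tau> * D.row_pairing k v y)" if v: "v \<in> carrier (D.FM k)" for v \<tau>
    using rp_eq[OF w(1)[OF lc[OF v]] v w(2)[OF lc[OF v]]] by (simp add: \<psi>_def)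
  have dh: "C.dual_hom (\<psi> \<tau>)" for \<tau>
    unfolding C.dual_hom_def
  proof (intro conjI ballI)
    show "cmod (\<psi> \<tau> \<kappa>) = 1" for \<kappa> by (simp add: \<psi>_def)
    fix \<kappa> \<kappa>' assume k: "\<kappa> \<in> chars" "\<kappa>' \<in> chars"
    have "\<psi> \<tau> (C.char_mult \<kappa> \<kappa>') = \<psi> \<tau> (lin k \<phi> (w \<kappa> \<oplus>\<^bsub>D.FM k\<^esub> w \<kappa>'))"
      using lin_add[OF w(1)[OF k(1)] w(1)[OF k(2)], of \<phi>] w(2)[OF k(1)] w(2)[OF k(2)] by simp
    also have "\<dots> = cis (\<tau> * (D.row_pairing k (w \<kappa>) y + D.row_pairing k (w \<kappa>') y))"
      unfolding \<psi>_lin[OF D.FM_add_closed[OF w(1)[OF k(1)] w(1)[OF k(2)]]]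
      using D.row_pairing_add[where y=y, OF w(1)[OF k(1)] w(1)[OF k(2)] yb] by simp
    also have "\<dots> = \<psi> \<tau> \<kappa> * \<psi> \<tau> \<kappa>'" by (simp add: \<psi>_def distrib_left cis_mult)
    finally show "\<psi> \<tau> (C.char_mult \<kappa> \<kappa>') = \<psi> \<tau> \<kappa> * \<psi> \<tau> \<kappa>'" .
  qed
  obtain U where U: "openin T U" "\<one>\<^bsub>X\<^esub> \<in> U"
    "\<And>x. x \<in> carrier X \<Longrightarrow> (\<And>s. s \<in> carrier \<Gamma> \<Longrightarrow> \<alpha> s x \<in> U) \<Longrightarrow> x = \<one>\<^bsub>X\<^esub>"
    using ex unfolding expansive_iff by blast
  obtain F e where F: "finite F" "F \<subseteq> chars" "e > 0"
    "\<And>z. z \<in> carrier X \<Longrightarrow> (\<And>\<phi>. \<phi> \<in> F \<Longrightarrow> cmod (\<phi> z - 1) < e) \<Longrightarrow> z \<in> U"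
    using C.char_neighbourhood[OF U(1,2)] by metis
  have "\<forall>j\<in>{..<k}. \<exists>b\<ge>0. \<forall>s\<in>carrier \<Gamma>. \<bar>y j s\<bar> \<le> b" using yb unfolding D.bdd_def by blast
  from bchoice[OF this] obtain b where b: "\<And>j. j < k \<Longrightarrow> b j \<ge> 0" "\<And>j s. j < k \<Longrightarrow> s \<in> carrier \<Gamma> \<Longrightarrow> \<bar>y j s\<bar> \<le> b j"
    by (auto simp: lessThan_iff)
  define K where "K = (\<Sum>j<k. b j)"
  have K: "\<bar>y j s\<bar> \<le> K" if "j < k" "s \<in> carrier \<Gamma>" for j s
    using b(2)[OF that] member_le_sum[of j "{..<k}" b] b(1) that(1) unfolding K_def by auto
  have K0: "K \<ge> 0" unfolding K_def by (intro sum_nonneg) (use b(1) in auto)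
  define N where "N = K * (\<Sum>\<kappa>\<in>F. \<Sum>j<k. D.l1_norm (l1_of (w \<kappa> j)))"
  have N0: "N \<ge> 0" unfolding N_def by (intro mult_nonneg_nonneg K0 sum_nonneg D.l1_norm_nonneg)
  \<comment> \<open>The first bound keeps the orbit of the point inside \<open>U\<close>; the second
    lets \<open>\<tau> * y j0 s0\<close> be recovered from its exponential, since it is smaller than
    \<open>2 * pi\<close>.\<close>
  define \<tau> where "\<tau> = min (e / (2 * (N + 1))) (1 / (K + 1))"
  have \<tau>: "\<tau> > 0" using F(3) N0 K0 by (simp add: \<tau>_def add_nonneg_pos)
  have \<tau>N: "\<tau> * N < e"
  proof -
    have "\<tau> * N \<le> e / (2 * (N + 1)) * N" using N0 by (intro mult_right_mono) (auto simp: \<tau>_def)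
    also have "\<dots> < e" using F(3) N0 by (simp add: field_simps add_nonneg_pos)
    finally show ?thesis .
  qed
  have \<tau>K: "\<tau> * K < 1"
  proof -
    have "\<tau> * K \<le> 1 / (K + 1) * K" using K0 by (intro mult_right_mono) (auto simp: \<tau>_def)
    also have "\<dots> < 1" using K0 by (simp add: field_simps)
    finally show ?thesis .
  qed
  obtain x where x: "x \<in> carrier X" "\<And>\<kappa>. \<kappa> \<in> chars \<Longrightarrow> \<kappa> x = \<psi> \<tau> \<kappa>"
    using C.dual_hom_is_evaluation[OF dh] by blast
  have ev: "\<kappa> (\<alpha> s x) = cis (\<tau> * D.row_pairing k (w \<kappa>) (\<lambda>j r. y j (inv\<^bsub>\<Gamma>\<^esub> s \<otimes>\<^bsub>\<Gamma>\<^esub> r)))"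
    if \<kappa>: "\<kappa> \<in> chars" and s: "s \<in> carrier \<Gamma>" for \<kappa> s
  proof -
    have s': "inv\<^bsub>\<Gamma>\<^esub> s \<in> carrier \<Gamma>" using s by simp
    note wF = w(1)[OF \<kappa>] and pF = D.FM_smult_closed[OF D.point_ZG[OF s'] w(1)[OF \<kappa>], of 1]
    have "\<kappa> (\<alpha> s x) = lin k \<phi> (D.point (inv\<^bsub>\<Gamma>\<^esub> s) 1 \<odot>\<^bsub>D.FM k\<^esub> w \<kappa>) x"
      using lin_shift[where \<phi>=\<phi>, OF s' wF \<phi> x(1)] w(2)[OF \<kappa>] s by simp
    also have "\<dots> = cis (\<tau> * D.row_pairing k (D.point (inv\<^bsub>\<Gamma>\<^esub> s) 1 \<odot>\<^bsub>D.FM k\<^esub> w \<kappa>) y)"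
      using x(2)[OF lc[OF pF]] \<psi>_lin[OF pF] by simp
    finally show ?thesis using D.row_pairing_shift[where y=y, OF s' wF yb] by simp
  qed
  have "\<alpha> s x \<in> U" if s: "s \<in> carrier \<Gamma>" for s
  proof (rule F(4)[OF act_closed[OF s x(1)]])
    fix \<kappa> assume \<kappa>: "\<kappa> \<in> F"
    then have \<kappa>c: "\<kappa> \<in> chars" using F(2) by blast
    let ?R = "D.row_pairing k (w \<kappa>) (\<lambda>j r. y j (inv\<^bsub>\<Gamma>\<^esub> s \<otimes>\<^bsub>\<Gamma>\<^esub> r))"
    have "\<bar>?R\<bar> \<le> K * (\<Sum>j<k. D.l1_norm (l1_of (w \<kappa> j)))"
      using s by (intro D.row_pairing_bound w(1)[OF \<kappa>c] K) auto
    also have "\<dots> \<le> N" unfolding N_def using F(1) \<kappa>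
      by (intro mult_left_mono K0 member_le_sum sum_nonneg D.l1_norm_nonneg)
    finally have "\<bar>\<tau> * ?R\<bar> \<le> \<tau> * N" using \<tau> by (simp add: abs_mult)
    then show "cmod (\<kappa> (\<alpha> s x) - 1) < e"
      using ev[OF \<kappa>c s] norm_cis_minus_one_le[of "\<tau> * ?R"] \<tau>N by simp
  qed
  then have x1: "x = \<one>\<^bsub>X\<^esub>" by (rule U(3)[OF x(1)])
  \<comment> \<open>A translated basis vector, whose pairing with \<open>y\<close> is the single
    value \<open>y j0 s0\<close>.\<close>
  let ?v = "D.point s0 1 \<odot>\<^bsub>D.FM k\<^esub> basis k j0"
  have v: "?v \<in> carrier (D.FM k)" by (rule D.FM_smult_closed[OF D.point_ZG[OF s0] basis_closed])
  have rv: "D.row_pairing k ?v y = y j0 s0"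
    using D.row_pairing_shift[where y=y, OF s0 basis_closed yb] row_pairing_basis[OF j0, of "\<lambda>j r. y j (s0 \<otimes>\<^bsub>\<Gamma>\<^esub> r)"] s0 by simp
  have "cis (\<tau> * y j0 s0) = lin k \<phi> ?v x" using x(2)[OF lc[OF v]] \<psi>_lin[OF v, of \<tau>] rv by simp
  also have "\<dots> = 1" using x1 C.char_at_one[OF lc[OF v]] by simp
  finally have c1: "cis (\<tau> * y j0 s0) = 1" .
  have "\<bar>\<tau> * y j0 s0\<bar> \<le> \<tau> * K" using K[OF j0 s0] \<tau> by (simp add: abs_mult)
  also have "\<dots> < 2 * pi" using \<tau>K pi_gt3 by linarith
  finally have "\<tau> * y j0 s0 = 0" by (rule cis_eq_one_small[OF c1])
  then show "y j0 s0 = 0" using \<tau> by simp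
qed

text \<open>If the orbit of \<open>x\<close> stays close to \<open>\<one>\<close>, then the angles of \<open>\<phi> j\<close> along it are so small that the rows
  of \<open>A\<close>, which pair with them to multiples of \<open>2 * pi\<close>, pair with them to \<open>0\<close>.\<close>

theorem invertible_matrix_expansive:
  assumes P: "presents k \<phi> J" and A: "matrix_l1_of k A \<in> Units (D.MatL k)" "\<And>i. i < k \<Longrightarrow> A i \<in> J"
  shows "expansive \<Gamma> X T \<alpha>"
proof -
  have \<phi>: "\<And>j. j < k \<Longrightarrow> \<phi> j \<in> chars" and Jd: "J = {w \<in> carrier (D.FM k). lin k \<phi> w = C.char_one}"
    and sur: "\<And>\<kappa>. \<kappa> \<in> chars \<Longrightarrow> \<exists>w\<in>carrier (D.FM k). lin k \<phi> w = \<kappa>"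
    using P by (auto simp: presents_def)
  have AF: "A i \<in> carrier (D.FM k)" if "i < k" for i using A(2)[OF that] Jd by blast
  define N where "N = (\<Sum>i<k. \<Sum>j<k. D.l1_norm (l1_of (A i j)))"
  have N0: "N \<ge> 0" unfolding N_def by (intro sum_nonneg D.l1_norm_nonneg)
  \<comment> \<open>Angles of size at most \<open>d\<close> pair with each row of \<open>A\<close>
    to less than \<open>d * N + 1 \<le> 2 * pi\<close>; being multiples of \<open>2 * pi\<close>,
    these pairings vanish.\<close>
  define d where "d = 1 / (N + 1)"
  have d: "d > 0" "d * N < 1" using N0 by (auto simp: d_def field_simps)
  obtain e where e: "e > 0" "\<And>z. cmod (z - 1) < e \<Longrightarrow> \<bar>Arg z\<bar> < d" using Arg_small[OF d(1)] by metis
  \<comment> \<open>The factor \<open>topspace T\<close> covers \<open>k = 0\<close>, where the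
    intersection over \<open>j\<close> is the whole type.\<close>
  define U where "U = (\<Inter>j\<in>{..<k}. {x \<in> carrier X. cmod (\<phi> j x - 1) < e}) \<inter> topspace T"
  have "openin T U"
    unfolding U_def
  proof (rule openin_INT)
    fix j assume "j \<in> {..<k}"
    then have "continuous_map T euclideanreal (\<lambda>x. cmod (\<phi> j x - 1))" by (intro C.continuous_char_dist \<phi>) simp
    from openin_continuous_map_preimage[OF this, of "{..<e}"]
    show "openin T {x \<in> carrier X. cmod (\<phi> j x - 1) < e}" by (simp add: C.topspace_eq)
  qed simp
  moreover have "\<one>\<^bsub>X\<^esub> \<in> U" using e(1) by (simp add: U_def C.char_at_one \<phi> C.topspace_eq)
  moreover have "x = \<one>\<^bsub>X\<^esub>" if x: "x \<in> carrier X" and xU: "\<forall>s\<in>carrier \<Gamma>. \<alpha> s x \<in> U" for x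
  proof -
    have small: "\<bar>ang (\<phi> j) x s\<bar> \<le> d" if "j < k" "s \<in> carrier \<Gamma>" for j s
    proof -
      have "\<alpha> (inv\<^bsub>\<Gamma>\<^esub> s) x \<in> U" using xU that(2) by simp
      then have "cmod (\<phi> j (\<alpha> (inv\<^bsub>\<Gamma>\<^esub> s) x) - 1) < e" using that(1) by (simp add: U_def)
      from e(2)[OF this] show ?thesis by (simp add: ang_def)
    qed
    have ang0: "ang (\<phi> j) x s = 0" if j: "j < k" and s: "s \<in> carrier \<Gamma>" for j s
    proof (rule D.invertible_annihilator[where y="\<lambda>j. ang (\<phi> j) x", OF A(1) AF _ _ j s])
      show "D.bdd (ang (\<phi> j) x)" for j by (rule ang_bdd)
      fix i t assume i: "i < k" and t: "t \<in> carrier \<Gamma>"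
      let ?R = "D.row_pairing k (A i) (\<lambda>j r. ang (\<phi> j) x (t \<otimes>\<^bsub>\<Gamma>\<^esub> r))"
      have "cis ?R = lin k \<phi> (D.point t 1 \<odot>\<^bsub>D.FM k\<^esub> A i) x"
        using D.row_pairing_shift[OF t AF[OF i], of "\<lambda>j. ang (\<phi> j) x"] ang_bdd by (simp add: lin_apply[OF x])
      also have "\<dots> = 1"
        using lin_shift[where \<phi>=\<phi>, OF t AF[OF i] \<phi> x] A(2)[OF i] Jd act_closed[OF D.inv_closed[OF t] x]
        by (simp add: C.char_one_apply)
      finally have c1: "cis ?R = 1" .
      have "\<bar>?R\<bar> \<le> d * (\<Sum>j<k. D.l1_norm (l1_of (A i j)))"
        using t by (intro D.row_pairing_bound AF[OF i] small) auto
      also have "\<dots> \<le> d * N" unfolding N_def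
        using d(1) i by (intro mult_left_mono member_le_sum sum_nonneg D.l1_norm_nonneg) auto
      also have "\<dots> < 2 * pi" using d(2) pi_gt3 by linarith
      finally show "?R = 0" by (rule cis_eq_one_small[OF c1])
    qed
    show "x = \<one>\<^bsub>X\<^esub>"
    proof (rule ccontr)
      assume "x \<noteq> \<one>\<^bsub>X\<^esub>"
      then obtain \<kappa> where \<kappa>: "\<kappa> \<in> chars" "\<kappa> x \<noteq> 1" using C.characters_separate[OF x] by blast
      obtain w where w: "w \<in> carrier (D.FM k)" "lin k \<phi> w = \<kappa>" using sur[OF \<kappa>(1)] by blast
      have "D.row_pairing k w (\<lambda>j. ang (\<phi> j) x) = (\<Sum>j<k. 0)"
        unfolding D.row_pairing_def
      proof (intro sum.cong refl)
        fix j assume "j \<in> {..<k}"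
        then have "D.pairing (l1_of (w j)) (ang (\<phi> j) x) = D.pairing (l1_of (w j)) (\<lambda>s. 0)"
          by (intro D.pairing_cong) (simp add: ang0)
        then show "D.pairing (l1_of (w j)) (ang (\<phi> j) x) = 0" by (simp add: D.pairing_zero)
      qed
      then show False using \<kappa>(2) lin_apply[OF x, of k \<phi> w] w(2) by simp
    qed
  qed
  ultimately show ?thesis unfolding expansive_iff by blast
qed

end

section \<open>The tensor product\<close>

lemma trivial_quotient_free_iff:
  assumes R: "R \<subseteq> carrier (free_Abelian_group S)"
  shows "trivial_group (free_Abelian_group S Mod generate (free_Abelian_group S) R)
    \<longleftrightarrow> (\<forall>x\<in>S. frag_of x \<in> generate (free_Abelian_group S) R)" (is "?triv \<longleftrightarrow> ?gen")
proof -
  let ?F = "free_Abelian_group S" let ?H = "generate ?F R"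
  interpret F: comm_group ?F by (rule abelian_free_Abelian_group)
  have H: "subgroup ?H ?F" by (rule F.generate_is_subgroup[OF R])
  have Hc: "?H \<subseteq> carrier ?F" by (rule subgroup.subset[OF H])
  have N: "?H \<lhd> ?F" using H by (simp add: F.normal_iff_subgroup)
  show ?thesis
  proof
    assume ?triv
    then have C: "rcosets\<^bsub>?F\<^esub> ?H = {?H}" by (simp add: trivial_group_def FactGroup_def)
    show ?gen
    proof
      fix x assume x: "x \<in> S"
      have c: "frag_of x \<in> carrier ?F" using x by simp
      have "?H #>\<^bsub>?F\<^esub> frag_of x \<in> rcosets\<^bsub>?F\<^esub> ?H" by (rule F.rcosetsI[OF Hc c])
      then show "frag_of x \<in> ?H" using F.rcos_self[OF c H] unfolding C by blast
    qed
  next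
    assume gen: ?gen
    have all: "c \<in> ?H" if c: "Poly_Mapping.keys c \<subseteq> S" for c
    proof (rule free_Abelian_group_induct[OF c])
      show "0 \<in> ?H" using subgroup.one_closed[OF H] by simp
      show "x - y \<in> ?H" if "Poly_Mapping.keys y \<subseteq> S" "x \<in> ?H" "y \<in> ?H" for x y
        using subgroup.m_closed[OF H that(2) subgroup.m_inv_closed[OF H that(3)]] that(1) by simp
      show "frag_of a \<in> ?H" if "a \<in> S" for a using gen that by blast
    qed
    have "?H #>\<^bsub>?F\<^esub> a = ?H" if "a \<in> carrier ?F" for a
      using that all by (intro F.coset_join2 H) auto
    then have "rcosets\<^bsub>?F\<^esub> ?H = {?H}" using F.one_closed unfolding RCOSETS_def by blast
    then show ?triv using normal.factorgroup_is_group[OF N] by (simp add: trivial_group_def FactGroup_def)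
  qed
qed

context discrete_group begin

lemma row_pairing_smult:
  assumes a: "a \<in> ZG" and w: "w \<in> carrier (FM k)" and y: "\<And>j. j < k \<Longrightarrow> bdd (y j)"
  shows "row_pairing k (a \<odot>\<^bsub>FM k\<^esub> w) y = pairing (l1_of a) (\<lambda>r. row_pairing k w (\<lambda>j u. y j (r \<otimes> u)))"
proof -
  have b: "bdd (\<lambda>r. pairing (l1_of (w j)) (\<lambda>u. y j (r \<otimes> u)))" if j: "j < k" for j
  proof -
    obtain K where K: "\<And>s. s \<in> G \<Longrightarrow> \<bar>y j s\<bar> \<le> K" using y[OF j] unfolding bdd_def by blast
    show ?thesis by (rule bddI, rule pairing_bound[OF ZG_L1[OF FM_entry[OF w j]] K]) simp
  qed
  have "row_pairing k (a \<odot>\<^bsub>FM k\<^esub> w) y = (\<Sum>j<k. pairing (l1_of a) (\<lambda>r. pairing (l1_of (w j)) (\<lambda>u. y j (r \<otimes> u))))"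
    unfolding row_pairing_def
    by (intro sum.cong refl) (simp add: FM_smult l1_of_mult a FM_entry[OF w] conv_pairing(2) ZG_L1 y)
  also have "\<dots> = pairing (l1_of a) (\<lambda>r. row_pairing k w (\<lambda>j u. y j (r \<otimes> u)))"
    unfolding row_pairing_def by (rule pairing_sum_right[symmetric]) (auto intro!: ZG_L1 a b)
  finally show ?thesis .
qed

end

context algebraic_action begin

abbreviation "tensor_basis \<equiv> D.L1 \<times> chars"
abbreviation "relators \<equiv> tensor_relations (group_ring \<Gamma>) (l1_ring \<Gamma>) (\<lambda>f a. f \<otimes>\<^bsub>l1_ring \<Gamma>\<^esub> l1_of a) M"
abbreviation "null_tensors \<equiv> generate (free_Abelian_group tensor_basis) relators"

lemma relators_eq:
  "relators =
     {frag_of ((\<lambda>s. f s + f' s), \<kappa>) - frag_of (f, \<kappa>) - frag_of (f', \<kappa>) | f f' \<kappa>.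
        f \<in> D.L1 \<and> f' \<in> D.L1 \<and> \<kappa> \<in> chars} \<union>
     {frag_of (f, C.char_mult \<kappa> \<kappa>') - frag_of (f, \<kappa>) - frag_of (f, \<kappa>') | f \<kappa> \<kappa>'.
        f \<in> D.L1 \<and> \<kappa> \<in> chars \<and> \<kappa>' \<in> chars} \<union>
     {frag_of (D.conv f (l1_of a), \<kappa>) - frag_of (f, a \<odot>\<^bsub>M\<^esub> \<kappa>) | f a \<kappa>.
        f \<in> D.L1 \<and> a \<in> D.ZG \<and> \<kappa> \<in> chars}"
  unfolding tensor_relations_def D.l1_ring_add M_simps ..

lemma keys_diff_subset:
  "Poly_Mapping.keys a \<subseteq> S \<Longrightarrow> Poly_Mapping.keys b \<subseteq> S \<Longrightarrow> Poly_Mapping.keys (a - b) \<subseteq> S"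
  using keys_diff by fastforce

lemma relators_subset: "relators \<subseteq> carrier (free_Abelian_group tensor_basis)"
proof
  fix u assume "u \<in> relators"
  then show "u \<in> carrier (free_Abelian_group tensor_basis)"
    unfolding relators_eq carrier_free_Abelian_group_iff
  proof (elim UnE CollectE exE conjE, goal_cases)
    case (1 f f' \<kappa>)
    then show ?case by (simp add: keys_diff_subset D.L1_add)
  next
    case (2 f \<kappa> \<kappa>')
    then show ?case by (simp add: keys_diff_subset C.char_mult_closed)
  next
    case (3 f a \<kappa>)
    then show ?case by (simp add: keys_diff_subset D.conv_L1 D.ZG_L1 smult_closed)
  qed
qed

lemma trivial_l1_tensor_iff:
  "trivial_group (l1_tensor \<Gamma> M) \<longleftrightarrow> (\<forall>f\<in>D.L1. \<forall>\<kappa>\<in>chars. frag_of (f, \<kappa>) \<in> null_tensors)"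
  unfolding l1_tensor_def tensor_product_def Let_def
  using trivial_quotient_free_iff[OF relators_subset] by (simp add: M_simps)

lemma null_tensors_subgroup: "subgroup null_tensors (free_Abelian_group tensor_basis)"
  by (rule group.generate_is_subgroup[OF group_free_Abelian_group relators_subset])

text \<open>Congruence modulo the relations, so that identities between tensors can be chained
  without handling cosets.\<close>

definition tensor_eq (infix "\<approx>\<^sub>\<otimes>" 50) where "u \<approx>\<^sub>\<otimes> v \<longleftrightarrow> u - v \<in> null_tensors"

lemma null_tensors_add: "u \<in> null_tensors \<Longrightarrow> v \<in> null_tensors \<Longrightarrow> u + v \<in> null_tensors"
  using subgroup.m_closed[OF null_tensors_subgroup] by simp

lemma null_tensors_uminus: "u \<in> null_tensors \<Longrightarrow> - u \<in> null_tensors"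
  using subgroup.m_inv_closed[OF null_tensors_subgroup, of u] subgroup.mem_carrier[OF null_tensors_subgroup, of u]
  by simp

lemma tensor_eq_refl: "u \<approx>\<^sub>\<otimes> u"
  using subgroup.one_closed[OF null_tensors_subgroup] by (simp add: tensor_eq_def)

lemma tensor_eq_sym: "u \<approx>\<^sub>\<otimes> v \<Longrightarrow> v \<approx>\<^sub>\<otimes> u"
  using null_tensors_uminus[of "u - v"] by (simp add: tensor_eq_def)

lemma tensor_eq_trans [trans]: "u \<approx>\<^sub>\<otimes> v \<Longrightarrow> v \<approx>\<^sub>\<otimes> w \<Longrightarrow> u \<approx>\<^sub>\<otimes> w"
  using null_tensors_add[of "u - v" "v - w"] by (simp add: tensor_eq_def)

lemma tensor_eq_add: "u \<approx>\<^sub>\<otimes> v \<Longrightarrow> u' \<approx>\<^sub>\<otimes> v' \<Longrightarrow> u + u' \<approx>\<^sub>\<otimes> v + v'"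
  using null_tensors_add[of "u - v" "u' - v'"] by (simp add: tensor_eq_def algebra_simps)

lemma tensor_eq_sum: "(\<And>i. i \<in> I \<Longrightarrow> u i \<approx>\<^sub>\<otimes> v i) \<Longrightarrow> sum u I \<approx>\<^sub>\<otimes> sum v I"
  by (induction I rule: infinite_finite_induct) (auto intro: tensor_eq_add tensor_eq_refl)

lemma tensor_eq_relator: "u - v \<in> relators \<Longrightarrow> u \<approx>\<^sub>\<otimes> v"
  unfolding tensor_eq_def by (rule generate.incl)

lemma tensor_eq_add_left:
  assumes "f \<in> D.L1" "f' \<in> D.L1" "\<kappa> \<in> chars"
  shows "frag_of ((\<lambda>s. f s + f' s), \<kappa>) \<approx>\<^sub>\<otimes> frag_of (f, \<kappa>) + frag_of (f', \<kappa>)"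
proof (rule tensor_eq_relator)
  have "frag_of ((\<lambda>s. f s + f' s), \<kappa>) - frag_of (f, \<kappa>) - frag_of (f', \<kappa>) \<in> relators"
    unfolding relators_eq using assms by blast
  then show "frag_of ((\<lambda>s. f s + f' s), \<kappa>) - (frag_of (f, \<kappa>) + frag_of (f', \<kappa>)) \<in> relators"
    by (simp only: diff_diff_eq)
qed

lemma tensor_eq_add_right:
  assumes "f \<in> D.L1" "\<kappa> \<in> chars" "\<kappa>' \<in> chars"
  shows "frag_of (f, C.char_mult \<kappa> \<kappa>') \<approx>\<^sub>\<otimes> frag_of (f, \<kappa>) + frag_of (f, \<kappa>')"
proof (rule tensor_eq_relator)
  have "frag_of (f, C.char_mult \<kappa> \<kappa>') - frag_of (f, \<kappa>) - frag_of (f, \<kappa>') \<in> relators"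
    unfolding relators_eq using assms by blast
  then show "frag_of (f, C.char_mult \<kappa> \<kappa>') - (frag_of (f, \<kappa>) + frag_of (f, \<kappa>')) \<in> relators"
    by (simp only: diff_diff_eq)
qed

lemma tensor_eq_balanced:
  assumes "f \<in> D.L1" "a \<in> D.ZG" "\<kappa> \<in> chars"
  shows "frag_of (f, a \<odot>\<^bsub>M\<^esub> \<kappa>) \<approx>\<^sub>\<otimes> frag_of (D.conv f (l1_of a), \<kappa>)"
  by (rule tensor_eq_sym, rule tensor_eq_relator) (unfold relators_eq, use assms in blast)

lemma tensor_eq_double: "u \<approx>\<^sub>\<otimes> u + u \<Longrightarrow> u \<approx>\<^sub>\<otimes> 0"
  using null_tensors_uminus[of "u - (u + u)"] by (simp add: tensor_eq_def)

lemma tensor_eq_zero: "\<kappa> \<in> chars \<Longrightarrow> frag_of ((\<lambda>s. 0), \<kappa>) \<approx>\<^sub>\<otimes> 0"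
  using tensor_eq_add_left[OF D.L1_zero D.L1_zero, of \<kappa>] by (intro tensor_eq_double) simp

lemma tensor_eq_one: "f \<in> D.L1 \<Longrightarrow> frag_of (f, C.char_one) \<approx>\<^sub>\<otimes> 0"
  using tensor_eq_add_right[OF _ C.char_one_closed C.char_one_closed, of f]
  by (intro tensor_eq_double) (simp add: char_mult_one C.char_one_closed)

lemma tensor_eq_sum_left:
  assumes "finite I" "\<And>i. i \<in> I \<Longrightarrow> g i \<in> D.L1" "\<kappa> \<in> chars"
  shows "frag_of ((\<lambda>s. \<Sum>i\<in>I. g i s), \<kappa>) \<approx>\<^sub>\<otimes> (\<Sum>i\<in>I. frag_of (g i, \<kappa>))"
  using assms(1,2)
proof (induction I rule: finite_induct)
  case empty then show ?case by (simp add: tensor_eq_zero assms(3))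
next
  case (insert i I)
  have "frag_of ((\<lambda>s. g i s + (\<Sum>i\<in>I. g i s)), \<kappa>) \<approx>\<^sub>\<otimes> frag_of (g i, \<kappa>) + frag_of ((\<lambda>s. \<Sum>i\<in>I. g i s), \<kappa>)"
    using insert.prems by (intro tensor_eq_add_left D.L1_sum assms(3)) auto
  also have "\<dots> \<approx>\<^sub>\<otimes> frag_of (g i, \<kappa>) + (\<Sum>i\<in>I. frag_of (g i, \<kappa>))"
    using insert by (intro tensor_eq_add tensor_eq_refl) auto
  finally show ?case using insert.hyps by simp
qed

lemma tensor_eq_lin:
  assumes f: "f \<in> D.L1"
  shows "\<forall>j<n. w j \<in> D.ZG \<Longrightarrow> \<forall>j<n. \<phi> j \<in> chars \<Longrightarrow>
    frag_of (f, lin n \<phi> w) \<approx>\<^sub>\<otimes> (\<Sum>j<n. frag_of (D.conv f (l1_of (w j)), \<phi> j))"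
proof (induction n)
  case 0 then show ?case by (simp add: lin_0 tensor_eq_one f)
next
  case (Suc n)
  have wn: "w n \<in> D.ZG" and \<phi>n: "\<phi> n \<in> chars" using Suc.prems by auto
  have ln: "lin n \<phi> w \<in> chars" using Suc.prems by (intro lin_closed) auto
  have "frag_of (f, lin (Suc n) \<phi> w) \<approx>\<^sub>\<otimes> frag_of (f, lin n \<phi> w) + frag_of (f, w n \<odot>\<^bsub>M\<^esub> \<phi> n)"
    unfolding lin_Suc[where w=w and k=n and \<phi>=\<phi>, OF wn \<phi>n]
    by (rule tensor_eq_add_right[OF f ln smult_closed[OF wn \<phi>n]])
  also have "\<dots> \<approx>\<^sub>\<otimes> (\<Sum>j<n. frag_of (D.conv f (l1_of (w j)), \<phi> j)) + frag_of (D.conv f (l1_of (w n)), \<phi> n)"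
    using Suc by (intro tensor_eq_add tensor_eq_balanced f wn \<phi>n) auto
  finally show ?case by simp
qed

text \<open>With \<open>B\<close> a left inverse of \<open>A\<close>, a tensor of \<open>f\<close>
  and \<open>\<phi> l\<close> is the sum over \<open>i\<close> of the tensors of
  \<open>f B l i\<close> with the combination of the \<open>\<phi> j\<close> given by row
  \<open>i\<close> of \<open>A\<close>. These combinations are trivial because the rows lie in
  \<open>J\<close>.\<close>

theorem invertible_matrix_trivial_tensor:
  assumes P: "presents k \<phi> J" and A: "matrix_l1_of k A \<in> Units (D.MatL k)" "\<And>i. i < k \<Longrightarrow> A i \<in> J"
  shows "trivial_group (l1_tensor \<Gamma> M)"
proof -
  have \<phi>: "\<And>j. j < k \<Longrightarrow> \<phi> j \<in> chars" and Jd: "J = {w \<in> carrier (D.FM k). lin k \<phi> w = C.char_one}"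
    and sur: "\<And>\<kappa>. \<kappa> \<in> chars \<Longrightarrow> \<exists>w\<in>carrier (D.FM k). lin k \<phi> w = \<kappa>"
    using P by (auto simp: presents_def)
  have AF: "A i \<in> carrier (D.FM k)" "lin k \<phi> (A i) = C.char_one" if "i < k" for i using A(2)[OF that] Jd by blast+
  obtain B where B: "D.mat_L1 k B"
    "\<And>i j. i < k \<Longrightarrow> j < k \<Longrightarrow> D.mat_mult k B (matrix_l1_of k A) i j = D.mat_one i j"
    using D.matrix_unitE[OF A(1)] by blast
  have Am: "matrix_l1_of k A i j = l1_of (A i j)" if "i < k" "j < k" for i j
    using that by (simp add: matrix_l1_of_def)
  have AL: "l1_of (A i j) \<in> D.L1" if "i < k" "j < k" for i j
    using D.ZG_L1[OF D.FM_entry[OF AF(1)]] that by blast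
  have gen: "frag_of (f, \<phi> l) \<approx>\<^sub>\<otimes> 0" if f: "f \<in> D.L1" and l: "l < k" for f l
  proof -
    let ?g = "\<lambda>i. D.conv f (B l i)"
    have BL: "B l i \<in> D.L1" if "i < k" for i using B(1) l that by (simp add: D.mat_L1_def)
    have gL: "?g i \<in> D.L1" if "i < k" for i by (rule D.conv_L1[OF f BL[OF that]])
    have row: "(\<lambda>s. \<Sum>i<k. D.conv (?g i) (l1_of (A i j)) s) = (if l = j then f else (\<lambda>s. 0))" if j: "j < k" for j
    proof -
      have "(\<lambda>s. \<Sum>i<k. D.conv (?g i) (l1_of (A i j)) s) = (\<lambda>s. \<Sum>i<k. D.conv f (D.conv (B l i) (l1_of (A i j))) s)"
        using j by (intro ext sum.cong refl) (simp add: D.conv_assoc f BL AL)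
      also have "\<dots> = D.conv f (\<lambda>s. \<Sum>i<k. D.conv (B l i) (l1_of (A i j)) s)"
        by (rule D.conv_sum_right[symmetric]) (auto intro!: D.conv_L1 BL AL j f)
      also have "(\<lambda>s. \<Sum>i<k. D.conv (B l i) (l1_of (A i j)) s) = D.mat_one l j"
        unfolding B(2)[OF l j, symmetric] D.mat_mult_def
        by (intro ext sum.cong refl) (simp add: Am j)
      finally show ?thesis by (simp add: D.mat_one_def D.conv_one_right f D.conv_zero)
    qed
    have "frag_of (f, \<phi> l) = (\<Sum>j<k. if l = j then frag_of (f, \<phi> l) else 0)" using l by simp
    also have "\<dots> \<approx>\<^sub>\<otimes> (\<Sum>j<k. frag_of (if l = j then f else (\<lambda>s. 0), \<phi> j))"
      using \<phi> by (intro tensor_eq_sum) (auto intro: tensor_eq_refl tensor_eq_sym[OF tensor_eq_zero])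
    also have "\<dots> \<approx>\<^sub>\<otimes> (\<Sum>j<k. \<Sum>i<k. frag_of (D.conv (?g i) (l1_of (A i j)), \<phi> j))"
    proof (rule tensor_eq_sum)
      fix j assume "j \<in> {..<k}"
      then have j: "j < k" by simp
      show "frag_of (if l = j then f else (\<lambda>s. 0), \<phi> j) \<approx>\<^sub>\<otimes> (\<Sum>i<k. frag_of (D.conv (?g i) (l1_of (A i j)), \<phi> j))"
        unfolding row[OF j, symmetric] by (rule tensor_eq_sum_left) (auto intro!: D.conv_L1 gL AL j \<phi>)
    qed
    also have "(\<Sum>j<k. \<Sum>i<k. frag_of (D.conv (?g i) (l1_of (A i j)), \<phi> j))
        = (\<Sum>i<k. \<Sum>j<k. frag_of (D.conv (?g i) (l1_of (A i j)), \<phi> j))" by (rule sum.swap)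
    also have "\<dots> \<approx>\<^sub>\<otimes> (\<Sum>i<k. 0)"
    proof (rule tensor_eq_sum)
      fix i assume "i \<in> {..<k}"
      then have i: "i < k" by simp
      have "frag_of (?g i, lin k \<phi> (A i)) \<approx>\<^sub>\<otimes> (\<Sum>j<k. frag_of (D.conv (?g i) (l1_of (A i j)), \<phi> j))"
        using \<phi> D.FM_entry[OF AF(1)[OF i]] by (intro tensor_eq_lin gL i) auto
      then show "(\<Sum>j<k. frag_of (D.conv (?g i) (l1_of (A i j)), \<phi> j)) \<approx>\<^sub>\<otimes> 0"
        using tensor_eq_trans[OF tensor_eq_sym tensor_eq_one[OF gL[OF i]]] by (simp add: AF(2)[OF i])
    qed
    finally show ?thesis by simp
  qed
  have "frag_of (f, \<kappa>) \<in> null_tensors" if f: "f \<in> D.L1" and \<kappa>: "\<kappa> \<in> chars" for f \<kappa>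
  proof -
    obtain w where w: "w \<in> carrier (D.FM k)" "lin k \<phi> w = \<kappa>" using sur[OF \<kappa>] by blast
    have "frag_of (f, lin k \<phi> w) \<approx>\<^sub>\<otimes> (\<Sum>j<k. frag_of (D.conv f (l1_of (w j)), \<phi> j))"
      using \<phi> D.FM_entry[OF w(1)] by (intro tensor_eq_lin f) auto
    also have "\<dots> \<approx>\<^sub>\<otimes> (\<Sum>j<k. 0)"
      by (rule tensor_eq_sum) (auto intro!: gen D.conv_L1 f D.ZG_L1 D.FM_entry[OF w(1)])
    finally show ?thesis by (simp add: tensor_eq_def w(2))
  qed
  then show ?thesis unfolding trivial_l1_tensor_iff by blast
qed

text \<open>The universal property in the one direction used: \<open>\<beta>\<close> extends to the
  free abelian group and kills all relators, while every elementary tensor is generated by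
  relators.\<close>

lemma trivial_tensor_balanced_zero:
  fixes \<beta> :: "('g \<Rightarrow> real) \<Rightarrow> ('x \<Rightarrow> complex) \<Rightarrow> real"
  assumes triv: "trivial_group (l1_tensor \<Gamma> M)"
    and left: "\<And>f f' \<kappa>. f \<in> D.L1 \<Longrightarrow> f' \<in> D.L1 \<Longrightarrow> \<kappa> \<in> chars \<Longrightarrow> \<beta> (\<lambda>s. f s + f' s) \<kappa> = \<beta> f \<kappa> + \<beta> f' \<kappa>"
    and right: "\<And>f \<kappa> \<kappa>'. f \<in> D.L1 \<Longrightarrow> \<kappa> \<in> chars \<Longrightarrow> \<kappa>' \<in> chars \<Longrightarrow> \<beta> f (C.char_mult \<kappa> \<kappa>') = \<beta> f \<kappa> + \<beta> f \<kappa>'"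
    and balanced: "\<And>f a \<kappa>. f \<in> D.L1 \<Longrightarrow> a \<in> D.ZG \<Longrightarrow> \<kappa> \<in> chars \<Longrightarrow> \<beta> (D.conv f (l1_of a)) \<kappa> = \<beta> f (a \<odot>\<^bsub>M\<^esub> \<kappa>)"
    and "f \<in> D.L1" "\<kappa> \<in> chars"
  shows "\<beta> f \<kappa> = 0"
proof -
  let ?F = "free_Abelian_group tensor_basis"
  let ?R = "\<lparr>carrier = UNIV, monoid.mult = (+), one = 0\<rparr> :: real monoid"
  interpret R: comm_group ?R
  proof (rule comm_groupI)
    show "\<exists>y\<in>carrier ?R. y \<otimes>\<^bsub>?R\<^esub> x = \<one>\<^bsub>?R\<^esub>" for x by (auto intro: exI[of _ "- x"])
  qed auto
  obtain h where h: "h \<in> hom ?F ?R" "\<And>p. p \<in> tensor_basis \<Longrightarrow> h (frag_of p) = (\<lambda>(f, \<kappa>). \<beta> f \<kappa>) p"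
    by (rule R.free_Abelian_group_universal[of "\<lambda>(f, \<kappa>). \<beta> f \<kappa>" tensor_basis]) auto
  interpret h: group_hom ?F ?R h
    by (intro group_hom.intro group_hom_axioms.intro R.is_group group_free_Abelian_group h(1))
  have hd: "h (u - v) = h u - h v" if "Poly_Mapping.keys u \<subseteq> tensor_basis" "Poly_Mapping.keys v \<subseteq> tensor_basis" for u v
    using h.hom_mult[of "u - v" v] keys_diff_subset[OF that] that by simp
  have hf: "h (frag_of (f, \<kappa>)) = \<beta> f \<kappa>" if "f \<in> D.L1" "\<kappa> \<in> chars" for f \<kappa> using h(2)[of "(f, \<kappa>)"] that by simp
  have "relators \<subseteq> kernel ?F ?R h"
  proof
    fix u assume u: "u \<in> relators"
    have "h u = 0" using u unfolding relators_eq
    proof (elim UnE CollectE exE conjE, goal_cases)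
      case (1 f f' \<kappa>)
      then show ?case by (simp add: hd hf keys_diff_subset D.L1_add left)
    next
      case (2 f \<kappa> \<kappa>')
      then show ?case by (simp add: hd hf keys_diff_subset C.char_mult_closed right)
    next
      case (3 f a \<kappa>)
      then show ?case by (simp add: hd hf D.conv_L1 D.ZG_L1 smult_closed balanced)
    qed
    then show "u \<in> kernel ?F ?R h" using subsetD[OF relators_subset u] by (simp add: kernel_def)
  qed
  then have "null_tensors \<subseteq> kernel ?F ?R h"
    by (rule group.generate_subgroup_incl[OF group_free_Abelian_group _ h.subgroup_kernel])
  moreover have "frag_of (f, \<kappa>) \<in> null_tensors" using triv assms(5,6) unfolding trivial_l1_tensor_iff by blast
  ultimately show ?thesis using hf[OF assms(5,6)] by (auto simp: kernel_def)
qed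

text \<open>The balanced map pairs \<open>f\<close> with \<open>\<gamma> \<kappa>\<close>. At the
  unit mass of \<open>s0\<close> and the generator \<open>\<phi> j0\<close> it takes the value
  \<open>y j0 s0\<close>.\<close>

theorem trivial_tensor_trivial_annihilator:
  assumes triv: "trivial_group (l1_tensor \<Gamma> M)" and P: "presents k \<phi> J"
  shows "D.trivial_annihilator k J"
  unfolding D.trivial_annihilator_def
proof (intro allI impI ballI)
  fix y j0 s0 assume y: "\<forall>j<k. D.bdd (y j)" and zero: "\<forall>w\<in>J. D.row_pairing k w y = 0"
    and j0: "j0 < k" and s0: "s0 \<in> carrier \<Gamma>"
  have \<phi>: "\<And>j. j < k \<Longrightarrow> \<phi> j \<in> chars" and Jd: "J = {w \<in> carrier (D.FM k). lin k \<phi> w = C.char_one}"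
    and sur: "\<And>\<kappa>. \<kappa> \<in> chars \<Longrightarrow> \<exists>w\<in>carrier (D.FM k). lin k \<phi> w = \<kappa>"
    using P by (auto simp: presents_def)
  define w where "w \<kappa> = (SOME w. w \<in> carrier (D.FM k) \<and> lin k \<phi> w = \<kappa>)" for \<kappa>
  have w: "w \<kappa> \<in> carrier (D.FM k)" "lin k \<phi> (w \<kappa>) = \<kappa>" if "\<kappa> \<in> chars" for \<kappa>
    using someI_ex[of "\<lambda>w. w \<in> carrier (D.FM k) \<and> lin k \<phi> w = \<kappa>"] sur[OF that] by (auto simp: w_def)
  have lc: "lin k \<phi> v \<in> chars" if "v \<in> carrier (D.FM k)" for v by (rule lin_closed_FM[OF that \<phi>])
  define Y where "Y t j r = y j (t \<otimes>\<^bsub>\<Gamma>\<^esub> r)" for t j r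
  have yb: "D.bdd (y j)" if "j < k" for j using y that by blast
  have Yb: "D.bdd (Y t j)" if "j < k" "t \<in> carrier \<Gamma>" for t j
    unfolding Y_def using D.bdd_reindex[OF yb[OF that(1)], of "\<lambda>r. t \<otimes>\<^bsub>\<Gamma>\<^esub> r"] that(2) by simp
  have Yz: "D.row_pairing k v (Y t) = 0" if v: "v \<in> J" and t: "t \<in> carrier \<Gamma>" for v t
  proof -
    have vF: "v \<in> carrier (D.FM k)" using v Jd by blast
    have "D.row_pairing k v (Y t) = D.row_pairing k (D.point t 1 \<odot>\<^bsub>D.FM k\<^esub> v) y"
      unfolding Y_def by (rule D.row_pairing_shift[OF t vF yb, symmetric])
    also have "\<dots> = 0" using zero D.submoduleD(4)[OF presents_submodule[OF P] D.point_ZG[OF t] v] by blast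
    finally show ?thesis .
  qed
  \<comment> \<open>Recording the pairings with all translates of \<open>y\<close> gives a bounded
    function on the group; the dependence on \<open>t\<close> is what makes the resulting map
    balanced.\<close>
  define \<gamma> where "\<gamma> \<kappa> t = D.row_pairing k (w \<kappa>) (Y t)" for \<kappa> t
  have \<gamma>_lin: "\<gamma> (lin k \<phi> v) t = D.row_pairing k v (Y t)" if v: "v \<in> carrier (D.FM k)" and t: "t \<in> carrier \<Gamma>" for v t
    unfolding \<gamma>_def
    by (rule presents_row_pairing_eq[OF P Yb[OF _ t] Yz[OF _ t] w(1)[OF lc[OF v]] v w(2)[OF lc[OF v]]])
  have \<gamma>b: "D.bdd (\<gamma> \<kappa>)" if \<kappa>: "\<kappa> \<in> chars" for \<kappa>
  proof -
    have "\<forall>j\<in>{..<k}. \<exists>b\<ge>0. \<forall>s\<in>carrier \<Gamma>. \<bar>y j s\<bar> \<le> b" using yb unfolding D.bdd_def by blast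
    from bchoice[OF this] obtain b where b: "\<And>j. j < k \<Longrightarrow> b j \<ge> 0"
      "\<And>j s. j < k \<Longrightarrow> s \<in> carrier \<Gamma> \<Longrightarrow> \<bar>y j s\<bar> \<le> b j" by (auto simp: lessThan_iff)
    have K: "\<bar>y j s\<bar> \<le> (\<Sum>j<k. b j)" if "j < k" "s \<in> carrier \<Gamma>" for j s
      using b(2)[OF that] member_le_sum[of j "{..<k}" b] b(1) that(1) by auto
    show ?thesis
      unfolding \<gamma>_def Y_def by (rule D.bddI, rule D.row_pairing_bound[OF w(1)[OF \<kappa>] K]) auto
  qed
  have \<gamma>_add: "\<gamma> (C.char_mult \<kappa> \<kappa>') t = \<gamma> \<kappa> t + \<gamma> \<kappa>' t"
    if c: "\<kappa> \<in> chars" "\<kappa>' \<in> chars" and t: "t \<in> carrier \<Gamma>" for \<kappa> \<kappa>' t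
  proof -
    have "\<gamma> (C.char_mult \<kappa> \<kappa>') t = \<gamma> (lin k \<phi> (w \<kappa> \<oplus>\<^bsub>D.FM k\<^esub> w \<kappa>')) t"
      using lin_add[OF w(1)[OF c(1)] w(1)[OF c(2)], of \<phi>] w(2)[OF c(1)] w(2)[OF c(2)] by simp
    also have "\<dots> = D.row_pairing k (w \<kappa> \<oplus>\<^bsub>D.FM k\<^esub> w \<kappa>') (Y t)"
      by (rule \<gamma>_lin[OF D.FM_add_closed[OF w(1)[OF c(1)] w(1)[OF c(2)]] t])
    also have "\<dots> = \<gamma> \<kappa> t + \<gamma> \<kappa>' t"
      unfolding \<gamma>_def by (rule D.row_pairing_add[OF w(1)[OF c(1)] w(1)[OF c(2)] Yb[OF _ t]])
    finally show ?thesis .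
  qed
  have \<gamma>_smult: "\<gamma> (a \<odot>\<^bsub>M\<^esub> \<kappa>) t = D.pairing (l1_of a) (\<lambda>r. \<gamma> \<kappa> (t \<otimes>\<^bsub>\<Gamma>\<^esub> r))"
    if a: "a \<in> D.ZG" and c: "\<kappa> \<in> chars" and t: "t \<in> carrier \<Gamma>" for a \<kappa> t
  proof -
    have "lin k \<phi> (a \<odot>\<^bsub>D.FM k\<^esub> w \<kappa>) = a \<odot>\<^bsub>M\<^esub> lin k \<phi> (w \<kappa>)" by (rule lin_smult[OF a w(1)[OF c] \<phi>])
    then have "\<gamma> (a \<odot>\<^bsub>M\<^esub> \<kappa>) t = \<gamma> (lin k \<phi> (a \<odot>\<^bsub>D.FM k\<^esub> w \<kappa>)) t" by (simp add: w(2)[OF c])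
    also have "\<dots> = D.row_pairing k (a \<odot>\<^bsub>D.FM k\<^esub> w \<kappa>) (Y t)"
      by (rule \<gamma>_lin[OF D.FM_smult_closed[OF a w(1)[OF c]] t])
    also have "\<dots> = D.pairing (l1_of a) (\<lambda>r. D.row_pairing k (w \<kappa>) (\<lambda>j u. Y t j (r \<otimes>\<^bsub>\<Gamma>\<^esub> u)))"
      by (rule D.row_pairing_smult[OF a w(1)[OF c] Yb[OF _ t]])
    also have "\<dots> = D.pairing (l1_of a) (\<lambda>r. \<gamma> \<kappa> (t \<otimes>\<^bsub>\<Gamma>\<^esub> r))"
    proof (rule D.pairing_cong)
      fix r assume r: "r \<in> carrier \<Gamma>"
      have "D.row_pairing k (w \<kappa>) (\<lambda>j u. Y t j (r \<otimes>\<^bsub>\<Gamma>\<^esub> u)) = \<gamma> \<kappa> (t \<otimes>\<^bsub>\<Gamma>\<^esub> r)"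
        unfolding \<gamma>_def D.row_pairing_def Y_def using t r
        by (intro sum.cong refl D.pairing_cong) (simp add: D.m_assoc)
      then show "l1_of a r * D.row_pairing k (w \<kappa>) (\<lambda>j u. Y t j (r \<otimes>\<^bsub>\<Gamma>\<^esub> u)) = l1_of a r * \<gamma> \<kappa> (t \<otimes>\<^bsub>\<Gamma>\<^esub> r)" by simp
    qed
    finally show ?thesis .
  qed
  have \<beta>0: "D.pairing f (\<gamma> \<kappa>) = 0" if f: "f \<in> D.L1" and \<kappa>: "\<kappa> \<in> chars" for f \<kappa>
  proof (rule trivial_tensor_balanced_zero[OF triv _ _ _ f \<kappa>])
    show "D.pairing (\<lambda>s. f s + f' s) (\<gamma> \<kappa>) = D.pairing f (\<gamma> \<kappa>) + D.pairing f' (\<gamma> \<kappa>)"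
      if "f \<in> D.L1" "f' \<in> D.L1" "\<kappa> \<in> chars" for f f' \<kappa>
      by (rule D.pairing_add_left[OF that(1,2) \<gamma>b[OF that(3)]])
    show "D.pairing f (\<gamma> (C.char_mult \<kappa> \<kappa>')) = D.pairing f (\<gamma> \<kappa>) + D.pairing f (\<gamma> \<kappa>')"
      if "f \<in> D.L1" "\<kappa> \<in> chars" "\<kappa>' \<in> chars" for f \<kappa> \<kappa>'
      unfolding D.pairing_add_right[OF that(1) \<gamma>b[OF that(2)] \<gamma>b[OF that(3)], symmetric]
      using that by (intro D.pairing_cong) (simp add: \<gamma>_add)
    show "D.pairing (D.conv f (l1_of a)) (\<gamma> \<kappa>) = D.pairing f (\<gamma> (a \<odot>\<^bsub>M\<^esub> \<kappa>))"
      if "f \<in> D.L1" "a \<in> D.ZG" "\<kappa> \<in> chars" for f a \<kappa>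
      unfolding D.conv_pairing(2)[OF that(1) D.ZG_L1[OF that(2)] \<gamma>b[OF that(3)]]
      using that by (intro D.pairing_cong) (simp add: \<gamma>_smult)
  qed
  have "y j0 s0 = D.row_pairing k (basis k j0) (Y s0)"
    using row_pairing_basis[OF j0, of "Y s0"] s0 by (simp add: Y_def)
  also have "\<dots> = \<gamma> (\<phi> j0) s0" unfolding lin_basis[where \<phi>=\<phi>, OF j0 \<phi>[OF j0], symmetric]
    by (rule \<gamma>_lin[OF basis_closed s0, symmetric])
  also have "\<dots> = D.pairing (l1_of (D.point s0 1)) (\<gamma> (\<phi> j0))" by (rule D.pairing_point[OF s0, symmetric])
  also have "\<dots> = 0" by (rule \<beta>0[OF D.ZG_L1[OF D.point_ZG[OF s0]] \<phi>[OF j0]])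
  finally show "y j0 s0 = 0" .
qed

end

theorem theorem3p1:
  fixes \<Gamma> :: "'g monoid" and X :: "'x monoid" and T :: "'x topology"
    and \<alpha> :: "'g \<Rightarrow> 'x \<Rightarrow> 'x"
  assumes "group \<Gamma>" and "countable (carrier \<Gamma>)"
    and "compact_metrizable_abelian_group X T"
    and "acts_by_automorphisms \<Gamma> X T \<alpha>"
  shows
    "(expansive \<Gamma> X T \<alpha>
      \<longleftrightarrow>
      finitely_generated_left_module (group_ring \<Gamma>) (dual_module \<Gamma> X T \<alpha>) \<and>
      (\<forall>k J. submodule J (group_ring \<Gamma>) (free_left_module (group_ring \<Gamma>) k) \<and>
         left_module_isomorphic (group_ring \<Gamma>) (dual_module \<Gamma> X T \<alpha>)
           (quotient_left_module (free_left_module (group_ring \<Gamma>) k) J) \<longrightarrow>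
         (\<exists>A\<in>carrier (matrix_ring (group_ring \<Gamma>) k).
            matrix_l1_of k A \<in> Units (matrix_ring (l1_ring \<Gamma>) k) \<and> (\<forall>i<k. A i \<in> J))))
     \<and>
     (expansive \<Gamma> X T \<alpha>
      \<longleftrightarrow>
      (\<exists>k J. \<exists>A\<in>carrier (matrix_ring (group_ring \<Gamma>) k).
         submodule J (group_ring \<Gamma>) (free_left_module (group_ring \<Gamma>) k) \<and>
         matrix_l1_of k A \<in> Units (matrix_ring (l1_ring \<Gamma>) k) \<and>
         left_module_isomorphic (group_ring \<Gamma>) (dual_module \<Gamma> X T \<alpha>)
           (quotient_left_module (free_left_module (group_ring \<Gamma>) k) J) \<and>
         (\<forall>i<k. A i \<in> J)))
     \<and>
     (expansive \<Gamma> X T \<alpha>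
      \<longleftrightarrow>
      finitely_generated_left_module (group_ring \<Gamma>) (dual_module \<Gamma> X T \<alpha>) \<and>
      trivial_group (l1_tensor \<Gamma> (dual_module \<Gamma> X T \<alpha>)))"
proof -
  interpret A: compact_metrizable_abelian_group X T by (rule assms(3))
  obtain m where m: "invariant_mean X m" using A.invariant_mean_exists by blast
  interpret algebraic_action \<Gamma> X T m \<alpha>
    by (intro algebraic_action.intro discrete_group.intro compact_group_mean.intro
        algebraic_action_axioms.intro assms m)
  let ?R = "group_ring \<Gamma>"
  let ?fg = "finitely_generated_left_module ?R M"
  let ?iso = "\<lambda>k J. left_module_isomorphic ?R M (D.QM k J)"
  let ?mat = "\<lambda>k J A. matrix_l1_of k A \<in> Units (D.MatL k) \<and> (\<forall>i<k. A i \<in> J)"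
  let ?i = "expansive \<Gamma> X T \<alpha>"
  let ?ii = "?fg \<and> (\<forall>k J. submodule J ?R (D.FM k) \<and> ?iso k J \<longrightarrow> (\<exists>A\<in>carrier (matrix_ring ?R k). ?mat k J A))"
  let ?iii = "\<exists>k J. \<exists>A\<in>carrier (matrix_ring ?R k). submodule J ?R (D.FM k) \<and>
      matrix_l1_of k A \<in> Units (D.MatL k) \<and> ?iso k J \<and> (\<forall>i<k. A i \<in> J)"
  let ?iv = "?fg \<and> trivial_group (l1_tensor \<Gamma> M)"
  have "?ii" if ?i
  proof (intro conjI allI impI)
    show ?fg by (rule expansive_finitely_generated[OF that])
    fix k J assume "submodule J ?R (D.FM k) \<and> ?iso k J"
    then have J: "submodule J ?R (D.FM k)" and I: "?iso k J" by blast+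
    obtain \<phi> where "presents k \<phi> J" using isomorphic_presents[OF J I] by blast
    then show "\<exists>A\<in>carrier (matrix_ring ?R k). ?mat k J A"
      by (intro D.exists_matrix_of_trivial_annihilator[OF J] expansive_trivial_annihilator[OF that])
  qed
  moreover have "?iii" if two: ?ii
  proof -
    obtain k \<phi> J where P: "presents k \<phi> J" using finitely_generated_presents two by blast
    then show ?thesis using two presents_submodule[OF P] presents_isomorphic[OF P] by blast
  qed
  moreover have "?i \<and> ?iv" if three: ?iii
  proof -
    obtain k J A where A: "submodule J ?R (D.FM k)" "?iso k J" "matrix_l1_of k A \<in> Units (D.MatL k)"
      "\<And>i. i < k \<Longrightarrow> A i \<in> J" using three by blast
    obtain \<phi> where P: "presents k \<phi> J" using isomorphic_presents[OF A(1,2)] by blast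
    have ex: ?i by (rule invertible_matrix_expansive[OF P A(3,4)])
    show ?thesis using ex expansive_finitely_generated[OF ex] invertible_matrix_trivial_tensor[OF P A(3,4)] by blast
  qed
  moreover have "?iii" if four: ?iv
  proof -
    obtain k \<phi> J where P: "presents k \<phi> J" using finitely_generated_presents four by blast
    have "D.trivial_annihilator k J" using trivial_tensor_trivial_annihilator[OF _ P] four by blast
    from D.exists_matrix_of_trivial_annihilator[OF presents_submodule[OF P] this]
    show ?thesis using presents_submodule[OF P] presents_isomorphic[OF P] by blast
  qed
  \<comment> \<open>The implications at hand lead from (1) to (2), from (2) to (3), from (3) to both
    (1) and (4), and from (4) to (3).\<close>
  ultimately have "(?i \<longleftrightarrow> ?ii) \<and> (?i \<longleftrightarrow> ?iii) \<and> (?i \<longleftrightarrow> ?iv)" by argo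
  then show ?thesis .
qed

end
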